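(* Let $1\le p<\infty$, $r,s\in\mathbb{N}$ with $s\le 2r$, and let $f\in L_p(\mathbb{R}^d)$ satisfy $f\in\ell_p(X_\sigma)$ for all $\sigma>0$ and $$\|f_{\gamma/\sigma,r}-f\|_{\ell_p(X_\sigma)}\to0\quad\text{as }\sigma\to\infty .$$ Suppose that for all $\sigma>0$ the operator $G_\sigma$ satisfies $(A_1)$, $(A_2)$ and $(A_3)$ (with this $s$), and that $G_\sigma f\in\Phi_\sigma\cap W_p^s(\mathbb{R}^d)$. Suppose also that $G_\sigma f(\xi)=f(\xi)$ for all $\xi\in X_\sigma$, and $X_\sigma\subset X_{2\sigma}$. Then $$\|f_{\gamma/\sigma,r}-f\|_{\ell_p(X_\sigma)}+\omega_s(f,\sigma^{-1})_p\le C\sum_{k=0}^\infty(\sigma2^k)^{-s}|G_{2^k\sigma}f|_{W_p^s},$$ where the constant $C$ is independent of $f$ and $\sigma$.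
   Context: $L_p(\mathbb{R}^d)$, $1\le p<\infty$, is the space of finite-valued measurable $f:\mathbb{R}^d\to\mathbb{R}$ with $\|f\|_p=(\int_{\mathbb{R}^d}|f|^p)^{1/p}<\infty$; functions equal almost everywhere are NOT identified (each function has a definite value at each point). $W_p^s(\mathbb{R}^d)$ is the Sobolev space, with semi-norm $|f|_{W_p^s}=\sum_{|\alpha|_1=s}\|D^\alpha f\|_p$. Sampling points: for each $\sigma>0$, $X_\sigma\subset\mathbb{R}^d$ is a finite or infinite set with $\min_{\xi\ne\xi'\in X_\sigma}|\xi-\xi'|>2\gamma/\sigma$, where $\gamma\in(0,1]$ is independent of $\sigma$. $\|f\|_{\ell_p(X_\sigma)}=\big(\sigma^{-d}\sum_{\xi\in X_\sigma}|f(\xi)|^p\big)^{1/p}$, and $f\in\ell_p(X_\sigma)$ means this is finite. Band-limited functions: $\mathcal{B}_p^\sigma(\mathbb{R}^d)=\{\varphi\in L_p(\mathbb{R}^d)\cap L_1(\mathbb{R}^d):\operatorname{supp}\widehat\varphi\subset[-\sigma,\sigma]^d\}$, with $\widehat\varphi(x)=\int_{\mathbb{R}^d}\varphi(y)e^{-2\pi i(x,y)}dy$. Sampling operator: $G_\sigma f(x)=\sum_{\xi\in X_\sigma}f(\xi)\psi_{\xi,\sigma}(x)$ with given kernel functions $\psi_{\xi,\sigma}$. Assumptions, with positive constants $\kappa_i$ independent of $\sigma$ and of the function: $(A_1)$ $\|G_\sigma f\|_p\le\kappa_1\|f\|_{\ell_p(X_\sigma)}$ for all $f\in L_p(\mathbb{R}^d)\cap\ell_p(X_\sigma)$;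 $(A_2)$ $\kappa_2\|f\|_{\ell_p(X_\sigma)}\le\|G_\sigma f\|_p$ for all $f\in L_p(\mathbb{R}^d)\cap\ell_p(X_\sigma)$; $(A_3)$ for the given $s\in\mathbb{N}$ there is $\lambda\in(0,1]$ (independent of $\sigma$) such that $\|g-G_\sigma g\|_p\le\kappa_3\sigma^{-s}|g|_{W_p^s}$ for all $g\in\mathcal{B}_p^{\lambda\sigma}(\mathbb{R}^d)$. Approximating family: $\Phi=(\Phi_\sigma)_{\sigma\ge0}$ is a family of subspaces of $L_p(\mathbb{R}^d)$ such that $0\in\Phi_\sigma$ for all $\sigma>0$; $\Phi_0=\{0\}$; $a\Phi_\sigma=\Phi_\sigma$ for each $a\ne0$; $\Phi_\sigma+\Phi_\sigma\subset\Phi_{c\sigma}$ for some constant $c=c(\Phi)$; and, for the given $p$ and $s$, there are constants $c_1,c_2>0$ such that for all $\sigma>0$: (Jackson) $\inf_{g\in\Phi_\sigma}\|f-g\|_p\le c_1\sigma^{-s}|f|_{W_p^s}$ for $f\in W_p^s(\mathbb{R}^d)$, and (Bernstein) $|g|_{W_p^s}\le c_2\sigma^s\|g\|_p$ for $g\in\Phi_\sigma$. Modulus of smoothness: $\omega_s(f,\delta)_p=\sup_{|h|<\delta}\|\Delta_h^sf\|_p$, $\Delta_h^sf(x)=\sum_{\nu=0}^s\binom{s}{\nu}(-1)^\nu f(x+(s-\nu)h)$. Averaged operator: $f_{\delta,r}(x)=-\frac{2}{\binom{2r}{r}}\sum_{j=1}^r(-1)^j\binom{2r}{r-j}f_{\delta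 j/r}(x)$, where $f_\delta(x)=\frac1{|B_\delta|}\int_{B_\delta(x)}f(y)\,dy$ and $B_\delta(x)$ is the open Euclidean ball of radius $\delta$ centred at $x$, $B_\delta=B_\delta(0)$. *)

theory Defs
  imports "HOL-Analysis.Analysis"
begin

section \<open>Function spaces\<close>

text \<open>Elements of \<open>L_p\<close> are honest functions: no quotient by equality almost everywhere.
  The norm is real-valued and meaningful only on \<open>Lp_space p\<close>; every definition below that
  bounds a norm also requires membership in the space wherever it is not automatic.\<close>

definition Lp_space :: "real \<Rightarrow> (real^'d \<Rightarrow> real) set" where
  "Lp_space p = {f. f \<in> borel_measurable lebesgue \<and> integrable lebesgue (\<lambda>x. \<bar>f x\<bar> powr p)}"

definition Lp_norm :: "real \<Rightarrow> (real^'d \<Rightarrow> real) \<Rightarrow> real" where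
  "Lp_norm p f = (LINT x|lebesgue. \<bar>f x\<bar> powr p) powr (1 / p)"

definition partial_deriv :: "'d \<Rightarrow> (real^'d \<Rightarrow> real) \<Rightarrow> real^'d \<Rightarrow> real" where
  "partial_deriv i f x = frechet_derivative f (at x) (axis i 1)"

definition iter_partial_deriv :: "'d list \<Rightarrow> (real^'d \<Rightarrow> real) \<Rightarrow> real^'d \<Rightarrow> real" where
  "iter_partial_deriv is f = foldr partial_deriv is f"

text \<open>If all iterated partial derivatives are (Frechet) differentiable, they are all continuous,
  so this is \<open>C\<^sup>\<infinity>\<close> with compact support.\<close>

definition test_function :: "(real^'d \<Rightarrow> real) \<Rightarrow> bool" where
  "test_function \<phi> \<longleftrightarrow>
     (\<forall>is x. iter_partial_deriv is \<phi> differentiable (at x)) \<and> bounded {x. \<phi> x \<noteq> 0}"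

definition locally_integrable :: "(real^'d \<Rightarrow> real) \<Rightarrow> bool" where
  "locally_integrable f \<longleftrightarrow> (\<forall>K. compact K \<longrightarrow> set_integrable lebesgue K f)"

text \<open>A multi-index is a function \<open>\<alpha> :: 'd \<Rightarrow> nat\<close> on the set of coordinates, of order
  \<open>\<Sum>i\<in>UNIV. \<alpha> i\<close>.  On test functions \<open>D\<^sup>\<alpha>\<close> is the iterated partial derivative along any list
  of coordinates that contains each \<open>i\<close> exactly \<open>\<alpha> i\<close> times; the order is irrelevant there.\<close>

definition multi_indices :: "nat \<Rightarrow> ('d::finite \<Rightarrow> nat) set" where
  "multi_indices k = {\<alpha>. (\<Sum>i\<in>UNIV. \<alpha> i) = k}"

definition is_weak_deriv ::
  "('d::finite \<Rightarrow> nat) \<Rightarrow> (real^'d \<Rightarrow> real) \<Rightarrow> (real^'d \<Rightarrow> real) \<Rightarrow> bool" where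
  "is_weak_deriv \<alpha> f g \<longleftrightarrow> locally_integrable f \<and> locally_integrable g \<and>
     (\<forall>\<phi> is. test_function \<phi> \<and> (\<forall>i. count_list is i = \<alpha> i) \<longrightarrow>
        (LINT x|lebesgue. f x * iter_partial_deriv is \<phi> x) =
        (-1) ^ (\<Sum>i\<in>UNIV. \<alpha> i) * (LINT x|lebesgue. g x * \<phi> x))"

text \<open>Weak derivatives are unique up to null sets, so norms do not depend on the choice.\<close>

definition weak_deriv :: "('d::finite \<Rightarrow> nat) \<Rightarrow> (real^'d \<Rightarrow> real) \<Rightarrow> real^'d \<Rightarrow> real" where
  "weak_deriv \<alpha> f = (SOME g. is_weak_deriv \<alpha> f g)"

definition Sobolev_space :: "real \<Rightarrow> nat \<Rightarrow> (real^'d \<Rightarrow> real) set" where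
  "Sobolev_space p s = {f \<in> Lp_space p.
     \<forall>k\<le>s. \<forall>\<alpha>\<in>multi_indices k. \<exists>g\<in>Lp_space p. is_weak_deriv \<alpha> f g}"

definition Sobolev_seminorm :: "real \<Rightarrow> nat \<Rightarrow> (real^'d \<Rightarrow> real) \<Rightarrow> real" where
  "Sobolev_seminorm p s f = (\<Sum>\<alpha>\<in>multi_indices s. Lp_norm p (weak_deriv \<alpha> f))"

definition fourier_transform :: "(real^'d \<Rightarrow> real) \<Rightarrow> real^'d \<Rightarrow> complex" where
  "fourier_transform \<phi> x =
     (LINT y|lebesgue. complex_of_real (\<phi> y) * exp (- 2 * pi * \<i> * complex_of_real (x \<bullet> y)))"

text \<open>A band-limited function equals a continuous (indeed entire) function almost everywhere.
  Since functions are evaluated pointwise on sampling sets, that continuous representative is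
  meant: a modification of it on a null set has the same Fourier transform but arbitrary samples.\<close>

definition band_limited :: "real \<Rightarrow> real \<Rightarrow> (real^'d \<Rightarrow> real) set" where
  "band_limited p \<sigma> = {\<phi> \<in> Lp_space p \<inter> Lp_space 1. continuous_on UNIV \<phi> \<and>
     closure {x. fourier_transform \<phi> x \<noteq> 0} \<subseteq> cbox (\<chi> i. - \<sigma>) (\<chi> i. \<sigma>)}"


section \<open>Modulus of smoothness and averages\<close>

definition finite_diff :: "nat \<Rightarrow> real^'d \<Rightarrow> (real^'d \<Rightarrow> real) \<Rightarrow> real^'d \<Rightarrow> real" where
  "finite_diff s h f x =
     (\<Sum>\<nu>\<le>s. real (s choose \<nu>) * (-1) ^ \<nu> * f (x + real (s - \<nu>) *\<^sub>R h))"

text \<open>For \<open>f\<close> in \<open>L_p\<close> and \<open>\<delta> > 0\<close> the supremum is over a nonempty set bounded by \<open>2 ^ s * Lp_norm p f\<close>.\<close>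

definition modulus_of_smoothness :: "real \<Rightarrow> nat \<Rightarrow> (real^'d \<Rightarrow> real) \<Rightarrow> real \<Rightarrow> real" where
  "modulus_of_smoothness p s f \<delta> = (SUP h\<in>{h. norm h < \<delta>}. Lp_norm p (finite_diff s h f))"

definition ball_average :: "real \<Rightarrow> (real^'d \<Rightarrow> real) \<Rightarrow> real^'d \<Rightarrow> real" where
  "ball_average \<delta> f x =
     1 / measure lebesgue (ball (0::real^'d) \<delta>) * (LINT y:ball x \<delta>|lebesgue. f y)"

definition averaged :: "real \<Rightarrow> nat \<Rightarrow> (real^'d \<Rightarrow> real) \<Rightarrow> real^'d \<Rightarrow> real" where
  "averaged \<delta> r f x = - 2 / real ((2 * r) choose r) *
     (\<Sum>j = 1..r. (-1) ^ j * real ((2 * r) choose (r - j)) *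
        ball_average (\<delta> * real j / real r) f x)"


section \<open>Sampling\<close>

definition sampling_sets :: "real \<Rightarrow> (real \<Rightarrow> (real^'d) set) \<Rightarrow> bool" where
  "sampling_sets \<gamma> X \<longleftrightarrow>
     (\<forall>\<sigma>>0. \<forall>\<xi>\<in>X \<sigma>. \<forall>\<xi>'\<in>X \<sigma>. \<xi> \<noteq> \<xi>' \<longrightarrow> norm (\<xi> - \<xi>') > 2 * \<gamma> / \<sigma>)"

definition lp_space :: "real \<Rightarrow> (real^'d) set \<Rightarrow> (real^'d \<Rightarrow> real) set" where
  "lp_space p X = {f. (\<lambda>\<xi>. \<bar>f \<xi>\<bar> powr p) summable_on X}"

definition lp_norm :: "real \<Rightarrow> real \<Rightarrow> (real^'d) set \<Rightarrow> (real^'d \<Rightarrow> real) \<Rightarrow> real" where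
  "lp_norm p \<sigma> X f = (1 / \<sigma> ^ CARD('d) * (\<Sum>\<^sub>\<infinity>\<xi>\<in>X. \<bar>f \<xi>\<bar> powr p)) powr (1 / p)"

definition sampling_op ::
  "(real \<Rightarrow> (real^'d) set) \<Rightarrow> (real \<Rightarrow> real^'d \<Rightarrow> real^'d \<Rightarrow> real) \<Rightarrow> real \<Rightarrow>
     (real^'d \<Rightarrow> real) \<Rightarrow> real^'d \<Rightarrow> real" where
  "sampling_op X \<psi> \<sigma> f x = (\<Sum>\<^sub>\<infinity>\<xi>\<in>X \<sigma>. f \<xi> * \<psi> \<sigma> \<xi> x)"

text \<open>That \<open>G\<^sub>\<sigma> f\<close> is a function with a finite value at each point means that its defining
  series, over a set without a distinguished order, converges at each point.\<close>

definition sampling_op_defined ::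
  "real \<Rightarrow> (real \<Rightarrow> (real^'d) set) \<Rightarrow> (real \<Rightarrow> real^'d \<Rightarrow> real^'d \<Rightarrow> real) \<Rightarrow> real \<Rightarrow> bool" where
  "sampling_op_defined p X \<psi> \<sigma> \<longleftrightarrow>
     (\<forall>f \<in> Lp_space p \<inter> lp_space p (X \<sigma>). \<forall>x. (\<lambda>\<xi>. f \<xi> * \<psi> \<sigma> \<xi> x) summable_on X \<sigma>)"

definition cond_A1 ::
  "real \<Rightarrow> (real \<Rightarrow> (real^'d) set) \<Rightarrow> (real \<Rightarrow> real^'d \<Rightarrow> real^'d \<Rightarrow> real) \<Rightarrow> real \<Rightarrow> real \<Rightarrow> bool" where
  "cond_A1 p X \<psi> \<kappa>\<^sub>1 \<sigma> \<longleftrightarrow> (\<forall>f \<in> Lp_space p \<inter> lp_space p (X \<sigma>).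
     sampling_op X \<psi> \<sigma> f \<in> Lp_space p \<and>
     Lp_norm p (sampling_op X \<psi> \<sigma> f) \<le> \<kappa>\<^sub>1 * lp_norm p \<sigma> (X \<sigma>) f)"

text \<open>Only used together with \<open>cond_A1\<close>, which provides \<open>G\<^sub>\<sigma> f \<in> L_p\<close>.\<close>

definition cond_A2 ::
  "real \<Rightarrow> (real \<Rightarrow> (real^'d) set) \<Rightarrow> (real \<Rightarrow> real^'d \<Rightarrow> real^'d \<Rightarrow> real) \<Rightarrow> real \<Rightarrow> real \<Rightarrow> bool" where
  "cond_A2 p X \<psi> \<kappa>\<^sub>2 \<sigma> \<longleftrightarrow> (\<forall>f \<in> Lp_space p \<inter> lp_space p (X \<sigma>).
     \<kappa>\<^sub>2 * lp_norm p \<sigma> (X \<sigma>) f \<le> Lp_norm p (sampling_op X \<psi> \<sigma> f))"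

definition cond_A3 ::
  "real \<Rightarrow> nat \<Rightarrow> (real \<Rightarrow> (real^'d) set) \<Rightarrow> (real \<Rightarrow> real^'d \<Rightarrow> real^'d \<Rightarrow> real) \<Rightarrow>
     real \<Rightarrow> real \<Rightarrow> real \<Rightarrow> bool" where
  "cond_A3 p s X \<psi> \<kappa>\<^sub>3 lam \<sigma> \<longleftrightarrow> (\<forall>g \<in> band_limited p (lam * \<sigma>).
     (\<lambda>x. g x - sampling_op X \<psi> \<sigma> g x) \<in> Lp_space p \<and>
     Lp_norm p (\<lambda>x. g x - sampling_op X \<psi> \<sigma> g x) \<le>
       \<kappa>\<^sub>3 * \<sigma> powr (- real s) * Sobolev_seminorm p s g)"


section \<open>Approximating families\<close>

definition linear_subspace_of ::
  "(real^'d \<Rightarrow> real) set \<Rightarrow> (real^'d \<Rightarrow> real) set \<Rightarrow> bool" where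
  "linear_subspace_of V L \<longleftrightarrow> V \<subseteq> L \<and> (\<lambda>x. 0) \<in> V \<and>
     (\<forall>f\<in>V. \<forall>g\<in>V. (\<lambda>x. f x + g x) \<in> V) \<and> (\<forall>a. \<forall>f\<in>V. (\<lambda>x. a * f x) \<in> V)"

text \<open>Some of the closure conditions are redundant for linear subspaces.  The Bernstein inequality
  presupposes that the semi-norm of \<open>g\<close> is finite, hence the membership in the Sobolev space.\<close>

definition approximating_family ::
  "real \<Rightarrow> nat \<Rightarrow> (real \<Rightarrow> (real^'d \<Rightarrow> real) set) \<Rightarrow> bool" where
  "approximating_family p s \<Phi> \<longleftrightarrow>
     (\<forall>\<sigma>\<ge>0. linear_subspace_of (\<Phi> \<sigma>) (Lp_space p)) \<and>
     (\<forall>\<sigma>>0. (\<lambda>x. 0) \<in> \<Phi> \<sigma>) \<and>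
     \<Phi> 0 = {\<lambda>x. 0} \<and>
     (\<forall>\<sigma>\<ge>0. \<forall>a. a \<noteq> 0 \<longrightarrow> (\<lambda>g x. a * g x) ` \<Phi> \<sigma> = \<Phi> \<sigma>) \<and>
     (\<exists>c>0. \<forall>\<sigma>\<ge>0. \<forall>f\<in>\<Phi> \<sigma>. \<forall>g\<in>\<Phi> \<sigma>. (\<lambda>x. f x + g x) \<in> \<Phi> (c * \<sigma>)) \<and>
     (\<exists>c\<^sub>1>0. \<forall>\<sigma>>0. \<forall>f\<in>Sobolev_space p s.
        (INF g\<in>\<Phi> \<sigma>. Lp_norm p (\<lambda>x. f x - g x)) \<le>
          c\<^sub>1 * \<sigma> powr (- real s) * Sobolev_seminorm p s f) \<and>
     (\<exists>c\<^sub>2>0. \<forall>\<sigma>>0. \<forall>g\<in>\<Phi> \<sigma>. g \<in> Sobolev_space p s \<and>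
        Sobolev_seminorm p s g \<le> c\<^sub>2 * \<sigma> powr real s * Lp_norm p g)"

end

theory Submission
  imports Defs "HOL-Probability.Sinc_Integral" "HOL-Computational_Algebra.Polynomial"
begin

text \<open>
  The core is the estimate of the difference between \<open>G\<^sub>2\<^sub>\<tau> f\<close> and \<open>G\<^sub>\<tau> f\<close> by
  \<open>\<tau>\<close> to the power \<open>-s\<close> times the seminorm of \<open>g = G\<^sub>2\<^sub>\<tau> f\<close>. Since \<open>g\<close> interpolates \<open>f\<close> and
  the point sets are nested, \<open>G\<^sub>2\<^sub>\<tau> g = g\<close> and \<open>G\<^sub>\<tau> g = G\<^sub>\<tau> f\<close>. A Jackson-type mean \<open>P\<close> of \<open>g\<close>,
  formed with a kernel whose Fourier transform has compact support, is band-limited, lies within the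
  required distance of \<open>g\<close> in \<open>L\<^sub>p\<close> and has a controlled seminorm; as (A3) applies to \<open>P\<close>,
  (A2) turns the distance of \<open>P\<close> and \<open>g\<close> in \<open>L\<^sub>p\<close> into one on the samples, and (A1) turns that
  one back into a distance of \<open>G\<^sub>\<tau> P\<close> and \<open>G\<^sub>\<tau> g\<close>.

  Summing over \<open>\<tau> = 2\<^sup>k \<sigma>\<close> bounds \<open>f - G\<^sub>\<sigma> f\<close> as soon as \<open>G\<^sub>\<sigma> f\<close> tends to \<open>f\<close>. This
  is where the hypothesis on the averages enters: for band-limited \<open>P\<close> close to \<open>f\<close>, the samples
  of \<open>P - f\<close> are compared with those of its average, which are bounded by the \<open>L\<^sub>p\<close> norm
  because balls around distinct sampling points are disjoint. The modulus of smoothness and the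
  averaged error of \<open>f\<close> are then estimated through \<open>G\<^sub>\<sigma> f\<close>; the samples of the averaged error
  of \<open>P\<close> need a Plancherel--Polya inequality, and \<open>s \<le> 2 r\<close> is used because the averaged error is
  a mean of differences of order \<open>2 r\<close>.
\<close>

section \<open>The spaces \<open>L\<^sub>p\<close> over a measure\<close>

text \<open>(A3) speaks only about band-limited functions, and these must be continuous and
  integrable, whereas \<open>G (2 * \<tau>) f\<close> is merely a Sobolev function. Its kernel means
  need not qualify. They are formed from a truncation instead, and every estimate carries an
  arbitrary additive \<epsilon> that is removed at the end.

  The kernel must have a Fourier transform vanishing outside a cube and also decay faster than any
  power: its moment of order \<open>s\<close> enters the Jackson estimate, and its decay makes the
  sums over sampling points converge. It is a product of cosine transforms of a smooth bump. That
  its own transform vanishes outside the band is the one case of Fourier inversion required, and in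
  one variable this reduces to the limits of the sine integral \<open>Si\<close>. All scales use
  dilations of this one kernel, so the constants depend on neither \<sigma> nor \<open>f\<close>.

  Hoelder's inequality and duality are avoided: the norm estimates rest on one weighted Jensen
  inequality and on Tonelli's theorem.\<close>

definition Lp_on :: "'a measure \<Rightarrow> real \<Rightarrow> ('a \<Rightarrow> real) set" where
  "Lp_on M p = {f. f \<in> borel_measurable M \<and> integrable M (\<lambda>x. \<bar>f x\<bar> powr p)}"

text \<open>The measure is left arbitrary so that a single proof of Minkowski's inequality serves
  \<open>lborel\<close>, \<open>lebesgue\<close> and, for the samples,
  \<open>count_space X\<close>.\<close>

definition Lp_norm_on :: "'a measure \<Rightarrow> real \<Rightarrow> ('a \<Rightarrow> real) \<Rightarrow> real" where
  "Lp_norm_on M p f = (LINT x|M. \<bar>f x\<bar> powr p) powr (1 / p)"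

lemma Lp_norm_on_nonneg [simp]: "0 \<le> Lp_norm_on M p f"
  by (simp add: Lp_norm_on_def)

lemma Lp_norm_on_powr: "p \<ge> 1 \<Longrightarrow> Lp_norm_on M p f powr p = (LINT x|M. \<bar>f x\<bar> powr p)"
  by (auto simp: Lp_norm_on_def powr_powr)

lemma Lp_on_nn:
  assumes "p \<ge> 1" "f \<in> Lp_on M p"
  shows "(\<integral>\<^sup>+x. ennreal (\<bar>f x\<bar> powr p) \<partial>M) = ennreal (Lp_norm_on M p f powr p)"
  using assms by (subst nn_integral_eq_integral) (auto simp: Lp_on_def Lp_norm_on_powr)

text \<open>Most later norm bounds are proved in this form: membership and bound come out of one
  estimate of a nonnegative integral, where Tonelli's theorem asks for no integrability.\<close>

lemma Lp_on_leI:
  assumes "p \<ge> 1" "c \<ge> 0" "f \<in> borel_measurable M"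
    and le: "(\<integral>\<^sup>+x. ennreal (\<bar>f x\<bar> powr p) \<partial>M) \<le> ennreal (c powr p)"
  shows "f \<in> Lp_on M p" "Lp_norm_on M p f \<le> c"
proof -
  have i: "integrable M (\<lambda>x. \<bar>f x\<bar> powr p)"
    using assms by (intro integrableI_bounded) (auto intro: le_less_trans)
  then show f: "f \<in> Lp_on M p" using assms by (auto simp: Lp_on_def)
  have "ennreal (Lp_norm_on M p f powr p) \<le> ennreal (c powr p)"
    using Lp_on_nn[OF assms(1) f] le by simp
  then have "Lp_norm_on M p f powr p \<le> c powr p" by simp
  then show "Lp_norm_on M p f \<le> c"
    by (metis Lp_norm_on_nonneg assms(1,2) not_le powr_less_mono2 zero_less_one order_less_le_trans)
qed

text \<open>The tangent at \<open>a\<close> lies below the graph of a convex function. The point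
  \<open>u = 0\<close> is treated by hand because the convexity argument runs on the open
  half-line.\<close>

lemma powr_above_tangent:
  fixes a u p :: real
  assumes "a > 0" "u \<ge> 0" "p \<ge> 1"
  shows "a powr p + p * a powr (p - 1) * (u - a) \<le> u powr p"
proof (cases "u = 0")
  case True
  have "a powr p = a powr (p - 1) * a"
    using assms by (metis add.commute diff_add_cancel powr_add powr_one less_imp_le)
  then have "a powr p + p * a powr (p - 1) * (u - a) = (1 - p) * (a powr (p - 1) * a)"
    using True by (simp add: algebra_simps)
  also have "\<dots> \<le> 0" using assms by (simp add: mult_nonpos_nonneg)
  finally show ?thesis using True by simp
next
  case False
  have "u powr p - a powr p \<ge> (p * a powr (p - 1)) * (u - a)"
    by (rule convex_on_imp_above_tangent[where A = "{0<..}"])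
       (use assms False in \<open>auto intro!: powr_convex derivative_eq_intros simp: interior_open\<close>)
  then show ?thesis by simp
qed

lemma abs_le_1_plus_powr: "p \<ge> 1 \<Longrightarrow> \<bar>x\<bar> \<le> 1 + \<bar>x\<bar> powr p" for x p :: real
proof (cases "\<bar>x\<bar> \<le> 1")
  case False
  assume "p \<ge> 1"
  then have "\<bar>x\<bar> powr 1 \<le> \<bar>x\<bar> powr p" using False by (intro powr_mono) auto
  then show ?thesis by simp
qed (simp add: add_increasing2)

text \<open>Jensen's inequality for the measure with density \<open>\<bar>w z\<bar>\<close>; as that
  measure is not normalised, its total mass appears with exponent \<open>p - 1\<close>. The
  right-hand side may be infinite, so nothing is required of \<open>u\<close> beyond
  measurability.\<close>

lemma jensen_powr:
  fixes w u :: "'a \<Rightarrow> real"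
  assumes p: "p \<ge> 1" and w: "integrable M w" and [measurable]: "u \<in> borel_measurable M"
  shows "ennreal (\<bar>LINT z|M. w z * u z\<bar> powr p)
    \<le> ennreal ((LINT z|M. \<bar>w z\<bar>) powr (p - 1)) * (\<integral>\<^sup>+z. ennreal (\<bar>w z\<bar> * \<bar>u z\<bar> powr p) \<partial>M)"
    (is "?L \<le> ennreal (?W powr _) * ?I")
proof (cases "?W = 0")
  case True
  then have "AE z in M. w z = 0"
    using integral_nonneg_eq_0_iff_AE[of M "\<lambda>z. \<bar>w z\<bar>"] w by auto
  then have "(LINT z|M. w z * u z) = 0"
    by (intro integral_eq_zero_AE) auto
  then show ?thesis by simp
next
  case False
  have W: "?W > 0" using False by (simp add: less_le)
  have [measurable]: "w \<in> borel_measurable M" using w by auto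
  show ?thesis
  proof (cases "?I = \<infinity>")
    case True
    then show ?thesis using W by (simp add: ennreal_mult_top)
  next
    case False
    then have i: "integrable M (\<lambda>z. \<bar>w z\<bar> * \<bar>u z\<bar> powr p)"
      by (intro integrableI_bounded) (auto simp: less_top)
    have i1: "integrable M (\<lambda>z. \<bar>w z\<bar> * \<bar>u z\<bar>)"
    proof (rule Bochner_Integration.integrable_bound)
      show "integrable M (\<lambda>z. \<bar>w z\<bar> + \<bar>w z\<bar> * \<bar>u z\<bar> powr p)" using w i by auto
      show "AE z in M. norm (\<bar>w z\<bar> * \<bar>u z\<bar>) \<le> norm (\<bar>w z\<bar> + \<bar>w z\<bar> * \<bar>u z\<bar> powr p)"
      proof (rule AE_I2)
        fix z
        have "\<bar>w z\<bar> * \<bar>u z\<bar> \<le> \<bar>w z\<bar> * (1 + \<bar>u z\<bar> powr p)"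
          using abs_le_1_plus_powr[OF p] by (intro mult_left_mono) auto
        then show "norm (\<bar>w z\<bar> * \<bar>u z\<bar>) \<le> norm (\<bar>w z\<bar> + \<bar>w z\<bar> * \<bar>u z\<bar> powr p)"
          by (simp add: algebra_simps)
      qed
    qed simp
    define A where "A = (LINT z|M. \<bar>w z\<bar> * \<bar>u z\<bar>)"
    have A0: "A \<ge> 0" by (simp add: A_def)
    have le: "\<bar>LINT z|M. w z * u z\<bar> \<le> A"
      unfolding A_def using integral_norm_bound[of M "\<lambda>z. w z * u z"] by (simp add: abs_mult)
    have "A powr p \<le> ?W powr (p - 1) * (LINT z|M. \<bar>w z\<bar> * \<bar>u z\<bar> powr p)"
    proof (cases "A = 0")
      case False
      \<comment> \<open>The tangent is taken at the weighted mean of \<open>\<bar>u z\<bar>\<close>;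
        integrated against \<open>\<bar>w z\<bar>\<close>, its linear term then vanishes.\<close>
      define a where "a = A / ?W"
      have a: "a > 0" "A = a * ?W" using False A0 W by (auto simp: a_def)
      have "a powr p * ?W = (LINT z|M. \<bar>w z\<bar> * (a powr p - p * a powr (p - 1) * a) + (p * a powr (p - 1)) * (\<bar>w z\<bar> * \<bar>u z\<bar>))"
        using w i1 a(2) by (simp add: A_def[symmetric], simp add: algebra_simps)
      also have "\<dots> \<le> (LINT z|M. \<bar>w z\<bar> * \<bar>u z\<bar> powr p)"
      proof (rule integral_mono)
        fix z
        have "\<bar>w z\<bar> * (a powr p + p * a powr (p - 1) * (\<bar>u z\<bar> - a)) \<le> \<bar>w z\<bar> * \<bar>u z\<bar> powr p"
          using powr_above_tangent[OF a(1) _ p, of "\<bar>u z\<bar>"] by (intro mult_left_mono) auto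
        then show "\<bar>w z\<bar> * (a powr p - p * a powr (p - 1) * a) + (p * a powr (p - 1)) * (\<bar>w z\<bar> * \<bar>u z\<bar>) \<le> \<bar>w z\<bar> * \<bar>u z\<bar> powr p"
          by (simp add: algebra_simps)
      qed (use w i i1 in auto)
      finally have *: "a powr p * ?W \<le> (LINT z|M. \<bar>w z\<bar> * \<bar>u z\<bar> powr p)" .
      have "A powr p = ?W powr (p - 1) * (a powr p * ?W)"
        using a W powr_add[of ?W "p - 1" 1] by (simp add: powr_mult)
      then show ?thesis using * by (simp add: mult_left_mono)
    qed (use i in simp)
    then have "\<bar>LINT z|M. w z * u z\<bar> powr p \<le> ?W powr (p - 1) * (LINT z|M. \<bar>w z\<bar> * \<bar>u z\<bar> powr p)"
      using powr_mono2[OF _ _ le, of p] p by simp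
    also have "ennreal \<dots> = ennreal (?W powr (p - 1)) * ?I"
      using i by (subst nn_integral_eq_integral) (auto simp: ennreal_mult)
    finally show ?thesis by (simp add: ennreal_leI)
  qed
qed

text \<open>Jensen's inequality at each fixed \<open>x\<close>, then Tonelli. The inner integrals
  are kept as functions of \<open>z\<close>, since the approximate identity argument lets them tend
  to 0 pointwise.\<close>

lemma (in pair_sigma_finite) minkowski_jensen:
  fixes w :: "'a \<Rightarrow> real" and Q :: "'a \<Rightarrow> 'b \<Rightarrow> real"
  assumes p: "p \<ge> 1" and w: "integrable M1 w"
    and Q[measurable]: "(\<lambda>(z, x). Q z x) \<in> borel_measurable (M1 \<Otimes>\<^sub>M M2)"
  shows "(\<integral>\<^sup>+x. ennreal (\<bar>LINT z|M1. w z * Q z x\<bar> powr p) \<partial>M2)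
    \<le> ennreal ((LINT z|M1. \<bar>w z\<bar>) powr (p - 1)) *
       (\<integral>\<^sup>+z. ennreal \<bar>w z\<bar> * (\<integral>\<^sup>+x. ennreal (\<bar>Q z x\<bar> powr p) \<partial>M2) \<partial>M1)"
proof -
  have [measurable]: "w \<in> borel_measurable M1" using w by auto
  have "(\<integral>\<^sup>+x. ennreal (\<bar>LINT z|M1. w z * Q z x\<bar> powr p) \<partial>M2)
    \<le> (\<integral>\<^sup>+x. ennreal ((LINT z|M1. \<bar>w z\<bar>) powr (p - 1)) *
        (\<integral>\<^sup>+z. ennreal (\<bar>w z\<bar> * \<bar>Q z x\<bar> powr p) \<partial>M1) \<partial>M2)"
    by (intro nn_integral_mono jensen_powr p w) measurable
  also have "\<dots> = ennreal ((LINT z|M1. \<bar>w z\<bar>) powr (p - 1)) *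
        (\<integral>\<^sup>+x. \<integral>\<^sup>+z. ennreal (\<bar>w z\<bar> * \<bar>Q z x\<bar> powr p) \<partial>M1 \<partial>M2)"
    by (rule nn_integral_cmult) measurable
  also have "(\<integral>\<^sup>+x. \<integral>\<^sup>+z. ennreal (\<bar>w z\<bar> * \<bar>Q z x\<bar> powr p) \<partial>M1 \<partial>M2)
     = (\<integral>\<^sup>+z. \<integral>\<^sup>+x. ennreal (\<bar>w z\<bar> * \<bar>Q z x\<bar> powr p) \<partial>M2 \<partial>M1)"
    by (rule Fubini') measurable
  also have "\<dots> = (\<integral>\<^sup>+z. ennreal \<bar>w z\<bar> * (\<integral>\<^sup>+x. ennreal (\<bar>Q z x\<bar> powr p) \<partial>M2) \<partial>M1)"
    by (auto simp: ennreal_mult intro!: nn_integral_cong nn_integral_cmult)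
  finally show ?thesis .
qed

text \<open>The bound on \<open>Q z\<close> is demanded only where \<open>w z\<close> is nonzero, so
  a weight supported in a ball limits the steps \<open>z\<close> that have to be considered.\<close>

lemma (in pair_sigma_finite) minkowski_jensen_bound:
  fixes w :: "'a \<Rightarrow> real" and Q :: "'a \<Rightarrow> 'b \<Rightarrow> real"
  assumes p: "p \<ge> 1" and w: "integrable M1 w"
    and Q[measurable]: "(\<lambda>(z, x). Q z x) \<in> borel_measurable (M1 \<Otimes>\<^sub>M M2)"
    and C: "C \<ge> 0" "\<And>z. z \<in> space M1 \<Longrightarrow> w z \<noteq> 0 \<Longrightarrow> Q z \<in> Lp_on M2 p \<and> Lp_norm_on M2 p (Q z) \<le> C"
  shows "(\<lambda>x. LINT z|M1. w z * Q z x) \<in> Lp_on M2 p"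
    and "Lp_norm_on M2 p (\<lambda>x. LINT z|M1. w z * Q z x) \<le> (LINT z|M1. \<bar>w z\<bar>) * C"
proof -
  let ?W = "LINT z|M1. \<bar>w z\<bar>"
  have [measurable]: "w \<in> borel_measurable M1" using w by auto
  have "(\<integral>\<^sup>+z. ennreal \<bar>w z\<bar> * (\<integral>\<^sup>+x. ennreal (\<bar>Q z x\<bar> powr p) \<partial>M2) \<partial>M1)
      \<le> (\<integral>\<^sup>+z. ennreal \<bar>w z\<bar> * ennreal (C powr p) \<partial>M1)"
  proof (rule nn_integral_mono)
    fix z assume z: "z \<in> space M1"
    show "ennreal \<bar>w z\<bar> * (\<integral>\<^sup>+x. ennreal (\<bar>Q z x\<bar> powr p) \<partial>M2) \<le> ennreal \<bar>w z\<bar> * ennreal (C powr p)"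
    proof (cases "w z = 0")
      case False
      then have "(\<integral>\<^sup>+x. ennreal (\<bar>Q z x\<bar> powr p) \<partial>M2) \<le> ennreal (C powr p)"
        using C(2)[OF z] p by (subst Lp_on_nn) (auto intro!: ennreal_leI powr_mono2)
      then show ?thesis by (intro mult_left_mono) auto
    qed simp
  qed
  also have "\<dots> = ennreal ?W * ennreal (C powr p)"
    using w by (subst nn_integral_multc) (auto simp: nn_integral_eq_integral)
  finally have "ennreal (?W powr (p - 1)) * (\<integral>\<^sup>+z. ennreal \<bar>w z\<bar> * (\<integral>\<^sup>+x. ennreal (\<bar>Q z x\<bar> powr p) \<partial>M2) \<partial>M1)
     \<le> ennreal (?W powr (p - 1)) * (ennreal ?W * ennreal (C powr p))"
    by (rule mult_left_mono) simp
  also have "\<dots> = ennreal ((?W powr (p - 1) * ?W) * C powr p)"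
    by (simp add: ennreal_mult mult.assoc)
  also have "?W powr (p - 1) * ?W = ?W powr p"
    using powr_add[of ?W "p - 1" 1] by simp
  also have "?W powr p * C powr p = (?W * C) powr p"
    using C by (simp add: powr_mult)
  finally have *: "(\<integral>\<^sup>+x. ennreal (\<bar>LINT z|M1. w z * Q z x\<bar> powr p) \<partial>M2) \<le> ennreal ((?W * C) powr p)"
    using minkowski_jensen[OF p w Q] by (rule order.trans[rotated])
  have [measurable]: "(\<lambda>x. LINT z|M1. w z * Q z x) \<in> borel_measurable M2"
    by measurable
  show "(\<lambda>x. LINT z|M1. w z * Q z x) \<in> Lp_on M2 p" "Lp_norm_on M2 p (\<lambda>x. LINT z|M1. w z * Q z x) \<le> ?W * C"
    using Lp_on_leI[OF p _ _ *] C by auto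
qed

lemma Lp_on_cmult: "f \<in> Lp_on M p \<Longrightarrow> (\<lambda>x. c * f x) \<in> Lp_on M p"
  by (auto simp: Lp_on_def abs_mult powr_mult)

lemma Lp_norm_on_cmult: "p \<ge> 1 \<Longrightarrow> Lp_norm_on M p (\<lambda>x. c * f x) = \<bar>c\<bar> * Lp_norm_on M p f"
  by (auto simp: Lp_norm_on_def abs_mult powr_mult powr_powr)

lemma Lp_on_zero [simp]: "(\<lambda>x. 0) \<in> Lp_on M p" and Lp_norm_on_zero [simp]: "Lp_norm_on M p (\<lambda>x. 0) = 0"
  by (auto simp: Lp_on_def Lp_norm_on_def)

text \<open>Minkowski's inequality is Jensen's inequality on the two-point space \<open>bool\<close>
  with masses \<open>A\<close> and \<open>B\<close>: the sum
  \<open>\<bar>f x\<bar> + \<bar>g x\<bar>\<close> is the integral of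
  \<open>\<bar>f x\<bar> / A\<close> and \<open>\<bar>g x\<bar> / B\<close>. The masses are positive
  upper bounds of the two norms rather than the norms themselves, which avoids division by 0; they
  are lowered to the norms at the end.\<close>

lemma Lp_on_add:
  assumes p: "p \<ge> 1" and f: "f \<in> Lp_on M p" and g: "g \<in> Lp_on M p"
  shows "(\<lambda>x. f x + g x) \<in> Lp_on M p"
    and Lp_norm_on_triangle: "Lp_norm_on M p (\<lambda>x. f x + g x) \<le> Lp_norm_on M p f + Lp_norm_on M p g"
proof -
  have m[measurable]: "f \<in> borel_measurable M" "g \<in> borel_measurable M"
    using f g by (auto simp: Lp_on_def)
  have key: "(\<lambda>x. f x + g x) \<in> Lp_on M p \<and> Lp_norm_on M p (\<lambda>x. f x + g x) \<le> A + B"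
    if A: "A > 0" "Lp_norm_on M p f \<le> A" and B: "B > 0" "Lp_norm_on M p g \<le> B" for A B
  proof -
    have pt: "\<bar>f x + g x\<bar> powr p \<le> (A + B) powr (p - 1) * (A powr (1 - p) * \<bar>f x\<bar> powr p + B powr (1 - p) * \<bar>g x\<bar> powr p)" for x
    proof -
      let ?w = "\<lambda>b. if b then A else B" and ?u = "\<lambda>b. if b then \<bar>f x\<bar> / A else \<bar>g x\<bar> / B"
      have "\<bar>f x + g x\<bar> powr p \<le> (\<bar>f x\<bar> + \<bar>g x\<bar>) powr p"
        using p by (intro powr_mono2) auto
      moreover have "ennreal ((\<bar>f x\<bar> + \<bar>g x\<bar>) powr p) \<le> ennreal ((A + B) powr (p - 1)) * ennreal (A * (\<bar>f x\<bar> / A) powr p + B * (\<bar>g x\<bar> / B) powr p)"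
        using jensen_powr[OF p, where M = "count_space (UNIV :: bool set)" and w = ?w and u = ?u] A B
        by (simp add: integrable_count_space lebesgue_integral_count_space_finite nn_integral_count_space_finite UNIV_bool add.commute)
      ultimately have "\<bar>f x + g x\<bar> powr p \<le> (A + B) powr (p - 1) * (A * (\<bar>f x\<bar> / A) powr p + B * (\<bar>g x\<bar> / B) powr p)"
        using A B by (simp add: ennreal_mult[symmetric] del: ennreal_plus)
      moreover have "c * (y / c) powr p = c powr (1 - p) * y powr p" if "c > 0" "y \<ge> 0" for c y :: real
        using that by (simp add: powr_divide powr_diff)
      ultimately show ?thesis using A B by simp
    qed
    have "(\<integral>\<^sup>+x. ennreal (\<bar>f x + g x\<bar> powr p) \<partial>M) \<le>
      (\<integral>\<^sup>+x. ennreal ((A + B) powr (p - 1) * (A powr (1 - p))) * ennreal (\<bar>f x\<bar> powr p)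
          + ennreal ((A + B) powr (p - 1) * B powr (1 - p)) * ennreal (\<bar>g x\<bar> powr p) \<partial>M)"
      using pt by (intro nn_integral_mono)
        (auto simp: ennreal_mult[symmetric] ennreal_plus[symmetric] algebra_simps simp del: ennreal_plus intro!: ennreal_leI)
    also have "\<dots> = ennreal ((A + B) powr (p - 1) * (A powr (1 - p))) * ennreal (Lp_norm_on M p f powr p)
          + ennreal ((A + B) powr (p - 1) * B powr (1 - p)) * ennreal (Lp_norm_on M p g powr p)"
      by (simp add: nn_integral_add nn_integral_cmult Lp_on_nn[OF p f] Lp_on_nn[OF p g])
    also have "\<dots> \<le> ennreal ((A + B) powr (p - 1) * (A powr (1 - p))) * ennreal (A powr p)
          + ennreal ((A + B) powr (p - 1) * B powr (1 - p)) * ennreal (B powr p)"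
      using p A B by (intro add_mono mult_left_mono ennreal_leI powr_mono2) auto
    also have "\<dots> = ennreal ((A + B) powr (p - 1) * (A powr (1 - p) * A powr p + B powr (1 - p) * B powr p))"
      by (simp add: ennreal_mult[symmetric] ennreal_plus[symmetric] algebra_simps del: ennreal_plus)
    also have "A powr (1 - p) * A powr p + B powr (1 - p) * B powr p = A + B"
      using A B by (simp add: powr_add[symmetric])
    also have "(A + B) powr (p - 1) * (A + B) = (A + B) powr p"
      using A B powr_add[of "A + B" "p - 1" 1] by simp
    finally show ?thesis
      using Lp_on_leI[OF p _ _ , of "A + B" "\<lambda>x. f x + g x" M] A B by auto
  qed
  show "(\<lambda>x. f x + g x) \<in> Lp_on M p"
    using key[of "Lp_norm_on M p f + 1" "Lp_norm_on M p g + 1"] by (simp add: add_nonneg_pos)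
  show "Lp_norm_on M p (\<lambda>x. f x + g x) \<le> Lp_norm_on M p f + Lp_norm_on M p g"
  proof (rule field_le_epsilon)
    fix e :: real assume "e > 0"
    then show "Lp_norm_on M p (\<lambda>x. f x + g x) \<le> Lp_norm_on M p f + Lp_norm_on M p g + e"
      using key[of "Lp_norm_on M p f + e / 2" "Lp_norm_on M p g + e / 2"] by (simp add: add_nonneg_pos)
  qed
qed

lemma Lp_on_diff:
  assumes p: "p \<ge> 1" and f: "f \<in> Lp_on M p" and g: "g \<in> Lp_on M p"
  shows "(\<lambda>x. f x - g x) \<in> Lp_on M p"
    and Lp_norm_on_triangle_diff: "Lp_norm_on M p (\<lambda>x. f x - g x) \<le> Lp_norm_on M p f + Lp_norm_on M p g"
  using Lp_on_add[OF p f Lp_on_cmult[OF g, of "-1"]] Lp_norm_on_triangle[OF p f Lp_on_cmult[OF g, of "-1"]]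
    Lp_norm_on_cmult[OF p, of M "-1" g] by auto

lemma Lp_on_sum:
  assumes p: "p \<ge> 1" and "finite I" "\<And>i. i \<in> I \<Longrightarrow> f i \<in> Lp_on M p"
  shows "(\<lambda>x. \<Sum>i\<in>I. f i x) \<in> Lp_on M p"
    and Lp_norm_on_sum: "Lp_norm_on M p (\<lambda>x. \<Sum>i\<in>I. f i x) \<le> (\<Sum>i\<in>I. Lp_norm_on M p (f i))"
proof -
  have "(\<lambda>x. \<Sum>i\<in>I. f i x) \<in> Lp_on M p \<and> Lp_norm_on M p (\<lambda>x. \<Sum>i\<in>I. f i x) \<le> (\<Sum>i\<in>I. Lp_norm_on M p (f i))"
    using assms(2,3)
  proof (induction I rule: finite_induct)
    case (insert i I)
    then have h: "f i \<in> Lp_on M p" "(\<lambda>x. \<Sum>i\<in>I. f i x) \<in> Lp_on M p" by auto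
    show ?case
      using insert Lp_on_add[OF p h] Lp_norm_on_triangle[OF p h] by auto
  qed simp
  then show "(\<lambda>x. \<Sum>i\<in>I. f i x) \<in> Lp_on M p" "Lp_norm_on M p (\<lambda>x. \<Sum>i\<in>I. f i x) \<le> (\<Sum>i\<in>I. Lp_norm_on M p (f i))"
    by auto
qed

lemma Lp_norm_on_mono:
  assumes p: "p \<ge> 1" and g: "g \<in> Lp_on M p" and f: "f \<in> borel_measurable M"
    and le: "\<And>x. x \<in> space M \<Longrightarrow> \<bar>f x\<bar> \<le> \<bar>g x\<bar>"
  shows "f \<in> Lp_on M p" "Lp_norm_on M p f \<le> Lp_norm_on M p g"
proof -
  have "(\<integral>\<^sup>+x. ennreal (\<bar>f x\<bar> powr p) \<partial>M) \<le> (\<integral>\<^sup>+x. ennreal (\<bar>g x\<bar> powr p) \<partial>M)"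
    using le p by (intro nn_integral_mono ennreal_leI powr_mono2) auto
  then have "(\<integral>\<^sup>+x. ennreal (\<bar>f x\<bar> powr p) \<partial>M) \<le> ennreal (Lp_norm_on M p g powr p)"
    using Lp_on_nn[OF p g] by simp
  then show "f \<in> Lp_on M p" "Lp_norm_on M p f \<le> Lp_norm_on M p g"
    using Lp_on_leI[OF p Lp_norm_on_nonneg f] by auto
qed

lemma Lp_on_cong_AE:
  assumes "AE x in M. f x = g x" "f \<in> borel_measurable M" "g \<in> borel_measurable M"
  shows "f \<in> Lp_on M p \<longleftrightarrow> g \<in> Lp_on M p" "Lp_norm_on M p f = Lp_norm_on M p g"
proof -
  have ae: "AE x in M. \<bar>f x\<bar> powr p = \<bar>g x\<bar> powr p" using assms(1) by auto
  have "integrable M (\<lambda>x. \<bar>f x\<bar> powr p) \<longleftrightarrow> integrable M (\<lambda>x. \<bar>g x\<bar> powr p)"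
    using ae assms by (intro integrable_cong_AE) auto
  then show "f \<in> Lp_on M p \<longleftrightarrow> g \<in> Lp_on M p" using assms by (simp add: Lp_on_def)
  show "Lp_norm_on M p f = Lp_norm_on M p g"
    unfolding Lp_norm_on_def using ae assms by (subst integral_cong_AE[of _ _ "\<lambda>x. \<bar>g x\<bar> powr p"]) auto
qed

lemma Lp_norm_on_tendsto_0_I:
  assumes p: "p \<ge> 1" and "((\<lambda>n. LINT x|M. \<bar>f n x\<bar> powr p) \<longlongrightarrow> 0) F"
  shows "((\<lambda>n. Lp_norm_on M p (f n)) \<longlongrightarrow> 0) F"
proof -
  have "((\<lambda>n. (LINT x|M. \<bar>f n x\<bar> powr p) powr (1 / p)) \<longlongrightarrow> 0 powr (1 / p)) F"
    using assms by (intro tendsto_powr') (auto intro!: tendsto_intros)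
  then show ?thesis by (simp add: Lp_norm_on_def)
qed

lemma Lp_norm_on_dominated_convergence:
  fixes f :: "nat \<Rightarrow> 'a \<Rightarrow> real"
  assumes p: "p \<ge> 1" and g: "g \<in> Lp_on M p" and [measurable]: "\<And>n. f n \<in> borel_measurable M"
    and le: "\<And>n. AE x in M. \<bar>f n x\<bar> \<le> g x" and lim: "AE x in M. (\<lambda>n. f n x) \<longlonglongrightarrow> 0"
  shows "(\<lambda>n. Lp_norm_on M p (f n)) \<longlonglongrightarrow> 0"
proof (rule Lp_norm_on_tendsto_0_I[OF p])
  have "(\<lambda>n. LINT x|M. \<bar>f n x\<bar> powr p) \<longlonglongrightarrow> (LINT x|M. 0)"
  proof (rule integral_dominated_convergence[where w = "\<lambda>x. \<bar>g x\<bar> powr p"])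
    show "integrable M (\<lambda>x. \<bar>g x\<bar> powr p)" using g by (simp add: Lp_on_def)
    show "AE x in M. (\<lambda>n. \<bar>f n x\<bar> powr p) \<longlonglongrightarrow> 0"
      using lim
    proof eventually_elim
      case (elim x)
      have "(\<lambda>n. \<bar>f n x\<bar> powr p) \<longlonglongrightarrow> 0 powr p"
        using elim p by (intro tendsto_powr') (auto intro!: tendsto_intros tendsto_rabs_zero)
      then show ?case by simp
    qed
    show "AE x in M. norm (\<bar>f n x\<bar> powr p) \<le> \<bar>g x\<bar> powr p" for n
      using le[of n] by eventually_elim (use p in \<open>auto intro!: powr_mono2\<close>)
  qed auto
  then show "(\<lambda>n. LINT x|M. \<bar>f n x\<bar> powr p) \<longlonglongrightarrow> 0" by simp
qed

section \<open>Smooth functions of product form\<close>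

text \<open>Smooth functions on the line are carried along with all their derivatives; \<open>D 0\<close> is the function itself.\<close>

definition tower :: "(nat \<Rightarrow> real \<Rightarrow> real) \<Rightarrow> bool" where
  "tower D \<longleftrightarrow> (\<forall>n t. (D n has_real_derivative D (Suc n) t) (at t))"

lemma towerD: "tower D \<Longrightarrow> (D n has_real_derivative D (Suc n) t) (at t)"
  by (simp add: tower_def)

lemma tower_shift: "tower D \<Longrightarrow> tower (\<lambda>n. D (Suc n))"
  by (simp add: tower_def)

lemma tower_isCont: "tower D \<Longrightarrow> isCont (D n) t"
  using towerD DERIV_isCont by blast

lemma tower_continuous_on: "tower D \<Longrightarrow> continuous_on S (D n)"
  using tower_isCont continuous_at_imp_continuous_on by blast

lemma tower_borel: "tower D \<Longrightarrow> D n \<in> borel_measurable borel"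
  by (rule borel_measurable_continuous_onI[OF tower_continuous_on])

lemma tower_affine: "tower D \<Longrightarrow> tower (\<lambda>n t. c ^ n * D n (a + c * t))"
proof -
  assume D: "tower D"
  have "((\<lambda>t. c ^ n * D n (a + c * t)) has_real_derivative c ^ n * (D (Suc n) (a + c * t) * c)) (at t)" for n t
    by (intro DERIV_cmult DERIV_chain2[OF towerD[OF D]]) (auto intro!: derivative_eq_intros)
  then show ?thesis by (simp add: tower_def ac_simps)
qed

lemma tower_cmult: "tower D \<Longrightarrow> tower (\<lambda>n t. c * D n t)"
  unfolding tower_def by (auto intro!: derivative_eq_intros)

text \<open>Leibniz' rule without binomial coefficients: each of the \<open>n\<close>
  differentiations falls on either factor by shifting its tower.\<close>

primrec tower_prod :: "nat \<Rightarrow> (nat \<Rightarrow> real \<Rightarrow> real) \<Rightarrow> (nat \<Rightarrow> real \<Rightarrow> real) \<Rightarrow> real \<Rightarrow> real" where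
  "tower_prod 0 A B = (\<lambda>t. A 0 t * B 0 t)"
| "tower_prod (Suc n) A B = (\<lambda>t. tower_prod n (\<lambda>m. A (Suc m)) B t + tower_prod n A (\<lambda>m. B (Suc m)) t)"

lemma tower_mult:
  assumes "tower A" "tower B"
  shows "tower (\<lambda>n. tower_prod n A B)"
proof -
  have "(tower_prod n A B has_real_derivative tower_prod (Suc n) A B t) (at t)" for n t
    using assms
  proof (induction n arbitrary: A B)
    case 0
    then show ?case
      using DERIV_mult[OF towerD[OF 0(1), of 0] towerD[OF 0(2), of 0]] by (simp add: mult.commute add.commute)
  next
    case (Suc n)
    show ?case
      using DERIV_add[OF Suc.IH[OF tower_shift[OF Suc.prems(1)] Suc.prems(2)]
          Suc.IH[OF Suc.prems(1) tower_shift[OF Suc.prems(2)]]]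
      by (subst tower_prod.simps(2)) simp
  qed
  then show ?thesis by (simp add: tower_def)
qed

lemma tower_prod_zero_left:
  assumes "\<And>m. A m t = 0"
  shows "tower_prod n A B t = 0"
  using assms by (induction n arbitrary: A B) auto

section \<open>Two towers: the identity and a smooth bump\<close>

definition id_tower :: "nat \<Rightarrow> real \<Rightarrow> real" where
  "id_tower n t = (if n = 0 then t else if n = 1 then 1 else 0)"

lemma tower_id: "tower id_tower"
proof -
  have "id_tower 0 = (\<lambda>t. t)" "id_tower (Suc 0) = (\<lambda>t. 1)" "\<And>n. id_tower (Suc (Suc n)) = (\<lambda>t. 0)"
    by (auto simp: id_tower_def)
  then have "(id_tower n has_real_derivative id_tower (Suc n) t) (at t)" for n t
    by (cases n; cases "n - 1") auto
  then show ?thesis by (simp add: tower_def)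
qed

text \<open>For \<open>t > 0\<close> the derivatives of \<open>exp (- (1 / t))\<close> are
  polynomials in \<open>1 / t\<close> times the same exponential. With \<open>u = 1 / t\<close>,
  differentiating \<open>q u * exp (- u)\<close> in \<open>t\<close> gives the factor
  \<open>u ^ 2\<close> and replaces \<open>q\<close> by \<open>q - pderiv q\<close>.\<close>

primrec flat_poly :: "nat \<Rightarrow> real poly" where
  "flat_poly 0 = 1"
| "flat_poly (Suc n) = [:0, 0, 1:] * (flat_poly n - pderiv (flat_poly n))"

definition flat_exp :: "nat \<Rightarrow> real \<Rightarrow> real" where
  "flat_exp n t = (if t > 0 then poly (flat_poly n) (1 / t) * exp (- (1 / t)) else 0)"

lemma poly_mult_exp_minus_tendsto_0: "((\<lambda>x. poly q x * exp (- x)) \<longlongrightarrow> 0) at_top" for q :: "real poly"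
proof -
  have "((\<lambda>x. \<Sum>i\<le>degree q. coeff q i * (x ^ i / exp x)) \<longlongrightarrow> (\<Sum>i\<le>degree q. coeff q i * 0)) at_top"
    by (intro tendsto_intros tendsto_power_div_exp_0)
  then show ?thesis
    by (simp add: poly_altdef exp_minus field_simps sum_divide_distrib)
qed

lemma tower_flat_exp: "tower flat_exp"
  unfolding tower_def
proof (intro allI)
  fix n and t :: real
  consider "t > 0" | "t < 0" | "t = 0" by linarith
  then show "(flat_exp n has_real_derivative flat_exp (Suc n) t) (at t)"
  proof cases
    case 1
    have "((\<lambda>t. poly (flat_poly n) (1 / t) * exp (- (1 / t))) has_real_derivative flat_exp (Suc n) t) (at t)"
      using 1 by (auto intro!: derivative_eq_intros DERIV_chain2[OF poly_DERIV] simp: flat_exp_def field_simps power2_eq_square)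
    then show ?thesis
      by (rule DERIV_cong_ev[OF refl _ refl, THEN iffD1, rotated])
         (use 1 in \<open>auto simp: flat_exp_def eventually_nhds intro!: exI[of _ "{0<..}"]\<close>)
  next
    case 2
    have "((\<lambda>t. 0) has_real_derivative flat_exp (Suc n) t) (at t)"
      using 2 by (simp add: flat_exp_def)
    then show ?thesis
      by (rule DERIV_cong_ev[OF refl _ refl, THEN iffD1, rotated])
         (use 2 in \<open>auto simp: flat_exp_def eventually_nhds intro!: exI[of _ "{..<0}"]\<close>)
  next
    case 3
    have r: "((\<lambda>h. flat_exp n h / h) \<longlongrightarrow> 0) (at_right 0)"
    proof -
      have "filterlim (\<lambda>h::real. 1 / h) at_top (at_right 0)"
        using filterlim_inverse_at_top_right by (simp add: inverse_eq_divide)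
      \<comment> \<open>The difference quotient at 0 from the right is again such a product: the
        division by \<open>h\<close> only adds one factor \<open>1 / h\<close> to the
        polynomial.\<close>
      then have "((\<lambda>h. poly ([:0, 1:] * flat_poly n) (1 / h) * exp (- (1 / h))) \<longlongrightarrow> 0) (at_right 0)"
        by (rule filterlim_compose[OF poly_mult_exp_minus_tendsto_0])
      then show ?thesis
        by (rule Lim_transform_eventually)
           (auto simp: flat_exp_def eventually_at_right_less field_simps intro: eventually_mono[OF eventually_at_right_less])
    qed
    have l: "((\<lambda>h. flat_exp n h / h) \<longlongrightarrow> 0) (at_left 0)"
      by (rule Lim_transform_eventually[OF tendsto_const])
         (auto simp: flat_exp_def eventually_at_left_field intro!: exI[of _ "-1"])
    have "((\<lambda>h. flat_exp n h / h) \<longlongrightarrow> 0) (at 0)"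
      using l r by (simp add: filterlim_split_at)
    then show ?thesis using 3
      by (simp add: DERIV_def flat_exp_def)
  qed
qed

text \<open>The function \<open>exp (- (1 / (1 + t))) * exp (- (1 / (1 - t)))\<close> on the open
  interval from -1 to 1, continued by 0. The trivial factors are kept so that the shape matches
  \<open>tower_affine\<close>.\<close>

definition bump :: "nat \<Rightarrow> real \<Rightarrow> real" where
  "bump n = tower_prod n (\<lambda>m t. 1 ^ m * flat_exp m (1 + 1 * t)) (\<lambda>m t. (-1) ^ m * flat_exp m (1 + (-1) * t))"

lemma tower_bump: "tower bump"
  unfolding bump_def by (intro tower_mult tower_affine tower_flat_exp)

lemma tower_prod_zero_right:
  assumes "\<And>m. B m t = 0"
  shows "tower_prod n A B t = 0"
  using assms by (induction n arbitrary: A B) auto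

lemma bump_eq_0: "\<bar>t\<bar> \<ge> 1 \<Longrightarrow> bump n t = 0"
  unfolding bump_def
  by (cases "t \<ge> 0") (auto intro: tower_prod_zero_right tower_prod_zero_left simp: flat_exp_def)

lemma bump_0: "bump 0 t = flat_exp 0 (1 + t) * flat_exp 0 (1 - t)"
  by (simp add: bump_def)

lemma bump_nonneg: "bump 0 t \<ge> 0"
  by (simp add: bump_0 flat_exp_def)

lemma bump_pos: "\<bar>t\<bar> < 1 \<Longrightarrow> bump 0 t > 0"
  by (simp add: bump_0 flat_exp_def abs_less_iff)

text \<open>As \<open>D i\<close> is a tower, \<open>tprod D \<alpha>\<close> is the partial
  derivative of order \<alpha> of the product of the functions \<open>D i 0\<close>: differentiation
  in \<open>x $ i\<close> only raises \<open>\<alpha> i\<close>, and all orders stay in the same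
  family.\<close>

definition tprod :: "('d \<Rightarrow> nat \<Rightarrow> real \<Rightarrow> real) \<Rightarrow> ('d \<Rightarrow> nat) \<Rightarrow> real^'d \<Rightarrow> real" where
  "tprod D \<alpha> x = (\<Prod>i\<in>UNIV. D i (\<alpha> i) (x $ i))"

lemma tprod_has_derivative:
  assumes "\<forall>i. tower (D i)"
  shows "(tprod D \<alpha> has_derivative (\<lambda>h. \<Sum>i\<in>UNIV. h $ i * tprod D (\<alpha>(i := Suc (\<alpha> i))) x)) (at x)"
proof -
  have "((\<lambda>x. \<Prod>i\<in>UNIV. D i (\<alpha> i) (x $ i)) has_derivative
     (\<lambda>h. \<Sum>i\<in>UNIV. (h $ i * D i (Suc (\<alpha> i)) (x $ i)) * (\<Prod>j\<in>UNIV - {i}. D j (\<alpha> j) (x $ j)))) (at x)"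
  proof (rule has_derivative_prod)
    fix i
    have "((\<lambda>x. x $ i) has_derivative (\<lambda>h. h $ i)) (at x)"
      by (simp add: bounded_linear_vec_nth bounded_linear_imp_has_derivative)
    then show "((\<lambda>x. D i (\<alpha> i) (x $ i)) has_derivative (\<lambda>h. h $ i * D i (Suc (\<alpha> i)) (x $ i))) (at x)"
      by (rule DERIV_compose_FDERIV[where f = "D i (\<alpha> i)", OF towerD[OF assms[rule_format]]])
  qed
  moreover have "D i (Suc (\<alpha> i)) (x $ i) * (\<Prod>j\<in>UNIV - {i}. D j (\<alpha> j) (x $ j)) = tprod D (\<alpha>(i := Suc (\<alpha> i))) x" for i
    unfolding tprod_def by (subst prod.remove[of _ i]) (auto intro!: prod.cong)
  ultimately show ?thesis
    unfolding tprod_def[of D \<alpha>, abs_def] by (simp add: mult.assoc)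
qed

lemma frechet_axis: "(\<Sum>i\<in>UNIV. axis j 1 $ i * c i) = (c j :: real)"
  using sum.delta[of UNIV j c] by (simp add: axis_def if_distribR eq_commute[of j] mult_delta_left)

lemma partial_deriv_tprod:
  assumes "\<forall>i. tower (D i)"
  shows "partial_deriv i (tprod D \<alpha>) = tprod D (\<alpha>(i := Suc (\<alpha> i)))"
proof
  fix x
  show "partial_deriv i (tprod D \<alpha>) x = tprod D (\<alpha>(i := Suc (\<alpha> i))) x"
    unfolding partial_deriv_def
    by (subst frechet_derivative_at[OF tprod_has_derivative[OF assms], symmetric]) (simp add: frechet_axis)
qed

lemma iter_partial_deriv_simps [simp]:
  "iter_partial_deriv [] f = f"
  "iter_partial_deriv (i # js) f = partial_deriv i (iter_partial_deriv js f)"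
  by (simp_all add: iter_partial_deriv_def)

lemma iter_partial_deriv_append:
  "iter_partial_deriv (js @ ks) f = iter_partial_deriv js (iter_partial_deriv ks f)"
  by (simp add: iter_partial_deriv_def)

lemma iter_partial_deriv_tprod:
  assumes "\<forall>i. tower (D i)"
  shows "iter_partial_deriv js (tprod D \<alpha>) = tprod D (\<lambda>i. \<alpha> i + count_list js i)"
proof (induction js)
  case (Cons j js)
  have "(\<lambda>i. \<alpha> i + count_list js i)(j := Suc (\<alpha> j + count_list js j)) = (\<lambda>i. \<alpha> i + count_list (j # js) i)"
    by auto
  with Cons show ?case
    using assms by (simp add: partial_deriv_tprod)
qed simp

lemma tprod_differentiable:
  assumes "\<forall>i. tower (D i)"
  shows "tprod D \<alpha> differentiable (at x)"
  using tprod_has_derivative[OF assms] unfolding differentiable_def by blast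

lemma tprod_continuous:
  assumes "\<forall>i. tower (D i)"
  shows "continuous_on S (tprod D \<alpha>)"
  by (rule continuous_at_imp_continuous_on) (use assms in \<open>blast intro: differentiable_imp_continuous_within tprod_differentiable\<close>)

lemma tprod_borel:
  assumes "\<forall>i. tower (D i)"
  shows "tprod D \<alpha> \<in> borel_measurable borel"
  by (rule borel_measurable_continuous_onI[OF tprod_continuous[OF assms]])

lemma test_function_tprod:
  assumes "\<forall>i. tower (D i)" and R: "\<And>i t. \<bar>t\<bar> \<ge> R \<Longrightarrow> D i (\<alpha> i) t = 0"
  shows "test_function (tprod D \<alpha>)"
  unfolding test_function_def
proof (intro conjI allI)
  show "iter_partial_deriv js (tprod D \<alpha>) differentiable at x" for js x
    using tprod_differentiable[OF assms(1)] by (simp add: iter_partial_deriv_tprod[OF assms(1)])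
  have "norm x \<le> CARD('a) * R" if "tprod D \<alpha> x \<noteq> 0" for x
  proof -
    have "\<bar>x $ i\<bar> \<le> R" for i
      using that R[of "x $ i" i] by (auto simp: tprod_def not_le intro: ccontr)
    then have "(\<Sum>i\<in>UNIV. \<bar>x $ i\<bar>) \<le> (\<Sum>i\<in>(UNIV :: 'a set). R)"
      by (rule sum_mono)
    then show ?thesis using norm_le_l1_cart[of x] by simp
  qed
  then show "bounded {x. tprod D \<alpha> x \<noteq> 0}"
    by (auto simp: bounded_iff)
qed

lemma tprod_reflect:
  "tprod D \<alpha> (x - y) = (-1) ^ (\<Sum>i\<in>UNIV. \<alpha> i) * tprod (\<lambda>i m t. (-1) ^ m * D i m (x $ i + (-1) * t)) \<alpha> y"
proof -
  let ?n = "\<Sum>i\<in>UNIV. \<alpha> i"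
  have "tprod (\<lambda>i m t. (-1) ^ m * D i m (x $ i + (-1) * t)) \<alpha> y = (-1) ^ ?n * tprod D \<alpha> (x - y)"
    by (simp add: tprod_def prod.distrib power_sum)
  moreover have "(-1) ^ ?n * (-1) ^ ?n = (1 :: real)"
    by (metis left_minus_one_mult_self mult.right_neutral)
  ultimately show ?thesis by (metis mult.assoc mult_1)
qed

lemma tower_reflect: "tower D \<Longrightarrow> tower (\<lambda>m t. (-1) ^ m * D m (a + (-1) * t))"
  by (rule tower_affine)

section \<open>Supports and bounds of test functions\<close>

lemma test_function_differentiable: "test_function \<phi> \<Longrightarrow> iter_partial_deriv js \<phi> differentiable (at x)"
  by (simp add: test_function_def)

lemma bounded_support_partial_deriv:
  assumes "bounded {x. f x \<noteq> 0}"
  shows "bounded {x. partial_deriv i f x \<noteq> 0}"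
proof -
  have "{x. partial_deriv i f x \<noteq> 0} \<subseteq> closure {x. f x \<noteq> 0}"
  proof (intro subsetI, rule ccontr)
    fix x assume x: "x \<in> {x. partial_deriv i f x \<noteq> 0}" "x \<notin> closure {x. f x \<noteq> 0}"
    have z: "0 = f y" if "y \<in> - closure {x. f x \<noteq> 0}" for y
    proof (rule ccontr)
      assume "0 \<noteq> f y"
      then have "y \<in> {x. f x \<noteq> 0}" by simp
      then have "y \<in> closure {x. f x \<noteq> 0}" by (rule subsetD[OF closure_subset])
      with that show False by (meson ComplD)
    qed
    have "(f has_derivative (\<lambda>h. 0)) (at x)"
      by (rule has_derivative_transform_within_open[OF has_derivative_const open_Compl[OF closed_closure] _ z])
         (use x(2) in simp_all)
    then have "frechet_derivative f (at x) = (\<lambda>h. 0)"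
      by (rule frechet_derivative_at[symmetric])
    then show False using x by (simp add: partial_deriv_def)
  qed
  then show ?thesis by (rule bounded_subset[OF bounded_closure[OF assms]])
qed

lemma test_function_iter:
  assumes "test_function \<phi>"
  shows "test_function (iter_partial_deriv js \<phi>)"
proof -
  have "bounded {x. iter_partial_deriv js \<phi> x \<noteq> 0}"
    using assms by (induction js) (auto simp: test_function_def intro!: bounded_support_partial_deriv)
  then show ?thesis
    using assms by (simp add: test_function_def iter_partial_deriv_append[symmetric])
qed

lemma test_function_continuous: "test_function \<phi> \<Longrightarrow> continuous_on S \<phi>"
  using test_function_differentiable[of \<phi> "[]"]
  by (intro continuous_at_imp_continuous_on ballI differentiable_imp_continuous_within) simp

lemma test_function_borel: "test_function \<phi> \<Longrightarrow> \<phi> \<in> borel_measurable borel"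
  by (rule borel_measurable_continuous_onI[OF test_function_continuous])

lemma test_function_partial: "test_function \<phi> \<Longrightarrow> test_function (partial_deriv i \<phi>)"
  using test_function_iter[of \<phi> "[i]"] by simp

lemma continuous_bounded_support_bounded:
  fixes f :: "real^'d \<Rightarrow> real"
  assumes "continuous_on UNIV f" "bounded {x. f x \<noteq> 0}"
  obtains B where "B \<ge> 0" "\<And>x. \<bar>f x\<bar> \<le> B" and "\<And>x. norm x \<ge> B \<Longrightarrow> f x = 0"
proof -
  obtain R where R: "\<And>x. f x \<noteq> 0 \<Longrightarrow> norm x \<le> R" "R > 0"
    using assms(2) by (auto simp: bounded_pos)
  have "compact (f ` cball 0 R)"
    using assms(1) by (intro compact_continuous_image) (auto intro: continuous_on_subset)
  then obtain B where B: "\<And>x. norm x \<le> R \<Longrightarrow> \<bar>f x\<bar> \<le> B" "B > 0"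
    using compact_imp_bounded[of "f ` cball 0 R"] by (force simp: bounded_pos)
  show ?thesis
  proof (rule that[of "max B (R + 1)"])
    show "\<bar>f x\<bar> \<le> max B (R + 1)" for x
      using B(1)[of x] R(1)[of x] B(2) by (cases "f x = 0") auto
    show "f x = 0" if "norm x \<ge> max B (R + 1)" for x
      using R(1)[of x] that by fastforce
  qed (use B in simp)
qed

section \<open>Translation invariance and integration by parts\<close>

lemma integrable_indicator_cball:
  "integrable lborel (indicator (cball c R) :: 'a::euclidean_space \<Rightarrow> real)"
  by (intro integrable_real_indicator) (use emeasure_lborel_cball_finite[of c R] in simp_all)

lemma bounded_support_integrable:
  fixes f :: "real^'d \<Rightarrow> real"
  assumes "f \<in> borel_measurable borel" "\<And>x. \<bar>f x\<bar> \<le> B" "bounded {x. f x \<noteq> 0}"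
  shows "integrable lborel f"
proof -
  obtain R where R: "\<And>x. f x \<noteq> 0 \<Longrightarrow> norm x \<le> R" 
    using assms(3) by (auto simp: bounded_iff)
  show ?thesis
  proof (rule Bochner_Integration.integrable_bound[of _ "\<lambda>x. B * indicator (cball 0 R) x"])
    show "integrable lborel (\<lambda>x::real^'d. B * indicator (cball 0 R) x)"
      by (intro integrable_mult_right integrable_indicator_cball)
    show "AE x in lborel. norm (f x) \<le> norm (B * indicator (cball 0 R) x)"
      using assms(2) R by (auto simp: indicator_def intro!: AE_I2 intro: order.trans[OF _ abs_ge_self])
  qed (use assms in auto)
qed

lemma lborel_shift:
  fixes f :: "'a::euclidean_space \<Rightarrow> 'b::{banach, second_countable_topology}"
  assumes "f \<in> borel_measurable borel"
  shows "(LINT x|lborel. f (x + c)) = (LINT x|lborel. f x)"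
    and "integrable lborel (\<lambda>x. f (x + c)) \<longleftrightarrow> integrable lborel f"
  using assms lborel_distr_plus[of c] integral_distr[of "(+) c" lborel borel f] integrable_distr_eq[of "(+) c" lborel borel f]
  by (simp_all add: add.commute)

lemma lborel_nn_shift:
  fixes f :: "'a::euclidean_space \<Rightarrow> ennreal"
  assumes "f \<in> borel_measurable borel"
  shows "(\<integral>\<^sup>+x. f (x + c) \<partial>lborel) = (\<integral>\<^sup>+x. f x \<partial>lborel)"
  using assms lborel_distr_plus[of c] nn_integral_distr[of "(+) c" lborel borel f] by (simp add: add.commute)

text \<open>By translation invariance the integral of every difference quotient in direction
  \<open>axis i 1\<close> is 0. The mean value theorem and the bounded support provide a majorant,
  and dominated convergence passes to the derivative, so no iterated integration along coordinate
  lines is needed.\<close>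

lemma integral_partial_deriv_zero:
  fixes F :: "real^'d \<Rightarrow> real"
  assumes d: "\<And>x. F differentiable (at x)" and c: "continuous_on UNIV (partial_deriv i F)"
    and b: "bounded {x. F x \<noteq> 0}"
  shows "(LINT x|lborel. partial_deriv i F x) = 0"
proof -
  let ?e = "axis i 1 :: real^'d"
  have cF: "continuous_on UNIV F"
    by (intro continuous_at_imp_continuous_on ballI differentiable_imp_continuous_within d)
  then have [measurable]: "F \<in> borel_measurable borel"
    by (rule borel_measurable_continuous_onI)
  have [measurable]: "partial_deriv i F \<in> borel_measurable borel"
    by (rule borel_measurable_continuous_onI[OF c])
  obtain B where B: "B \<ge> 0" "\<And>x. \<bar>F x\<bar> \<le> B" "\<And>x. norm x \<ge> B \<Longrightarrow> F x = 0"
    using continuous_bounded_support_bounded[OF cF b] by metis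
  obtain B' where B': "B' \<ge> 0" "\<And>x. \<bar>partial_deriv i F x\<bar> \<le> B'"
    using continuous_bounded_support_bounded[OF c bounded_support_partial_deriv[OF b]] by metis
  have dl: "((\<lambda>t. F (x + t *\<^sub>R ?e)) has_real_derivative partial_deriv i F (x + t *\<^sub>R ?e)) (at t)" for x t
  proof -
    have fd: "(F has_derivative frechet_derivative F (at (x + t *\<^sub>R ?e))) (at (x + t *\<^sub>R ?e))"
      using d frechet_derivative_works by blast
    have "((\<lambda>t. x + t *\<^sub>R ?e) has_derivative (\<lambda>h. h *\<^sub>R ?e)) (at t)"
      by (auto intro!: derivative_eq_intros)
    from has_derivative_compose[OF this fd]
    have "((\<lambda>t. F (x + t *\<^sub>R ?e)) has_derivative (\<lambda>h. frechet_derivative F (at (x + t *\<^sub>R ?e)) (h *\<^sub>R ?e))) (at t)" .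
    moreover have "frechet_derivative F (at (x + t *\<^sub>R ?e)) (h *\<^sub>R ?e) = h * partial_deriv i F (x + t *\<^sub>R ?e)" for h
      using linear_cmul[OF has_derivative_linear[OF fd]] by (simp add: partial_deriv_def)
    ultimately show ?thesis
      by (simp add: has_field_derivative_def mult.commute[of _ "partial_deriv _ _ _"])
  qed
  define q where "q n x = (F (x + (1 / Suc n) *\<^sub>R ?e) - F x) * Suc n" for n x
  have iF: "integrable lborel F"
    by (rule bounded_support_integrable[OF _ B(2) b]) measurable
  have "(\<lambda>n. LINT x|lborel. q n x) \<longlonglongrightarrow> (LINT x|lborel. partial_deriv i F x)"
  proof (rule integral_dominated_convergence[where w = "\<lambda>x. B' * indicator (cball 0 (B + 1)) x"])
    show "integrable lborel (\<lambda>x::real^'d. B' * indicator (cball 0 (B + 1)) x)"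
      by (intro integrable_mult_right integrable_indicator_cball)
    show "AE x in lborel. (\<lambda>n. q n x) \<longlonglongrightarrow> partial_deriv i F x"
    proof (rule AE_I2)
      fix x
      have "((\<lambda>h. (F (x + (0 + h) *\<^sub>R ?e) - F (x + 0 *\<^sub>R ?e)) / h) \<longlongrightarrow> partial_deriv i F x) (at 0)"
        using dl[of x 0] by (simp add: DERIV_def)
      moreover have "filterlim (\<lambda>n. 1 / Suc n) (at (0::real)) sequentially"
        using LIMSEQ_inverse_real_of_nat by (intro filterlim_atI) (auto simp: inverse_eq_divide)
      ultimately show "(\<lambda>n. q n x) \<longlonglongrightarrow> partial_deriv i F x"
        using filterlim_compose[of "\<lambda>h. (F (x + (0 + h) *\<^sub>R ?e) - F (x + 0 *\<^sub>R ?e)) / h" _ "at 0" "\<lambda>n. 1 / Suc n" sequentially]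
        by (simp add: q_def)
    qed
    show "AE x in lborel. norm (q n x) \<le> B' * indicator (cball 0 (B + 1)) x" for n
    proof (rule AE_I2)
      fix x :: "real^'d"
      show "norm (q n x) \<le> B' * indicator (cball 0 (B + 1)) x"
      proof (cases "norm x \<le> B + 1")
        case True
        obtain z where "F (x + (1 / Suc n) *\<^sub>R ?e) - F (x + 0 *\<^sub>R ?e) = (1 / Suc n - 0) * partial_deriv i F (x + z *\<^sub>R ?e)"
          using MVT2[of 0 "1 / real (Suc n)", OF _ dl] by auto
        then have "q n x = partial_deriv i F (x + z *\<^sub>R ?e)" by (simp add: q_def)
        then show ?thesis using True B' by simp
      next
        case False
        have "norm (x + (1 / Suc n) *\<^sub>R ?e) \<ge> norm x - norm ((1 / Suc n) *\<^sub>R ?e)"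
          using norm_triangle_ineq4[of "x + (1 / Suc n) *\<^sub>R ?e" "(1 / Suc n) *\<^sub>R ?e"] by simp
        moreover have "norm ((1 / real (Suc n)) *\<^sub>R ?e) \<le> 1" by (simp add: norm_axis_1)
        ultimately have "norm (x + (1 / Suc n) *\<^sub>R ?e) \<ge> B" using False by linarith
        then show ?thesis using B(3) False by (simp add: q_def)
      qed
    qed
  qed (simp_all add: q_def[abs_def])
  moreover have "(LINT x|lborel. q n x) = 0" for n
    unfolding q_def using iF lborel_shift[of F] by simp
  ultimately show ?thesis by (simp add: LIMSEQ_const_iff)
qed

text \<open>The product rule combined with \<open>integral_partial_deriv_zero\<close>. Bounded
  support is asked of \<open>\<phi>\<close> alone, because the formula is later applied to the
  band-limited kernel, whose factors decay but need not have bounded support.\<close>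

lemma integral_by_parts_tprod:
  assumes D: "\<forall>i. tower (D i)" and \<phi>: "test_function \<phi>"
  shows "(LINT x|lborel. tprod D \<alpha> x * partial_deriv i \<phi> x) =
    - (LINT x|lborel. tprod D (\<alpha>(i := Suc (\<alpha> i))) x * \<phi> x)"
proof -
  let ?u = "tprod D \<alpha>" and ?u' = "tprod D (\<alpha>(i := Suc (\<alpha> i)))"
  have d\<phi>: "\<phi> differentiable (at x)" for x
    using test_function_differentiable[OF \<phi>, of "[]"] by simp
  have pd: "partial_deriv i (\<lambda>x. ?u x * \<phi> x) x = ?u x * partial_deriv i \<phi> x + ?u' x * \<phi> x" for x
  proof -
    have "((\<lambda>x. ?u x * \<phi> x) has_derivative (\<lambda>h. ?u x * frechet_derivative \<phi> (at x) h
         + (\<Sum>i\<in>UNIV. h $ i * tprod D (\<alpha>(i := Suc (\<alpha> i))) x) * \<phi> x)) (at x)"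
      by (rule has_derivative_mult[OF tprod_has_derivative[OF D]])
         (use d\<phi> frechet_derivative_works in blast)
    from frechet_derivative_at[OF this, symmetric] show ?thesis
      by (simp add: partial_deriv_def frechet_axis)
  qed
  have cu: "continuous_on UNIV ?u" "continuous_on UNIV ?u'" using tprod_continuous[OF D] by auto
  have c\<phi>: "continuous_on UNIV \<phi>" "continuous_on UNIV (partial_deriv i \<phi>)"
    using test_function_continuous[OF \<phi>] test_function_continuous[OF test_function_partial[OF \<phi>]] by auto
  have b: "bounded {x. \<phi> x \<noteq> 0}" "bounded {x. partial_deriv i \<phi> x \<noteq> 0}"
    using \<phi> test_function_partial[OF \<phi>, of i] by (auto simp: test_function_def)
  have i: "integrable lborel (\<lambda>x. f x * g x)"
    if "continuous_on UNIV f" "continuous_on UNIV g" "bounded {x. g x \<noteq> 0}" for f g :: "real^'a \<Rightarrow> real"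
  proof -
    have c: "continuous_on UNIV (\<lambda>x. f x * g x)" using that by (intro continuous_intros)
    have b: "bounded {x. f x * g x \<noteq> 0}" by (rule bounded_subset[OF that(3)]) auto
    show ?thesis
      using continuous_bounded_support_bounded[OF c b] bounded_support_integrable[OF _ _ b]
        borel_measurable_continuous_onI[OF c] by metis
  qed
  have "0 = (LINT x|lborel. partial_deriv i (\<lambda>x. ?u x * \<phi> x) x)"
  proof (rule integral_partial_deriv_zero[symmetric])
    show "(\<lambda>x. ?u x * \<phi> x) differentiable at x" for x
      using tprod_differentiable[OF D] d\<phi> by (intro differentiable_mult) auto
    show "continuous_on UNIV (partial_deriv i (\<lambda>x. ?u x * \<phi> x))"
      unfolding pd[abs_def] using cu c\<phi> by (intro continuous_intros)
    show "bounded {x. ?u x * \<phi> x \<noteq> 0}" by (rule bounded_subset[OF b(1)]) auto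
  qed
  also have "\<dots> = (LINT x|lborel. ?u x * partial_deriv i \<phi> x) + (LINT x|lborel. ?u' x * \<phi> x)"
    unfolding pd using cu c\<phi> b by (intro Bochner_Integration.integral_add i)
  finally show ?thesis by simp
qed

lemma integral_by_parts_tprod_iter:
  assumes D: "\<forall>i. tower (D i)" and \<phi>: "test_function \<phi>"
  shows "(LINT x|lborel. tprod D \<alpha> x * iter_partial_deriv js \<phi> x) =
    (-1) ^ length js * (LINT x|lborel. tprod D (\<lambda>i. \<alpha> i + count_list js i) x * \<phi> x)"
proof (induction js arbitrary: \<alpha>)
  case (Cons j js)
  have "(LINT x|lborel. tprod D \<alpha> x * iter_partial_deriv (j # js) \<phi> x) =
     - (LINT x|lborel. tprod D (\<alpha>(j := Suc (\<alpha> j))) x * iter_partial_deriv js \<phi> x)"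
    using integral_by_parts_tprod[OF D test_function_iter[OF \<phi>]] by simp
  also have "(\<lambda>i. (\<alpha>(j := Suc (\<alpha> j))) i + count_list js i) = (\<lambda>i. \<alpha> i + count_list (j # js) i)"
    by auto
  note Cons[of "\<alpha>(j := Suc (\<alpha> j))", unfolded this]
  finally show ?case by simp
qed simp

lemma test_function_translate:
  assumes "test_function \<phi>"
  shows "iter_partial_deriv js (\<lambda>x. \<phi> (x + y)) = (\<lambda>x. iter_partial_deriv js \<phi> (x + y))" (is ?A)
    and "test_function (\<lambda>x. \<phi> (x + y))"
proof -
  have d: "((\<lambda>x. iter_partial_deriv js \<phi> (x + y)) has_derivative
      frechet_derivative (iter_partial_deriv js \<phi>) (at (x + y))) (at x)" for js x
  proof -
    have "((\<lambda>x. x + y) has_derivative (\<lambda>h. h)) (at x)" by (auto intro!: derivative_eq_intros)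
    from has_derivative_compose[OF this] show ?thesis
      using test_function_differentiable[OF assms] frechet_derivative_works by blast
  qed
  show eq: "iter_partial_deriv js (\<lambda>x. \<phi> (x + y)) = (\<lambda>x. iter_partial_deriv js \<phi> (x + y))" for js
  proof (induction js)
    case (Cons j js)
    show ?case
      using frechet_derivative_at[OF d[of js], symmetric]
      by (simp add: Cons fun_eq_iff partial_deriv_def)
  qed simp
  have "bounded ((\<lambda>x. x - y) ` {x. \<phi> x \<noteq> 0})"
    using assms by (simp add: bounded_translation_minus test_function_def)
  then have "bounded {x. \<phi> (x + y) \<noteq> 0}"
    by (rule bounded_subset) (auto simp: image_iff intro!: exI[of _ "_ + y"])
  then show "test_function (\<lambda>x. \<phi> (x + y))"
    using d unfolding test_function_def eq differentiable_def by blast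
qed

lemma lborel_pair_sigma_finite:
  "pair_sigma_finite (lborel :: 'a::euclidean_space measure) (lborel :: 'b::euclidean_space measure)" ..

section \<open>Translations, differences and convolutions\<close>

lemma Lp_on_shift:
  fixes f :: "'a::euclidean_space \<Rightarrow> real"
  assumes "f \<in> Lp_on lborel p"
  shows "(\<lambda>x. f (x + h)) \<in> Lp_on lborel p" "Lp_norm_on lborel p (\<lambda>x. f (x + h)) = Lp_norm_on lborel p f"
proof -
  have [measurable]: "f \<in> borel_measurable borel" using assms by (auto simp: Lp_on_def)
  show "(\<lambda>x. f (x + h)) \<in> Lp_on lborel p" "Lp_norm_on lborel p (\<lambda>x. f (x + h)) = Lp_norm_on lborel p f"
    using assms lborel_shift[of "\<lambda>x. \<bar>f x\<bar> powr p" h] by (auto simp: Lp_on_def Lp_norm_on_def)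
qed

lemma finite_diff_0 [simp]: "finite_diff 0 h f = f"
  by (simp add: finite_diff_def fun_eq_iff)

text \<open>Pascal's rule splits the binomial sum into the difference of order \<open>s\<close> at
  the shifted and at the unshifted point.\<close>

lemma finite_diff_Suc: "finite_diff (Suc s) h f x = finite_diff s h f (x + h) - finite_diff s h f x"
proof -
  let ?g = "\<lambda>k. f (x + real k *\<^sub>R h)"
  have "finite_diff (Suc s) h f x = ?g (Suc s) +
      (\<Sum>\<nu>\<le>s. real (Suc s choose Suc \<nu>) * (-1) ^ Suc \<nu> * ?g (s - \<nu>))"
    unfolding finite_diff_def by (subst sum.atMost_Suc_shift) simp
  also have "(\<Sum>\<nu>\<le>s. real (Suc s choose Suc \<nu>) * (-1) ^ Suc \<nu> * ?g (s - \<nu>)) =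
     (\<Sum>\<nu>\<le>s. real (s choose Suc \<nu>) * (-1) ^ Suc \<nu> * ?g (s - \<nu>)) - finite_diff s h f x"
    unfolding finite_diff_def sum_subtractf[symmetric]
    by (rule sum.cong) (simp_all add: ring_distribs)
  also have "?g (Suc s) + ((\<Sum>\<nu>\<le>s. real (s choose Suc \<nu>) * (-1) ^ Suc \<nu> * ?g (s - \<nu>)) - finite_diff s h f x)
    = (\<Sum>\<nu>\<le>Suc s. real (s choose \<nu>) * (-1) ^ \<nu> * ?g (Suc s - \<nu>)) - finite_diff s h f x"
    by (simp only: sum.atMost_Suc_shift) simp
  also have "(\<Sum>\<nu>\<le>Suc s. real (s choose \<nu>) * (-1) ^ \<nu> * ?g (Suc s - \<nu>)) = finite_diff s h f (x + h)"
    unfolding finite_diff_def by (simp add: Suc_diff_le algebra_simps)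
  finally show ?thesis .
qed

lemma finite_diff_add: "finite_diff (m + n) h f = finite_diff m h (finite_diff n h f)"
proof (induction m)
  case (Suc m)
  then show ?case by (simp add: fun_eq_iff finite_diff_Suc)
qed simp

lemma finite_diff_Suc': "finite_diff (Suc s) h f = finite_diff s h (\<lambda>x. f (x + h) - f x)"
proof -
  have "finite_diff 1 h f = (\<lambda>x. f (x + h) - f x)"
    by (simp add: fun_eq_iff finite_diff_Suc)
  then show ?thesis using finite_diff_add[of s 1 h f] by simp
qed

lemma finite_diff_diff:
  "finite_diff s h (\<lambda>x. f x - g x) x = finite_diff s h f x - finite_diff s h g x"
  by (simp add: finite_diff_def sum_subtractf algebra_simps)

lemma finite_diff_borel [measurable]:
  assumes [measurable]: "f \<in> borel_measurable borel"
  shows "finite_diff s h f \<in> borel_measurable borel"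
  unfolding finite_diff_def[abs_def] by measurable

lemma finite_diff_Lp_on:
  fixes f :: "real^'d \<Rightarrow> real"
  assumes p: "p \<ge> 1" and f: "f \<in> Lp_on lborel p"
  shows "finite_diff s h f \<in> Lp_on lborel p"
    and finite_diff_Lp_norm_on: "Lp_norm_on lborel p (finite_diff s h f) \<le> 2 ^ s * Lp_norm_on lborel p f"
proof -
  have "finite_diff s h f \<in> Lp_on lborel p \<and> Lp_norm_on lborel p (finite_diff s h f) \<le> 2 ^ s * Lp_norm_on lborel p f"
  proof (induction s)
    case (Suc s)
    then have a: "finite_diff s h f \<in> Lp_on lborel p" by simp
    have "finite_diff (Suc s) h f = (\<lambda>x. finite_diff s h f (x + h) - finite_diff s h f x)"
      by (simp add: fun_eq_iff finite_diff_Suc)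
    then show ?case
      using Lp_on_diff[OF p Lp_on_shift(1)[OF a] a, of h] Lp_norm_on_triangle_diff[OF p Lp_on_shift(1)[OF a] a, of h]
        Lp_on_shift(2)[OF a, of h] Suc by simp
  qed (use f in simp)
  then show "finite_diff s h f \<in> Lp_on lborel p" "Lp_norm_on lborel p (finite_diff s h f) \<le> 2 ^ s * Lp_norm_on lborel p f"
    by auto
qed

section \<open>Density of continuous functions and continuity of translations\<close>

lemma bounded_support_Lp_on:
  fixes f :: "real^'d \<Rightarrow> real"
  assumes p: "p \<ge> 1" and f: "f \<in> borel_measurable borel" "\<And>x. \<bar>f x\<bar> \<le> B" "bounded {x. f x \<noteq> 0}"
  shows "f \<in> Lp_on lborel p"
proof -
  have "integrable lborel (\<lambda>x. \<bar>f x\<bar> powr p)"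
    by (rule bounded_support_integrable[where B = "B powr p"])
       (use f p in \<open>auto intro!: powr_mono2\<close>)
  then show ?thesis using f by (simp add: Lp_on_def)
qed

lemma Lp_on_cball: "p \<ge> 1 \<Longrightarrow> (\<lambda>x::real^'d. c * indicator (cball 0 R) x) \<in> Lp_on lborel p"
  by (rule bounded_support_Lp_on[where B = "\<bar>c\<bar>"])
     (auto simp: indicator_def intro!: bounded_subset[OF bounded_cball[of 0 R]] split: if_splits)

lemma Lp_truncate:
  fixes f :: "real^'d \<Rightarrow> real"
  assumes p: "p \<ge> 1" and f: "f \<in> Lp_on lborel p"
  shows "(\<lambda>m. Lp_norm_on lborel p (\<lambda>x. (if norm x \<le> real m then f x else 0) - f x)) \<longlonglongrightarrow> 0"
proof (rule Lp_norm_on_dominated_convergence[OF p])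
  have [measurable]: "f \<in> borel_measurable borel" using f by (auto simp: Lp_on_def)
  show "(\<lambda>x. \<bar>f x\<bar>) \<in> Lp_on lborel p" using f by (auto simp: Lp_on_def)
  show "(\<lambda>x. (if norm x \<le> real m then f x else 0) - f x) \<in> borel_measurable lborel" for m by measurable
  show "AE x in lborel. (\<lambda>m. (if norm x \<le> real m then f x else 0) - f x) \<longlonglongrightarrow> 0"
  proof (rule AE_I2)
    fix x :: "real^'d"
    have "eventually (\<lambda>m. norm x \<le> real m) sequentially"
      using eventually_ge_at_top[of "nat \<lceil>norm x\<rceil>"] by eventually_elim linarith
    then have "eventually (\<lambda>m. (if norm x \<le> real m then f x else 0) - f x = 0) sequentially"
      by eventually_elim auto
    then show "(\<lambda>m. (if norm x \<le> real m then f x else 0) - f x) \<longlonglongrightarrow> 0"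
      by (rule tendsto_eventually)
  qed
qed auto

lemma Lp_clamp:
  fixes f :: "real^'d \<Rightarrow> real"
  assumes p: "p \<ge> 1" and f: "f \<in> Lp_on lborel p"
  shows "(\<lambda>m. Lp_norm_on lborel p (\<lambda>x. (if norm x \<le> real m then max (- real m) (min (real m) (f x)) else 0) - f x)) \<longlonglongrightarrow> 0"
proof (rule Lp_norm_on_dominated_convergence[OF p])
  have [measurable]: "f \<in> borel_measurable borel" using f by (auto simp: Lp_on_def)
  show "(\<lambda>x. \<bar>f x\<bar>) \<in> Lp_on lborel p" using f by (auto simp: Lp_on_def)
  show "(\<lambda>x. (if norm x \<le> real m then max (- real m) (min (real m) (f x)) else 0) - f x) \<in> borel_measurable lborel" for m by measurable
  show "AE x in lborel. (\<lambda>m. (if norm x \<le> real m then max (- real m) (min (real m) (f x)) else 0) - f x) \<longlonglongrightarrow> 0"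
  proof (rule AE_I2)
    fix x :: "real^'d"
    have "eventually (\<lambda>m. norm x \<le> real m \<and> \<bar>f x\<bar> \<le> real m) sequentially"
      using eventually_ge_at_top[of "max (nat \<lceil>norm x\<rceil>) (nat \<lceil>\<bar>f x\<bar>\<rceil>)"]
    proof eventually_elim
      case (elim m)
      then have "nat \<lceil>norm x\<rceil> \<le> m" "nat \<lceil>\<bar>f x\<bar>\<rceil> \<le> m" by simp_all
      then show ?case by linarith
    qed
    then have "eventually (\<lambda>m. (if norm x \<le> real m then max (- real m) (min (real m) (f x)) else 0) - f x = 0) sequentially"
      by eventually_elim (auto simp: abs_le_iff)
    then show "(\<lambda>m. (if norm x \<le> real m then max (- real m) (min (real m) (f x)) else 0) - f x) \<longlonglongrightarrow> 0"
      by (rule tendsto_eventually)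
  qed
qed (auto simp: max_def min_def)

text \<open>Clamping reduces to a bounded function with bounded support. Lebesgue measurability,
  read as being an almost everywhere limit of continuous functions, supplies pointwise approximants;
  clamped and cut off, they have a common majorant, so dominated convergence turns pointwise
  convergence into convergence of norms.\<close>

lemma Lp_dense_continuous:
  fixes f :: "real^'d \<Rightarrow> real"
  assumes p: "p \<ge> 1" and f: "f \<in> Lp_on lborel p" and e: "e > 0"
  obtains g where "continuous_on UNIV g" "bounded {x. g x \<noteq> 0}" "g \<in> Lp_on lborel p"
    "Lp_norm_on lborel p (\<lambda>x. g x - f x) < e"
proof -
  have [measurable]: "f \<in> borel_measurable borel" using f by (auto simp: Lp_on_def)
  let ?c = "\<lambda>m f x. if norm x \<le> real m then max (- real m) (min (real m) (f x)) else 0"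
  obtain m where m: "Lp_norm_on lborel p (\<lambda>x. ?c m f x - f x) < e / 2"
    using order_tendstoD(2)[OF Lp_clamp[OF p f], of "e / 2"] e
    by (auto simp: eventually_sequentially)
  let ?k = "?c m f"
  have kS: "?k \<in> Lp_on lborel p"
    by (rule bounded_support_Lp_on[OF p, where B = m])
       (auto intro!: bounded_subset[OF bounded_cball[of 0 "real m"]])
  have "?k \<in> borel_measurable lborel" by measurable
  then have "?k \<in> borel_measurable lebesgue" by (rule measurable_completion)
  then have "?k measurable_on UNIV"
    by (simp add: measurable_on_iff_borel_measurable)
  then obtain N g where N: "negligible N" and g: "\<And>n. continuous_on UNIV (g n)"
    and lim: "\<And>x. x \<notin> N \<Longrightarrow> (\<lambda>n. g n x) \<longlonglongrightarrow> ?k x"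
    unfolding measurable_on_def by auto
  \<comment> \<open>It is 1 where \<open>?k\<close> lives and 0 beyond radius
    \<open>real m + 1\<close>, so it changes no limit and gives all approximants the same bounded
    support.\<close>
  define cutoff where "cutoff x = max 0 (min 1 (real m + 1 - norm x))" for x :: "real^'d"
  define h where "h n x = cutoff x * max (- real m) (min (real m) (g n x))" for n x
  have hc: "continuous_on UNIV (h n)" for n
    unfolding h_def cutoff_def by (intro continuous_intros g)
  have h1: "\<bar>cutoff x\<bar> \<le> 1" "norm x > m + 1 \<Longrightarrow> cutoff x = 0" for x
    by (auto simp: cutoff_def)
  have hb: "\<bar>h n x\<bar> \<le> real m" for n x
  proof -
    have "\<bar>max (- real m) (min (real m) (g n x))\<bar> \<le> real m" by auto
    then have "\<bar>cutoff x\<bar> * \<bar>max (- real m) (min (real m) (g n x))\<bar> \<le> 1 * real m"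
      using h1 by (intro mult_mono) auto
    then show ?thesis by (simp add: h_def abs_mult)
  qed
  have hs: "h n x = 0" if "norm x > m + 1" for n x using h1(2)[OF that] by (simp add: h_def)
  have [measurable]: "h n \<in> borel_measurable borel" for n
    by (rule borel_measurable_continuous_onI[OF hc])
  have hS: "h n \<in> Lp_on lborel p" and hbd: "bounded {x. h n x \<noteq> 0}" for n
  proof -
    show b: "bounded {x. h n x \<noteq> 0}"
      by (rule bounded_subset[OF bounded_cball[of 0 "real m + 1"]]) (use hs in force)
    show "h n \<in> Lp_on lborel p"
      by (rule bounded_support_Lp_on[OF p _ hb b]) measurable
  qed
  have "(\<lambda>n. Lp_norm_on lborel p (\<lambda>x. h n x - ?k x)) \<longlonglongrightarrow> 0"
  proof (rule Lp_norm_on_dominated_convergence[OF p Lp_on_cball[OF p, of "2 * real m" "real m + 1"]])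
    show "(\<lambda>x. h n x - ?k x) \<in> borel_measurable lborel" for n by measurable
    show "AE x in lborel. \<bar>h n x - ?k x\<bar> \<le> 2 * real m * indicat_real (cball 0 (real m + 1)) x" for n
    proof (rule AE_I2)
      fix x :: "real^'d"
      have "\<bar>?k x\<bar> \<le> real m" by auto
      then show "\<bar>h n x - ?k x\<bar> \<le> 2 * real m * indicat_real (cball 0 (real m + 1)) x"
        using hb[of n x] hs[of x n] by (auto simp: indicator_def)
    qed
    have "AE x in lebesgue. x \<notin> N"
      using N by (intro AE_not_in) (simp add: negligible_iff_null_sets)
    then have "AE x in lborel. x \<notin> N" by (simp add: AE_completion_iff)
    then show "AE x in lborel. (\<lambda>n. h n x - ?k x) \<longlonglongrightarrow> 0"
    proof eventually_elim
      case (elim x)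
      have "(\<lambda>n. h n x) \<longlonglongrightarrow> cutoff x * max (- real m) (min (real m) (?k x))"
        unfolding h_def by (intro tendsto_intros lim elim)
      also have "cutoff x * max (- real m) (min (real m) (?k x)) = ?k x"
        by (auto simp: cutoff_def)
      finally show ?case by (simp add: LIM_zero)
    qed
  qed
  then obtain n where n: "Lp_norm_on lborel p (\<lambda>x. h n x - ?k x) < e / 2"
    using order_tendstoD(2)[of "\<lambda>n. Lp_norm_on lborel p (\<lambda>x. h n x - ?k x)" 0 sequentially "e / 2"] e
    by (auto simp: eventually_sequentially)
  have "Lp_norm_on lborel p (\<lambda>x. h n x - f x) = Lp_norm_on lborel p (\<lambda>x. (h n x - ?k x) + (?k x - f x))"
    by (rule arg_cong[where f = "Lp_norm_on lborel p"]) (simp add: fun_eq_iff)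
  also have "\<dots> < e"
    using Lp_norm_on_triangle[OF p Lp_on_diff(1)[OF p hS kS] Lp_on_diff(1)[OF p kS f], of n] m n by simp
  finally show ?thesis using that hc hS hbd by blast
qed

lemma Lp_translation_continuous_support:
  fixes g :: "real^'d \<Rightarrow> real"
  assumes p: "p \<ge> 1" and c: "continuous_on UNIV g" and b: "bounded {x. g x \<noteq> 0}" and h: "h \<longlonglongrightarrow> 0"
  shows "(\<lambda>n. Lp_norm_on lborel p (\<lambda>x. g (x + h n) - g x)) \<longlonglongrightarrow> 0"
proof -
  have [measurable]: "g \<in> borel_measurable borel" by (rule borel_measurable_continuous_onI[OF c])
  obtain B where B: "B \<ge> 0" "\<And>x. \<bar>g x\<bar> \<le> B" "\<And>x. norm x \<ge> B \<Longrightarrow> g x = 0"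
    using continuous_bounded_support_bounded[OF c b] by metis
  obtain H where H: "\<And>n. norm (h n) \<le> H" "H > 0"
    using convergent_imp_bounded[OF h] by (auto simp: bounded_pos)
  show ?thesis
  proof (rule Lp_norm_on_dominated_convergence[OF p Lp_on_cball[OF p, of "2 * B" "B + H"]])
    show "(\<lambda>x. g (x + h n) - g x) \<in> borel_measurable lborel" for n by measurable
    show "AE x in lborel. \<bar>g (x + h n) - g x\<bar> \<le> 2 * B * indicat_real (cball 0 (B + H)) x" for n
    proof (rule AE_I2)
      fix x :: "real^'d"
      show "\<bar>g (x + h n) - g x\<bar> \<le> 2 * B * indicat_real (cball 0 (B + H)) x"
      proof (cases "norm x \<le> B + H")
        case True
        then show ?thesis using B(2)[of x] B(2)[of "x + h n"] by (auto simp: indicator_def)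
      next
        case False
        have "norm x \<le> norm (x + h n) + norm (h n)"
          using norm_triangle_ineq4[of "x + h n" "h n"] by simp
        then have "norm (x + h n) \<ge> B" "norm x \<ge> B" using False H(1)[of n] H(2) by auto
        then show ?thesis using B by simp
      qed
    qed
    show "AE x in lborel. (\<lambda>n. g (x + h n) - g x) \<longlonglongrightarrow> 0"
    proof (rule AE_I2)
      fix x
      have "(\<lambda>n. g (x + h n)) \<longlonglongrightarrow> g (x + 0)"
        by (rule continuous_on_tendsto_compose[OF c tendsto_add[OF tendsto_const h]]) auto
      then show "(\<lambda>n. g (x + h n) - g x) \<longlonglongrightarrow> 0" by (simp add: LIM_zero)
    qed
  qed
qed

text \<open>The three-epsilon argument: for a continuous function of bounded support the claim is
  dominated convergence, and translation does not enlarge the distance to such a function.\<close>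

lemma Lp_translation_continuous:
  fixes f :: "real^'d \<Rightarrow> real"
  assumes p: "p \<ge> 1" and f: "f \<in> Lp_on lborel p" and h: "h \<longlonglongrightarrow> 0"
  shows "(\<lambda>n. Lp_norm_on lborel p (\<lambda>x. f (x + h n) - f x)) \<longlonglongrightarrow> 0"
proof (rule LIMSEQ_I)
  fix e :: real assume "e > 0"
  then have e: "e / 3 > 0" by simp
  obtain g where g: "continuous_on UNIV g" "bounded {x. g x \<noteq> 0}" "g \<in> Lp_on lborel p"
    "Lp_norm_on lborel p (\<lambda>x. g x - f x) < e / 3"
    using Lp_dense_continuous[OF p f e] .
  have d: "(\<lambda>x. g x - f x) \<in> Lp_on lborel p" using Lp_on_diff p f g by blast
  obtain M where M: "\<And>n. n \<ge> M \<Longrightarrow> Lp_norm_on lborel p (\<lambda>x. g (x + h n) - g x) < e / 3"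
    using order_tendstoD(2)[OF Lp_translation_continuous_support[OF p g(1,2) h] e]
    by (auto simp: eventually_sequentially)
  have "Lp_norm_on lborel p (\<lambda>x. f (x + h n) - f x) < e" if "n \<ge> M" for n
  proof -
    have "Lp_norm_on lborel p (\<lambda>x. f (x + h n) - f x) =
      Lp_norm_on lborel p (\<lambda>x. ((g (x + h n) - g x) - (g (x + h n) - f (x + h n))) + (g x - f x))"
      by (rule arg_cong[where f = "Lp_norm_on lborel p"]) (simp add: fun_eq_iff)
    also have "\<dots> \<le> Lp_norm_on lborel p (\<lambda>x. (g (x + h n) - g x) - (g (x + h n) - f (x + h n))) + Lp_norm_on lborel p (\<lambda>x. g x - f x)"
      by (intro Lp_norm_on_triangle p d Lp_on_diff Lp_on_shift g f)
    also have "Lp_norm_on lborel p (\<lambda>x. (g (x + h n) - g x) - (g (x + h n) - f (x + h n))) \<le>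
       Lp_norm_on lborel p (\<lambda>x. g (x + h n) - g x) + Lp_norm_on lborel p (\<lambda>x. g (x + h n) - f (x + h n))"
      by (intro Lp_norm_on_triangle_diff p d Lp_on_diff Lp_on_shift g f)
    also have "Lp_norm_on lborel p (\<lambda>x. g (x + h n) - f (x + h n)) = Lp_norm_on lborel p (\<lambda>x. g x - f x)"
      using Lp_on_shift(2)[OF d] by simp
    finally show ?thesis using M[OF that] g(4) by simp
  qed
  then show "\<exists>no. \<forall>n\<ge>no. norm (Lp_norm_on lborel p (\<lambda>x. f (x + h n) - f x) - 0) < e" by auto
qed

lemma approx_identity:
  fixes f :: "real^'d \<Rightarrow> real"
  assumes p: "p \<ge> 1" and f: "f \<in> Lp_on lborel p" and w: "integrable lborel w" and h: "h \<longlonglongrightarrow> 0"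
  shows "(\<lambda>n. Lp_norm_on lborel p (\<lambda>x. LINT z|lborel. w z * (f (x + h n *\<^sub>R z) - f x))) \<longlonglongrightarrow> 0"
proof -
  have [measurable]: "f \<in> borel_measurable borel" "w \<in> borel_measurable borel" using f w by (auto simp: Lp_on_def)
  define Q where "Q n z x = f (x + h n *\<^sub>R z) - f x" for n and z x :: "real^'d"
  have Qm[measurable]: "(\<lambda>(z, x). Q n z x) \<in> borel_measurable (lborel \<Otimes>\<^sub>M lborel)" for n
    unfolding Q_def by measurable
  have QS: "Q n z \<in> Lp_on lborel p" for n z
    unfolding Q_def by (intro Lp_on_diff p Lp_on_shift f)
  have QN: "Lp_norm_on lborel p (Q n z) \<le> 2 * Lp_norm_on lborel p f" for n z
    unfolding Q_def using Lp_norm_on_triangle_diff[OF p Lp_on_shift(1)[OF f] f] Lp_on_shift(2)[OF f] by simp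
  have Nm[measurable]: "(\<lambda>z. Lp_norm_on lborel p (Q n z)) \<in> borel_measurable borel" for n
  proof -
    have "(\<lambda>z. LINT x|lborel. \<bar>Q n z x\<bar> powr p) \<in> borel_measurable lborel"
      by measurable
    then show ?thesis unfolding Lp_norm_on_def by simp
  qed
  define W where "W = (LINT z|lborel. \<bar>w z\<bar>)"
  define I where "I n = (LINT z|lborel. \<bar>w z\<bar> * Lp_norm_on lborel p (Q n z) powr p)" for n
  let ?F = "\<lambda>n x. LINT z|lborel. w z * Q n z x"
  have ii: "integrable lborel (\<lambda>z. \<bar>w z\<bar> * Lp_norm_on lborel p (Q n z) powr p)" for n
  proof (rule Bochner_Integration.integrable_bound)
    show "integrable lborel (\<lambda>z. \<bar>w z\<bar> * (2 * Lp_norm_on lborel p f) powr p)" using w by simp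
    show "AE z in lborel. norm (\<bar>w z\<bar> * Lp_norm_on lborel p (Q n z) powr p) \<le> norm (\<bar>w z\<bar> * (2 * Lp_norm_on lborel p f) powr p)"
      using QN p by (intro AE_I2) (auto intro!: mult_left_mono powr_mono2)
  qed simp
  have I: "I \<longlonglongrightarrow> 0"
  proof -
    have "I \<longlonglongrightarrow> (LINT z::real^'d|lborel. 0)"
      unfolding I_def
    proof (rule integral_dominated_convergence[where w = "\<lambda>z. \<bar>w z\<bar> * (2 * Lp_norm_on lborel p f) powr p"])
      show "AE z in lborel. (\<lambda>n. \<bar>w z\<bar> * Lp_norm_on lborel p (Q n z) powr p) \<longlonglongrightarrow> 0"
      proof (rule AE_I2)
        fix z :: "real^'d"
        have "(\<lambda>n. h n *\<^sub>R z) \<longlonglongrightarrow> 0 *\<^sub>R z" by (rule tendsto_scaleR[OF h tendsto_const])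
        then have "(\<lambda>n. Lp_norm_on lborel p (Q n z)) \<longlonglongrightarrow> 0"
          unfolding Q_def by (intro Lp_translation_continuous p f) simp
        then have "(\<lambda>n. \<bar>w z\<bar> * Lp_norm_on lborel p (Q n z) powr p) \<longlonglongrightarrow> \<bar>w z\<bar> * 0 powr p"
          using p by (intro tendsto_intros tendsto_powr') auto
        then show "(\<lambda>n. \<bar>w z\<bar> * Lp_norm_on lborel p (Q n z) powr p) \<longlonglongrightarrow> 0" by simp
      qed
      show "integrable lborel (\<lambda>z. \<bar>w z\<bar> * (2 * Lp_norm_on lborel p f) powr p)" using w by simp
      show "AE z in lborel. norm (\<bar>w z\<bar> * Lp_norm_on lborel p (Q n z) powr p) \<le> \<bar>w z\<bar> * (2 * Lp_norm_on lborel p f) powr p" for n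
        using QN p by (intro AE_I2) (auto intro!: mult_left_mono powr_mono2)
    qed simp_all
    then show ?thesis by simp
  qed
  have FI: "(\<integral>\<^sup>+x. ennreal (\<bar>?F n x\<bar> powr p) \<partial>lborel) \<le> ennreal (W powr (p - 1) * I n)" for n
  proof -
    have "(\<integral>\<^sup>+x. ennreal (\<bar>?F n x\<bar> powr p) \<partial>lborel)
      \<le> ennreal (W powr (p - 1)) * (\<integral>\<^sup>+z. ennreal \<bar>w z\<bar> * (\<integral>\<^sup>+x. ennreal (\<bar>Q n z x\<bar> powr p) \<partial>lborel) \<partial>lborel)"
      unfolding W_def by (rule pair_sigma_finite.minkowski_jensen[OF lborel_pair_sigma_finite p w Qm])
    also have "(\<integral>\<^sup>+z. ennreal \<bar>w z\<bar> * (\<integral>\<^sup>+x. ennreal (\<bar>Q n z x\<bar> powr p) \<partial>lborel) \<partial>lborel) = ennreal (I n)"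
      unfolding I_def using ii[of n] by (subst nn_integral_eq_integral[symmetric]) (auto simp: Lp_on_nn[OF p QS] ennreal_mult)
    finally show ?thesis by (simp add: ennreal_mult I_def)
  qed
  have "(\<lambda>n. Lp_norm_on lborel p (?F n)) \<longlonglongrightarrow> 0"
  proof (rule tendsto_sandwich[OF _ _ tendsto_const])
    have Fm: "?F n \<in> borel_measurable lborel" for n by measurable
    have Ipos: "W powr (p - 1) * I n \<ge> 0" for n by (simp add: I_def)
    have "Lp_norm_on lborel p (?F n) \<le> (W powr (p - 1) * I n) powr (1 / p)" for n
      using Lp_on_leI(2)[OF p _ Fm, of "(W powr (p - 1) * I n) powr (1 / p)" n] FI[of n] Ipos[of n] p
      by (simp add: powr_powr)
    then show "\<forall>\<^sub>F n in sequentially. Lp_norm_on lborel p (?F n) \<le> (W powr (p - 1) * I n) powr (1 / p)" by simp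
    have "(\<lambda>n. (W powr (p - 1) * I n) powr (1 / p)) \<longlonglongrightarrow> (W powr (p - 1) * 0) powr (1 / p)"
      using p Ipos by (intro tendsto_powr' tendsto_intros I) auto
    then show "(\<lambda>n. (W powr (p - 1) * I n) powr (1 / p)) \<longlonglongrightarrow> 0" by simp
  qed simp
  then show ?thesis by (simp add: Q_def)
qed

section \<open>Affine substitution, convolution and product integrals\<close>

lemma lborel_integral_affine:
  fixes f :: "real^'d \<Rightarrow> 'b::{banach, second_countable_topology}"
  assumes [measurable]: "f \<in> borel_measurable borel" and c: "c \<noteq> 0"
  shows "(LINT x|lborel. f x) = \<bar>c\<bar> ^ CARD('d) *\<^sub>R (LINT x|lborel. f (t + c *\<^sub>R x))"
    and "integrable lborel (\<lambda>x. f (t + c *\<^sub>R x)) \<longleftrightarrow> integrable lborel f"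
proof -
  have eq: "lborel = density (distr lborel borel (\<lambda>x. t + c *\<^sub>R x)) (\<lambda>_. ennreal (\<bar>c\<bar> ^ CARD('d)))"
    using lborel_affine[OF c, of t] by simp
  have "(LINT x|lborel. f x) = (LINT x|density (distr lborel borel (\<lambda>x. t + c *\<^sub>R x)) (\<lambda>_. ennreal (\<bar>c\<bar> ^ CARD('d))). f x)"
    by (subst eq) simp
  also have "\<dots> = \<bar>c\<bar> ^ CARD('d) *\<^sub>R (LINT x|lborel. f (t + c *\<^sub>R x))"
    by (subst integral_density) (auto simp: integral_distr)
  finally show "(LINT x|lborel. f x) = \<bar>c\<bar> ^ CARD('d) *\<^sub>R (LINT x|lborel. f (t + c *\<^sub>R x))" .
  have "integrable lborel f \<longleftrightarrow> integrable (density (distr lborel borel (\<lambda>x. t + c *\<^sub>R x)) (\<lambda>_. ennreal (\<bar>c\<bar> ^ CARD('d)))) f"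
    by (subst eq) simp
  also have "\<dots> \<longleftrightarrow> integrable lborel (\<lambda>x. f (t + c *\<^sub>R x))"
  proof -
    let ?a = "\<bar>c\<bar> ^ CARD('d)"
    have "integrable lborel (\<lambda>x. ?a *\<^sub>R f (t + c *\<^sub>R x)) \<longleftrightarrow> integrable lborel (\<lambda>x. f (t + c *\<^sub>R x))"
      using integrable_scaleR_right[of "inverse ?a" lborel "\<lambda>x. ?a *\<^sub>R f (t + c *\<^sub>R x)"] c by auto
    then show ?thesis
      by (subst integrable_density) (simp_all add: integrable_distr_eq)
  qed
  finally show "integrable lborel (\<lambda>x. f (t + c *\<^sub>R x)) \<longleftrightarrow> integrable lborel f" by simp
qed

lemma lborel_nn_affine:
  fixes f :: "real^'d \<Rightarrow> ennreal"
  assumes [measurable]: "f \<in> borel_measurable borel" and c: "c \<noteq> 0"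
  shows "(\<integral>\<^sup>+x. f x \<partial>lborel) = ennreal (\<bar>c\<bar> ^ CARD('d)) * (\<integral>\<^sup>+x. f (t + c *\<^sub>R x) \<partial>lborel)"
proof -
  have eq: "lborel = density (distr lborel borel (\<lambda>x. t + c *\<^sub>R x)) (\<lambda>_. ennreal (\<bar>c\<bar> ^ CARD('d)))"
    using lborel_affine[OF c, of t] by simp
  have "(\<integral>\<^sup>+x. f x \<partial>lborel) = (\<integral>\<^sup>+x. f x \<partial>density (distr lborel borel (\<lambda>x. t + c *\<^sub>R x)) (\<lambda>_. ennreal (\<bar>c\<bar> ^ CARD('d))))"
    by (subst eq) simp
  also have "\<dots> = ennreal (\<bar>c\<bar> ^ CARD('d)) * (\<integral>\<^sup>+x. f (t + c *\<^sub>R x) \<partial>lborel)"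
    by (subst nn_integral_density) (auto simp: nn_integral_distr nn_integral_cmult)
  finally show ?thesis .
qed

definition conv :: "(real^'d \<Rightarrow> real) \<Rightarrow> (real^'d \<Rightarrow> real) \<Rightarrow> real^'d \<Rightarrow> real" where
  "conv K g x = (LINT y|lborel. K (x - y) * g y)"

lemma conv_commute:
  assumes [measurable]: "K \<in> borel_measurable borel" "g \<in> borel_measurable borel"
  shows "conv K g x = (LINT z|lborel. K z * g (x - z))"
  unfolding conv_def by (subst lborel_integral_affine(1)[of _ "-1" x]) auto

lemma conv_Lp_on:
  fixes g :: "real^'d \<Rightarrow> real"
  assumes p: "p \<ge> 1" and K: "integrable lborel K" and g: "g \<in> Lp_on lborel p"
  shows "conv K g \<in> Lp_on lborel p" "Lp_norm_on lborel p (conv K g) \<le> (LINT z|lborel. \<bar>K z\<bar>) * Lp_norm_on lborel p g"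
proof -
  have [measurable]: "g \<in> borel_measurable borel" "K \<in> borel_measurable borel" using g K by (auto simp: Lp_on_def)
  have eq: "conv K g = (\<lambda>x. LINT z|lborel. K z * g (x + (- z)))"
    by (simp add: fun_eq_iff conv_commute)
  have m: "(\<lambda>(z, x). g (x + (- z))) \<in> borel_measurable (lborel \<Otimes>\<^sub>M lborel)" by measurable
  have s: "(\<lambda>x. g (x + (- z))) \<in> Lp_on lborel p \<and> Lp_norm_on lborel p (\<lambda>x. g (x + (- z))) \<le> Lp_norm_on lborel p g" for z
    using Lp_on_shift[OF g, of "-z"] by simp
  show "conv K g \<in> Lp_on lborel p" "Lp_norm_on lborel p (conv K g) \<le> (LINT z|lborel. \<bar>K z\<bar>) * Lp_norm_on lborel p g"
    unfolding eq using pair_sigma_finite.minkowski_jensen_bound[OF lborel_pair_sigma_finite p K m Lp_norm_on_nonneg s] by auto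
qed

text \<open>The bound \<open>\<bar>g y\<bar> \<le> 1 + \<bar>g y\<bar> powr p\<close> replaces
  Hoelder's inequality: the 1 meets the integrable kernel, the power its supremum. Integrability
  thus holds at every \<open>x\<close>, which pointwise evaluation at samples requires.\<close>

lemma conv_integrable:
  fixes g :: "real^'d \<Rightarrow> real"
  assumes p: "p \<ge> 1" and K: "integrable lborel K" "\<And>x. \<bar>K x\<bar> \<le> B" and g: "g \<in> Lp_on lborel p"
  shows "integrable lborel (\<lambda>y. K (x - y) * g y)"
proof (rule Bochner_Integration.integrable_bound)
  have [measurable]: "g \<in> borel_measurable borel" "K \<in> borel_measurable borel" using g K by (auto simp: Lp_on_def)
  have B: "B \<ge> 0" using K(2)[of 0] by linarith
  have "integrable lborel (\<lambda>y. \<bar>K (x - y)\<bar>)"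
    using K lborel_integral_affine(2)[of K "-1" x] by auto
  then show "integrable lborel (\<lambda>y. \<bar>K (x - y)\<bar> + B * \<bar>g y\<bar> powr p)"
    using g by (auto simp: Lp_on_def)
  show "AE y in lborel. norm (K (x - y) * g y) \<le> norm (\<bar>K (x - y)\<bar> + B * \<bar>g y\<bar> powr p)"
  proof (rule AE_I2)
    fix y
    have "\<bar>K (x - y)\<bar> * \<bar>g y\<bar> \<le> \<bar>K (x - y)\<bar> * (1 + \<bar>g y\<bar> powr p)"
      using abs_le_1_plus_powr[OF p] by (intro mult_left_mono) auto
    also have "\<dots> = \<bar>K (x - y)\<bar> + \<bar>K (x - y)\<bar> * \<bar>g y\<bar> powr p" by (simp add: algebra_simps)
    also have "\<dots> \<le> \<bar>K (x - y)\<bar> + B * \<bar>g y\<bar> powr p"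
      using K(2) by (intro add_left_mono mult_right_mono) auto
    finally show "norm (K (x - y) * g y) \<le> norm (\<bar>K (x - y)\<bar> + B * \<bar>g y\<bar> powr p)"
      using B by (simp add: abs_mult)
  qed
  show "(\<lambda>y. K (x - y) * g y) \<in> borel_measurable lborel" by measurable
qed

lemma conv_shift: "conv K (\<lambda>y. g (y + h)) x = conv K g (x + h)"
  if [measurable]: "K \<in> borel_measurable borel" "g \<in> borel_measurable borel"
  by (simp add: conv_commute algebra_simps)

text \<open>Lebesgue measure is an image of the product measure indexed by \<open>Basis\<close>;
  \<open>idx\<close> translates basis vectors into coordinates, after which Fubini for products
  applies.\<close>

lemma lborel_integral_prod:
  fixes f :: "'d::finite \<Rightarrow> real \<Rightarrow> 'b::{real_normed_field, banach, second_countable_topology}"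
  assumes f: "\<And>i. integrable lborel (f i)"
  shows "integrable lborel (\<lambda>x::real^'d. \<Prod>i\<in>UNIV. f i (x $ i))"
    and "(LINT x|lborel. (\<Prod>i\<in>UNIV. f i ((x::real^'d) $ i))) = (\<Prod>i\<in>UNIV. LINT t|lborel. f i t)"
proof -
  interpret product_sigma_finite "\<lambda>_::real^'d. lborel :: real measure" ..
  let ?ax = "\<lambda>i::'d. axis i (1::real)"
  have inj: "inj ?ax" by (auto simp: inj_def axis_eq_axis)
  have bas: "range ?ax = (Basis :: (real^'d) set)" by (auto simp: Basis_vec_def)
  define idx where "idx = inv ?ax"
  have idx: "idx (?ax i) = i" for i unfolding idx_def by (rule inv_f_f[OF inj])
  have [measurable]: "f i \<in> borel_measurable borel" for i using f[of i] by auto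
  have eqp: "(\<Prod>i\<in>UNIV. g i (F (?ax i))) = (\<Prod>b\<in>Basis. g (idx b) (F b))" for g :: "'d \<Rightarrow> real \<Rightarrow> 'b" and F
    unfolding bas[symmetric] by (subst prod.reindex[OF inj]) (simp add: idx)
  have comp: "(\<Sum>b\<in>Basis. F b *\<^sub>R b) $ i = F (?ax i)" for F :: "real^'d \<Rightarrow> real" and i
  proof -
    have "(\<Sum>b\<in>Basis. F b *\<^sub>R b) $ i = (\<Sum>b\<in>Basis. F b *\<^sub>R b) \<bullet> ?ax i"
      by (simp add: inner_axis)
    also have "\<dots> = F (?ax i)" by (rule inner_sum_left_Basis) (auto simp: bas[symmetric])
    finally show ?thesis .
  qed
  have int: "integrable (Pi\<^sub>M Basis (\<lambda>_. lborel)) (\<lambda>F. \<Prod>b\<in>(Basis :: (real^'d) set). f (idx b) (F b))"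
    by (rule product_integrable_prod) (auto intro: f)
  have val: "(LINT F|Pi\<^sub>M Basis (\<lambda>_. lborel). (\<Prod>b\<in>(Basis :: (real^'d) set). f (idx b) (F b))) = (\<Prod>b\<in>(Basis :: (real^'d) set). LINT t|lborel. f (idx b) t)"
    by (rule product_integral_prod) (auto intro: f)
  have m: "(\<lambda>F. \<Sum>b\<in>(Basis :: (real^'d) set). F b *\<^sub>R b) \<in> Pi\<^sub>M Basis (\<lambda>_. lborel) \<rightarrow>\<^sub>M borel"
    by measurable
  show "integrable lborel (\<lambda>x::real^'d. \<Prod>i\<in>UNIV. f i (x $ i))"
    by (subst lborel_eq, subst integrable_distr_eq[OF m]) (simp_all only: comp eqp int, measurable)
  show "(LINT x|lborel. (\<Prod>i\<in>UNIV. f i ((x::real^'d) $ i))) = (\<Prod>i\<in>UNIV. LINT t|lborel. f i t)"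
    by (subst lborel_eq, subst integral_distr[OF m])
       (simp_all only: comp eqp val eqp[of "\<lambda>i t. LINT t|lborel. f i t"], measurable)
qed

lemma integrable_pair_mult:
  fixes a :: "'a::euclidean_space \<Rightarrow> real" and b :: "'b::euclidean_space \<Rightarrow> real"
  assumes a: "integrable lborel a" and b: "integrable lborel b"
  shows "integrable (lborel \<Otimes>\<^sub>M lborel) (\<lambda>(x, y). a x * b y)"
proof -
  have [measurable]: "a \<in> borel_measurable borel" "b \<in> borel_measurable borel" using a b by auto
  show ?thesis
    by (rule pair_sigma_finite.Fubini_integrable[OF lborel_pair_sigma_finite])
       (use a b in \<open>auto simp: abs_mult\<close>)
qed

section \<open>Mollifiers and the uniqueness of weak derivatives\<close>

lemma bump_integrable: "integrable lborel (bump n)"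
proof -
  have "compact (bump n ` {-1..1})"
    using tower_continuous_on[OF tower_bump] by (intro compact_continuous_image) auto
  then obtain B where B: "\<And>t. -1 \<le> t \<Longrightarrow> t \<le> 1 \<Longrightarrow> \<bar>bump n t\<bar> \<le> B"
    using compact_imp_bounded[of "bump n ` {-1..1}"] by (force simp: bounded_iff)
  have le: "\<bar>bump n t\<bar> \<le> \<bar>B * indicator {-1..1} t\<bar>" for t
    using B[of t] bump_eq_0[of t n] by (cases "\<bar>t\<bar> \<ge> 1") (auto simp: indicator_def abs_if split: if_splits)
  show ?thesis
  proof (rule Bochner_Integration.integrable_bound)
    show "integrable lborel (\<lambda>t::real. B * indicator {-1..1} t)"
      by (intro integrable_mult_right integrable_real_indicator) auto
    show "AE t in lborel. norm (bump n t) \<le> norm (B * indicator {-1..1} t)"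
      using le by simp
  qed (use tower_borel[OF tower_bump] in simp)
qed

definition bump_mass :: real where "bump_mass = (LINT t|lborel. bump 0 t)"

lemma bump_mass_pos: "bump_mass > 0"
proof -
  have "bump_mass \<noteq> 0"
  proof
    assume "bump_mass = 0"
    then have "AE t in lborel. bump 0 t = 0"
      unfolding bump_mass_def using integral_nonneg_eq_0_iff_AE[OF bump_integrable[of 0]] bump_nonneg by simp
    then have "AE t in (lborel :: real measure). \<not> (-1 < t \<and> t < 1)"
    proof eventually_elim
      case (elim t)
      then show ?case using bump_pos[of t] by (auto simp: abs_less_iff)
    qed
    from emeasure_eq_0_AE[OF this] have "emeasure lborel {t::real. -1 < t \<and> t < 1} = 0"
      by simp
    moreover have "{t::real. -1 < t \<and> t < 1} = {-1<..<1}" by auto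
    ultimately show False by simp
  qed
  moreover have "bump_mass \<ge> 0" unfolding bump_mass_def by (simp add: bump_nonneg)
  ultimately show ?thesis by simp
qed

definition moll_tower :: "real \<Rightarrow> nat \<Rightarrow> real \<Rightarrow> real" where
  "moll_tower e n t = (1 / (bump_mass * e)) * ((1 / e) ^ n * bump n (0 + (1 / e) * t))"

lemma tower_moll: "tower (moll_tower e)"
  unfolding moll_tower_def by (intro tower_cmult tower_affine tower_bump)

lemma moll_tower_eq_0: "e > 0 \<Longrightarrow> \<bar>t\<bar> \<ge> e \<Longrightarrow> moll_tower e n t = 0"
  by (simp add: moll_tower_def bump_eq_0)

definition moll :: "real \<Rightarrow> real^'d \<Rightarrow> real" where
  "moll e = tprod (\<lambda>_. moll_tower e) (\<lambda>_. 0)"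

lemma moll_nonneg: "e > 0 \<Longrightarrow> moll e x \<ge> 0"
  unfolding moll_def tprod_def moll_tower_def
  by (intro prod_nonneg) (use bump_mass_pos bump_nonneg in simp)

lemma moll_scale: "e > 0 \<Longrightarrow> moll e (e *\<^sub>R x :: real^'d) = moll 1 x / e ^ CARD('d)"
  unfolding moll_def tprod_def moll_tower_def
  by (simp add: prod_dividef prod.distrib divide_simps power_mult_distrib)

lemma moll_borel [measurable]: "moll e \<in> borel_measurable borel"
  unfolding moll_def by (rule tprod_borel) (simp add: tower_moll)

lemma moll_1_integral: "integrable lborel (moll 1)" "(LINT x|lborel. moll 1 x) = 1"
proof -
  have i: "integrable lborel (moll_tower 1 0)"
    unfolding moll_tower_def[abs_def] using bump_integrable[of 0] by simp
  have "(LINT t|lborel. moll_tower 1 0 t) = 1"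
    unfolding moll_tower_def using bump_mass_pos by (simp add: bump_mass_def)
  then show "integrable lborel (moll 1)" "(LINT x|lborel. moll 1 x) = 1"
    unfolding moll_def tprod_def[abs_def] using lborel_integral_prod[OF i] by auto
qed

lemma conv_moll:
  fixes g :: "real^'d \<Rightarrow> real"
  assumes e: "e > 0" and [measurable]: "g \<in> borel_measurable borel"
  shows "conv (moll e) g x = (LINT z|lborel. moll 1 z * g (x + (- e) *\<^sub>R z))"
proof -
  have "conv (moll e) g x = (LINT z|lborel. moll e z * g (x - z))"
    by (rule conv_commute) measurable
  also have "\<dots> = (LINT z|lborel. e ^ CARD('d) * (moll e (e *\<^sub>R z) * g (x - e *\<^sub>R z)))"
    using e by (subst lborel_integral_affine(1)[of _ e 0]) auto
  also have "\<dots> = (LINT z|lborel. moll 1 z * g (x + (- e) *\<^sub>R z))"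
    using e by (intro Bochner_Integration.integral_cong) (auto simp: moll_scale)
  finally show ?thesis .
qed

lemma moll_bounded:
  assumes e: "e > 0"
  obtains B where "\<And>x::real^'d. \<bar>moll e x\<bar> \<le> B"
proof -
  have t: "test_function (moll e :: real^'d \<Rightarrow> real)"
    unfolding moll_def by (rule test_function_tprod[where R = e]) (use e in \<open>auto simp: tower_moll moll_tower_eq_0\<close>)
  show ?thesis
    using continuous_bounded_support_bounded[OF test_function_continuous[OF t]] t that
    by (metis test_function_def)
qed

lemma moll_approx:
  fixes g :: "real^'d \<Rightarrow> real"
  assumes p: "p \<ge> 1" and g: "g \<in> Lp_on lborel p" and e: "\<And>n. e n > 0" "e \<longlonglongrightarrow> 0"
  shows "(\<lambda>n. Lp_norm_on lborel p (\<lambda>x. conv (moll (e n)) g x - g x)) \<longlonglongrightarrow> 0"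
proof -
  have [measurable]: "g \<in> borel_measurable borel" using g by (auto simp: Lp_on_def)
  have i: "integrable lborel (\<lambda>z. moll 1 z * g (x + (- e n) *\<^sub>R z))" for n x
  proof -
    have b: "(\<lambda>z. g (x + (- e n) *\<^sub>R z)) \<in> Lp_on lborel p"
      using g lborel_integral_affine(2)[of "\<lambda>y. \<bar>g y\<bar> powr p" "- e n" x] e(1)[of n] by (auto simp: Lp_on_def)
    obtain B where B: "\<And>x::real^'d. \<bar>moll 1 x\<bar> \<le> B" using moll_bounded[of 1] by auto
    have "integrable lborel (\<lambda>z. moll 1 (0 - z) * g (x + (- e n) *\<^sub>R (- z)))"
      using conv_integrable[OF p moll_1_integral(1) B, of "\<lambda>z. g (x + (- e n) *\<^sub>R (- z))" 0]
        b lborel_integral_affine(2)[of "\<lambda>z. \<bar>g (x + (- e n) *\<^sub>R z)\<bar> powr p" "-1" 0] by (auto simp: Lp_on_def)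
    then show ?thesis
      using lborel_integral_affine(2)[of "\<lambda>z. moll 1 z * g (x + (- e n) *\<^sub>R z)" "-1" 0] by simp
  qed
  have m1: "integrable lborel (moll 1 :: real^'d \<Rightarrow> real)" "(LINT x|lborel. moll 1 (x::real^'d)) = 1"
    by (rule moll_1_integral)+
  have "conv (moll (e n)) g x - g x = (LINT z|lborel. moll 1 z * (g (x + (- e n) *\<^sub>R z) - g x))" for n x
    using i[of x n] m1 e(1)[of n] by (simp add: conv_moll right_diff_distrib)
  then show ?thesis
    using approx_identity[OF p g moll_1_integral(1), of "\<lambda>n. - e n"] tendsto_minus[OF e(2)] by simp
qed

lemma test_function_moll_shift:
  fixes x :: "real^'d"
  assumes e: "e > 0"
  shows "test_function (\<lambda>y. moll e (x - y))"
    and "iter_partial_deriv js (\<lambda>y. moll e (x - y)) y =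
      (-1) ^ length js * tprod (\<lambda>_. moll_tower e) (count_list js) (x - y)"
proof -
  let ?D = "\<lambda>i m t. (-1) ^ m * moll_tower e m (x $ i + (-1) * t)"
  have D: "\<forall>i. tower (?D i)" by (intro allI tower_reflect tower_moll)
  have eq: "(\<lambda>y. moll e (x - y)) = tprod ?D (\<lambda>_. 0)"
    unfolding moll_def by (simp add: fun_eq_iff tprod_reflect)
  have "norm x + e > 0" using e by (simp add: add_nonneg_pos)
  show "test_function (\<lambda>y. moll e (x - y))"
    unfolding eq
  proof (rule test_function_tprod[OF D, where R = "norm x + e"])
    fix i and t :: real assume "norm x + e \<le> \<bar>t\<bar>"
    moreover have "\<bar>x $ i\<bar> \<le> norm x" by (rule component_le_norm_cart)
    ultimately have "\<bar>x $ i - t\<bar> \<ge> e" by linarith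
    then show "?D i 0 t = 0" using e by (simp add: moll_tower_eq_0)
  qed
  have sum: "(\<Sum>i\<in>UNIV. count_list js i) = length js"
    by (rule sum_count_set) auto
  show "iter_partial_deriv js (\<lambda>y. moll e (x - y)) y =
      (-1) ^ length js * tprod (\<lambda>_. moll_tower e) (count_list js) (x - y)"
    unfolding eq iter_partial_deriv_tprod[OF D]
    by (simp add: tprod_reflect[of "\<lambda>_. moll_tower e"] sum mult.assoc[symmetric] power_mult_distrib[symmetric])
qed

text \<open>The fundamental lemma of the calculus of variations. The value of a mollification at a
  point is an integral of \<open>h\<close> against a test function, hence 0, while the
  mollifications of a truncated \<open>h\<close> converge to it in norm.\<close>

lemma weak_zero_imp_AE_zero:
  fixes h :: "real^'d \<Rightarrow> real"
  assumes [measurable]: "h \<in> borel_measurable borel"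
    and loc: "\<And>R. integrable lborel (\<lambda>x. indicator (cball 0 R) x * h x)"
    and z: "\<And>\<phi>. test_function \<phi> \<Longrightarrow> (LINT x|lborel. h x * \<phi> x) = 0"
  shows "AE x in lborel. h x = 0"
proof -
  have "AE x in lborel. norm x \<le> real N \<longrightarrow> h x = 0" for N
  proof -
    \<comment> \<open>The mollifiers used are supported in a cube of half-width at most 1, where the
      norm is at most \<open>CARD('d)\<close>. Truncating \<open>h\<close> at radius
      \<open>M\<close> is therefore invisible to the mollification at points of norm at most
      \<open>N\<close>.\<close>
    define M where "M = real N + CARD('d)"
    define hM where "hM x = (if norm x \<le> M then h x else 0)" for x
    define u where "u x = (if norm x \<le> real N then h x else 0)" for x
    have [measurable]: "hM \<in> borel_measurable borel" "u \<in> borel_measurable borel"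
      unfolding hM_def u_def by measurable
    have hM: "hM \<in> Lp_on lborel 1"
    proof -
      have "hM = (\<lambda>x. indicator (cball 0 M) x * h x)" by (auto simp: hM_def fun_eq_iff indicator_def)
      then show ?thesis using loc[of M] by (simp add: Lp_on_def)
    qed
    define e where "e n = inverse (real (Suc n))" for n
    have e: "\<And>n. e n > 0" "e \<longlonglongrightarrow> 0" "\<And>n. e n \<le> 1"
      unfolding e_def[abs_def] using LIMSEQ_inverse_real_of_nat by (auto simp: inverse_eq_divide simp del: of_nat_Suc)
    have lim: "(\<lambda>n. Lp_norm_on lborel 1 (\<lambda>x. conv (moll (e n)) hM x - hM x)) \<longlonglongrightarrow> 0"
      by (rule moll_approx[OF _ hM e(1,2)]) simp
    have convz: "conv (moll (e n)) hM x = 0" if x: "norm x \<le> real N" for n x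
    proof -
      have "conv (moll (e n)) hM x = (LINT y|lborel. h y * moll (e n) (x - y))"
        unfolding conv_def
      proof (rule Bochner_Integration.integral_cong[OF refl])
        fix y
        show "moll (e n) (x - y) * hM y = h y * moll (e n) (x - y)"
        proof (cases "moll (e n) (x - y) = 0")
          case False
          have "\<bar>(x - y) $ i\<bar> \<le> 1" for i
          proof (rule ccontr)
            assume "\<not> \<bar>(x - y) $ i\<bar> \<le> 1"
            then have "moll_tower (e n) 0 ((x - y) $ i) = 0"
              using e(1,3)[of n] by (intro moll_tower_eq_0) auto
            then show False using False unfolding moll_def tprod_def by (simp add: prod_zero_iff)
          qed
          then have "(\<Sum>i\<in>UNIV. \<bar>(x - y) $ i\<bar>) \<le> (\<Sum>i\<in>(UNIV :: 'd set). 1)"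
            by (intro sum_mono) auto
          then have "norm (x - y) \<le> CARD('d)" using norm_le_l1_cart[of "x - y"] by simp
          then have "norm y \<le> M" using x norm_triangle_sub[of y x] by (simp add: M_def norm_minus_commute)
          then show ?thesis by (simp add: hM_def)
        qed simp
      qed
      also have "\<dots> = 0" by (rule z[OF test_function_moll_shift(1)[OF e(1)]])
      finally show ?thesis .
    qed
    have cS: "conv (moll (e n)) hM \<in> Lp_on lborel 1" for n
      using e(1)[of n] lborel_integral_affine(2)[of "moll (e n)" "e n" 0] moll_1_integral
      by (intro conv_Lp_on hM) (auto simp: moll_scale)
    have "Lp_norm_on lborel 1 u \<le> Lp_norm_on lborel 1 (\<lambda>x. conv (moll (e n)) hM x - hM x)" for n
    proof (rule Lp_norm_on_mono(2))
      show "(\<lambda>x. conv (moll (e n)) hM x - hM x) \<in> Lp_on lborel 1"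
        by (intro Lp_on_diff cS hM) simp
      show "\<bar>u x\<bar> \<le> \<bar>conv (moll (e n)) hM x - hM x\<bar>" for x
        using convz[of x n] by (auto simp: u_def hM_def M_def)
    qed auto
    then have "Lp_norm_on lborel 1 u \<le> 0"
      by (intro LIMSEQ_le_const[OF lim]) auto
    then have "Lp_norm_on lborel 1 u = 0" by (intro antisym) auto
    then have "(LINT x|lborel. \<bar>u x\<bar> powr 1) = 0" by (simp add: Lp_norm_on_def)
    moreover have "integrable lborel (\<lambda>x. \<bar>u x\<bar> powr 1)"
      by (rule Bochner_Integration.integrable_bound[of _ "\<lambda>x. \<bar>hM x\<bar> powr 1"])
         (use hM in \<open>auto simp: Lp_on_def u_def hM_def M_def\<close>)
    ultimately have "AE x in lborel. \<bar>u x\<bar> powr 1 = 0"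
      using integral_nonneg_eq_0_iff_AE[of lborel "\<lambda>x. \<bar>u x\<bar> powr 1"] by simp
    then show ?thesis by eventually_elim (auto simp: u_def)
  qed
  then have "AE x in lborel. \<forall>N. norm x \<le> real N \<longrightarrow> h x = 0"
    by (simp only: AE_all_countable) blast
  then show ?thesis
    by eventually_elim (use real_arch_simple in blast)
qed

section \<open>Finite differences of Sobolev functions\<close>

text \<open>The testing identity of \<open>is_weak_deriv\<close>, but with integrals over
  \<open>lborel\<close>, for Borel functions. Local integrability is left out since it follows from
  membership in \<open>Lp_on lborel p\<close>.\<close>

definition weak_pair :: "('d::finite \<Rightarrow> nat) \<Rightarrow> (real^'d \<Rightarrow> real) \<Rightarrow> (real^'d \<Rightarrow> real) \<Rightarrow> bool" where
  "weak_pair \<alpha> f v \<longleftrightarrow> (\<forall>\<phi> js. test_function \<phi> \<and> (\<forall>i. count_list js i = \<alpha> i) \<longrightarrow>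
     (LINT x|lborel. f x * iter_partial_deriv js \<phi> x) =
       (-1) ^ (\<Sum>i\<in>UNIV. \<alpha> i) * (LINT x|lborel. v x * \<phi> x))"

lemma tprod_bounded_support:
  fixes D :: "'d::finite \<Rightarrow> nat \<Rightarrow> real \<Rightarrow> real"
  assumes D: "\<forall>i. tower (D i)" and R: "\<And>i m t. \<bar>t\<bar> \<ge> R \<Longrightarrow> D i m t = 0"
  obtains B where "B \<ge> 0" "\<And>x. \<bar>tprod D \<alpha> x\<bar> \<le> B" "\<And>x. norm x \<ge> B \<Longrightarrow> tprod D \<alpha> x = 0" "integrable lborel (tprod D \<alpha>)"
proof -
  have t: "test_function (tprod D \<alpha>)"
    by (rule test_function_tprod[OF D]) (rule R)
  then have b: "bounded {x. tprod D \<alpha> x \<noteq> 0}" by (simp add: test_function_def)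
  obtain B where B: "B \<ge> 0" "\<And>x. \<bar>tprod D \<alpha> x\<bar> \<le> B" "\<And>x. norm x \<ge> B \<Longrightarrow> tprod D \<alpha> x = 0"
    using continuous_bounded_support_bounded[OF test_function_continuous[OF t] b] by metis
  show ?thesis
    using that[OF B] bounded_support_integrable[OF test_function_borel[OF t] B(2) b] by blast
qed

text \<open>The fundamental theorem of calculus along the segment from \<open>x\<close> to
  \<open>x + h\<close> is applied to the kernel under the integral, so \<open>g\<close> needs no
  smoothness; Fubini then moves the integration over the segment outside.\<close>

lemma conv_tprod_increment:
  fixes D :: "'d::finite \<Rightarrow> nat \<Rightarrow> real \<Rightarrow> real" and g :: "real^'d \<Rightarrow> real"
  assumes D: "\<forall>i. tower (D i)" and R: "\<And>i m t. \<bar>t\<bar> \<ge> R \<Longrightarrow> D i m t = 0"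
    and p: "p \<ge> 1" and g: "g \<in> Lp_on lborel p"
  shows "conv (tprod D \<alpha>) g (x + h) - conv (tprod D \<alpha>) g x =
    (LINT t|lborel. indicator {0..1} t *
      (\<Sum>i\<in>UNIV. h $ i * conv (tprod D (\<alpha>(i := Suc (\<alpha> i)))) g (x + t *\<^sub>R h)))"
proof -
  have [measurable]: "g \<in> borel_measurable borel" using g by (auto simp: Lp_on_def)
  have [measurable]: "tprod D \<beta> \<in> borel_measurable borel" for \<beta> by (rule tprod_borel[OF D])
  define S where "S u = (\<Sum>i\<in>UNIV. h $ i * tprod D (\<alpha>(i := Suc (\<alpha> i))) u)" for u
  have [measurable]: "S \<in> borel_measurable borel" unfolding S_def by measurable
  have cS: "continuous_on UNIV S"
    unfolding S_def by (intro continuous_intros tprod_continuous[OF D])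
  have ci: "integrable lborel (\<lambda>y. tprod D \<beta> (x - y) * g y)" for \<beta> x
    by (rule tprod_bounded_support[OF D R, where \<alpha> = \<beta>]) (auto intro: conv_integrable[OF p _ _ g])
  have FTC: "(LINT t|lborel. indicator {0..1} t * S (u + t *\<^sub>R h)) = tprod D \<alpha> (u + h) - tprod D \<alpha> u" for u
  proof -
    have "(LINT t|lborel. indicator {0..1} t *\<^sub>R S (u + t *\<^sub>R h)) = tprod D \<alpha> (u + 1 *\<^sub>R h) - tprod D \<alpha> (u + 0 *\<^sub>R h)"
    proof (rule integral_FTC_atLeastAtMost)
      show "continuous_on {0..1} (\<lambda>t. S (u + t *\<^sub>R h))"
        by (rule continuous_on_compose2[OF cS]) (auto intro!: continuous_intros)
      fix t :: real
      have "((\<lambda>t. u + t *\<^sub>R h) has_derivative (\<lambda>c. c *\<^sub>R h)) (at t within {0..1})"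
        by (auto intro!: derivative_eq_intros)
      from has_derivative_compose[OF this tprod_has_derivative[OF D]]
      show "((\<lambda>t. tprod D \<alpha> (u + t *\<^sub>R h)) has_vector_derivative S (u + t *\<^sub>R h)) (at t within {0..1})"
        by (simp add: has_vector_derivative_def S_def sum_distrib_left mult.assoc)
    qed simp
    then show ?thesis by simp
  qed
  obtain M where M: "M \<ge> 0" "\<And>u. \<bar>S u\<bar> \<le> M" "\<And>u. norm u \<ge> M \<Longrightarrow> S u = 0"
  proof -
    have b: "bounded {u. tprod D \<beta> u \<noteq> 0}" for \<beta>
      using test_function_tprod[OF D, of R \<beta>] R by (simp add: test_function_def)
    have "bounded {u. S u \<noteq> 0}"
    proof (rule bounded_subset)
      show "bounded (\<Union>i\<in>UNIV. {u. tprod D (\<alpha>(i := Suc (\<alpha> i))) u \<noteq> 0})"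
        using b by (intro bounded_UN) auto
      show "{u. S u \<noteq> 0} \<subseteq> (\<Union>i\<in>UNIV. {u. tprod D (\<alpha>(i := Suc (\<alpha> i))) u \<noteq> 0})"
        unfolding S_def by (auto intro: ccontr intro!: sum.neutral)
    qed
    then show ?thesis using continuous_bounded_support_bounded[OF cS] that by metis
  qed
  \<comment> \<open>For \<open>norm y > R'\<close> the argument \<open>x - y + t *\<^sub>R h\<close>
    has norm above \<open>M\<close> for every \<open>t\<close> between 0 and 1, so \<open>S\<close>
    vanishes there.\<close>
  define R' where "R' = M + norm x + norm h"
  have int: "integrable (lborel \<Otimes>\<^sub>M lborel) (\<lambda>(t, y). indicator {0..1} t * S (x - y + t *\<^sub>R h) * g y)"
  proof (rule Bochner_Integration.integrable_bound)
    show "integrable (lborel \<Otimes>\<^sub>M lborel) (\<lambda>(t::real, y). indicator {0..1} t * (M * (indicator (cball 0 R') y + \<bar>g y\<bar> powr p)))"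
    proof (rule integrable_pair_mult)
      show "integrable lborel (\<lambda>y. M * (indicator (cball 0 R') y + \<bar>g y\<bar> powr p))"
        using g by (auto simp: Lp_on_def intro!: integrable_indicator_cball)
    qed (auto intro!: integrable_real_indicator)
    show "(\<lambda>(t, y). indicator {0..1} t * S (x - y + t *\<^sub>R h) * g y) \<in> borel_measurable (lborel \<Otimes>\<^sub>M lborel)"
      by measurable
    have "\<bar>indicator {0..1} t * S (x - y + t *\<^sub>R h) * g y\<bar> \<le> \<bar>indicator {0..1} t * (M * (indicator (cball 0 R') y + \<bar>g y\<bar> powr p))\<bar>"
      for t :: real and y
    proof (cases "t \<in> {0..1} \<and> S (x - y + t *\<^sub>R h) \<noteq> 0")
      case True
      have "norm y \<le> norm (x - y + t *\<^sub>R h) + norm (x + t *\<^sub>R h)"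
        using norm_triangle_ineq4[of "x + t *\<^sub>R h" "x - y + t *\<^sub>R h"] by (simp add: algebra_simps)
      also have "norm (x + t *\<^sub>R h) \<le> norm x + norm h"
        using norm_triangle_ineq[of x "t *\<^sub>R h"] True mult_left_le_one_le[of "norm h" t] by simp
      finally have "norm y \<le> R'" using M(3)[of "x - y + t *\<^sub>R h"] True by (auto simp: R'_def not_le intro: ccontr)
      moreover have "\<bar>S (x - y + t *\<^sub>R h)\<bar> * \<bar>g y\<bar> \<le> M * (1 + \<bar>g y\<bar> powr p)"
        using M abs_le_1_plus_powr[OF p] by (intro mult_mono) auto
      ultimately show ?thesis using True M by (simp add: abs_mult)
    qed (auto simp: indicator_def)
    then show "AE ty in lborel \<Otimes>\<^sub>M lborel. norm (case ty of (t, y) \<Rightarrow> indicator {0..1} t * S (x - y + t *\<^sub>R h) * g y)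
        \<le> norm (case ty of (t, y) \<Rightarrow> indicator {0..1} t * (M * (indicator (cball 0 R') y + \<bar>g y\<bar> powr p)))"
      by (auto intro!: AE_I2)
  qed
  have "conv (tprod D \<alpha>) g (x + h) - conv (tprod D \<alpha>) g x
     = (LINT y|lborel. (tprod D \<alpha> (x - y + h) - tprod D \<alpha> (x - y)) * g y)"
    using ci[of \<alpha> "x + h"] ci[of \<alpha> x]
    by (simp add: conv_def left_diff_distrib algebra_simps)
  also have "\<dots> = (LINT y|lborel. LINT t|lborel. indicator {0..1} t * S (x - y + t *\<^sub>R h) * g y)"
    unfolding FTC[symmetric] by simp
  also have "\<dots> = (LINT t|lborel. LINT y|lborel. indicator {0..1} t * S (x - y + t *\<^sub>R h) * g y)"
    by (rule pair_sigma_finite.Fubini_integral[OF lborel_pair_sigma_finite int])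
  also have "\<dots> = (LINT t|lborel. indicator {0..1} t *
      (\<Sum>i\<in>UNIV. h $ i * conv (tprod D (\<alpha>(i := Suc (\<alpha> i)))) g (x + t *\<^sub>R h)))"
  proof (rule Bochner_Integration.integral_cong[OF refl])
    fix t :: real
    have "(LINT y|lborel. S (x - y + t *\<^sub>R h) * g y) =
       (LINT y|lborel. (\<Sum>i\<in>UNIV. h $ i * (tprod D (\<alpha>(i := Suc (\<alpha> i))) ((x + t *\<^sub>R h) - y) * g y)))"
      by (simp add: S_def sum_distrib_left algebra_simps)
    also have "\<dots> = (\<Sum>i\<in>UNIV. h $ i * conv (tprod D (\<alpha>(i := Suc (\<alpha> i)))) g (x + t *\<^sub>R h))"
      unfolding conv_def using ci by (subst Bochner_Integration.integral_sum) (auto intro!: integrable_mult_right)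
    finally show "(LINT y|lborel. indicator {0..1} t * S (x - y + t *\<^sub>R h) * g y) = indicator {0..1} t *
      (\<Sum>i\<in>UNIV. h $ i * conv (tprod D (\<alpha>(i := Suc (\<alpha> i)))) g (x + t *\<^sub>R h))"
      by (simp add: mult.assoc)
  qed
  finally show ?thesis .
qed

text \<open>Minkowski's inequality over the segment. Each component of \<open>h\<close> is estimated
  by \<open>norm h\<close>, whence the factor \<open>CARD('d)\<close>.\<close>

lemma conv_tprod_increment_bound:
  fixes D :: "'d::finite \<Rightarrow> nat \<Rightarrow> real \<Rightarrow> real" and g :: "real^'d \<Rightarrow> real"
  assumes D: "\<forall>i. tower (D i)" and R: "\<And>i m t. \<bar>t\<bar> \<ge> R \<Longrightarrow> D i m t = 0"
    and p: "p \<ge> 1" and g: "g \<in> Lp_on lborel p"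
    and C: "\<And>i. Lp_norm_on lborel p (conv (tprod D (\<alpha>(i := Suc (\<alpha> i)))) g) \<le> C"
  shows "Lp_norm_on lborel p (\<lambda>x. conv (tprod D \<alpha>) g (x + h) - conv (tprod D \<alpha>) g x) \<le> CARD('d) * norm h * C"
proof -
  let ?G = "\<lambda>i. conv (tprod D (\<alpha>(i := Suc (\<alpha> i)))) g"
  have GS: "?G i \<in> Lp_on lborel p" for i
    by (rule tprod_bounded_support[OF D R, where \<alpha> = "\<alpha>(i := Suc (\<alpha> i))"]) (auto intro!: conv_Lp_on[OF p _ g])
  have [measurable]: "?G i \<in> borel_measurable borel" for i using GS[of i] by (simp add: Lp_on_def)
  define Q where "Q t x = (\<Sum>i\<in>UNIV. h $ i * ?G i (x + t *\<^sub>R h))" for t :: real and x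
  have C0: "C \<ge> 0" using order.trans[OF Lp_norm_on_nonneg C] .
  have "Lp_norm_on lborel p (\<lambda>x. LINT t|lborel. indicator {0..1} t * Q t x) \<le> (LINT t|lborel. \<bar>indicator {0..1::real} t\<bar>) * (CARD('d) * norm h * C)"
  proof (rule pair_sigma_finite.minkowski_jensen_bound(2)[OF lborel_pair_sigma_finite p])
    show "(\<lambda>(t, x). Q t x) \<in> borel_measurable (lborel \<Otimes>\<^sub>M lborel)" unfolding Q_def by measurable
    show "integrable lborel (indicator {0..1::real} :: real \<Rightarrow> real)" by (auto intro!: integrable_real_indicator)
    show "Q t \<in> Lp_on lborel p \<and> Lp_norm_on lborel p (Q t) \<le> CARD('d) * norm h * C" for t
    proof
      have s: "(\<lambda>x. h $ i * ?G i (x + t *\<^sub>R h)) \<in> Lp_on lborel p" for i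
        by (intro Lp_on_cmult Lp_on_shift GS)
      show "Q t \<in> Lp_on lborel p" unfolding Q_def[abs_def] by (intro Lp_on_sum p s) auto
      have "Lp_norm_on lborel p (Q t) \<le> (\<Sum>i\<in>UNIV. Lp_norm_on lborel p (\<lambda>x. h $ i * ?G i (x + t *\<^sub>R h)))"
        unfolding Q_def[abs_def] by (intro Lp_norm_on_sum p s) auto
      also have "\<dots> \<le> (\<Sum>i\<in>(UNIV::'d set). norm h * C)"
        using C component_le_norm_cart[of h]
        by (intro sum_mono) (auto simp: Lp_norm_on_cmult[OF p] Lp_on_shift(2)[OF GS] intro!: mult_mono)
      finally show "Lp_norm_on lborel p (Q t) \<le> CARD('d) * norm h * C" by simp
    qed
  qed (use C0 in auto)
  moreover have "conv (tprod D \<alpha>) g (x + h) - conv (tprod D \<alpha>) g x = (LINT t|lborel. indicator {0..1} t * Q t x)" for x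
    unfolding Q_def by (rule conv_tprod_increment[OF D R p g])
  ultimately show ?thesis by simp
qed

text \<open>A difference of a convolution is the convolution with the differenced \<open>g\<close>.
  The induction can therefore move one difference at a time onto \<open>g\<close> and then exchange
  it for a derivative of the kernel and a factor \<open>CARD('d) * norm h\<close>.\<close>

lemma finite_diff_conv_tprod_bound:
  fixes D :: "'d::finite \<Rightarrow> nat \<Rightarrow> real \<Rightarrow> real" and g :: "real^'d \<Rightarrow> real"
  assumes D: "\<forall>i. tower (D i)" and R: "\<And>i m t. \<bar>t\<bar> \<ge> R \<Longrightarrow> D i m t = 0" and p: "p \<ge> 1"
  shows "g \<in> Lp_on lborel p \<Longrightarrow>
    (\<And>js. length js = m \<Longrightarrow> Lp_norm_on lborel p (conv (tprod D (\<lambda>i. \<alpha> i + count_list js i)) g) \<le> C) \<Longrightarrow>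
    Lp_norm_on lborel p (finite_diff m h (conv (tprod D \<alpha>) g)) \<le> (CARD('d) * norm h) ^ m * C"
proof (induction m arbitrary: g C)
  case 0
  then show ?case using 0(2)[of "[]"] by simp
next
  case (Suc m)
  have [measurable]: "g \<in> borel_measurable borel" using Suc(2) by (auto simp: Lp_on_def)
  have [measurable]: "tprod D \<beta> \<in> borel_measurable borel" for \<beta> by (rule tprod_borel[OF D])
  let ?g = "\<lambda>y. g (y + h) - g y"
  have gS: "?g \<in> Lp_on lborel p" by (intro Lp_on_diff p Lp_on_shift Suc.prems(1))
  have ci: "integrable lborel (\<lambda>y. tprod D \<beta> (x - y) * g y)" "integrable lborel (\<lambda>y. tprod D \<beta> (x - y) * g (y + h))" for \<beta> x
    by (rule tprod_bounded_support[OF D R, where \<alpha> = \<beta>];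
        auto intro!: conv_integrable[OF p] Suc.prems(1) Lp_on_shift)+
  have eq: "conv (tprod D \<beta>) ?g x = conv (tprod D \<beta>) g (x + h) - conv (tprod D \<beta>) g x" for \<beta> x
    using ci[of \<beta> x] by (simp add: conv_shift[symmetric]) (simp add: conv_def right_diff_distrib)
  have "Lp_norm_on lborel p (finite_diff m h (conv (tprod D \<alpha>) ?g)) \<le> (CARD('d) * norm h) ^ m * (CARD('d) * norm h * C)"
  proof (rule Suc.IH[OF gS])
    fix js :: "'d list" assume js: "length js = m"
    have "(\<lambda>i. \<alpha> i + count_list js i)(j := Suc (\<alpha> j + count_list js j)) = (\<lambda>i. \<alpha> i + count_list (j # js) i)" for j
      by auto
    then have "Lp_norm_on lborel p (conv (tprod D ((\<lambda>i. \<alpha> i + count_list js i)(j := Suc (\<alpha> j + count_list js j)))) g) \<le> C" for j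
      using Suc.prems(2)[of "j # js"] js by simp
    then show "Lp_norm_on lborel p (conv (tprod D (\<lambda>i. \<alpha> i + count_list js i)) ?g) \<le> CARD('d) * norm h * C"
      unfolding eq by (intro conv_tprod_increment_bound[OF D R p Suc.prems(1)])
  qed
  then show ?case
    by (simp add: finite_diff_Suc' eq[abs_def] mult.assoc mult.left_commute)
qed

lemma multi_indices_finite: "finite (multi_indices k :: ('d::finite \<Rightarrow> nat) set)"
proof (rule finite_subset)
  show "multi_indices k \<subseteq> (PiE (UNIV :: 'd set) (\<lambda>_. {..k}))"
    by (auto simp: multi_indices_def PiE_def intro: member_le_sum)
  show "finite (PiE (UNIV :: 'd set) (\<lambda>_. {..k}))" by (intro finite_PiE) auto
qed

lemma count_list_multi_indices: "count_list js \<in> multi_indices (length js)"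
  unfolding multi_indices_def using sum_count_set[of js UNIV] by simp

text \<open>Derivatives of a mollification of \<open>g\<close> are mollifications of the weak
  derivatives, whose norms stay below \<open>S\<close> because the mollifier has mass 1. The smooth
  estimate thus holds uniformly in the width \<open>e\<close> and survives \<open>e\<close> tending
  to 0.\<close>

lemma sobolev_finite_diff_bound:
  fixes g :: "real^'d \<Rightarrow> real"
  assumes p: "p \<ge> 1" and g: "g \<in> Lp_on lborel p"
    and v: "\<And>\<alpha>. \<alpha> \<in> multi_indices s \<Longrightarrow> \<exists>v\<in>Lp_on lborel p. weak_pair \<alpha> g v \<and> Lp_norm_on lborel p v \<le> S"
  shows "Lp_norm_on lborel p (finite_diff s h g) \<le> (CARD('d) * norm h) ^ s * S"
proof -
  have bound: "Lp_norm_on lborel p (finite_diff s h (conv (moll e) g)) \<le> (CARD('d) * norm h) ^ s * S" if e: "e > 0" for e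
    unfolding moll_def
  proof (rule finite_diff_conv_tprod_bound[OF _ _ p g, where R = e])
    fix js :: "'d list" assume js: "length js = s"
    obtain v where vS: "v \<in> Lp_on lborel p" and wp: "weak_pair (count_list js) g v" and vN: "Lp_norm_on lborel p v \<le> S"
      using v[of "count_list js"] count_list_multi_indices[of js] js by auto
    have "conv (tprod (\<lambda>_. moll_tower e) (\<lambda>i. 0 + count_list js i)) g x = conv (moll e) v x" for x
    proof -
      \<comment> \<open>The weak derivative is tested with the mollifier centred at
        \<open>x\<close>. Differentiating in \<open>y\<close> instead of \<open>x - y\<close>
        produces the same sign as the definition of weak derivatives, so the two cancel.\<close>
      have "(LINT y|lborel. g y * iter_partial_deriv js (\<lambda>y. moll e (x - y)) y) =
          (-1) ^ length js * (LINT y|lborel. v y * moll e (x - y))"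
        using wp test_function_moll_shift(1)[OF e, of x] sum_count_set[of js UNIV] unfolding weak_pair_def by simp
      then have "(-1) ^ length js * (LINT y|lborel. g y * tprod (\<lambda>_. moll_tower e) (count_list js) (x - y)) =
          (-1) ^ length js * (LINT y|lborel. v y * moll e (x - y))"
        unfolding test_function_moll_shift(2)[OF e]
        by (simp add: mult.left_commute[of "g _"])
      then show ?thesis by (simp add: conv_def mult.commute)
    qed
    then have "Lp_norm_on lborel p (conv (tprod (\<lambda>_. moll_tower e) (\<lambda>i. 0 + count_list js i)) g) = Lp_norm_on lborel p (conv (moll e) v)"
      by presburger
    also have "\<dots> \<le> (LINT z|lborel. \<bar>moll e (z::real^'d)\<bar>) * Lp_norm_on lborel p v"
      using e lborel_integral_affine(2)[of "moll e" e 0] moll_1_integral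
      by (intro conv_Lp_on p vS) (auto simp: moll_scale)
    also have "(LINT z|lborel. \<bar>moll e (z::real^'d)\<bar>) = 1"
      using e moll_1_integral by (subst lborel_integral_affine(1)[of _ e 0]) (auto simp: moll_scale moll_nonneg)
    finally show "Lp_norm_on lborel p (conv (tprod (\<lambda>_. moll_tower e) (\<lambda>i. 0 + count_list js i)) g) \<le> S"
      using vN by simp
  qed (use e in \<open>auto simp: tower_moll moll_tower_eq_0\<close>)
  define e where "e n = inverse (real (Suc n))" for n
  have e: "\<And>n. e n > 0" "e \<longlonglongrightarrow> 0"
    unfolding e_def[abs_def] using LIMSEQ_inverse_real_of_nat by (auto simp del: of_nat_Suc)
  have cS: "conv (moll (e n)) g \<in> Lp_on lborel p" for n
    using e(1)[of n] lborel_integral_affine(2)[of "moll (e n)" "e n" 0] moll_1_integral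
    by (intro conv_Lp_on p g) (auto simp: moll_scale)
  have "(\<lambda>n. (CARD('d) * norm h) ^ s * S + 2 ^ s * Lp_norm_on lborel p (\<lambda>x. conv (moll (e n)) g x - g x)) \<longlonglongrightarrow> (CARD('d) * norm h) ^ s * S + 2 ^ s * 0"
    by (intro tendsto_intros moll_approx p g e)
  moreover have "Lp_norm_on lborel p (finite_diff s h g) \<le> (CARD('d) * norm h) ^ s * S + 2 ^ s * Lp_norm_on lborel p (\<lambda>x. conv (moll (e n)) g x - g x)" for n
  proof -
    have dS: "(\<lambda>x. conv (moll (e n)) g x - g x) \<in> Lp_on lborel p" by (intro Lp_on_diff p cS g)
    have "finite_diff s h g = (\<lambda>x. finite_diff s h (conv (moll (e n)) g) x - finite_diff s h (\<lambda>x. conv (moll (e n)) g x - g x) x)"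
      by (simp add: fun_eq_iff finite_diff_diff)
    then have "Lp_norm_on lborel p (finite_diff s h g) \<le> Lp_norm_on lborel p (finite_diff s h (conv (moll (e n)) g))
        + Lp_norm_on lborel p (finite_diff s h (\<lambda>x. conv (moll (e n)) g x - g x))"
      using Lp_norm_on_triangle_diff[OF p finite_diff_Lp_on(1)[OF p cS] finite_diff_Lp_on(1)[OF p dS]] by simp
    then show ?thesis using bound[OF e(1)[of n]] finite_diff_Lp_norm_on[OF p dS, of s h] by linarith
  qed
  ultimately show ?thesis by (intro LIMSEQ_le_const) auto
qed

section \<open>A kernel with compactly supported Fourier transform\<close>

lemma integral_by_parts_bump:
  fixes Q :: "nat \<Rightarrow> real \<Rightarrow> real"
  assumes Q: "tower Q" and z: "Q n 1 = 0" "Q n (-1) = 0"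
    and G: "\<And>y. (G has_real_derivative g y) (at y)" and g: "continuous_on {-1..1} g"
  shows "integral {-1..1} (\<lambda>y. Q n y * g y) = - integral {-1..1} (\<lambda>y. Q (Suc n) y * G y)"
proof -
  have cG: "continuous_on {-1..1} G" using G by (meson DERIV_isCont continuous_at_imp_continuous_on)
  have "((\<lambda>y. Q n y * g y + Q (Suc n) y * G y) has_integral (Q n 1 * G 1 - Q n (-1) * G (-1))) {-1..1}"
  proof (rule fundamental_theorem_of_calculus)
    fix y :: real
    have "((\<lambda>y. Q n y * G y) has_real_derivative (Q n y * g y + Q (Suc n) y * G y)) (at y)"
      using DERIV_mult[OF towerD[OF Q, of n] G] by (simp add: mult.commute add.commute)
    then show "((\<lambda>y. Q n y * G y) has_vector_derivative (Q n y * g y + Q (Suc n) y * G y)) (at y within {-1..1})"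
      using has_field_derivative_at_within has_real_derivative_iff_has_vector_derivative by blast
  qed simp
  moreover have "(\<lambda>y. Q n y * g y) integrable_on {-1..1}" "(\<lambda>y. Q (Suc n) y * G y) integrable_on {-1..1}"
    by (intro integrable_continuous_real continuous_intros tower_continuous_on Q g cG)+
  ultimately show ?thesis
    using z by (simp add: has_integral_iff integral_add)
qed

text \<open>The tower of \<open>bump 0 y * y ^ m\<close>: the \<open>m\<close>-th derivative of the
  cosine transform brings down \<open>y ^ m\<close>, and its decay needs all derivatives of that
  product.\<close>

primrec moment_bump :: "nat \<Rightarrow> nat \<Rightarrow> real \<Rightarrow> real" where
  "moment_bump 0 = bump"
| "moment_bump (Suc m) = (\<lambda>n. tower_prod n id_tower (moment_bump m))"

lemma tower_moment_bump: "tower (moment_bump m)"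
  by (induction m) (auto intro: tower_bump tower_mult tower_id)

lemma moment_bump_0: "moment_bump m 0 y = bump 0 y * y ^ m"
  by (induction m) (auto simp: id_tower_def)

lemma moment_bump_eq_0: "\<bar>t\<bar> \<ge> 1 \<Longrightarrow> moment_bump m n t = 0"
  by (induction m arbitrary: n) (auto simp: bump_eq_0 intro: tower_prod_zero_right)

text \<open>Differentiation with respect to \<open>t\<close> multiplies \<open>q\<close> by \<open>y\<close> and adds \<open>pi / 2\<close> to the phase, so the
  cosine transform and all its derivatives have this form.\<close>

definition phase_integral :: "(real \<Rightarrow> real) \<Rightarrow> real \<Rightarrow> real \<Rightarrow> real" where
  "phase_integral q \<theta> t = integral {-1..1} (\<lambda>y. q y * cos (t * y + \<theta>))"

lemma phase_integral_by_parts: "t * phase_integral (moment_bump m n) \<theta> t = - phase_integral (moment_bump m (Suc n)) (\<theta> - pi / 2) t"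
proof -
  have "((\<lambda>y. sin (t * y + \<theta>)) has_real_derivative t * cos (t * y + \<theta>)) (at y)" for y
    by (auto intro!: derivative_eq_intros)
  moreover have "continuous_on {-1..1} (\<lambda>y. t * cos (t * y + \<theta>))" by (intro continuous_intros)
  ultimately have "integral {-1..1} (\<lambda>y. moment_bump m n y * (t * cos (t * y + \<theta>))) =
     - integral {-1..1} (\<lambda>y. moment_bump m (Suc n) y * sin (t * y + \<theta>))"
    by (intro integral_by_parts_bump tower_moment_bump) (auto simp: moment_bump_eq_0)
  moreover have "sin (t * y + \<theta>) = cos (t * y + (\<theta> - pi / 2))" for y
    by (simp add: cos_diff sin_add cos_add algebra_simps)
  moreover have "integral {-1..1} (\<lambda>y. moment_bump m n y * (t * cos (t * y + \<theta>))) = t * phase_integral (moment_bump m n) \<theta> t"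
    unfolding phase_integral_def by (subst integral_mult_right[symmetric]) (simp add: mult.left_commute)
  ultimately show ?thesis by (simp add: phase_integral_def)
qed

lemma phase_integral_bounded: "\<bar>phase_integral (moment_bump m n) \<theta> t\<bar> \<le> integral {-1..1} (\<lambda>y. \<bar>moment_bump m n y\<bar>)"
proof -
  have i: "(\<lambda>y. moment_bump m n y * cos (t * y + \<theta>)) integrable_on {-1..1}" "(\<lambda>y. \<bar>moment_bump m n y\<bar>) integrable_on {-1..1}"
    by (intro integrable_continuous_real continuous_intros tower_continuous_on tower_moment_bump)+
  have "norm (phase_integral (moment_bump m n) \<theta> t) \<le> integral {-1..1} (\<lambda>y. \<bar>moment_bump m n y\<bar>)"
    unfolding phase_integral_def
  proof (rule integral_norm_bound_integral[OF i])
    fix y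
    have "\<bar>moment_bump m n y\<bar> * \<bar>cos (t * y + \<theta>)\<bar> \<le> \<bar>moment_bump m n y\<bar> * 1"
      by (intro mult_left_mono) auto
    then show "norm (moment_bump m n y * cos (t * y + \<theta>)) \<le> \<bar>moment_bump m n y\<bar>" by (simp add: abs_mult)
  qed
  then show ?thesis by simp
qed

text \<open>Every integration by parts trades a factor \<open>t\<close> for a derivative of the bump
  and a phase shift. No boundary terms arise, as the bump and all its derivatives vanish at 1 and
  -1.\<close>

lemma phase_integral_decay: "\<bar>t\<bar> ^ N * \<bar>phase_integral (moment_bump m n) \<theta> t\<bar> \<le> integral {-1..1} (\<lambda>y. \<bar>moment_bump m (n + N) y\<bar>)"
proof (induction N arbitrary: n \<theta>)
  case 0
  then show ?case using phase_integral_bounded by simp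
next
  case (Suc N)
  have "\<bar>t\<bar> ^ Suc N * \<bar>phase_integral (moment_bump m n) \<theta> t\<bar> = \<bar>t\<bar> ^ N * \<bar>t * phase_integral (moment_bump m n) \<theta> t\<bar>"
    by (simp add: abs_mult)
  also have "\<dots> \<le> integral {-1..1} (\<lambda>y. \<bar>moment_bump m (n + Suc N) y\<bar>)"
    unfolding phase_integral_by_parts using Suc.IH[of "Suc n" "\<theta> - pi / 2"] by simp
  finally show ?case .
qed

definition fbump :: "nat \<Rightarrow> real \<Rightarrow> real" where
  "fbump m t = phase_integral (moment_bump m 0) (real m * (pi / 2)) t"

lemma tower_fbump: "tower fbump"
  unfolding tower_def
proof (intro allI)
  fix m t
  let ?f = "\<lambda>t y. moment_bump m 0 y * cos (t * y + real m * (pi / 2))"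
  let ?g = "\<lambda>t y. moment_bump (Suc m) 0 y * cos (t * y + real (Suc m) * (pi / 2))"
  have "((\<lambda>t. integral (cbox (-1) 1) (?f t)) has_field_derivative integral (cbox (-1) 1) (?g t)) (at t within UNIV)"
  proof (rule leibniz_rule_field_derivative)
    show "((\<lambda>t. ?f t y) has_field_derivative ?g t y) (at t within UNIV)" for t y
    proof -
      have "cos (t * y + real (Suc m) * (pi / 2)) = - sin (t * y + real m * (pi / 2))"
        by (simp add: algebra_simps cos_add sin_add add_divide_distrib)
      then show ?thesis
        by (auto intro!: derivative_eq_intros simp: moment_bump_0 id_tower_def)
    qed
    show "?f t integrable_on cbox (-1) 1" for t
      by (intro integrable_continuous continuous_intros tower_continuous_on tower_moment_bump)
    show "continuous_on (UNIV \<times> cbox (-1) 1) (\<lambda>(t, y). ?g t y)"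
      unfolding split_beta
      by (intro continuous_intros continuous_on_compose2[OF tower_continuous_on[OF tower_moment_bump]]) auto
  qed auto
  then show "(fbump m has_real_derivative fbump (Suc m) t) (at t)"
    by (simp add: fbump_def[abs_def] phase_integral_def)
qed

lemma one_plus_power_le: "(1 + x) ^ N \<le> 2 ^ N * (1 + x ^ N)" if "x \<ge> 0" for x :: real
proof (cases "x \<le> 1")
  case True
  then have "(1 + x) ^ N \<le> 2 ^ N" using that by (intro power_mono) auto
  also have "\<dots> \<le> 2 ^ N * (1 + x ^ N)" using that by simp
  finally show ?thesis .
next
  case False
  then have "(1 + x) ^ N \<le> (2 * x) ^ N" by (intro power_mono) auto
  also have "\<dots> \<le> 2 ^ N * (1 + x ^ N)" by (simp add: power_mult_distrib)
  finally show ?thesis .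
qed

lemma fbump_decay: "\<exists>C>0. \<forall>t. \<bar>fbump m t\<bar> * (1 + \<bar>t\<bar>) ^ N \<le> C"
proof -
  let ?I = "\<lambda>n. integral {-1..1} (\<lambda>y. \<bar>moment_bump m n y\<bar>)"
  have "\<bar>fbump m t\<bar> * (1 + \<bar>t\<bar>) ^ N \<le> 2 ^ N * (\<bar>?I 0\<bar> + \<bar>?I N\<bar>) + 1" for t
  proof -
    have "\<bar>fbump m t\<bar> * (1 + \<bar>t\<bar>) ^ N \<le> \<bar>fbump m t\<bar> * (2 ^ N * (1 + \<bar>t\<bar> ^ N))"
      by (intro mult_left_mono one_plus_power_le) auto
    also have "\<dots> = 2 ^ N * (\<bar>fbump m t\<bar> + \<bar>t\<bar> ^ N * \<bar>fbump m t\<bar>)" by (simp add: algebra_simps)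
    also have "\<dots> \<le> 2 ^ N * (\<bar>?I 0\<bar> + \<bar>?I N\<bar>)"
      using phase_integral_bounded[of m 0 "real m * (pi / 2)" t] phase_integral_decay[of t N m 0 "real m * (pi / 2)"]
      by (intro mult_left_mono add_mono) (auto simp: fbump_def)
    finally show ?thesis by simp
  qed
  then show ?thesis by (intro exI[of _ "2 ^ N * (\<bar>?I 0\<bar> + \<bar>?I N\<bar>) + 1"]) (auto intro: add_nonneg_pos)
qed

lemma integrable_inverse_square: "integrable lborel (\<lambda>t::real. 1 / (1 + \<bar>t\<bar>)\<^sup>2)"
proof (rule Bochner_Integration.integrable_bound)
  show "integrable lborel (\<lambda>x::real. inverse (1 + x\<^sup>2))"
    using integrable_inverse_1_plus_square by (simp add: set_integrable_def)
  show "AE t in (lborel :: real measure). norm (1 / (1 + \<bar>t\<bar>)\<^sup>2) \<le> norm (inverse (1 + t\<^sup>2))"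
  proof (rule AE_I2)
    fix t :: real
    have "1 + t\<^sup>2 \<le> (1 + \<bar>t\<bar>)\<^sup>2" by (simp add: power2_sum)
    then show "norm (1 / (1 + \<bar>t\<bar>)\<^sup>2) \<le> norm (inverse (1 + t\<^sup>2))"
      by (simp add: inverse_eq_divide frac_le add_pos_nonneg)
  qed
qed simp

lemma integrable_decay:
  assumes [measurable]: "f \<in> borel_measurable borel" and C: "\<And>t::real. \<bar>f t\<bar> * (1 + \<bar>t\<bar>)\<^sup>2 \<le> C"
  shows "integrable lborel f"
proof (rule Bochner_Integration.integrable_bound[OF integrable_mult_right[OF integrable_inverse_square]])
  show "AE t in lborel. norm (f t) \<le> norm (C * (1 / (1 + \<bar>t\<bar>)\<^sup>2))"
  proof (rule AE_I2)
    fix t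
    have "\<bar>f t\<bar> \<le> C / (1 + \<bar>t\<bar>)\<^sup>2"
      using C[of t] by (subst pos_le_divide_eq) (auto simp: add_pos_nonneg)
    also have "\<dots> \<le> \<bar>C / (1 + \<bar>t\<bar>)\<^sup>2\<bar>" by (rule abs_ge_self)
    finally show "norm (f t) \<le> norm (C * (1 / (1 + \<bar>t\<bar>)\<^sup>2))" by simp
  qed
qed simp

lemma fbump_integrable: "integrable lborel (fbump m)"
  using fbump_decay[of m 2] integrable_decay[OF tower_borel[OF tower_fbump]] by blast

lemma fbump_even: "fbump 0 (- t) = fbump 0 t"
  by (simp add: fbump_def phase_integral_def)

section \<open>Fourier inversion for the cosine transform of the bump\<close>

lemma integral_cos_symmetric: "integral {-T..T} (\<lambda>t. cos (t * v)) = 2 * T * sinc (T * v)" if "T \<ge> 0"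
proof (cases "v = 0")
  case False
  have "((\<lambda>t. cos (t * v)) has_integral (sin (T * v) / v - sin (- T * v) / v)) {-T..T}"
  proof (rule fundamental_theorem_of_calculus)
    fix t :: real
    have "((\<lambda>t. sin (t * v) / v) has_real_derivative cos (t * v)) (at t within {-T..T})"
      using False by (auto intro!: derivative_eq_intros)
    then show "((\<lambda>t. sin (t * v) / v) has_vector_derivative cos (t * v)) (at t within {-T..T})"
      by (simp add: has_real_derivative_iff_has_vector_derivative)
  qed (use that in simp)
  then show ?thesis using False by (cases "T = 0") (auto simp: integral_unique field_simps)
qed (use that in simp)

text \<open>After exchanging the integrals over a compact rectangle, the inner one is a pair of sinc
  kernels. These are not dominated uniformly in \<open>T\<close>; an integration by parts replaces
  them by their primitives \<open>Si\<close>, which are bounded.\<close>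

lemma fbump_truncated_inversion:
  assumes T: "T > 0"
  shows "integral {-T..T} (\<lambda>t. fbump 0 t * cos (u * t)) =
    - integral {-1..1} (\<lambda>y. bump 1 y * (Si (T * (y - u)) + Si (T * (y + u))))"
proof -
  let ?f = "\<lambda>t y. bump 0 y * cos (t * y) * cos (u * t)"
  have cb: "continuous_on S (bump n)" for n S by (rule tower_continuous_on[OF tower_bump])
  have "integral {-T..T} (\<lambda>t. fbump 0 t * cos (u * t)) = integral (cbox (-T) T) (\<lambda>t. integral (cbox (-1) 1) (?f t))"
    by (simp add: fbump_def phase_integral_def integral_mult_left)
  also have "\<dots> = integral (cbox (-1) 1) (\<lambda>y. integral (cbox (-T) T) (\<lambda>t. ?f t y))"
  proof (rule integral_swap_continuous)
    show "continuous_on (cbox (- T, - 1) (T, 1)) (\<lambda>(t, y). ?f t y)"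
      unfolding split_beta by (intro continuous_intros continuous_on_compose2[OF cb]) auto
  qed
  also have "\<dots> = integral {-1..1} (\<lambda>y. bump 0 y * (T * sinc (T * (y - u)) + T * sinc (T * (y + u))))"
  proof (unfold cbox_interval, rule integral_cong)
    fix y
    have "(\<lambda>t. ?f t y) = (\<lambda>t. bump 0 y / 2 * (cos (t * (y - u)) + cos (t * (y + u))))"
      by (simp add: fun_eq_iff right_diff_distrib distrib_left cos_diff cos_add mult.commute)
    then have "integral {-T..T} (\<lambda>t. ?f t y) = bump 0 y / 2 * integral {-T..T} (\<lambda>t. cos (t * (y - u)) + cos (t * (y + u)))"
      by simp
    also have "integral {-T..T} (\<lambda>t. cos (t * (y - u)) + cos (t * (y + u))) = 2 * T * sinc (T * (y - u)) + 2 * T * sinc (T * (y + u))"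
      using T by (subst integral_add) (auto intro!: integrable_continuous_real continuous_intros simp: integral_cos_symmetric)
    finally show "integral {-T..T} (\<lambda>t. ?f t y) = bump 0 y * (T * sinc (T * (y - u)) + T * sinc (T * (y + u)))"
      by (simp add: algebra_simps)
  qed
  also have "\<dots> = - integral {-1..1} (\<lambda>y. bump (Suc 0) y * (Si (T * (y - u)) + Si (T * (y + u))))"
  proof (rule integral_by_parts_bump[OF tower_bump])
    show "((\<lambda>y. Si (T * (y - u)) + Si (T * (y + u))) has_real_derivative (T * sinc (T * (y - u)) + T * sinc (T * (y + u)))) (at y)" for y
      by (rule derivative_eq_intros DERIV_chain2[OF DERIV_Si] refl | simp)+
    show "continuous_on {-1..1} (\<lambda>y. T * sinc (T * (y - u)) + T * sinc (T * (y + u)))"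
      by (intro continuous_intros)
  qed (simp_all add: bump_eq_0)
  finally show ?thesis by simp
qed

lemma Si_scaled_limit: "(\<lambda>n. Si (real (Suc n) * v)) \<longlonglongrightarrow> pi / 2 * sgn v"
proof -
  have r: "filterlim (\<lambda>n. real (Suc n)) at_top sequentially"
    by (rule filterlim_compose[OF filterlim_real_sequentially filterlim_Suc])
  have pos: "(\<lambda>n. Si (real (Suc n) * v)) \<longlonglongrightarrow> pi / 2" if "v > 0" for v
    by (rule filterlim_compose[OF Si_at_top]) (intro filterlim_at_top_mult_tendsto_pos[OF tendsto_const that r])
  consider "v > 0" | "v = 0" | "v < 0" by linarith
  then show ?thesis
  proof cases
    case 2
    then show ?thesis by (simp add: Si_alt_def zero_ereal_def)
  next
    case 3
    have "Si (real (Suc n) * v) = - Si (real (Suc n) * (- v))" for n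
      using Si_neg[of "real (Suc n) * (- v)"] 3 by (simp add: mult_nonneg_nonpos)
    then show ?thesis using tendsto_minus[OF pos[of "-v"]] 3 by (simp del: of_nat_Suc)
  qed (use pos in simp)
qed

lemma integral_lborel_truncate_limit:
  fixes F :: "real \<Rightarrow> real"
  assumes F: "integrable lborel F"
  shows "(\<lambda>n. integral {- real (Suc n)..real (Suc n)} F) \<longlonglongrightarrow> (LINT t|lborel. F t)"
proof -
  have [measurable]: "F \<in> borel_measurable borel" using F by auto
  have eq: "integral {- real (Suc n)..real (Suc n)} F = (LINT t|lborel. indicator {- real (Suc n)..real (Suc n)} t * F t)" for n
  proof -
    have "set_integrable lborel {- real (Suc n)..real (Suc n)} F"
      unfolding set_integrable_def using F by (intro integrable_mult_indicator) auto
    from set_borel_integral_eq_integral(2)[OF this] show ?thesis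
      by (simp add: set_lebesgue_integral_def)
  qed
  show ?thesis
    unfolding eq
  proof (rule integral_dominated_convergence[where w = "\<lambda>t. \<bar>F t\<bar>"])
    show "AE t in lborel. (\<lambda>n. indicator {- real (Suc n)..real (Suc n)} t * F t) \<longlonglongrightarrow> F t"
    proof (rule AE_I2)
      fix t :: real
      have "eventually (\<lambda>n. indicator {- real (Suc n)..real (Suc n)} t * F t = F t) sequentially"
        using eventually_ge_at_top[of "nat \<lceil>\<bar>t\<bar>\<rceil>"]
      proof eventually_elim
        case (elim n)
        then have "\<bar>t\<bar> \<le> real n" by linarith
        then show ?case by (auto simp: indicator_def)
      qed
      then show "(\<lambda>n. indicator {- real (Suc n)..real (Suc n)} t * F t) \<longlonglongrightarrow> F t"
        by (rule tendsto_eventually)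
    qed
  qed (use F in \<open>auto simp: indicator_def\<close>)
qed

lemma fbump_cos_integrable: "integrable lborel (\<lambda>t. fbump 0 t * cos (u * t))"
  using fbump_integrable[of 0] tower_borel[OF tower_fbump, of 0]
  by (rule_tac Bochner_Integration.integrable_bound[where f = "fbump 0"])
     (auto simp: abs_mult intro!: AE_I2 mult_left_le)

lemma fbump_sin_integrable: "integrable lborel (\<lambda>t. fbump 0 t * sin (u * t))"
  using fbump_integrable[of 0] tower_borel[OF tower_fbump, of 0]
  by (rule_tac Bochner_Integration.integrable_bound[where f = "fbump 0"])
     (auto simp: abs_mult intro!: AE_I2 mult_left_le)

text \<open>Since \<open>Si\<close> is bounded and \<open>Si (T * v)\<close> tends to
  \<open>pi / 2 * sgn v\<close>, dominated convergence applies to the truncated formula. The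
  right-hand side, which amounts to \<open>2 * pi * bump 0 u\<close>, is left unevaluated because it
  is needed only for \<open>\<bar>u\<bar> \<ge> 1\<close> and for \<open>u = 0\<close>.\<close>

lemma fbump_inversion:
  "(LINT t|lborel. fbump 0 t * cos (u * t)) =
    - integral {-1..1} (\<lambda>y. bump 1 y * (pi / 2 * sgn (y - u) + pi / 2 * sgn (y + u)))"
proof -
  obtain B where B: "\<And>T. \<bar>Si T\<bar> \<le> B" using bounded_Si by blast
  have cb: "continuous_on S (bump n)" for n S by (rule tower_continuous_on[OF tower_bump])
  have cSi: "continuous_on UNIV Si" using isCont_Si continuous_at_imp_continuous_on by blast
  have "(\<lambda>n. integral {-1..1} (\<lambda>y. bump 1 y * (Si (real (Suc n) * (y - u)) + Si (real (Suc n) * (y + u)))))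
     \<longlonglongrightarrow> integral {-1..1} (\<lambda>y. bump 1 y * (pi / 2 * sgn (y - u) + pi / 2 * sgn (y + u)))"
  proof (rule dominated_convergence(2))
    show "(\<lambda>y. bump 1 y * (Si (real (Suc n) * (y - u)) + Si (real (Suc n) * (y + u)))) integrable_on {-1..1}" for n
      by (intro integrable_continuous_real continuous_intros cb continuous_on_compose2[OF cSi]) auto
    show "(\<lambda>y. \<bar>bump 1 y\<bar> * (2 * B)) integrable_on {-1..1}"
      by (intro integrable_continuous_real continuous_intros cb)
    show "norm (bump 1 y * (Si (real (Suc n) * (y - u)) + Si (real (Suc n) * (y + u)))) \<le> \<bar>bump 1 y\<bar> * (2 * B)" for n y
      using B[of "real (Suc n) * (y - u)"] B[of "real (Suc n) * (y + u)"]
      by (auto simp: abs_mult simp del: of_nat_Suc intro!: mult_left_mono)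
    show "(\<lambda>n. bump 1 y * (Si (real (Suc n) * (y - u)) + Si (real (Suc n) * (y + u))))
       \<longlonglongrightarrow> bump 1 y * (pi / 2 * sgn (y - u) + pi / 2 * sgn (y + u))" for y
      by (intro tendsto_intros Si_scaled_limit)
  qed
  then have "(\<lambda>n. integral {- real (Suc n)..real (Suc n)} (\<lambda>t. fbump 0 t * cos (u * t))) \<longlonglongrightarrow>
     - integral {-1..1} (\<lambda>y. bump 1 y * (pi / 2 * sgn (y - u) + pi / 2 * sgn (y + u)))"
    by (subst fbump_truncated_inversion) (auto intro: tendsto_minus)
  then show ?thesis
    using LIMSEQ_unique integral_lborel_truncate_limit[OF fbump_cos_integrable] by blast
qed

text \<open>For \<open>\<bar>y\<bar> < 1 \<le> \<bar>u\<bar>\<close> the numbers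
  \<open>y - u\<close> and \<open>y + u\<close> have opposite signs, so the integrand of the
  inversion formula vanishes.\<close>

lemma fbump_fourier_zero:
  assumes "\<bar>u\<bar> \<ge> 1"
  shows "(LINT t|lborel. fbump 0 t * cos (u * t)) = 0"
proof -
  have "integral {-1..1} (\<lambda>y. bump 1 y * (pi / 2 * sgn (y - u) + pi / 2 * sgn (y + u))) = integral {-1..1} (\<lambda>y::real. 0::real)"
  proof (rule integral_cong)
    fix y :: real assume "y \<in> {-1..1}"
    show "bump 1 y * (pi / 2 * sgn (y - u) + pi / 2 * sgn (y + u)) = 0"
    proof (cases "\<bar>y\<bar> \<ge> 1")
      case False
      then have "sgn (y - u) = - sgn (y + u)" using assms by (auto simp: sgn_if)
      then show ?thesis by simp
    qed (simp add: bump_eq_0)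
  qed
  then show ?thesis by (simp add: fbump_inversion)
qed

definition fbump_mass :: real where "fbump_mass = (LINT t|lborel. fbump 0 t)"

text \<open>Inversion at \<open>u = 0\<close> evaluates the mass as
  \<open>2 * pi * bump 0 0\<close>. The integral is split at 0, where \<open>sgn\<close>
  jumps.\<close>

lemma fbump_mass_pos: "fbump_mass > 0"
proof -
  let ?g = "\<lambda>y. bump 1 y * (pi / 2 * sgn (y - 0) + pi / 2 * sgn (y + 0))"
  have d: "(bump 0 has_vector_derivative bump 1 y) (at y within S)" for y S
    using towerD[OF tower_bump, of 0 y] has_field_derivative_at_within has_real_derivative_iff_has_vector_derivative by fastforce
  have "(?g has_integral (- pi * (bump 0 0 - bump 0 (-1)))) {-1..0}"
  proof -
    have "((\<lambda>y. (- pi) * bump 1 y) has_integral ((- pi) * (bump 0 0 - bump 0 (-1)))) {-1..0}"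
      by (intro has_integral_mult_right fundamental_theorem_of_calculus d) simp
    then show ?thesis
      by (rule has_integral_spike[OF negligible_sing[of 0], rotated]) (auto simp: sgn_if)
  qed
  moreover have "(?g has_integral (pi * (bump 0 1 - bump 0 0))) {0..1}"
  proof -
    have "((\<lambda>y. pi * bump 1 y) has_integral (pi * (bump 0 1 - bump 0 0))) {0..1}"
      by (intro has_integral_mult_right fundamental_theorem_of_calculus d) simp
    then show ?thesis
      by (rule has_integral_spike[OF negligible_sing[of 0], rotated]) (auto simp: sgn_if)
  qed
  ultimately have "(?g has_integral (- pi * (bump 0 0 - bump 0 (-1)) + pi * (bump 0 1 - bump 0 0))) {-1..1}"
    by (intro has_integral_combine[of "-1" 0 1]) auto
  then have "integral {-1..1} ?g = - 2 * pi * bump 0 0"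
    by (simp add: integral_unique bump_eq_0)
  then have "fbump_mass = 2 * pi * bump 0 0"
    using fbump_inversion[of 0] by (simp add: fbump_mass_def)
  moreover have "2 * pi * bump 0 0 > 0" using bump_pos[of 0] by (intro mult_pos_pos) auto
  ultimately show ?thesis by simp
qed

section \<open>The kernel of mass 1, its dilations and its decay\<close>

definition kern_tower :: "real \<Rightarrow> nat \<Rightarrow> real \<Rightarrow> real" where
  "kern_tower b n t = (b / fbump_mass) * (b ^ n * fbump n (0 + b * t))"

lemma tower_kern: "tower (kern_tower b)"
  unfolding kern_tower_def by (intro tower_cmult tower_affine tower_fbump)

lemma kern_tower_decay: "\<exists>C>0. \<forall>t. \<bar>kern_tower b n t\<bar> * (1 + \<bar>b * t\<bar>) ^ N \<le> C"
proof -
  obtain C where C: "C > 0" "\<And>t. \<bar>fbump n t\<bar> * (1 + \<bar>t\<bar>) ^ N \<le> C" using fbump_decay by blast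
  let ?a = "\<bar>(b / fbump_mass) * b ^ n\<bar>"
  have "\<bar>kern_tower b n t\<bar> * (1 + \<bar>b * t\<bar>) ^ N \<le> ?a * C + 1" for t
  proof -
    have "\<bar>kern_tower b n t\<bar> * (1 + \<bar>b * t\<bar>) ^ N = ?a * (\<bar>fbump n (b * t)\<bar> * (1 + \<bar>b * t\<bar>) ^ N)"
      by (simp add: kern_tower_def abs_mult)
    also have "\<dots> \<le> ?a * C" by (intro mult_left_mono C) simp
    finally show ?thesis by simp
  qed
  moreover have "?a * C + 1 > 0" using C by (intro add_nonneg_pos) auto
  ultimately show ?thesis by blast
qed

lemma kern_tower_integrable: "b > 0 \<Longrightarrow> integrable lborel (kern_tower b n)"
  unfolding kern_tower_def[abs_def]
  using lborel_integrable_real_affine[OF fbump_integrable[of n], of b 0] by simp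

lemma kern_tower_integral: "b > 0 \<Longrightarrow> (LINT t|lborel. kern_tower b 0 t) = 1"
  using lborel_integral_real_affine[of b "fbump 0" 0] fbump_mass_pos
  by (simp add: kern_tower_def fbump_mass_def[symmetric])

lemma kern_tower_fourier:
  assumes b: "b > 0" and x: "\<bar>x\<bar> \<ge> b"
  shows "(LINT t|lborel. complex_of_real (kern_tower b 0 t) * exp (- 2 * pi * \<i> * complex_of_real (x * t))) = 0"
proof -
  \<comment> \<open>The dilation by \<open>b\<close> and the factor \<open>2 * pi\<close> in the
    transform lead to this frequency. The transform vanishes already for
    \<open>\<bar>x\<bar> \<ge> b / (2 * pi)\<close>; the cruder threshold \<open>b\<close> spares
    the later band widths the factor.\<close>
  define u where "u = 2 * pi * x / b"
  have "\<bar>x\<bar> / b \<ge> 1" using b x by simp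
  moreover have "1 \<le> 2 * pi" using pi_gt3 by simp
  ultimately have "2 * pi * (\<bar>x\<bar> / b) \<ge> 1 * 1" by (intro mult_mono) auto
  then have u: "\<bar>u\<bar> \<ge> 1" using b by (simp add: u_def abs_mult)
  let ?G = "\<lambda>t. complex_of_real (fbump 0 t) * exp (- \<i> * complex_of_real (u * t))"
  have "(LINT t|lborel. complex_of_real (kern_tower b 0 t) * exp (- 2 * pi * \<i> * complex_of_real (x * t)))
     = (LINT t|lborel. complex_of_real (b / fbump_mass) * ?G (0 + b * t))"
    using b by (intro Bochner_Integration.integral_cong) (auto simp: kern_tower_def u_def mult_ac)
  also have "\<dots> = complex_of_real (b / fbump_mass) * (LINT t|lborel. ?G (0 + b * t))"
    by (rule integral_mult_right_zero)
  also have "(LINT t|lborel. ?G (0 + b * t)) = (LINT t|lborel. ?G t) /\<^sub>R b"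
    using b lborel_integral_real_affine[of b ?G 0] by simp
  also have "(LINT t|lborel. ?G t) = 0"
  proof -
    have "?G t = complex_of_real (fbump 0 t * cos (u * t)) - \<i> * complex_of_real (fbump 0 t * sin (u * t))" for t
      by (simp add: exp_minus_Euler cos_of_real sin_of_real right_diff_distrib mult.left_commute del: of_real_mult) (simp add: mult.left_commute)
    then have "(LINT t|lborel. ?G t) = complex_of_real (LINT t|lborel. fbump 0 t * cos (u * t)) - \<i> * complex_of_real (LINT t|lborel. fbump 0 t * sin (u * t))"
    proof -
      have i: "integrable lborel (\<lambda>t. complex_of_real (fbump 0 t * cos (u * t)))"
        "integrable lborel (\<lambda>t. complex_of_real (fbump 0 t * sin (u * t)))"
        by (simp_all only: complex_of_real_integrable_eq fbump_cos_integrable fbump_sin_integrable)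
      assume eq: "\<And>t. ?G t = complex_of_real (fbump 0 t * cos (u * t)) - \<i> * complex_of_real (fbump 0 t * sin (u * t))"
      have "(LINT t|lborel. ?G t) = (LINT t|lborel. complex_of_real (fbump 0 t * cos (u * t))) - (LINT t|lborel. \<i> * complex_of_real (fbump 0 t * sin (u * t)))"
        unfolding eq by (intro Bochner_Integration.integral_diff integrable_mult_right i)
      then show ?thesis
        by (simp only: integral_complex_of_real integral_mult_right_zero)
    qed
    moreover have "(LINT t|lborel. fbump 0 t * sin (u * t)) = 0"
      using lborel_integral_real_affine[of "-1" "\<lambda>t. fbump 0 t * sin (u * t)" 0] by (simp add: fbump_even)
    ultimately show ?thesis using fbump_fourier_zero[OF u] by simp
  qed
  finally show ?thesis by simp
qed

definition kern_deriv :: "real \<Rightarrow> ('d \<Rightarrow> nat) \<Rightarrow> real^'d \<Rightarrow> real" where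
  "kern_deriv b = tprod (\<lambda>_. kern_tower b)"

definition kern :: "real \<Rightarrow> real^'d \<Rightarrow> real" where
  "kern b = kern_deriv b (\<lambda>_. 0)"

lemma kern_deriv_continuous: "continuous_on S (kern_deriv b \<alpha>)"
  unfolding kern_deriv_def by (rule tprod_continuous) (simp add: tower_kern)

lemma kern_deriv_borel [measurable]: "kern_deriv b \<alpha> \<in> borel_measurable borel"
  by (rule borel_measurable_continuous_onI[OF kern_deriv_continuous])

lemma kern_borel [measurable]: "kern b \<in> borel_measurable borel"
  by (simp add: kern_def)

lemma kern_deriv_bounded: "\<exists>B\<ge>0. \<forall>x. \<bar>kern_deriv b \<alpha> x\<bar> \<le> B"
proof -
  have "\<forall>i. \<exists>C>0. \<forall>t. \<bar>kern_tower b (\<alpha> i) t\<bar> * (1 + \<bar>b * t\<bar>) ^ 0 \<le> C"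
    using kern_tower_decay by blast
  then obtain C where C: "\<And>i. C i > 0" "\<And>i t. \<bar>kern_tower b (\<alpha> i) t\<bar> \<le> C i"
    by (metis mult.right_neutral power_0)
  have "\<bar>kern_deriv b \<alpha> x\<bar> \<le> (\<Prod>i\<in>UNIV. C i)" for x
    unfolding kern_deriv_def tprod_def abs_prod by (intro prod_mono) (use C in auto)
  then show ?thesis by (meson C(1) less_imp_le prod_nonneg)
qed

lemma kern_deriv_integrable: "b > 0 \<Longrightarrow> integrable lborel (kern_deriv b \<alpha>)"
  unfolding kern_deriv_def tprod_def[abs_def] by (intro lborel_integral_prod kern_tower_integrable)

lemma kern_integrable: "b > 0 \<Longrightarrow> integrable lborel (kern b)"
  by (simp add: kern_def kern_deriv_integrable)

lemma kern_integral: "b > 0 \<Longrightarrow> (LINT x|lborel. kern b x) = 1"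
  unfolding kern_def kern_deriv_def tprod_def
  by (subst lborel_integral_prod) (auto simp: kern_tower_integrable kern_tower_integral)

lemma kern_scale: "kern b x = b ^ CARD('d) * kern 1 (b *\<^sub>R x :: real^'d)"
  unfolding kern_def kern_deriv_def tprod_def kern_tower_def
  by (simp add: prod_dividef prod.distrib)

definition kern_norm :: "'d::finite itself \<Rightarrow> real" where
  "kern_norm _ = (LINT x|lborel. \<bar>kern 1 (x :: real^'d)\<bar>)"

lemma kern_abs_integral:
  assumes b: "b > 0"
  shows "(LINT x|lborel. \<bar>kern b (x :: real^'d)\<bar>) = kern_norm TYPE('d)"
  using b unfolding kern_norm_def
  by (subst lborel_integral_affine(1)[of "\<lambda>x::real^'d. \<bar>kern 1 x\<bar>" b 0])
     (simp_all add: kern_scale[of b] abs_mult del: scaleR_scaleR)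

lemma kern_norm_nonneg: "kern_norm TYPE('d::finite) \<ge> 0"
  by (simp add: kern_norm_def)

lemma conv_kern_scale:
  fixes g :: "real^'d \<Rightarrow> real"
  assumes b: "b > 0" and [measurable]: "g \<in> borel_measurable borel"
  shows "conv (kern b) g x = (LINT z|lborel. kern 1 z * g (x - (1 / b) *\<^sub>R z))"
proof -
  have "conv (kern b) g x = (LINT z|lborel. kern b z * g (x - z))"
    by (rule conv_commute) measurable
  also have "\<dots> = (LINT z|lborel. (1 / b) ^ CARD('d) * (kern b ((1 / b) *\<^sub>R z) * g (x - (1 / b) *\<^sub>R z)))"
    using b by (subst lborel_integral_affine(1)[of _ "1 / b" 0]) auto
  also have "\<dots> = (LINT z|lborel. kern 1 z * g (x - (1 / b) *\<^sub>R z))"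
    using b by (intro Bochner_Integration.integral_cong) (auto simp: kern_scale[of b] power_divide)
  finally show ?thesis .
qed

lemma one_plus_sum_le_prod: "finite I \<Longrightarrow> (\<And>i. i \<in> I \<Longrightarrow> f i \<ge> 0) \<Longrightarrow> 1 + (\<Sum>i\<in>I. f i) \<le> (\<Prod>i\<in>I. 1 + f i)"
  for f :: "'a \<Rightarrow> real"
proof (induction I rule: finite_induct)
  case (insert i I)
  then have IH: "1 + (\<Sum>i\<in>I. f i) \<le> (\<Prod>i\<in>I. 1 + f i)" by simp
  have "0 \<le> f i * (\<Sum>i\<in>I. f i)" using insert by (intro mult_nonneg_nonneg sum_nonneg) auto
  then have "1 + (\<Sum>i\<in>insert i I. f i) \<le> (1 + f i) * (1 + (\<Sum>i\<in>I. f i))"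
    using insert by (simp add: algebra_simps)
  also have "\<dots> \<le> (1 + f i) * (\<Prod>i\<in>I. 1 + f i)" using insert IH by (intro mult_left_mono) auto
  finally show ?case using insert by simp
qed simp

lemma one_plus_norm_le_prod: "1 + norm x \<le> (\<Prod>i\<in>UNIV. 1 + \<bar>x $ i\<bar>)" for x :: "real^'d"
  using norm_le_l1_cart[of x] one_plus_sum_le_prod[of UNIV "\<lambda>i. \<bar>x $ i\<bar>"] by simp

text \<open>The weight \<open>1 + norm z\<close> is at most the product of the
  \<open>1 + \<bar>z $ i\<bar>\<close>, which splits the moment into one-dimensional factors. Decay
  of order \<open>s + 2\<close> absorbs the power \<open>s\<close> and leaves an integrable
  square.\<close>

lemma kern_moment_integrable: "integrable lborel (\<lambda>z::real^'d. kern 1 z * (1 + norm z) ^ s)"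
proof (rule Bochner_Integration.integrable_bound)
  let ?f = "\<lambda>t. \<bar>kern_tower 1 0 t\<bar> * (1 + \<bar>t\<bar>) ^ s"
  have [measurable]: "kern_tower 1 0 \<in> borel_measurable borel" by (rule tower_borel[OF tower_kern])
  obtain C where C: "\<And>t. \<bar>kern_tower 1 0 t\<bar> * (1 + \<bar>1 * t\<bar>) ^ (s + 2) \<le> C"
    using kern_tower_decay by blast
  have "integrable lborel ?f"
    by (rule integrable_decay[where C = C]) (use C in \<open>auto simp: abs_mult power_add power2_eq_square mult_ac\<close>)
  then show "integrable lborel (\<lambda>x::real^'d. \<Prod>i\<in>UNIV. ?f (x $ i))"
    by (rule lborel_integral_prod)
  have "\<bar>kern 1 z * (1 + norm z) ^ s\<bar> \<le> (\<Prod>i\<in>UNIV. ?f (z $ i))" for z :: "real^'d"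
  proof -
    have "\<bar>kern 1 z\<bar> * (1 + norm z) ^ s \<le> \<bar>kern 1 z\<bar> * (\<Prod>i\<in>UNIV. 1 + \<bar>z $ i\<bar>) ^ s"
      using one_plus_norm_le_prod[of z] by (intro mult_left_mono power_mono) auto
    also have "\<dots> = (\<Prod>i\<in>UNIV. ?f (z $ i))"
      by (simp add: kern_def kern_deriv_def tprod_def abs_prod prod.distrib prod_power_distrib)
    finally show ?thesis by (simp add: abs_mult)
  qed
  then show "AE z::real^'d in lborel. norm (kern 1 z * (1 + norm z) ^ s) \<le> norm (\<Prod>i\<in>UNIV. ?f (z $ i))"
    by (auto intro: order.trans[OF _ abs_ge_self])
qed measurable

text \<open>An integrable majorant of the kernel up to a constant. Unlike the kernel, which may have
  zeros, it changes only by a bounded factor over distance 1, so its value at a point can be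
  compared with its values on a whole ball.\<close>

definition weight :: "real^'d \<Rightarrow> real" where
  "weight x = (\<Prod>i\<in>UNIV. 1 / (1 + \<bar>x $ i\<bar>)\<^sup>2)"

lemma weight_integrable: "integrable lborel (weight :: real^'d \<Rightarrow> real)"
  unfolding weight_def[abs_def] by (rule lborel_integral_prod) (rule integrable_inverse_square)

lemma weight_borel [measurable]: "weight \<in> borel_measurable borel"
  using weight_integrable by auto

lemma weight_nonneg: "weight x \<ge> 0"
  unfolding weight_def by (intro prod_nonneg) auto

lemma kern_weight_bound: "\<exists>C>0. \<forall>x::real^'d. \<bar>kern 1 x\<bar> \<le> C * weight x"
proof -
  obtain C where C: "C > 0" "\<And>t. \<bar>kern_tower 1 0 t\<bar> * (1 + \<bar>1 * t\<bar>)\<^sup>2 \<le> C"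
    using kern_tower_decay by blast
  have "\<bar>kern 1 x\<bar> \<le> C ^ CARD('d) * weight x" for x :: "real^'d"
  proof -
    have "\<bar>kern 1 x\<bar> \<le> (\<Prod>i\<in>UNIV. C * (1 / (1 + \<bar>x $ i\<bar>)\<^sup>2))"
      unfolding kern_def kern_deriv_def tprod_def abs_prod
    proof (intro prod_mono conjI)
      fix i
      have "\<bar>kern_tower 1 0 (x $ i)\<bar> \<le> C / (1 + \<bar>x $ i\<bar>)\<^sup>2"
        using C(2)[of "x $ i"] by (subst pos_le_divide_eq) (auto simp: add_pos_nonneg)
      then show "\<bar>kern_tower 1 0 (x $ i)\<bar> \<le> C * (1 / (1 + \<bar>x $ i\<bar>)\<^sup>2)" by simp
    qed simp
    then show ?thesis unfolding weight_def by (simp only: prod.distrib prod_constant)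
  qed
  moreover have "C ^ CARD('d) > 0" using C by simp
  ultimately show ?thesis by blast
qed

lemma weight_shift: "weight x \<le> 4 ^ CARD('d) * weight y" if "norm (x - y) \<le> 1" for x y :: "real^'d"
proof -
  have "(\<Prod>i\<in>UNIV. 1 / (1 + \<bar>x $ i\<bar>)\<^sup>2) \<le> (\<Prod>i\<in>UNIV. 4 * (1 / (1 + \<bar>y $ i\<bar>)\<^sup>2))"
  proof (intro prod_mono conjI)
    fix i
    have "\<bar>x $ i - y $ i\<bar> \<le> 1" using component_le_norm_cart[of "x - y" i] that by simp
    then have "1 + \<bar>y $ i\<bar> \<le> 2 * (1 + \<bar>x $ i\<bar>)" by (simp add: abs_if split: if_splits)
    then have "(1 + \<bar>y $ i\<bar>)\<^sup>2 \<le> (2 * (1 + \<bar>x $ i\<bar>))\<^sup>2" by (intro power_mono) auto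
    also have "\<dots> = 4 * (1 + \<bar>x $ i\<bar>)\<^sup>2" by (simp only: power_mult_distrib) simp
    finally have "(1 + \<bar>y $ i\<bar>)\<^sup>2 / 4 \<le> (1 + \<bar>x $ i\<bar>)\<^sup>2" by simp
    then have "1 / (1 + \<bar>x $ i\<bar>)\<^sup>2 \<le> 1 / ((1 + \<bar>y $ i\<bar>)\<^sup>2 / 4)"
      by (intro frac_le) (auto simp: add_pos_nonneg)
    then show "1 / (1 + \<bar>x $ i\<bar>)\<^sup>2 \<le> 4 * (1 / (1 + \<bar>y $ i\<bar>)\<^sup>2)" by simp
  qed simp
  then show ?thesis unfolding weight_def by (simp only: prod.distrib prod_constant)
qed

section \<open>Sampling sums\<close>

text \<open>The condition of \<open>sampling_sets\<close> for a single set, in the form used with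
  \<open>\<gamma> / \<sigma>\<close> for the radius: open balls of radius \<open>\<rho>\<close>
  around distinct points are disjoint.\<close>

definition separated :: "real \<Rightarrow> (real^'d) set \<Rightarrow> bool" where
  "separated \<rho> X \<longleftrightarrow> (\<forall>\<xi>\<in>X. \<forall>\<xi>'\<in>X. \<xi> \<noteq> \<xi>' \<longrightarrow> norm (\<xi> - \<xi>') > 2 * \<rho>)"

lemma separated_ball_unique:
  assumes "separated \<rho> X" "\<xi> \<in> X" "\<xi>' \<in> X" "z \<in> ball \<xi> \<rho>" "z \<in> ball \<xi>' \<rho>"
  shows "\<xi> = \<xi>'"
proof (rule ccontr)
  assume "\<xi> \<noteq> \<xi>'"
  then have "norm (\<xi> - \<xi>') > 2 * \<rho>" using assms by (auto simp: separated_def)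
  moreover have "dist \<xi> \<xi>' < 2 * \<rho>"
    using dist_triangle_less_add[of \<xi> z \<rho> \<xi>' \<rho>] assms by (simp add: dist_commute)
  ultimately show False by (simp add: dist_norm)
qed

text \<open>Disjoint nonempty open balls form a countable family. Countability is what permits sums
  over \<open>X\<close> to be interchanged with Lebesgue integrals.\<close>

lemma separated_countable:
  assumes s: "separated \<rho> X" and \<rho>: "\<rho> > 0"
  shows "countable X"
proof -
  have inj: "inj_on (\<lambda>\<xi>. ball \<xi> \<rho>) X"
  proof (rule inj_onI)
    fix \<xi> \<xi>' assume *: "\<xi> \<in> X" "\<xi>' \<in> X" "ball \<xi> \<rho> = ball \<xi>' \<rho>"
    then have "\<xi> \<in> ball \<xi>' \<rho>" "\<xi> \<in> ball \<xi> \<rho>" using \<rho> by (auto simp flip: *(3))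
    then show "\<xi> = \<xi>'" using separated_ball_unique[OF s] * by blast
  qed
  have "countable ((\<lambda>\<xi>. ball \<xi> \<rho>) ` X)"
  proof (rule countable_disjoint_open_subsets)
    show "pairwise disjnt ((\<lambda>\<xi>. ball \<xi> \<rho>) ` X)"
      unfolding pairwise_image pairwise_def disjnt_iff using separated_ball_unique[OF s] by blast
  qed auto
  then show ?thesis using inj by (rule countable_image_inj_on)
qed

lemma separated_indicator_sum:
  assumes s: "separated \<rho> X" and d: "\<delta> \<le> \<rho>"
  shows "(\<integral>\<^sup>+\<xi>. indicator (ball \<xi> \<delta>) z \<partial>count_space X) \<le> (1 :: ennreal)"
proof (cases "\<exists>\<xi>0\<in>X. z \<in> ball \<xi>0 \<delta>")
  case True
  then obtain \<xi>0 where \<xi>0: "\<xi>0 \<in> X" "z \<in> ball \<xi>0 \<delta>" by blast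
  have "\<xi> = \<xi>0" if "\<xi> \<in> X" "z \<in> ball \<xi> \<delta>" for \<xi>
    using separated_ball_unique[OF s that(1) \<xi>0(1), of z] that(2) \<xi>0(2) d by auto
  then have "(\<integral>\<^sup>+\<xi>. indicator (ball \<xi> \<delta>) z \<partial>count_space X) \<le> (\<integral>\<^sup>+\<xi>. indicator {\<xi>0} \<xi> \<partial>count_space X)"
    by (intro nn_integral_mono) (auto simp: indicator_def)
  also have "\<dots> \<le> 1"
    using \<xi>0 by (subst nn_integral_indicator) (auto simp: emeasure_count_space)
  finally show ?thesis .
next
  case False
  then have "(\<integral>\<^sup>+\<xi>. indicator (ball \<xi> \<delta>) z \<partial>count_space X) = (\<integral>\<^sup>+\<xi>. (0::ennreal) \<partial>count_space X)"
    by (intro nn_integral_cong) (auto simp: indicator_def)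
  then show ?thesis by simp
qed

text \<open>Each \<open>u \<xi>\<close> is at most the mean of \<open>G\<close> over its own ball,
  and these balls are disjoint translates of one another.\<close>

lemma separated_sum_le_integral:
  fixes X :: "(real^'d) set"
  assumes s: "separated \<rho> X" and \<rho>: "\<rho> > 0" and [measurable]: "G \<in> borel_measurable borel"
    and le: "\<And>\<xi> z. \<xi> \<in> X \<Longrightarrow> z \<in> ball \<xi> \<rho> \<Longrightarrow> u \<xi> \<le> G z"
  shows "emeasure lborel (ball (0::real^'d) \<rho>) * (\<integral>\<^sup>+\<xi>. u \<xi> \<partial>count_space X) \<le> (\<integral>\<^sup>+z. G z \<partial>lborel)"
proof -
  have emb: "emeasure lborel (ball \<xi> \<rho>) = emeasure lborel (ball (0::real^'d) \<rho>)" for \<xi> :: "real^'d"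
  proof -
    have "(\<integral>\<^sup>+x. indicator (ball \<xi> \<rho>) x \<partial>lborel) = (\<integral>\<^sup>+x. indicator (ball \<xi> \<rho>) (x + \<xi>) \<partial>lborel)"
      by (rule lborel_nn_shift[symmetric]) (auto intro: borel_measurable_indicator)
    also have "\<dots> = (\<integral>\<^sup>+x. indicator (ball (0::real^'d) \<rho>) x \<partial>lborel)"
      by (intro nn_integral_cong) (auto simp: indicator_def dist_norm)
    finally show ?thesis by simp
  qed
  have "emeasure lborel (ball (0::real^'d) \<rho>) * (\<integral>\<^sup>+\<xi>. u \<xi> \<partial>count_space X)
     = (\<integral>\<^sup>+\<xi>. (\<integral>\<^sup>+z. u \<xi> * indicator (ball \<xi> \<rho>) z \<partial>lborel) \<partial>count_space X)"
  proof (subst nn_integral_cmult[symmetric])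
    have "(\<integral>\<^sup>+z. u \<xi> * indicator (ball \<xi> \<rho>) z \<partial>lborel) = emeasure lborel (ball (0::real^'d) \<rho>) * u \<xi>" for \<xi> :: "real^'d"
      by (subst nn_integral_cmult_indicator) (simp, metis emb mult.commute)
    then show "(\<integral>\<^sup>+\<xi>. emeasure lborel (ball (0::real^'d) \<rho>) * u \<xi> \<partial>count_space X)
       = (\<integral>\<^sup>+\<xi>. (\<integral>\<^sup>+z. u \<xi> * indicator (ball \<xi> \<rho>) z \<partial>lborel) \<partial>count_space X)"
      by simp
  qed simp
  also have "\<dots> \<le> (\<integral>\<^sup>+\<xi>. (\<integral>\<^sup>+z. G z * indicator (ball \<xi> \<rho>) z \<partial>lborel) \<partial>count_space X)"
    by (intro nn_integral_mono) (use le in \<open>auto simp: indicator_def\<close>)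
  also have "\<dots> = (\<integral>\<^sup>+z. (\<integral>\<^sup>+\<xi>. G z * indicator (ball \<xi> \<rho>) z \<partial>count_space X) \<partial>lborel)"
    by (rule nn_integral_count_space_nn_integral[OF separated_countable[OF s \<rho>], symmetric])
       (auto intro!: borel_measurable_times_ennreal borel_measurable_indicator)
  also have "\<dots> = (\<integral>\<^sup>+z. G z * (\<integral>\<^sup>+\<xi>. indicator (ball \<xi> \<rho>) z \<partial>count_space X) \<partial>lborel)"
    by (intro nn_integral_cong nn_integral_cmult) simp
  also have "\<dots> \<le> (\<integral>\<^sup>+z. G z * 1 \<partial>lborel)"
    by (intro nn_integral_mono mult_left_mono separated_indicator_sum[OF s]) auto
  finally show ?thesis by simp
qed

text \<open>The sum is compared with the integral of \<open>weight\<close>. The condition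
  \<open>b * \<rho> \<le> 1\<close> makes the rescaled balls small enough for
  \<open>weight_shift\<close>, and the factor \<open>b ^ CARD('d)\<close> of the dilated kernel is
  absorbed by substitution, so the bound no longer depends on \<open>b\<close>.\<close>

lemma kern_separated_sum:
  "\<exists>C>0. \<forall>b \<rho> X y. 0 < b \<longrightarrow> 0 < \<rho> \<longrightarrow> b * \<rho> \<le> 1 \<longrightarrow> separated \<rho> X \<longrightarrow>
     (\<integral>\<^sup>+\<xi>. ennreal \<bar>kern b (\<xi> - y :: real^'d)\<bar> \<partial>count_space X) \<le> ennreal (C / \<rho> ^ CARD('d))"
proof -
  obtain C where C: "C > 0" "\<And>x::real^'d. \<bar>kern 1 x\<bar> \<le> C * weight x" using kern_weight_bound by blast
  let ?d = "CARD('d)"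
  define V where "V = measure lborel (ball (0::real^'d) 1)"
  have V: "V > 0" unfolding V_def using content_ball_pos[of 1 "0::real^'d"] by simp
  define I where "I = (LINT x|lborel. weight (x::real^'d))"
  have I: "I \<ge> 0" by (simp add: I_def weight_nonneg)
  define c where "c = 4 ^ ?d * C"
  have c: "c > 0" using C by (simp add: c_def)
  have "(\<integral>\<^sup>+\<xi>. ennreal \<bar>kern b (\<xi> - y :: real^'d)\<bar> \<partial>count_space X) \<le> ennreal ((c * I / V + 1) / \<rho> ^ ?d)"
    if b: "0 < b" and \<rho>: "0 < \<rho>" and b\<rho>: "b * \<rho> \<le> 1" and s: "separated \<rho> X" for b \<rho> X y
  proof -
    have pt: "\<bar>kern b (\<xi> - y)\<bar> \<le> c * b ^ ?d * weight (b *\<^sub>R (z - y))" if "z \<in> ball \<xi> \<rho>" for \<xi> z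
    proof -
      have "norm (b *\<^sub>R (\<xi> - y) - b *\<^sub>R (z - y)) = b * norm (\<xi> - z)"
        using b by (simp add: scaleR_diff_right[symmetric])
      also have "\<dots> \<le> b * \<rho>" using that b by (intro mult_left_mono) (auto simp: dist_norm)
      also note b\<rho>
      finally have "weight (b *\<^sub>R (\<xi> - y)) \<le> 4 ^ ?d * weight (b *\<^sub>R (z - y))" by (rule weight_shift)
      then have "C * weight (b *\<^sub>R (\<xi> - y)) \<le> C * (4 ^ ?d * weight (b *\<^sub>R (z - y)))"
        using C by (intro mult_left_mono) auto
      then have "\<bar>kern 1 (b *\<^sub>R (\<xi> - y))\<bar> \<le> C * (4 ^ ?d * weight (b *\<^sub>R (z - y)))"
        using C(2) order.trans by blast
      then have "b ^ ?d * \<bar>kern 1 (b *\<^sub>R (\<xi> - y))\<bar> \<le> b ^ ?d * (C * (4 ^ ?d * weight (b *\<^sub>R (z - y))))"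
        using b by (intro mult_left_mono) auto
      then show ?thesis
        using b by (subst kern_scale) (simp add: abs_mult c_def mult_ac)
    qed
    have "emeasure lborel (ball (0::real^'d) \<rho>) * (\<integral>\<^sup>+\<xi>. ennreal \<bar>kern b (\<xi> - y)\<bar> \<partial>count_space X)
      \<le> (\<integral>\<^sup>+z. ennreal (c * b ^ ?d * weight (b *\<^sub>R (z - y))) \<partial>lborel)"
      by (rule separated_sum_le_integral[OF s \<rho>]) (auto intro!: ennreal_leI pt)
    also have "\<dots> = (\<integral>\<^sup>+z. ennreal (c * b ^ ?d) * ennreal (weight (- (b *\<^sub>R y) + b *\<^sub>R z)) \<partial>lborel)"
      using b c by (intro nn_integral_cong) (auto simp: ennreal_mult weight_nonneg scaleR_diff_right)
    also have "\<dots> = ennreal c * (ennreal (b ^ ?d) * (\<integral>\<^sup>+z. ennreal (weight (- (b *\<^sub>R y) + b *\<^sub>R z)) \<partial>lborel))"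
      using b c by (simp add: nn_integral_cmult ennreal_mult mult.assoc)
    also have "ennreal (b ^ ?d) * (\<integral>\<^sup>+z. ennreal (weight (- (b *\<^sub>R y) + b *\<^sub>R z)) \<partial>lborel) = (\<integral>\<^sup>+z. ennreal (weight (z::real^'d)) \<partial>lborel)"
      using b lborel_nn_affine[of "\<lambda>z. ennreal (weight z)" b "- (b *\<^sub>R y)"] by simp
    also have "(\<integral>\<^sup>+z. ennreal (weight (z::real^'d)) \<partial>lborel) = ennreal I"
      unfolding I_def by (intro nn_integral_eq_integral weight_integrable) (simp add: weight_nonneg)
    finally have *: "emeasure lborel (ball (0::real^'d) \<rho>) * (\<integral>\<^sup>+\<xi>. ennreal \<bar>kern b (\<xi> - y)\<bar> \<partial>count_space X) \<le> ennreal (c * I)"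
      using c I by (simp add: ennreal_mult)
    have "measure lborel (ball (0::real^'d) \<rho>) = \<rho> ^ ?d * V"
      using content_ball_conv_unit_ball[of \<rho> "0::real^'d"] \<rho> by (simp add: V_def)
    then have e: "emeasure lborel (ball (0::real^'d) \<rho>) = ennreal (\<rho> ^ ?d * V)"
      using emeasure_eq_ennreal_measure[of lborel "ball (0::real^'d) \<rho>"] emeasure_lborel_ball_finite[of "0::real^'d" \<rho>] by simp
    let ?S = "\<integral>\<^sup>+\<xi>. ennreal \<bar>kern b (\<xi> - y)\<bar> \<partial>count_space X"
    have pos: "\<rho> ^ ?d * V > 0" using \<rho> V by simp
    have inv: "ennreal (1 / k) * (ennreal k * T) = T" if "k > 0" for k T
      using that by (simp add: mult.assoc[symmetric] ennreal_mult[symmetric])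
    have "?S = ennreal (1 / (\<rho> ^ ?d * V)) * (ennreal (\<rho> ^ ?d * V) * ?S)"
      by (rule inv[OF pos, symmetric])
    also have "\<dots> \<le> ennreal (1 / (\<rho> ^ ?d * V)) * ennreal (c * I)"
      using * e by (intro mult_left_mono) auto
    also have "\<dots> = ennreal (c * I / V / \<rho> ^ ?d)"
      using pos c I by (simp add: ennreal_mult[symmetric] mult.commute)
    also have "\<dots> \<le> ennreal ((c * I / V + 1) / \<rho> ^ ?d)"
      using \<rho> by (intro ennreal_leI divide_right_mono) auto
    finally show ?thesis .
  qed
  moreover have "c * I / V + 1 > 0" using c I V by (intro add_nonneg_pos) auto
  ultimately show ?thesis by blast
qed

section \<open>The sampling norm as an \<open>Lp_norm_on\<close> over counting measure\<close>

lemma lp_space_iff: "f \<in> lp_space p X \<longleftrightarrow> f \<in> Lp_on (count_space X) p"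
proof -
  have "(\<lambda>\<xi>. \<bar>f \<xi>\<bar> powr p) summable_on X \<longleftrightarrow> Infinite_Set_Sum.abs_summable_on (\<lambda>\<xi>. \<bar>f \<xi>\<bar> powr p) X"
    unfolding abs_summable_equivalent[symmetric] by simp
  then show ?thesis by (simp add: lp_space_def Lp_on_def abs_summable_on_def)
qed

lemma lp_norm_eq:
  fixes X :: "(real^'d) set"
  assumes p: "p \<ge> 1" and \<sigma>: "\<sigma> > 0" and f: "f \<in> lp_space p X"
  shows "lp_norm p \<sigma> X f = (1 / \<sigma> ^ CARD('d)) powr (1 / p) * Lp_norm_on (count_space X) p f"
proof -
  have "Infinite_Set_Sum.abs_summable_on (\<lambda>\<xi>. \<bar>f \<xi>\<bar> powr p) X"
    using f by (simp add: lp_space_iff Lp_on_def abs_summable_on_def)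
  then have "(\<Sum>\<^sub>\<infinity>\<xi>\<in>X. \<bar>f \<xi>\<bar> powr p) = (LINT \<xi>|count_space X. \<bar>f \<xi>\<bar> powr p)"
    by (simp add: infsetsum_infsum[symmetric] infsetsum_def)
  then show ?thesis
    unfolding lp_norm_def Lp_norm_on_def by (simp only: powr_mult)
qed

lemma lp_leI:
  fixes X :: "(real^'d) set"
  assumes p: "p \<ge> 1" and \<sigma>: "\<sigma> > 0" and c: "c \<ge> 0"
    and le: "(\<integral>\<^sup>+\<xi>. ennreal (\<bar>f \<xi>\<bar> powr p) \<partial>count_space X) \<le> ennreal (\<sigma> ^ CARD('d) * c powr p)"
  shows "f \<in> lp_space p X" "lp_norm p \<sigma> X f \<le> c"
proof -
  define K where "K = (\<sigma> ^ CARD('d)) powr (1 / p)"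
  have K: "K > 0" "K powr p = \<sigma> ^ CARD('d)" using p \<sigma> by (auto simp: K_def powr_powr)
  have "(\<integral>\<^sup>+\<xi>. ennreal (\<bar>f \<xi>\<bar> powr p) \<partial>count_space X) \<le> ennreal ((K * c) powr p)"
    using le K c by (simp add: powr_mult)
  then have *: "f \<in> Lp_on (count_space X) p" "Lp_norm_on (count_space X) p f \<le> K * c"
    using Lp_on_leI[OF p, of "K * c" f "count_space X"] K c by auto
  then show f: "f \<in> lp_space p X" by (simp add: lp_space_iff)
  have eq: "(1 / \<sigma> ^ CARD('d)) powr (1 / p) = 1 / K" using \<sigma> by (simp add: K_def powr_divide)
  show "lp_norm p \<sigma> X f \<le> c"
    unfolding lp_norm_eq[OF p \<sigma> f] eq using *(2) K c by (simp add: field_simps)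
qed

lemma lp_triangle:
  fixes X :: "(real^'d) set"
  assumes p: "p \<ge> 1" and \<sigma>: "\<sigma> > 0" and f: "f \<in> lp_space p X" and g: "g \<in> lp_space p X"
  shows "(\<lambda>x. f x + g x) \<in> lp_space p X" "(\<lambda>x. f x - g x) \<in> lp_space p X"
    and "lp_norm p \<sigma> X (\<lambda>x. f x + g x) \<le> lp_norm p \<sigma> X f + lp_norm p \<sigma> X g"
    and "lp_norm p \<sigma> X (\<lambda>x. f x - g x) \<le> lp_norm p \<sigma> X f + lp_norm p \<sigma> X g"
proof -
  have f': "f \<in> Lp_on (count_space X) p" and g': "g \<in> Lp_on (count_space X) p"
    using f g by (auto simp: lp_space_iff)
  show a: "(\<lambda>x. f x + g x) \<in> lp_space p X" and d: "(\<lambda>x. f x - g x) \<in> lp_space p X"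
    using Lp_on_add(1)[OF p f' g'] Lp_on_diff(1)[OF p f' g'] by (auto simp: lp_space_iff)
  have "(1 / \<sigma> ^ CARD('d)) powr (1 / p) \<ge> 0" by simp
  from mult_left_mono[OF Lp_norm_on_triangle[OF p f' g'] this] mult_left_mono[OF Lp_norm_on_triangle_diff[OF p f' g'] this]
  show "lp_norm p \<sigma> X (\<lambda>x. f x + g x) \<le> lp_norm p \<sigma> X f + lp_norm p \<sigma> X g"
    "lp_norm p \<sigma> X (\<lambda>x. f x - g x) \<le> lp_norm p \<sigma> X f + lp_norm p \<sigma> X g"
    by (simp_all add: lp_norm_eq[OF p \<sigma>] a d f g distrib_left)
qed

text \<open>Jensen's inequality at each sampling point, then an interchange of sum and integral,
  leave the sampling sum of the kernel. That sum is of order \<open>\<sigma> ^ CARD('d)\<close>,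
  which the normalisation of \<open>lp_norm\<close> cancels. Stating it for convolutions with the
  kernel, instead of all functions of a given band, makes a reproducing formula unnecessary;
  \<open>b \<le> \<sigma>\<close> and \<open>\<gamma> \<le> 1\<close> yield the hypothesis of
  \<open>kern_separated_sum\<close>.\<close>

lemma plancherel_polya:
  assumes p: "p \<ge> 1" and \<gamma>: "0 < \<gamma>" "\<gamma> \<le> 1"
  shows "\<exists>C>0. \<forall>b \<sigma> X h. 0 < b \<longrightarrow> b \<le> \<sigma> \<longrightarrow> separated (\<gamma> / \<sigma>) X \<longrightarrow> h \<in> Lp_on lborel p \<longrightarrow>
     conv (kern b) h \<in> lp_space p (X :: (real^'d) set) \<and> lp_norm p \<sigma> X (conv (kern b) h) \<le> C * Lp_norm_on lborel p h"
proof -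
  let ?d = "CARD('d)"
  obtain C where C: "C > 0" "\<And>b \<rho> X y. 0 < b \<Longrightarrow> 0 < \<rho> \<Longrightarrow> b * \<rho> \<le> 1 \<Longrightarrow> separated \<rho> X \<Longrightarrow>
     (\<integral>\<^sup>+\<xi>. ennreal \<bar>kern b (\<xi> - y :: real^'d)\<bar> \<partial>count_space X) \<le> ennreal (C / \<rho> ^ ?d)"
    using kern_separated_sum by metis
  define A where "A = kern_norm TYPE('d)"
  have A: "A \<ge> 0" by (simp add: A_def kern_norm_nonneg)
  define K where "K = (A powr (p - 1) * (C / \<gamma> ^ ?d)) powr (1 / p)"
  have Kp: "K powr p = A powr (p - 1) * (C / \<gamma> ^ ?d)" using p A C \<gamma> by (simp add: K_def powr_powr)
  have K0: "K \<ge> 0" by (simp add: K_def)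
  have "conv (kern b) h \<in> lp_space p X \<and> lp_norm p \<sigma> X (conv (kern b) h) \<le> K * Lp_norm_on lborel p h"
    if b: "0 < b" "b \<le> \<sigma>" and s: "separated (\<gamma> / \<sigma>) X" and h: "h \<in> Lp_on lborel p"
    for b \<sigma> and X :: "(real^'d) set" and h
  proof -
    have \<sigma>: "\<sigma> > 0" using b by simp
    have \<rho>: "\<gamma> / \<sigma> > 0" "b * (\<gamma> / \<sigma>) \<le> 1"
      using b \<sigma> \<gamma> mult_mono[of b \<sigma> \<gamma> 1] by (auto simp: field_simps)
    have [measurable]: "h \<in> borel_measurable borel" using h by (auto simp: Lp_on_def)
    have ki: "integrable lborel (\<lambda>y. kern b (\<xi> - y))" for \<xi>
      using lborel_integral_affine(2)[of "kern b" "-1" \<xi>] kern_integrable[OF b(1)] by simp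
    have kA: "(LINT y|lborel. \<bar>kern b (\<xi> - y)\<bar>) = A" for \<xi> :: "real^'d"
    proof -
      have "(LINT y|lborel. \<bar>kern b (y::real^'d)\<bar>) = A" by (simp add: A_def kern_abs_integral b)
      then show ?thesis using lborel_integral_affine(1)[of "\<lambda>y::real^'d. \<bar>kern b y\<bar>" "-1" \<xi>] by simp
    qed
    have pt: "ennreal (\<bar>conv (kern b) h \<xi>\<bar> powr p) \<le> ennreal (A powr (p - 1)) *
        (\<integral>\<^sup>+y. ennreal (\<bar>kern b (\<xi> - y)\<bar> * \<bar>h y\<bar> powr p) \<partial>lborel)" for \<xi>
      unfolding conv_def kA[of \<xi>, symmetric] by (rule jensen_powr[OF p ki]) measurable
    have "(\<integral>\<^sup>+\<xi>. ennreal (\<bar>conv (kern b) h \<xi>\<bar> powr p) \<partial>count_space X) \<le>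
       (\<integral>\<^sup>+\<xi>. ennreal (A powr (p - 1)) * (\<integral>\<^sup>+y. ennreal (\<bar>kern b (\<xi> - y)\<bar> * \<bar>h y\<bar> powr p) \<partial>lborel) \<partial>count_space X)"
      by (intro nn_integral_mono pt)
    also have "\<dots> = ennreal (A powr (p - 1)) * (\<integral>\<^sup>+\<xi>. (\<integral>\<^sup>+y. ennreal (\<bar>kern b (\<xi> - y)\<bar> * \<bar>h y\<bar> powr p) \<partial>lborel) \<partial>count_space X)"
      by (rule nn_integral_cmult) simp
    also have "(\<integral>\<^sup>+\<xi>. (\<integral>\<^sup>+y. ennreal (\<bar>kern b (\<xi> - y)\<bar> * \<bar>h y\<bar> powr p) \<partial>lborel) \<partial>count_space X) =
        (\<integral>\<^sup>+y. (\<integral>\<^sup>+\<xi>. ennreal (\<bar>kern b (\<xi> - y)\<bar> * \<bar>h y\<bar> powr p) \<partial>count_space X) \<partial>lborel)"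
      by (rule nn_integral_count_space_nn_integral[OF separated_countable[OF s \<rho>(1)], symmetric]) measurable
    also have "\<dots> = (\<integral>\<^sup>+y. (\<integral>\<^sup>+\<xi>. ennreal \<bar>kern b (\<xi> - y)\<bar> \<partial>count_space X) * ennreal (\<bar>h y\<bar> powr p) \<partial>lborel)"
      by (intro nn_integral_cong) (simp add: ennreal_mult nn_integral_multc)
    also have "\<dots> \<le> (\<integral>\<^sup>+y. ennreal (C / (\<gamma> / \<sigma>) ^ ?d) * ennreal (\<bar>h y\<bar> powr p) \<partial>lborel)"
      by (intro nn_integral_mono mult_right_mono C(2) b \<rho> s) auto
    also have "\<dots> = ennreal (C / (\<gamma> / \<sigma>) ^ ?d) * ennreal (Lp_norm_on lborel p h powr p)"
      by (simp add: nn_integral_cmult Lp_on_nn[OF p h])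
    also have "ennreal (A powr (p - 1)) * (ennreal (C / (\<gamma> / \<sigma>) ^ ?d) * ennreal (Lp_norm_on lborel p h powr p))
      = ennreal (\<sigma> ^ ?d * (K * Lp_norm_on lborel p h) powr p)"
      using C \<gamma> \<sigma> A K0 by (simp add: ennreal_mult[symmetric] powr_mult Kp power_divide mult_ac)
    finally have fin: "(\<integral>\<^sup>+\<xi>. ennreal (\<bar>conv (kern b) h \<xi>\<bar> powr p) \<partial>count_space X) \<le> ennreal (\<sigma> ^ ?d * (K * Lp_norm_on lborel p h) powr p)"
      by (simp add: mult_left_mono)
    show ?thesis using lp_leI[OF p \<sigma> _ fin] K0 by simp
  qed
  then have "conv (kern b) h \<in> lp_space p X \<and> lp_norm p \<sigma> X (conv (kern b) h) \<le> (K + 1) * Lp_norm_on lborel p h"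
    if "0 < b" "b \<le> \<sigma>" "separated (\<gamma> / \<sigma>) X" "h \<in> Lp_on lborel p"
    for b \<sigma> and X :: "(real^'d) set" and h
    using that by (force simp: distrib_right intro: order.trans)
  moreover have "K + 1 > 0" using K0 by simp
  ultimately show ?thesis by blast
qed

section \<open>Convolution with the kernel\<close>

lemma bounded_support_L1:
  assumes p: "p \<ge> 1" and g: "g \<in> Lp_on lborel p" and R: "\<And>x::real^'d. norm x > R \<Longrightarrow> g x = 0"
  shows "integrable lborel g"
proof (rule Bochner_Integration.integrable_bound)
  have [measurable]: "g \<in> borel_measurable borel" using g by (auto simp: Lp_on_def)
  show "integrable lborel (\<lambda>x. indicator (cball 0 R) x + \<bar>g x\<bar> powr p)"
    using g by (auto simp: Lp_on_def intro!: integrable_indicator_cball)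
  show "AE x in lborel. norm (g x) \<le> norm (indicator (cball 0 R) x + \<bar>g x\<bar> powr p)"
  proof (rule AE_I2)
    fix x
    show "norm (g x) \<le> norm (indicator (cball 0 R) x + \<bar>g x\<bar> powr p)"
      using abs_le_1_plus_powr[OF p, of "g x"] R[of x] by (cases "norm x \<le> R") (auto simp: indicator_def)
  qed
  show "g \<in> borel_measurable lborel" by measurable
qed

lemma Lp_on_1: "g \<in> Lp_on lborel 1 \<longleftrightarrow> integrable lborel g"
  using integrable_norm_iff[of g lborel] by (auto simp: Lp_on_def)

lemma Lp_on_lebesgue:
  fixes f :: "real^'d \<Rightarrow> real"
  assumes [measurable]: "f \<in> borel_measurable borel"
  shows "f \<in> Lp_space p \<longleftrightarrow> f \<in> Lp_on lborel p" "Lp_norm p f = Lp_norm_on lborel p f"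
proof -
  have m: "f \<in> borel_measurable lborel" "(\<lambda>x. \<bar>f x\<bar> powr p) \<in> borel_measurable lborel" by measurable
  show "f \<in> Lp_space p \<longleftrightarrow> f \<in> Lp_on lborel p"
    using m by (simp add: Lp_space_def Lp_on_def integrable_completion[OF m(2)] measurable_completion)
  show "Lp_norm p f = Lp_norm_on lborel p f"
    by (simp add: Lp_norm_def Lp_norm_on_def integral_completion[OF m(2)])
qed

lemma conv_kern_continuous:
  fixes g :: "real^'d \<Rightarrow> real"
  assumes g: "integrable lborel g"
  shows "continuous_on UNIV (conv (kern b) g)"
proof -
  have [measurable]: "g \<in> borel_measurable borel" using g by auto
  obtain B where B: "B \<ge> 0" "\<And>x::real^'d. \<bar>kern b x\<bar> \<le> B"
    using kern_deriv_bounded[of b "\<lambda>_. 0"] by (auto simp: kern_def)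
  have "isCont (conv (kern b) g) x" for x
    unfolding continuous_at_sequentially comp_def conv_def
  proof (intro allI impI)
    fix u assume u: "u \<longlonglongrightarrow> x"
    show "(\<lambda>n. LINT y|lborel. kern b (u n - y) * g y) \<longlonglongrightarrow> (LINT y|lborel. kern b (x - y) * g y)"
    proof (rule integral_dominated_convergence[where w = "\<lambda>y. B * \<bar>g y\<bar>"])
      show "AE y in lborel. (\<lambda>n. kern b (u n - y) * g y) \<longlonglongrightarrow> kern b (x - y) * g y"
      proof (rule AE_I2)
        fix y
        have "(\<lambda>n. kern b (u n - y)) \<longlonglongrightarrow> kern b (x - y)"
          unfolding kern_def
          by (rule continuous_on_tendsto_compose[OF kern_deriv_continuous[of UNIV] tendsto_diff[OF u tendsto_const]]) auto
        then show "(\<lambda>n. kern b (u n - y) * g y) \<longlonglongrightarrow> kern b (x - y) * g y"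
          by (rule tendsto_mult_right)
      qed
      show "AE y in lborel. norm (kern b (u n - y) * g y) \<le> B * \<bar>g y\<bar>" for n
        using B by (auto simp: abs_mult intro!: AE_I2 mult_right_mono)
    qed (use g in auto)
  qed
  then show ?thesis by (simp add: continuous_at_imp_continuous_on)
qed

lemma kern_fourier:
  fixes x :: "real^'d"
  assumes b: "b > 0" and i: "\<bar>x $ i\<bar> \<ge> b"
  shows "(LINT z|lborel. complex_of_real (kern b z) * exp (- 2 * pi * \<i> * complex_of_real (x \<bullet> z))) = 0"
proof -
  let ?f = "\<lambda>i t. complex_of_real (kern_tower b 0 t) * exp (- 2 * pi * \<i> * complex_of_real (x $ i * t))"
  have eq: "complex_of_real (kern b z) * exp (- 2 * pi * \<i> * complex_of_real (x \<bullet> z)) = (\<Prod>i\<in>UNIV. ?f i (z $ i))" for z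
    by (simp add: kern_def kern_deriv_def tprod_def inner_vec_def sum_distrib_left exp_sum prod.distrib)
  have [measurable]: "kern_tower b 0 \<in> borel_measurable borel" by (rule tower_borel[OF tower_kern])
  have int: "integrable lborel (?f i)" for i
    by (rule Bochner_Integration.integrable_bound[OF kern_tower_integrable[OF b, of 0]])
       (auto simp: norm_mult norm_exp_eq_Re)
  have "(LINT z|lborel. (\<Prod>i\<in>UNIV. ?f i (z $ i))) = (\<Prod>i\<in>UNIV. LINT t|lborel. ?f i t)"
    by (rule lborel_integral_prod(2)[OF int])
  also have "\<dots> = 0"
    using kern_tower_fourier[OF b i] by (intro prod_zero) auto
  finally show ?thesis unfolding eq .
qed

text \<open>After Fubini the inner integral is, up to a factor of modulus
  \<open>\<bar>g y\<bar>\<close>, the transform of the kernel at \<open>x\<close>, which is 0 as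
  soon as one coordinate leaves the band.\<close>

lemma conv_kern_fourier:
  fixes g :: "real^'d \<Rightarrow> real"
  assumes b: "b > 0" and g: "integrable lborel g" and i: "\<bar>x $ i\<bar> \<ge> b"
  shows "fourier_transform (conv (kern b) g) x = 0"
proof -
  have [measurable]: "g \<in> borel_measurable borel" using g by auto
  define E where "E u = exp (- 2 * pi * \<i> * complex_of_real (x \<bullet> u))" for u :: "real^'d"
  have E: "E (u + v) = E u * E v" for u v by (simp add: E_def inner_add_right exp_add[symmetric] algebra_simps)
  have En: "norm (E u) = 1" for u by (simp add: E_def norm_exp_eq_Re)
  have [measurable]: "E \<in> borel_measurable borel" unfolding E_def by measurable
  have [measurable]: "conv (kern b) g \<in> borel_measurable borel"
    by (rule borel_measurable_continuous_onI[OF conv_kern_continuous[OF g]])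
  have ki: "integrable lborel (\<lambda>u. kern b (u - y))" for y :: "real^'d"
    using lborel_shift(2)[of "kern b" "- y"] kern_integrable[OF b] by simp
  have ka: "(LINT u|lborel. \<bar>kern b (u - y)\<bar>) = kern_norm TYPE('d)" for y :: "real^'d"
    using lborel_shift(1)[of "\<lambda>u. \<bar>kern b u\<bar>" "- y"] kern_abs_integral[OF b, where 'd = 'd] by simp
  let ?F = "\<lambda>y u. complex_of_real (kern b (u - y) * g y) * E u"
  have int: "integrable (lborel \<Otimes>\<^sub>M lborel) (\<lambda>(y, u). ?F y u)"
  proof (rule pair_sigma_finite.Fubini_integrable[OF lborel_pair_sigma_finite])
    show "(\<lambda>(y, u). ?F y u) \<in> borel_measurable (lborel \<Otimes>\<^sub>M lborel)" by measurable
    have "(LINT u|lborel. norm (?F y u)) = kern_norm TYPE('d) * \<bar>g y\<bar>" for y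
      by (simp add: norm_mult En abs_mult ka)
    then show "integrable lborel (\<lambda>y. LINT u|lborel. norm (case (y, u) of (y, u) \<Rightarrow> ?F y u))"
      using g by simp
    show "AE y in lborel. integrable lborel (\<lambda>u. case (y, u) of (y, u) \<Rightarrow> ?F y u)"
    proof (rule AE_I2)
      fix y :: "real^'d"
      show "integrable lborel (\<lambda>u. case (y, u) of (y, u) \<Rightarrow> ?F y u)"
        by (rule Bochner_Integration.integrable_bound[OF integrable_mult_left[OF ki[of y], of "g y"]])
           (auto simp: norm_mult En)
    qed
  qed
  have "fourier_transform (conv (kern b) g) x = (LINT u|lborel. complex_of_real (conv (kern b) g u) * E u)"
    unfolding fourier_transform_def E_def by (rule integral_completion) measurable
  also have "\<dots> = (LINT u|lborel. LINT y|lborel. ?F y u)"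
    unfolding conv_def by (simp flip: integral_complex_of_real)
  also have "\<dots> = (LINT y|lborel. LINT u|lborel. ?F y u)"
    using pair_sigma_finite.Fubini_integral[OF lborel_pair_sigma_finite int] by simp
  also have "\<dots> = (LINT y::real^'d|lborel. 0)"
  proof (rule Bochner_Integration.integral_cong[OF refl])
    fix y :: "real^'d"
    have "(LINT u|lborel. ?F y u) = (LINT u|lborel. ?F y (u + y))"
      by (rule lborel_shift(1)[symmetric]) measurable
    also have "\<dots> = (LINT u|lborel. (complex_of_real (g y) * E y) * (complex_of_real (kern b u) * E u))"
      by (simp add: E mult_ac)
    also have "\<dots> = complex_of_real (g y) * E y * (LINT u|lborel. complex_of_real (kern b u) * E u)"
      by (rule integral_mult_right_zero)
    also have "(LINT u|lborel. complex_of_real (kern b u) * E u) = 0"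
      unfolding E_def by (rule kern_fourier[OF b i])
    finally show "(LINT u|lborel. ?F y u) = 0" by simp
  qed
  finally show ?thesis by simp
qed

text \<open>Bounded support makes \<open>g\<close> integrable. This gives continuity and
  integrability of the convolution and the Fubini step for its transform, none of which follow from
  membership in \<open>Lp_on lborel p\<close> when \<open>p > 1\<close>.\<close>

lemma conv_kern_band_limited:
  fixes g :: "real^'d \<Rightarrow> real"
  assumes p: "p \<ge> 1" and b: "b > 0" "b \<le> \<sigma>" and g: "g \<in> Lp_on lborel p" and R: "\<And>x. norm x > R \<Longrightarrow> g x = 0"
  shows "conv (kern b) g \<in> band_limited p \<sigma>"
proof -
  have g1: "integrable lborel g" by (rule bounded_support_L1[OF p g R])
  have c: "continuous_on UNIV (conv (kern b) g)" by (rule conv_kern_continuous[OF g1])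
  then have m: "conv (kern b) g \<in> borel_measurable borel" by (rule borel_measurable_continuous_onI)
  have "conv (kern b) g \<in> Lp_on lborel p" "conv (kern b) g \<in> Lp_on lborel 1"
    using g g1 p kern_integrable[OF b(1)] conv_Lp_on(1)[of 1] by (auto intro!: conv_Lp_on(1) simp: Lp_on_1)
  moreover have "closure {x. fourier_transform (conv (kern b) g) x \<noteq> 0} \<subseteq> cbox (\<chi> i. - \<sigma>) (\<chi> i. \<sigma>)"
  proof (rule closure_minimal)
    show "{x. fourier_transform (conv (kern b) g) x \<noteq> 0} \<subseteq> cbox (\<chi> i. - \<sigma>) (\<chi> i. \<sigma>)"
    proof
      fix x assume x: "x \<in> {x. fourier_transform (conv (kern b) g) x \<noteq> 0}"
      have "\<bar>x $ i\<bar> \<le> \<sigma>" for i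
        using conv_kern_fourier[OF b(1) g1, of x i] x b(2) by (cases "\<bar>x $ i\<bar> \<ge> b") auto
      then show "x \<in> cbox (\<chi> i. - \<sigma>) (\<chi> i. \<sigma>)"
        by (auto simp: mem_box_cart abs_le_iff minus_le_iff)
    qed
  qed (rule closed_cbox)
  ultimately show ?thesis
    using c m by (simp add: band_limited_def Lp_on_lebesgue[OF m])
qed

lemma Lp_space_eq_Lp_on:
  shows "f \<in> Lp_space p \<longleftrightarrow> f \<in> Lp_on lebesgue p" and "Lp_norm p f = Lp_norm_on lebesgue p f"
  by (simp_all add: Lp_space_def Lp_on_def Lp_norm_def Lp_norm_on_def)

lemma fourier_transform_sum:
  assumes "finite I" "\<And>i. i \<in> I \<Longrightarrow> f i \<in> Lp_space 1"
  shows "fourier_transform (\<lambda>x. \<Sum>i\<in>I. c i * f i x) y = (\<Sum>i\<in>I. complex_of_real (c i) * fourier_transform (f i) y)"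
proof -
  have int: "integrable lebesgue (\<lambda>u. complex_of_real (f i u) * exp (- 2 * pi * \<i> * complex_of_real (y \<bullet> u)))" if "i \<in> I" for i
  proof -
    have m: "f i \<in> borel_measurable lebesgue" and fi: "integrable lebesgue (\<lambda>x. \<bar>f i x\<bar>)"
      using assms(2)[OF that] by (auto simp: Lp_space_def)
    have e: "(\<lambda>u. exp (- 2 * pi * \<i> * complex_of_real (y \<bullet> u))) \<in> borel_measurable lebesgue"
      by (rule measurable_completion) measurable
    show ?thesis
    proof (rule Bochner_Integration.integrable_bound[OF fi])
      show "(\<lambda>u. complex_of_real (f i u) * exp (- 2 * pi * \<i> * complex_of_real (y \<bullet> u))) \<in> borel_measurable lebesgue"
        using m e by (intro borel_measurable_times) auto
    qed (auto simp: norm_mult norm_exp_eq_Re)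
  qed
  have "fourier_transform (\<lambda>x. \<Sum>i\<in>I. c i * f i x) y =
    (LINT u|lebesgue. (\<Sum>i\<in>I. complex_of_real (c i) * (complex_of_real (f i u) * exp (- 2 * pi * \<i> * complex_of_real (y \<bullet> u)))))"
    unfolding fourier_transform_def by (simp add: sum_distrib_right mult.assoc)
  also have "\<dots> = (\<Sum>i\<in>I. complex_of_real (c i) * fourier_transform (f i) y)"
    unfolding fourier_transform_def
    by (subst Bochner_Integration.integral_sum, rule integrable_mult_right, rule int, assumption)
       (simp only: integral_mult_right_zero)
  finally show ?thesis .
qed

lemma band_limited_sum:
  assumes p: "p \<ge> 1" and "finite I" and f: "\<And>i. i \<in> I \<Longrightarrow> f i \<in> band_limited p \<sigma>"
  shows "(\<lambda>x. \<Sum>i\<in>I. c i * f i x) \<in> band_limited p \<sigma>"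
proof -
  have f1: "f i \<in> Lp_space 1" if "i \<in> I" for i using f[OF that] by (simp add: band_limited_def)
  have "{x. fourier_transform (\<lambda>x. \<Sum>i\<in>I. c i * f i x) x \<noteq> 0} \<subseteq> cbox (\<chi> i. - \<sigma>) (\<chi> i. \<sigma>)"
  proof
    fix x assume x: "x \<in> {x. fourier_transform (\<lambda>x. \<Sum>i\<in>I. c i * f i x) x \<noteq> 0}"
    then have "(\<Sum>i\<in>I. complex_of_real (c i) * fourier_transform (f i) x) \<noteq> 0"
      using fourier_transform_sum[OF assms(2) f1, where c = c and y = x] by simp
    then obtain i where i: "i \<in> I" "fourier_transform (f i) x \<noteq> 0"
      by (metis (mono_tags, lifting) mult_zero_right sum.neutral)
    then have "x \<in> closure {x. fourier_transform (f i) x \<noteq> 0}"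
      by (intro subsetD[OF closure_subset]) simp
    then show "x \<in> cbox (\<chi> i. - \<sigma>) (\<chi> i. \<sigma>)" using f[OF i(1)] by (auto simp: band_limited_def)
  qed
  then have "closure {x. fourier_transform (\<lambda>x. \<Sum>i\<in>I. c i * f i x) x \<noteq> 0} \<subseteq> cbox (\<chi> i. - \<sigma>) (\<chi> i. \<sigma>)"
    by (rule closure_minimal) (rule closed_cbox)
  moreover have "(\<lambda>x. \<Sum>i\<in>I. c i * f i x) \<in> Lp_space p \<inter> Lp_space 1"
    using f p assms(2) unfolding Lp_space_eq_Lp_on Int_iff
    by (intro conjI Lp_on_sum Lp_on_cmult) (auto simp: band_limited_def Lp_space_eq_Lp_on)
  moreover have "continuous_on UNIV (\<lambda>x. \<Sum>i\<in>I. c i * f i x)"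
    using f by (intro continuous_intros) (auto simp: band_limited_def)
  ultimately show ?thesis by (simp add: band_limited_def)
qed

section \<open>Weak derivatives of convolutions\<close>

lemma conv_pairing_integrable:
  fixes h K \<psi> :: "real^'d \<Rightarrow> real"
  assumes p: "p \<ge> 1" and K: "integrable lborel K" and h: "h \<in> Lp_on lborel p"
    and \<psi>: "\<psi> \<in> borel_measurable borel" "\<And>x. \<bar>\<psi> x\<bar> \<le> B" "bounded {x. \<psi> x \<noteq> 0}"
  shows "integrable (lborel \<Otimes>\<^sub>M lborel) (\<lambda>(z, x). K z * h (x - z) * \<psi> x)"
proof -
  have [measurable]: "h \<in> borel_measurable borel" "K \<in> borel_measurable borel" "\<psi> \<in> borel_measurable borel"
    using h K \<psi> by (auto simp: Lp_on_def)
  have \<psi>i: "integrable lborel \<psi>" by (rule bounded_support_integrable[OF \<psi>])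
  have B: "B \<ge> 0" using \<psi>(2)[of 0] by linarith
  have hi: "integrable lborel (\<lambda>x. \<bar>h (x - z)\<bar> powr p)" for z
    using lborel_shift(2)[of "\<lambda>x. \<bar>h x\<bar> powr p" "- z"] h by (simp add: Lp_on_def)
  have hv: "(LINT x|lborel. \<bar>h (x - z)\<bar> powr p) = Lp_norm_on lborel p h powr p" for z
    using lborel_shift(1)[of "\<lambda>x. \<bar>h x\<bar> powr p" "- z"] by (simp add: Lp_norm_on_powr[OF p])
  have pt: "\<bar>h (x - z) * \<psi> x\<bar> \<le> \<bar>\<psi> x\<bar> + B * \<bar>h (x - z)\<bar> powr p" for x z
  proof -
    have "\<bar>h (x - z)\<bar> * \<bar>\<psi> x\<bar> \<le> (1 + \<bar>h (x - z)\<bar> powr p) * \<bar>\<psi> x\<bar>"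
      using abs_le_1_plus_powr[OF p] by (intro mult_right_mono) auto
    also have "\<dots> \<le> \<bar>\<psi> x\<bar> + B * \<bar>h (x - z)\<bar> powr p"
      using mult_right_mono[OF \<psi>(2)[of x], of "\<bar>h (x - z)\<bar> powr p"] by (simp add: algebra_simps)
    finally show ?thesis by (simp add: abs_mult)
  qed
  have i1: "integrable lborel (\<lambda>x. h (x - z) * \<psi> x)" for z
  proof (rule Bochner_Integration.integrable_bound)
    show "integrable lborel (\<lambda>x. \<bar>\<psi> x\<bar> + B * \<bar>h (x - z)\<bar> powr p)" using \<psi>i hi by simp
    show "AE x in lborel. norm (h (x - z) * \<psi> x) \<le> norm (\<bar>\<psi> x\<bar> + B * \<bar>h (x - z)\<bar> powr p)"
      using pt B by (auto simp: abs_mult)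
  qed measurable
  define M where "M = (LINT x|lborel. \<bar>\<psi> x\<bar>) + B * Lp_norm_on lborel p h powr p"
  have M: "(LINT x|lborel. \<bar>h (x - z) * \<psi> x\<bar>) \<le> M" for z
  proof -
    have "(LINT x|lborel. \<bar>h (x - z) * \<psi> x\<bar>) \<le> (LINT x|lborel. \<bar>\<psi> x\<bar> + B * \<bar>h (x - z)\<bar> powr p)"
      by (intro integral_mono pt) (use i1 hi \<psi>i in auto)
    also have "\<dots> = M" using hi \<psi>i by (simp add: M_def hv)
    finally show ?thesis .
  qed
  show ?thesis
  proof (rule pair_sigma_finite.Fubini_integrable[OF lborel_pair_sigma_finite])
    show "(\<lambda>(z, x). K z * h (x - z) * \<psi> x) \<in> borel_measurable (lborel \<Otimes>\<^sub>M lborel)" by measurable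
    have eq: "(LINT x|lborel. norm (case (z, x) of (z, x) \<Rightarrow> K z * h (x - z) * \<psi> x)) = \<bar>K z\<bar> * (LINT x|lborel. \<bar>h (x - z) * \<psi> x\<bar>)" for z
      by (simp add: abs_mult mult.assoc)
    show "integrable lborel (\<lambda>z. LINT x|lborel. norm (case (z, x) of (z, x) \<Rightarrow> K z * h (x - z) * \<psi> x))"
      unfolding eq
    proof (rule Bochner_Integration.integrable_bound)
      show "integrable lborel (\<lambda>z. K z * M)" using K by simp
      have "0 \<le> (LINT x|lborel. \<bar>h (x - z) * \<psi> x\<bar>)" for z by simp
      then show "AE z in lborel. norm (\<bar>K z\<bar> * (LINT x|lborel. \<bar>h (x - z) * \<psi> x\<bar>)) \<le> norm (K z * M)"
        using order.trans[OF M abs_ge_self] by (intro AE_I2) (simp add: abs_mult mult_left_mono)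
    qed measurable
    show "AE z in lborel. integrable lborel (\<lambda>x. case (z, x) of (z, x) \<Rightarrow> K z * h (x - z) * \<psi> x)"
      using i1 by (auto simp: mult.assoc)
  qed
qed

text \<open>The convolution is shifted onto translates of \<open>\<psi>\<close>. These are again
  test functions when \<open>\<psi>\<close> is one, so a weak derivative of \<open>h\<close>, known
  only through its tested form, can be inserted.\<close>

lemma conv_pairing:
  fixes h K \<psi> :: "real^'d \<Rightarrow> real"
  assumes p: "p \<ge> 1" and K: "integrable lborel K" and h: "h \<in> Lp_on lborel p"
    and \<psi>: "\<psi> \<in> borel_measurable borel" "\<And>x. \<bar>\<psi> x\<bar> \<le> B" "bounded {x. \<psi> x \<noteq> 0}"
  shows "(LINT x|lborel. conv K h x * \<psi> x) = (LINT z|lborel. K z * (LINT y|lborel. h y * \<psi> (y + z)))"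
proof -
  have [measurable]: "h \<in> borel_measurable borel" "K \<in> borel_measurable borel" "\<psi> \<in> borel_measurable borel"
    using h K \<psi> by (auto simp: Lp_on_def)
  have "(LINT x|lborel. conv K h x * \<psi> x) = (LINT x|lborel. LINT z|lborel. K z * h (x - z) * \<psi> x)"
    by (simp add: conv_commute)
  also have "\<dots> = (LINT z|lborel. LINT x|lborel. K z * h (x - z) * \<psi> x)"
    using pair_sigma_finite.Fubini_integral[OF lborel_pair_sigma_finite conv_pairing_integrable[OF assms]] by simp
  also have "\<dots> = (LINT z|lborel. K z * (LINT y|lborel. h y * \<psi> (y + z)))"
  proof (rule Bochner_Integration.integral_cong[OF refl])
    fix z
    have "(LINT x|lborel. K z * h (x - z) * \<psi> x) = (LINT y|lborel. K z * h (y + z - z) * \<psi> (y + z))"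
      by (rule lborel_shift(1)[symmetric]) measurable
    then show "(LINT x|lborel. K z * h (x - z) * \<psi> x) = K z * (LINT y|lborel. h y * \<psi> (y + z))"
      by (simp add: mult.assoc)
  qed
  finally show ?thesis .
qed

lemma test_function_bounds:
  assumes "test_function \<phi>"
  obtains B where "\<And>x. \<bar>\<phi> x\<bar> \<le> B" "bounded {x. \<phi> x \<noteq> 0}" "\<phi> \<in> borel_measurable borel"
  using assms continuous_bounded_support_bounded[OF test_function_continuous[OF assms]] test_function_borel[OF assms]
  by (metis test_function_def)

text \<open>The variant in which the derivative falls on \<open>g\<close>: the constant in the
  resulting bound is the mass of \<open>K\<close>, independent of how narrow the kernel is.\<close>

lemma weak_pair_conv:
  fixes K :: "real^'d \<Rightarrow> real"
  assumes p: "p \<ge> 1" and K: "integrable lborel K" and g: "g \<in> Lp_on lborel p" and v: "v \<in> Lp_on lborel p"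
    and w: "weak_pair \<alpha> g v"
  shows "weak_pair \<alpha> (conv K g) (conv K v)"
  unfolding weak_pair_def
proof (intro allI impI, elim conjE)
  fix \<phi> :: "real^'d \<Rightarrow> real" and js assume \<phi>: "test_function \<phi>" and js: "\<forall>i. count_list js i = \<alpha> i"
  let ?s = "(-1) ^ (\<Sum>i\<in>UNIV. \<alpha> i) :: real"
  obtain B where B: "\<And>x. \<bar>\<phi> x\<bar> \<le> B" "bounded {x. \<phi> x \<noteq> 0}" "\<phi> \<in> borel_measurable borel"
    using test_function_bounds[OF \<phi>] by blast
  obtain B' where B': "\<And>x. \<bar>iter_partial_deriv js \<phi> x\<bar> \<le> B'" "bounded {x. iter_partial_deriv js \<phi> x \<noteq> 0}"
    "iter_partial_deriv js \<phi> \<in> borel_measurable borel"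
    using test_function_bounds[OF test_function_iter[OF \<phi>]] by blast
  have "(LINT y|lborel. g y * iter_partial_deriv js \<phi> (y + z)) = ?s * (LINT y|lborel. v y * \<phi> (y + z))" for z
    using w[unfolded weak_pair_def, rule_format, of "\<lambda>y. \<phi> (y + z)" js] js
      test_function_translate[OF \<phi>, where y = z] by simp
  then show "(LINT x|lborel. conv K g x * iter_partial_deriv js \<phi> x) = ?s * (LINT x|lborel. conv K v x * \<phi> x)"
    unfolding conv_pairing[OF p K g B'(3,1,2)] conv_pairing[OF p K v B(3,1,2)]
    by (simp only: mult.left_commute[of "K _" ?s] integral_mult_right_zero)
qed

text \<open>The variant in which the derivative falls on the kernel, for functions that have no weak
  derivative, such as truncation errors.\<close>

lemma weak_pair_conv_kern:
  fixes h :: "real^'d \<Rightarrow> real"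
  assumes p: "p \<ge> 1" and b: "b > 0" and h: "h \<in> Lp_on lborel p"
  shows "weak_pair \<alpha> (conv (kern b) h) (conv (kern_deriv b \<alpha>) h)"
  unfolding weak_pair_def
proof (intro allI impI, elim conjE)
  fix \<phi> :: "real^'d \<Rightarrow> real" and js assume \<phi>: "test_function \<phi>" and js: "\<forall>i. count_list js i = \<alpha> i"
  let ?s = "(-1) ^ (\<Sum>i\<in>UNIV. \<alpha> i) :: real"
  have js': "count_list js = \<alpha>" using js by auto
  have len: "length js = (\<Sum>i\<in>UNIV. \<alpha> i)" using sum_count_set[of js UNIV] js' by simp
  have [measurable]: "h \<in> borel_measurable borel" using h by (auto simp: Lp_on_def)
  \<comment> \<open>Compared with \<open>conv_pairing\<close>, a further interchange isolates
    \<open>h y\<close>, so that the test function meets a translate of the kernel.\<close>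
  have swap: "(LINT x|lborel. conv K h x * \<psi> x) = (LINT y|lborel. h y * (LINT x|lborel. K (x - y) * \<psi> x))"
    if K: "integrable lborel K" and \<psi>: "test_function \<psi>" for K \<psi> :: "real^'d \<Rightarrow> real"
  proof -
    obtain B where B: "\<And>x. \<bar>\<psi> x\<bar> \<le> B" "bounded {x. \<psi> x \<noteq> 0}" and [measurable]: "\<psi> \<in> borel_measurable borel"
      using test_function_bounds[OF \<psi>] by blast
    have [measurable]: "K \<in> borel_measurable borel" using K by auto
    have int: "integrable (lborel \<Otimes>\<^sub>M lborel) (\<lambda>(z, y). h y * (K z * \<psi> (y + z)))"
    proof (rule pair_sigma_finite.Fubini_integrable[OF lborel_pair_sigma_finite])
      have m: "(\<lambda>(z, x). K z * h (x - z) * \<psi> x) \<in> borel_measurable (lborel \<Otimes>\<^sub>M lborel)" by measurable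
      have sh: "(LINT y|lborel. norm (h y * (K z * \<psi> (y + z)))) = (LINT x|lborel. norm (K z * h (x - z) * \<psi> x))" for z
        using lborel_shift(1)[of "\<lambda>x. norm (K z * h (x - z) * \<psi> x)" z] by (simp add: mult_ac)
      note I = conv_pairing_integrable[OF p K h _ B(1) B(2)]
      have "integrable lborel (\<lambda>z. LINT x|lborel. norm (case (z, x) of (z, x) \<Rightarrow> K z * h (x - z) * \<psi> x))"
        using pair_sigma_finite.integrable_fst'[OF lborel_pair_sigma_finite integrable_norm[OF I]] by simp
      then show "integrable lborel (\<lambda>z. LINT y|lborel. norm (case (z, y) of (z, y) \<Rightarrow> h y * (K z * \<psi> (y + z))))"
        using sh by simp
      have "AE z in lborel. integrable lborel (\<lambda>x. case (z, x) of (z, x) \<Rightarrow> K z * h (x - z) * \<psi> x)"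
        using pair_sigma_finite.AE_integrable_fst'[OF lborel_pair_sigma_finite I] by simp
      then show "AE z in lborel. integrable lborel (\<lambda>y. case (z, y) of (z, y) \<Rightarrow> h y * (K z * \<psi> (y + z)))"
      proof eventually_elim
        case (elim z)
        then show ?case
          using lborel_shift(2)[of "\<lambda>x. K z * h (x - z) * \<psi> x" z] by (simp add: mult_ac)
      qed
    qed measurable
    have "(LINT x|lborel. conv K h x * \<psi> x) = (LINT z|lborel. LINT y|lborel. h y * (K z * \<psi> (y + z)))"
      by (subst conv_pairing[OF p K h _ B(1) B(2)]) (auto simp: mult_ac)
    also have "\<dots> = (LINT y|lborel. LINT z|lborel. h y * (K z * \<psi> (y + z)))"
      using pair_sigma_finite.Fubini_integral[OF lborel_pair_sigma_finite int] by simp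
    also have "\<dots> = (LINT y|lborel. h y * (LINT x|lborel. K (x - y) * \<psi> x))"
    proof (rule Bochner_Integration.integral_cong[OF refl])
      fix y
      have "(LINT z|lborel. K (z + y - y) * \<psi> (z + y)) = (LINT x|lborel. K (x - y) * \<psi> x)"
        by (rule lborel_shift(1)) measurable
      then show "(LINT z|lborel. h y * (K z * \<psi> (y + z))) = h y * (LINT x|lborel. K (x - y) * \<psi> x)"
        by (simp add: add.commute)
    qed
    finally show ?thesis .
  qed
  \<comment> \<open>A translate of the kernel is again a product of towers, which is all that
    integration by parts asks for.\<close>
  have "(LINT x|lborel. kern b (x - y) * iter_partial_deriv js \<phi> x) = ?s * (LINT x|lborel. kern_deriv b \<alpha> (x - y) * \<phi> x)" for y
  proof -
    let ?D = "\<lambda>i m t. 1 ^ m * kern_tower b m (- (y $ i) + 1 * t)"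
    have D: "\<forall>i. tower (?D i)" by (intro allI tower_affine tower_kern)
    have eq: "kern_deriv b \<beta> (x - y) = tprod ?D \<beta> x" for \<beta> x
      by (simp add: kern_deriv_def tprod_def)
    show ?thesis
      using integral_by_parts_tprod_iter[OF D \<phi>, of "\<lambda>_. 0" js] by (simp add: kern_def eq js' len)
  qed
  then show "(LINT x|lborel. conv (kern b) h x * iter_partial_deriv js \<phi> x) = ?s * (LINT x|lborel. conv (kern_deriv b \<alpha>) h x * \<phi> x)"
    unfolding swap[OF kern_integrable[OF b] test_function_iter[OF \<phi>]] swap[OF kern_deriv_integrable[OF b] \<phi>]
    by (simp only: mult.left_commute[of "h _" ?s] integral_mult_right_zero)
qed

section \<open>Ball averages\<close>

definition unit_ball_volume :: "'d::finite itself \<Rightarrow> real" where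
  "unit_ball_volume _ = measure lborel (ball (0::real^'d) 1)"

text \<open>The substitution \<open>y = x + \<delta> *\<^sub>R z\<close> turns averages over balls
  of every radius into integrals against this one probability density, so the averages of different
  radii in \<open>averaged\<close> can be combined under one integral.\<close>

definition ball_density :: "real^'d \<Rightarrow> real" where
  "ball_density z = indicator (ball 0 1) z / unit_ball_volume TYPE('d)"

lemma unit_ball_volume_pos: "unit_ball_volume TYPE('d::finite) > 0"
  unfolding unit_ball_volume_def using content_ball_pos[of 1 "0::real^'d"] by simp

lemma ball_density_borel [measurable]: "ball_density \<in> borel_measurable borel"
  unfolding ball_density_def[abs_def]
  by (intro borel_measurable_divide borel_measurable_indicator) auto

lemma ball_density_nonneg: "ball_density (z::real^'d) \<ge> 0"
  using unit_ball_volume_pos[where 'd = 'd] by (simp add: ball_density_def)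

lemma ball_density_bound: "ball_density (z::real^'d) \<le> 1 / unit_ball_volume TYPE('d)"
  using unit_ball_volume_pos[where 'd = 'd] by (simp add: ball_density_def indicator_def)

lemma ball_density_abs_bound: "\<bar>ball_density (z::real^'d)\<bar> \<le> 1 / unit_ball_volume TYPE('d)"
  by (simp add: ball_density_nonneg ball_density_bound)

lemma ball_density_support: "ball_density z \<noteq> 0 \<Longrightarrow> norm z < 1"
  by (auto simp: ball_density_def indicator_def split: if_splits)

lemma ball_density_even: "ball_density (- z) = ball_density z"
  by (simp add: ball_density_def indicator_def)

lemma ball_density_integrable: "integrable lborel (ball_density :: real^'d \<Rightarrow> real)"
  and ball_density_integral: "(LINT z|lborel. ball_density (z::real^'d)) = 1"
proof -
  have "emeasure lborel (ball (0::real^'d) 1) < \<infinity>" by (rule emeasure_lborel_ball_finite)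
  then have "integrable lborel (indicator (ball (0::real^'d) 1) :: _ \<Rightarrow> real)"
    by (intro integrable_real_indicator) auto
  then show "integrable lborel (ball_density :: real^'d \<Rightarrow> real)"
    unfolding ball_density_def[abs_def] by simp
  show "(LINT z|lborel. ball_density (z::real^'d)) = 1"
    using unit_ball_volume_pos[where 'd = 'd] unfolding ball_density_def
    by (simp add: unit_ball_volume_def)
qed

lemma ball_density_abs_integral: "(LINT z|lborel. \<bar>ball_density (z::real^'d)\<bar>) = 1"
  using ball_density_integral[where 'd = 'd] by (simp add: ball_density_nonneg)

lemma Lp_on_affine:
  fixes f :: "real^'d \<Rightarrow> real"
  assumes f: "f \<in> Lp_on lborel p" and c: "c \<noteq> 0"
  shows "(\<lambda>z. f (x + c *\<^sub>R z)) \<in> Lp_on lborel p"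
proof -
  have [measurable]: "f \<in> borel_measurable borel" using f by (auto simp: Lp_on_def)
  show ?thesis
    using f lborel_integral_affine(2)[of "\<lambda>y. \<bar>f y\<bar> powr p" c x] c by (auto simp: Lp_on_def)
qed

lemma ball_density_Lp_integrable:
  fixes f :: "real^'d \<Rightarrow> real"
  assumes p: "p \<ge> 1" and f: "f \<in> Lp_on lborel p"
  shows "integrable lborel (\<lambda>z. ball_density z * f (x + c *\<^sub>R z))"
proof (cases "c = 0")
  case True
  then show ?thesis using ball_density_integrable[where 'd = 'd] by simp
next
  case False
  have g: "(\<lambda>y. f (x + (- c) *\<^sub>R y)) \<in> Lp_on lborel p" using Lp_on_affine[OF f, of "- c" x] False by simp
  have "\<And>z::real^'d. \<bar>ball_density z\<bar> \<le> 1 / unit_ball_volume TYPE('d)"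
    by (rule ball_density_abs_bound)
  from conv_integrable[OF p ball_density_integrable this g, of 0]
  have "integrable lborel (\<lambda>y. ball_density (0 - y) * f (x + (- c) *\<^sub>R y))" .
  moreover have [measurable]: "f \<in> borel_measurable borel" using f by (auto simp: Lp_on_def)
  ultimately show ?thesis
    using lborel_integral_affine(2)[of "\<lambda>z. ball_density z * f (x + c *\<^sub>R z)" "-1" 0] by simp
qed

lemma ball_average_eq:
  fixes f f' :: "real^'d \<Rightarrow> real"
  assumes \<delta>: "\<delta> > 0" and f: "f \<in> borel_measurable lebesgue" and [measurable]: "f' \<in> borel_measurable borel"
    and ae: "AE x in lborel. f x = f' x"
  shows "ball_average \<delta> f x = (LINT z|lborel. ball_density z * f' (x + \<delta> *\<^sub>R z))"
proof -
  have bm[measurable]: "ball x \<delta> \<in> sets borel" by simp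
  have ib[measurable]: "(indicator (ball x \<delta>) :: real^'d \<Rightarrow> real) \<in> borel_measurable borel" by simp
  have m: "(\<lambda>y. indicator (ball x \<delta>) y * f' y) \<in> borel_measurable lborel"
    by measurable
  have f'm: "f' \<in> borel_measurable lebesgue" by (rule measurable_completion) measurable
  have i: "indicator (ball x \<delta>) \<in> borel_measurable lebesgue" by (rule measurable_completion) measurable
  have ae': "AE x in lebesgue. f x = f' x" using ae by (rule AE_completion)
  have "(LINT y:ball x \<delta>|lebesgue. f y) = (LINT y|lebesgue. indicator (ball x \<delta>) y * f' y)"
    unfolding set_lebesgue_integral_def real_scaleR_def
    by (intro integral_cong_AE borel_measurable_times i f f'm) (use ae' in \<open>auto elim: eventually_mono\<close>)
  also have "\<dots> = (LINT y|lborel. indicator (ball x \<delta>) y * f' y)" by (rule integral_completion[OF m])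
  also have "\<dots> = \<delta> ^ CARD('d) * (LINT z|lborel. indicator (ball x \<delta>) (x + \<delta> *\<^sub>R z) * f' (x + \<delta> *\<^sub>R z))"
    using \<delta> by (subst lborel_integral_affine(1)[of _ \<delta> x]) auto
  also have "\<dots> = \<delta> ^ CARD('d) * (LINT z|lborel. indicator (ball 0 1) z * f' (x + \<delta> *\<^sub>R z))"
    using \<delta> by (intro arg_cong[where f = "\<lambda>t. \<delta> ^ CARD('d) * t"] Bochner_Integration.integral_cong) (auto simp: indicator_def dist_norm)
  finally have 1: "(LINT y:ball x \<delta>|lebesgue. f y) = \<delta> ^ CARD('d) * (LINT z|lborel. indicator (ball 0 1) z * f' (x + \<delta> *\<^sub>R z))" .
  have 2: "measure lebesgue (ball (0::real^'d) \<delta>) = \<delta> ^ CARD('d) * unit_ball_volume TYPE('d)"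
    using content_ball_conv_unit_ball[of \<delta> "0::real^'d"] \<delta> by (simp add: unit_ball_volume_def)
  have "(LINT z|lborel. ball_density z * f' (x + \<delta> *\<^sub>R z)) = (LINT z|lborel. (1 / unit_ball_volume TYPE('d)) * (indicator (ball 0 1) z * f' (x + \<delta> *\<^sub>R z)))"
    by (simp add: ball_density_def)
  also have "\<dots> = 1 / unit_ball_volume TYPE('d) * (LINT z|lborel. indicator (ball 0 1) z * f' (x + \<delta> *\<^sub>R z))"
    by (rule integral_mult_right_zero)
  finally show ?thesis
    unfolding ball_average_def 1 2 using \<delta> by simp
qed

section \<open>The averaged operator as a mean of central differences\<close>

definition avg_coeff :: "nat \<Rightarrow> nat \<Rightarrow> real" where
  "avg_coeff r j = - 2 / real ((2 * r) choose r) * ((-1) ^ j * real ((2 * r) choose (r - j)))"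

lemma averaged_eq:
  fixes f f' :: "real^'d \<Rightarrow> real"
  assumes \<delta>: "\<delta> > 0" and f: "f \<in> borel_measurable lebesgue" "f' \<in> borel_measurable borel"
    and ae: "AE x in lborel. f x = f' x"
  shows "averaged \<delta> r f x = (\<Sum>j = 1..r. avg_coeff r j * (LINT z|lborel. ball_density z * f' (x + (\<delta> * real j / real r) *\<^sub>R z)))"
  unfolding averaged_def sum_distrib_left
proof (rule sum.cong[OF refl])
  fix j assume "j \<in> {1..r}"
  then have "\<delta> * real j / real r > 0" using \<delta> by auto
  from ball_average_eq[OF this f ae, of x]
  show "- 2 / real (2 * r choose r) * ((- 1) ^ j * real (2 * r choose (r - j)) * ball_average (\<delta> * real j / real r) f x) =
    avg_coeff r j * (LINT z|lborel. ball_density z * f' (x + (\<delta> * real j / real r) *\<^sub>R z))"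
    by (simp add: avg_coeff_def)
qed

lemma averaged_eq_borel:
  fixes f :: "real^'d \<Rightarrow> real"
  assumes "\<delta> > 0" and [measurable]: "f \<in> borel_measurable borel"
  shows "averaged \<delta> r f x = (\<Sum>j = 1..r. avg_coeff r j * (LINT z|lborel. ball_density z * f (x + (\<delta> * real j / real r) *\<^sub>R z)))"
proof -
  have "f \<in> borel_measurable lborel" by measurable
  then show ?thesis by (intro averaged_eq assms measurable_completion) auto
qed

lemma averaged_cong_AE:
  fixes f f' :: "real^'d \<Rightarrow> real"
  assumes "\<delta> > 0" "f \<in> borel_measurable lebesgue" "f' \<in> borel_measurable borel" "AE x in lborel. f x = f' x"
  shows "averaged \<delta> r f = averaged \<delta> r f'"
  using averaged_eq[OF assms] averaged_eq_borel[OF assms(1,3)] by (simp add: fun_eq_iff)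

text \<open>The terms \<open>\<nu> = r - j\<close> and \<open>\<nu> = r + j\<close> have equal
  binomial coefficients and equal signs, hence are collected in pairs around the middle
  term.\<close>

lemma central_difference:
  "finite_diff (2 * r) h f (x - real r *\<^sub>R h) = (-1) ^ r * (real ((2 * r) choose r) * f x +
     (\<Sum>j = 1..r. (-1) ^ j * real ((2 * r) choose (r - j)) * (f (x + real j *\<^sub>R h) + f (x - real j *\<^sub>R h))))"
proof -
  let ?t = "\<lambda>\<nu>. real ((2 * r) choose \<nu>) * (-1) ^ \<nu> * f (x - real r *\<^sub>R h + real (2 * r - \<nu>) *\<^sub>R h)"
  let ?u = "\<lambda>j. real ((2 * r) choose (r - j)) * (-1) ^ j"
  have split: "{..2 * r} = {..<r} \<union> {r} \<union> {r<..2 * r}" by auto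
  have "finite_diff (2 * r) h f (x - real r *\<^sub>R h) = (\<Sum>\<nu>\<le>2 * r. ?t \<nu>)" by (simp add: finite_diff_def)
  also have "\<dots> = (\<Sum>\<nu><r. ?t \<nu>) + ?t r + (\<Sum>\<nu>\<in>{r<..2 * r}. ?t \<nu>)"
    unfolding split by (subst sum.union_disjoint; force)+
  also have "(\<Sum>\<nu><r. ?t \<nu>) = (\<Sum>j = 1..r. (-1) ^ r * (?u j * f (x + real j *\<^sub>R h)))"
  proof (rule sum.reindex_bij_witness[of _ "\<lambda>j. r - j" "\<lambda>\<nu>. r - \<nu>"])
    fix \<nu> assume "\<nu> \<in> {..<r}"
    then have \<nu>: "\<nu> < r" by simp
    obtain j where j: "r = \<nu> + j" using \<nu> less_imp_add_positive by blast
    have "(-1 :: real) ^ r * (-1) ^ j = (-1) ^ \<nu> * ((-1) ^ j * (-1) ^ j)" by (simp add: j power_add)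
    then have s: "(-1 :: real) ^ r * (-1) ^ j = (-1) ^ \<nu>" by (metis left_minus_one_mult_self mult.right_neutral)
    have "2 * r - \<nu> = r + j" using j by simp
    then have e: "x - real r *\<^sub>R h + real (2 * r - \<nu>) *\<^sub>R h = x + real j *\<^sub>R h"
      by (simp only: of_nat_add scaleR_add_left) simp
    have i: "r - \<nu> = j" "r - j = \<nu>" using j by simp_all
    have "(-1) ^ r * (?u j * f (x + real j *\<^sub>R h)) = real ((2 * r) choose \<nu>) * ((-1) ^ r * (-1) ^ j) * f (x + real j *\<^sub>R h)"
      unfolding i by simp
    then show "(-1) ^ r * (?u (r - \<nu>) * f (x + real (r - \<nu>) *\<^sub>R h)) = ?t \<nu>"
      unfolding s e i(1) .
  qed auto
  also have "(\<Sum>\<nu>\<in>{r<..2 * r}. ?t \<nu>) = (\<Sum>j = 1..r. (-1) ^ r * (?u j * f (x - real j *\<^sub>R h)))"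
  proof (rule sum.reindex_bij_witness[of _ "\<lambda>j. r + j" "\<lambda>\<nu>. \<nu> - r"])
    fix \<nu> assume "\<nu> \<in> {r<..2 * r}"
    then obtain j where j: "\<nu> = r + j" "j \<le> r" by (metis greaterThanAtMost_iff le_add_diff_inverse less_imp_le nat_add_left_cancel_le mult_2)
    have c: "(2 * r) choose (r + j) = (2 * r) choose (r - j)"
      using binomial_symmetric[of "r + j" "2 * r"] j by (simp add: algebra_simps)
    have e: "x - real r *\<^sub>R h + real (2 * r - \<nu>) *\<^sub>R h = x - real j *\<^sub>R h"
      using j by (simp add: algebra_simps of_nat_diff)
    have i: "\<nu> - r = j" using j by simp
    have "(-1) ^ r * (?u j * f (x - real j *\<^sub>R h)) = real ((2 * r) choose \<nu>) * (-1) ^ \<nu> * f (x - real j *\<^sub>R h)"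
      unfolding j(1) c by (simp add: power_add)
    then show "(-1) ^ r * (?u (\<nu> - r) * f (x - real (\<nu> - r) *\<^sub>R h)) = ?t \<nu>"
      unfolding e i .
  qed auto
  also have "?t r = (-1) ^ r * (real ((2 * r) choose r) * f x)"
    by (simp add: algebra_simps of_nat_diff)
  finally show ?thesis
    by (simp add: sum_distrib_left sum.distrib algebra_simps)
qed

text \<open>The coefficients of \<open>averaged\<close> are those of the central difference of order
  \<open>2 * r\<close>, doubled and divided by the middle coefficient. The density is even, so
  \<open>x + c j *\<^sub>R z\<close> and \<open>x - c j *\<^sub>R z\<close> contribute equally,
  which accounts for the doubling; subtracting \<open>f x\<close> supplies the middle term.\<close>

lemma averaged_minus_eq:
  fixes f :: "real^'d \<Rightarrow> real"
  assumes p: "p \<ge> 1" and f: "f \<in> Lp_on lborel p" and \<delta>: "\<delta> > 0" and r: "r \<ge> 1"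
  shows "averaged \<delta> r f x - f x = (LINT z|lborel. ball_density z *
    (- ((-1) ^ r / real ((2 * r) choose r)) * finite_diff (2 * r) ((\<delta> / real r) *\<^sub>R z) f (x - \<delta> *\<^sub>R z)))"
proof -
  have [measurable]: "f \<in> borel_measurable borel" using f by (auto simp: Lp_on_def)
  let ?w = "ball_density :: real^'d \<Rightarrow> real" and ?C = "real ((2 * r) choose r)"
  define c where "c j = \<delta> * real j / real r" for j
  have C: "?C > 0" by simp
  note bi = ball_density_Lp_integrable[OF p f, of x]
  have bi': "integrable lborel (\<lambda>z. ?w z * f (x - c j *\<^sub>R z))" for j
    using bi[of "- c j"] by simp
  have sym: "(LINT z|lborel. ?w z * f (x - c j *\<^sub>R z)) = (LINT z|lborel. ?w z * f (x + c j *\<^sub>R z))" for j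
    by (subst lborel_integral_affine(1)[of "\<lambda>z. ?w z * f (x + c j *\<^sub>R z)" "-1" 0]) (auto simp: ball_density_even)
  have pt: "- ((-1) ^ r / ?C) * finite_diff (2 * r) ((\<delta> / real r) *\<^sub>R z) f (x - \<delta> *\<^sub>R z)
     = (\<Sum>j = 1..r. avg_coeff r j / 2 * (f (x + c j *\<^sub>R z) + f (x - c j *\<^sub>R z))) - f x" for z
  proof -
    let ?S = "\<Sum>j = 1..r. (-1) ^ j * real ((2 * r) choose (r - j)) * (f (x + c j *\<^sub>R z) + f (x - c j *\<^sub>R z))"
    have rr: "real r *\<^sub>R ((\<delta> / real r) *\<^sub>R z) = \<delta> *\<^sub>R z" using r by simp
    have jj: "real j *\<^sub>R ((\<delta> / real r) *\<^sub>R z) = c j *\<^sub>R z" for j by (simp add: c_def mult.commute)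
    have "finite_diff (2 * r) ((\<delta> / real r) *\<^sub>R z) f (x - \<delta> *\<^sub>R z) = (-1) ^ r * (?C * f x + ?S)"
      using central_difference[of r "(\<delta> / real r) *\<^sub>R z" f x] unfolding rr unfolding jj .
    moreover have "((-1) ^ r :: real) * (-1) ^ r = 1" by (metis left_minus_one_mult_self mult.right_neutral)
    ultimately have "- ((-1) ^ r / ?C) * finite_diff (2 * r) ((\<delta> / real r) *\<^sub>R z) f (x - \<delta> *\<^sub>R z) = - (1 / ?C) * (?C * f x + ?S)"
      by (metis (no_types, lifting) minus_mult_left mult.assoc mult_1 times_divide_eq_left)
    also have "\<dots> = - f x - ?S / ?C"
      using C by (simp add: field_simps)
    finally have A: "- ((-1) ^ r / ?C) * finite_diff (2 * r) ((\<delta> / real r) *\<^sub>R z) f (x - \<delta> *\<^sub>R z) = - f x - ?S / ?C" .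
    have "- (?S / ?C) = (\<Sum>j = 1..r. avg_coeff r j / 2 * (f (x + c j *\<^sub>R z) + f (x - c j *\<^sub>R z)))"
      by (simp add: avg_coeff_def sum_divide_distrib sum_negf[symmetric])
    then show ?thesis unfolding A by linarith
  qed
  have "(LINT z|lborel. ?w z * (- ((-1) ^ r / ?C) * finite_diff (2 * r) ((\<delta> / real r) *\<^sub>R z) f (x - \<delta> *\<^sub>R z)))
    = (LINT z|lborel. (\<Sum>j = 1..r. avg_coeff r j / 2 * (?w z * f (x + c j *\<^sub>R z) + ?w z * f (x - c j *\<^sub>R z))) - ?w z * f x)"
    unfolding pt by (simp add: sum_distrib_left algebra_simps)
  also have "\<dots> = (\<Sum>j = 1..r. avg_coeff r j / 2 * ((LINT z|lborel. ?w z * f (x + c j *\<^sub>R z)) + (LINT z|lborel. ?w z * f (x - c j *\<^sub>R z)))) - f x"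
  proof -
    have "integrable lborel (\<lambda>z. avg_coeff r j / 2 * (?w z * f (x + c j *\<^sub>R z) + ?w z * f (x - c j *\<^sub>R z)))" for j
      by (intro integrable_mult_right Bochner_Integration.integrable_add bi bi')
    moreover have "integrable lborel (\<lambda>z. ?w z * f x)" using ball_density_integrable[where 'd = 'd] by simp
    moreover have "(LINT z|lborel. ?w z * f x) = f x" using ball_density_integral[where 'd = 'd] by simp
    moreover have "(LINT z|lborel. avg_coeff r j / 2 * (?w z * f (x + c j *\<^sub>R z) + ?w z * f (x - c j *\<^sub>R z)))
      = avg_coeff r j / 2 * ((LINT z|lborel. ?w z * f (x + c j *\<^sub>R z)) + (LINT z|lborel. ?w z * f (x - c j *\<^sub>R z)))" for j
      unfolding integral_mult_right_zero by (subst Bochner_Integration.integral_add[OF bi bi']) simp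
    ultimately show ?thesis
      by (subst Bochner_Integration.integral_diff; (simp only: Bochner_Integration.integral_sum Bochner_Integration.integrable_sum)?)
  qed
  also have "\<dots> = averaged \<delta> r f x - f x"
    unfolding sym unfolding averaged_eq_borel[OF \<delta> \<open>f \<in> borel_measurable borel\<close>] c_def by simp
  finally show ?thesis by simp
qed

text \<open>The density lives on the unit ball, so only steps of norm below
  \<open>\<delta> / r\<close> occur, and the prefactor is at most 1 because a central binomial
  coefficient is at least 1.\<close>

lemma averaged_diff_bound:
  fixes f :: "real^'d \<Rightarrow> real"
  assumes p: "p \<ge> 1" and f: "f \<in> Lp_on lborel p" and \<delta>: "\<delta> > 0" and r: "r \<ge> 1" and M: "M \<ge> 0"
    and le: "\<And>h. norm h \<le> \<delta> \<Longrightarrow> Lp_norm_on lborel p (finite_diff (2 * r) h f) \<le> M"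
  shows "(\<lambda>x. averaged \<delta> r f x - f x) \<in> Lp_on lborel p"
    and "Lp_norm_on lborel p (\<lambda>x. averaged \<delta> r f x - f x) \<le> M"
proof -
  have [measurable]: "f \<in> borel_measurable borel" using f by (auto simp: Lp_on_def)
  let ?k = "- ((-1) ^ r / real ((2 * r) choose r))"
  have k: "\<bar>?k\<bar> \<le> 1"
  proof -
    have "(1::real) \<le> real ((2 * r) choose r)"
      by (metis One_nat_def Suc_leI of_nat_1 of_nat_le_iff zero_less_binomial mult_2 le_add1)
    then show ?thesis by (simp add: abs_divide power_abs divide_le_eq)
  qed
  define Q where "Q z x = ?k * finite_diff (2 * r) ((\<delta> / real r) *\<^sub>R z) f (x - \<delta> *\<^sub>R z)" for z x
  have Qm: "(\<lambda>(z, x). Q z x) \<in> borel_measurable (lborel \<Otimes>\<^sub>M lborel)"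
    unfolding Q_def finite_diff_def by measurable
  have QS: "Q z \<in> Lp_on lborel p \<and> Lp_norm_on lborel p (Q z) \<le> M" if "ball_density z \<noteq> 0" for z
  proof -
    have z: "norm z < 1" by (rule ball_density_support[OF that])
    have "\<delta> / real r * norm z \<le> \<delta> * 1" using z r \<delta> by (intro mult_mono) (auto simp: divide_le_eq)
    then have n: "norm ((\<delta> / real r) *\<^sub>R z) \<le> \<delta>" using \<delta> by simp
    have S: "finite_diff (2 * r) ((\<delta> / real r) *\<^sub>R z) f \<in> Lp_on lborel p" by (rule finite_diff_Lp_on(1)[OF p f])
    have "Lp_norm_on lborel p (Q z) = \<bar>?k\<bar> * Lp_norm_on lborel p (finite_diff (2 * r) ((\<delta> / real r) *\<^sub>R z) f)"
      unfolding Q_def[abs_def] Lp_norm_on_cmult[OF p] using Lp_on_shift(2)[OF S, of "- (\<delta> *\<^sub>R z)"] by simp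
    also have "\<dots> \<le> 1 * M" using k le[OF n] by (intro mult_mono) auto
    finally show ?thesis
      using Lp_on_cmult[OF Lp_on_shift(1)[OF S, of "- (\<delta> *\<^sub>R z)"], of ?k] unfolding Q_def[abs_def] by simp
  qed
  have eq: "averaged \<delta> r f x - f x = (LINT z|lborel. ball_density z * Q z x)" for x
    unfolding Q_def by (rule averaged_minus_eq[OF p f \<delta> r])
  show "(\<lambda>x. averaged \<delta> r f x - f x) \<in> Lp_on lborel p" "Lp_norm_on lborel p (\<lambda>x. averaged \<delta> r f x - f x) \<le> M"
    unfolding eq using pair_sigma_finite.minkowski_jensen_bound[OF lborel_pair_sigma_finite p ball_density_integrable Qm M] QS
    by (auto simp: ball_density_abs_integral)
qed

lemma averaged_diff_Lp_on:
  fixes f :: "real^'d \<Rightarrow> real"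
  assumes p: "p \<ge> 1" and f: "f \<in> Lp_on lborel p" and \<delta>: "\<delta> > 0" and r: "r \<ge> 1"
  shows "(\<lambda>x. averaged \<delta> r f x - f x) \<in> Lp_on lborel p"
    and averaged_diff_Lp_norm_on: "Lp_norm_on lborel p (\<lambda>x. averaged \<delta> r f x - f x) \<le> 2 ^ (2 * r) * Lp_norm_on lborel p f"
  using averaged_diff_bound[OF p f \<delta> r, of "2 ^ (2 * r) * Lp_norm_on lborel p f"] finite_diff_Lp_norm_on[OF p f] by auto

lemma averaged_Lp_on:
  fixes f :: "real^'d \<Rightarrow> real"
  assumes p: "p \<ge> 1" and f: "f \<in> Lp_on lborel p" and \<delta>: "\<delta> > 0" and r: "r \<ge> 1"
  shows "averaged \<delta> r f \<in> Lp_on lborel p"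
  using Lp_on_add(1)[OF p averaged_diff_Lp_on(1)[OF p f \<delta> r] f] by simp

text \<open>Continuity of translations is stated along sequences, so a failure is turned into one:
  radii \<open>\<delta> n\<close> tending to 0, and by \<open>averaged_diff_bound\<close> steps
  \<open>h n\<close> within them whose differences of order \<open>2 * r\<close> remain above
  \<open>e\<close>. Such a difference is dominated by a single increment of
  \<open>f\<close>.\<close>

lemma averaged_diff_tendsto_0:
  fixes f :: "real^'d \<Rightarrow> real"
  assumes p: "p \<ge> 1" and f: "f \<in> Lp_on lborel p" and r: "r \<ge> 1" and e: "e > 0"
  shows "\<exists>d>0. \<forall>\<delta>. 0 < \<delta> \<longrightarrow> \<delta> < d \<longrightarrow> Lp_norm_on lborel p (\<lambda>x. averaged \<delta> r f x - f x) \<le> e"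
proof (rule ccontr)
  obtain s where s: "2 * r = Suc s" using r by (cases "2 * r") auto
  have fd: "Lp_norm_on lborel p (finite_diff (2 * r) h f) \<le> 2 ^ s * Lp_norm_on lborel p (\<lambda>x. f (x + h) - f x)" for h
    unfolding s finite_diff_Suc' by (intro finite_diff_Lp_norm_on p Lp_on_diff Lp_on_shift f)
  assume "\<not> ?thesis"
  then have "\<exists>\<delta>. 0 < \<delta> \<and> \<delta> < inverse (real (Suc n)) \<and> \<not> Lp_norm_on lborel p (\<lambda>x. averaged \<delta> r f x - f x) \<le> e" for n
    by (meson inverse_positive_iff_positive of_nat_0_less_iff zero_less_Suc)
  then obtain \<delta> where \<delta>: "\<And>n. 0 < \<delta> n" "\<And>n. \<delta> n < inverse (real (Suc n))"
    "\<And>n. \<not> Lp_norm_on lborel p (\<lambda>x. averaged (\<delta> n) r f x - f x) \<le> e" by metis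
  have "\<exists>h. norm h \<le> \<delta> n \<and> \<not> Lp_norm_on lborel p (finite_diff (2 * r) h f) \<le> e" for n
    using averaged_diff_bound(2)[OF p f \<delta>(1)[of n] r, of e] \<delta>(3)[of n] e by (meson less_imp_le)
  then obtain h where h: "\<And>n. norm (h n) \<le> \<delta> n" "\<And>n. \<not> Lp_norm_on lborel p (finite_diff (2 * r) (h n) f) \<le> e" by metis
  have "norm (h n) \<le> inverse (real (Suc n))" for n using h(1)[of n] \<delta>(2)[of n] by linarith
  then have "h \<longlonglongrightarrow> 0" by (intro Lim_null_comparison[OF _ LIMSEQ_inverse_real_of_nat] always_eventually allI)
  from tendsto_mult_right_zero[OF Lp_translation_continuous[OF p f this], of "2 ^ s"]
  have "(\<lambda>n. 2 ^ s * Lp_norm_on lborel p (\<lambda>x. f (x + h n) - f x)) \<longlonglongrightarrow> 0" .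
  then have "\<forall>\<^sub>F n in sequentially. 2 ^ s * Lp_norm_on lborel p (\<lambda>x. f (x + h n) - f x) < e"
    using e by (rule order_tendstoD(2))
  then obtain n where "2 ^ s * Lp_norm_on lborel p (\<lambda>x. f (x + h n) - f x) < e" by (auto simp: eventually_sequentially)
  then show False using fd[of "h n"] h(2)[of n] by linarith
qed

text \<open>Averaging is itself a convolution, hence commutes with \<open>conv K\<close>.\<close>

lemma averaged_conv:
  fixes h K :: "real^'d \<Rightarrow> real"
  assumes p: "p \<ge> 1" and K: "integrable lborel K" "\<And>x. \<bar>K x\<bar> \<le> B" and h: "h \<in> Lp_on lborel p" and \<delta>: "\<delta> > 0"
  shows "averaged \<delta> r (conv K h) x = conv K (averaged \<delta> r h) x"
proof -
  have [measurable]: "h \<in> borel_measurable borel" "K \<in> borel_measurable borel" using h K by (auto simp: Lp_on_def)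
  have cS: "conv K h \<in> Lp_on lborel p" by (rule conv_Lp_on(1)[OF p K(1) h])
  then have cm[measurable]: "conv K h \<in> borel_measurable borel" by (simp add: Lp_on_def)
  define A where "A c u = (LINT z|lborel. ball_density z * h (u + c *\<^sub>R z))" for c u
  have Am[measurable]: "A c \<in> borel_measurable borel" for c unfolding A_def[abs_def] by measurable
  have AS: "A c \<in> Lp_on lborel p" for c
  proof -
    have m: "(\<lambda>(z, x). h (x + c *\<^sub>R z)) \<in> borel_measurable (lborel \<Otimes>\<^sub>M lborel)" by measurable
    show ?thesis unfolding A_def[abs_def]
      using pair_sigma_finite.minkowski_jensen_bound(1)[OF lborel_pair_sigma_finite p ball_density_integrable m, of "Lp_norm_on lborel p h"]
        Lp_on_shift[OF h] by simp
  qed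
  have key: "(LINT z|lborel. ball_density z * conv K h (x + c *\<^sub>R z)) = conv K (A c) x" if c: "c > 0" for c
  proof -
    \<comment> \<open>The ball density moved to centre \<open>x\<close> and radius \<open>c\<close>:
      integrating against \<open>\<psi>\<close> is averaging at \<open>x\<close>, and
      \<open>conv_pairing\<close> moves the average onto \<open>h\<close>.\<close>
    define \<psi> where "\<psi> u = ball_density ((1 / c) *\<^sub>R (u - x)) / c ^ CARD('d)" for u
    have [measurable]: "\<psi> \<in> borel_measurable borel" unfolding \<psi>_def by measurable
    have b1: "\<bar>\<psi> u\<bar> \<le> (1 / unit_ball_volume TYPE('d)) / c ^ CARD('d)" for u
    proof -
      have "\<bar>\<psi> u\<bar> = \<bar>ball_density ((1 / c) *\<^sub>R (u - x))\<bar> / c ^ CARD('d)" using c by (simp add: \<psi>_def)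
      also have "\<dots> \<le> (1 / unit_ball_volume TYPE('d)) / c ^ CARD('d)"
        using c by (intro divide_right_mono ball_density_abs_bound) auto
      finally show ?thesis .
    qed
    have b2: "bounded {u. \<psi> u \<noteq> 0}"
    proof (rule bounded_subset[OF bounded_ball[of x c]])
      show "{u. \<psi> u \<noteq> 0} \<subseteq> ball x c"
        using ball_density_support c by (force simp: \<psi>_def dist_norm norm_minus_commute)
    qed
    have a: "(LINT u|lborel. g u * \<psi> (u + v)) = (LINT z|lborel. ball_density z * g (x - v + c *\<^sub>R z))"
      if [measurable]: "g \<in> borel_measurable borel" for g and v :: "real^'d"
    proof -
      have "\<psi> (x - v + c *\<^sub>R z + v) = ball_density z / c ^ CARD('d)" for z using c by (simp add: \<psi>_def)
      then have "(LINT u|lborel. g u * \<psi> (u + v)) = c ^ CARD('d) * (LINT z|lborel. (1 / c ^ CARD('d)) * (ball_density z * g (x - v + c *\<^sub>R z)))"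
        using c by (subst lborel_integral_affine(1)[of _ c "x - v"]) (simp_all add: mult.commute)
      then show ?thesis using c by (simp only: integral_mult_right_zero) simp
    qed
    have "(LINT z|lborel. ball_density z * conv K h (x + c *\<^sub>R z)) = (LINT u|lborel. conv K h u * \<psi> u)"
      using a[OF cm, of 0] by simp
    also have "\<dots> = (LINT v|lborel. K v * (LINT y|lborel. h y * \<psi> (y + v)))"
      by (rule conv_pairing[OF p K(1) h _ b1 b2]) measurable
    also have "\<dots> = conv K (A c) x"
      by (subst conv_commute) (auto simp: a A_def)
    finally show ?thesis .
  qed
  have "averaged \<delta> r (conv K h) x = (\<Sum>j = 1..r. avg_coeff r j * conv K (A (\<delta> * real j / real r)) x)"
    unfolding averaged_eq_borel[OF \<delta> cm] using \<delta> by (intro sum.cong) (auto simp: key)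
  also have "\<dots> = conv K (\<lambda>u. \<Sum>j = 1..r. avg_coeff r j * A (\<delta> * real j / real r) u) x"
    unfolding conv_def sum_distrib_left
    by (subst Bochner_Integration.integral_sum)
       (auto simp: mult.left_commute intro!: integrable_mult_right conv_integrable[OF p K AS])
  also have "(\<lambda>u. \<Sum>j = 1..r. avg_coeff r j * A (\<delta> * real j / real r) u) = averaged \<delta> r h"
    unfolding A_def by (simp add: fun_eq_iff averaged_eq_borel[OF \<delta>])
  finally show ?thesis .
qed

lemma lp_sum:
  fixes X :: "(real^'d) set"
  assumes p: "p \<ge> 1" and \<sigma>: "\<sigma> > 0" and I: "finite I" and f: "\<And>i. i \<in> I \<Longrightarrow> f i \<in> lp_space p X"
  shows "(\<lambda>x. \<Sum>i\<in>I. c i * f i x) \<in> lp_space p X"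
    and "lp_norm p \<sigma> X (\<lambda>x. \<Sum>i\<in>I. c i * f i x) \<le> (\<Sum>i\<in>I. \<bar>c i\<bar> * lp_norm p \<sigma> X (f i))"
proof -
  have f': "(\<lambda>x. c i * f i x) \<in> Lp_on (count_space X) p" if "i \<in> I" for i
    using f[OF that] by (intro Lp_on_cmult) (simp add: lp_space_iff)
  show S: "(\<lambda>x. \<Sum>i\<in>I. c i * f i x) \<in> lp_space p X"
    unfolding lp_space_iff by (rule Lp_on_sum(1)[OF p I f'])
  let ?k = "(1 / \<sigma> ^ CARD('d)) powr (1 / p)"
  have "lp_norm p \<sigma> X (\<lambda>x. \<Sum>i\<in>I. c i * f i x) \<le> ?k * (\<Sum>i\<in>I. Lp_norm_on (count_space X) p (\<lambda>x. c i * f i x))"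
    unfolding lp_norm_eq[OF p \<sigma> S] by (intro mult_left_mono Lp_norm_on_sum[OF p I f']) auto
  also have "\<dots> = (\<Sum>i\<in>I. \<bar>c i\<bar> * lp_norm p \<sigma> X (f i))"
    unfolding sum_distrib_left by (intro sum.cong) (auto simp: lp_norm_eq[OF p \<sigma> f] Lp_norm_on_cmult[OF p])
  finally show "lp_norm p \<sigma> X (\<lambda>x. \<Sum>i\<in>I. c i * f i x) \<le> (\<Sum>i\<in>I. \<bar>c i\<bar> * lp_norm p \<sigma> X (f i))" .
qed

text \<open>Point values of an arbitrary \<open>h\<close> cannot be bounded by its norm, but its
  averages over disjoint balls can. The radii occurring in \<open>averaged\<close> lie between
  \<open>\<gamma> / \<sigma> / r\<close> and \<open>\<gamma> / \<sigma>\<close>: the upper bound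
  keeps the balls disjoint, the lower one bounds the normalising factor.\<close>

lemma averaged_sample_bound:
  assumes p: "p \<ge> 1" and \<gamma>: "0 < \<gamma>" and r: "r \<ge> 1"
  shows "\<exists>C>0. \<forall>\<sigma> X h. 0 < \<sigma> \<longrightarrow> separated (\<gamma> / \<sigma>) X \<longrightarrow> h \<in> Lp_on lborel p \<longrightarrow>
    averaged (\<gamma> / \<sigma>) r h \<in> lp_space p (X :: (real^'d) set) \<and> lp_norm p \<sigma> X (averaged (\<gamma> / \<sigma>) r h) \<le> C * Lp_norm_on lborel p h"
proof -
  let ?d = "CARD('d)" and ?V = "unit_ball_volume TYPE('d)"
  have V: "?V > 0" by (rule unit_ball_volume_pos)
  \<comment> \<open>The smallest radius \<open>\<gamma> / \<sigma> / r\<close> gives the worst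
    normalisation, \<open>(real r * \<sigma> / \<gamma>) ^ CARD('d)\<close> over the volume of the
    unit ball; its power of \<open>\<sigma>\<close> belongs to \<open>lp_norm\<close>.\<close>
  define K where "K = ((real r / \<gamma>) ^ ?d / ?V) powr (1 / p)"
  have K0: "K \<ge> 0" by (simp add: K_def)
  have Kp: "K powr p = (real r / \<gamma>) ^ ?d / ?V" using p \<gamma> V by (simp add: K_def powr_powr)
  define A where "A h c u = (LINT z|lborel. ball_density z * h (u + c *\<^sub>R z))" for h and c :: real and u :: "real^'d"
  have key: "A h (\<gamma> / \<sigma> * real j / real r) \<in> lp_space p X \<and> lp_norm p \<sigma> X (A h (\<gamma> / \<sigma> * real j / real r)) \<le> K * Lp_norm_on lborel p h"
    if \<sigma>: "0 < \<sigma>" and s: "separated (\<gamma> / \<sigma>) X" and h: "h \<in> Lp_on lborel p" and j: "j \<in> {1..r}"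
    for \<sigma> and X :: "(real^'d) set" and h j
  proof -
    define c where "c = \<gamma> / \<sigma> * real j / real r"
    have \<rho>: "\<gamma> / \<sigma> > 0" using \<gamma> \<sigma> by simp
    have c: "c > 0" "c \<le> \<gamma> / \<sigma>" "\<gamma> / \<sigma> / real r \<le> c"
      using j \<gamma> \<sigma> mult_left_mono[of "real j / real r" 1 "\<gamma> / \<sigma>"] mult_left_mono[of 1 "real j" "\<gamma> / \<sigma> / real r"] r
      by (auto simp: c_def)
    have [measurable]: "h \<in> borel_measurable borel" using h by (auto simp: Lp_on_def)
    have ibm: "(\<lambda>y. indicator (ball u c) y :: ennreal) \<in> borel_measurable borel" for u :: "real^'d"
      by (intro borel_measurable_indicator) auto
    have pt: "ennreal (\<bar>A h c u\<bar> powr p) \<le> ennreal (1 / (?V * c ^ ?d)) * (\<integral>\<^sup>+y. indicator (ball u c) y * ennreal (\<bar>h y\<bar> powr p) \<partial>lborel)" for u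
    proof -
      have "ennreal (\<bar>A h c u\<bar> powr p) \<le> ennreal ((LINT z|lborel. \<bar>ball_density (z::real^'d)\<bar>) powr (p - 1)) *
         (\<integral>\<^sup>+z. ennreal (\<bar>ball_density z\<bar> * \<bar>h (u + c *\<^sub>R z)\<bar> powr p) \<partial>lborel)"
        unfolding A_def by (rule jensen_powr[OF p ball_density_integrable]) measurable
      also have "\<dots> = (\<integral>\<^sup>+z. ennreal (1 / ?V) * (indicator (ball u c) (u + c *\<^sub>R z) * ennreal (\<bar>h (u + c *\<^sub>R z)\<bar> powr p)) \<partial>lborel)"
        unfolding ball_density_abs_integral
        using V c by (auto simp: ball_density_def indicator_def dist_norm ennreal_mult[symmetric] intro!: nn_integral_cong)
      also have "\<dots> = ennreal (1 / ?V) * (\<integral>\<^sup>+z. indicator (ball u c) (u + c *\<^sub>R z) * ennreal (\<bar>h (u + c *\<^sub>R z)\<bar> powr p) \<partial>lborel)"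
      proof (rule nn_integral_cmult)
        have "(\<lambda>z. indicator (ball u c) (u + c *\<^sub>R z) :: ennreal) \<in> borel_measurable borel"
          by (rule measurable_compose[OF _ ibm]) measurable
        then show "(\<lambda>z. indicator (ball u c) (u + c *\<^sub>R z) * ennreal (\<bar>h (u + c *\<^sub>R z)\<bar> powr p)) \<in> borel_measurable lborel"
          by measurable
      qed
      also have "\<dots> = ennreal (1 / (?V * c ^ ?d)) * (\<integral>\<^sup>+y. indicator (ball u c) y * ennreal (\<bar>h y\<bar> powr p) \<partial>lborel)"
      proof -
        have "(\<lambda>y. indicator (ball u c) y * ennreal (\<bar>h y\<bar> powr p)) \<in> borel_measurable borel"
          using ibm[of u] by measurable
        from lborel_nn_affine[OF this, of c u] show ?thesis
          using c V by (simp add: mult.assoc[symmetric] ennreal_mult[symmetric])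
      qed
      finally show ?thesis .
    qed
    have "(\<integral>\<^sup>+\<xi>. ennreal (\<bar>A h c \<xi>\<bar> powr p) \<partial>count_space X) \<le>
      (\<integral>\<^sup>+\<xi>. ennreal (1 / (?V * c ^ ?d)) * (\<integral>\<^sup>+y. indicator (ball \<xi> c) y * ennreal (\<bar>h y\<bar> powr p) \<partial>lborel) \<partial>count_space X)"
      by (intro nn_integral_mono pt)
    also have "\<dots> = ennreal (1 / (?V * c ^ ?d)) * (\<integral>\<^sup>+\<xi>. (\<integral>\<^sup>+y. indicator (ball \<xi> c) y * ennreal (\<bar>h y\<bar> powr p) \<partial>lborel) \<partial>count_space X)"
      by (rule nn_integral_cmult) simp
    also have "(\<integral>\<^sup>+\<xi>. (\<integral>\<^sup>+y. indicator (ball \<xi> c) y * ennreal (\<bar>h y\<bar> powr p) \<partial>lborel) \<partial>count_space X)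
       = (\<integral>\<^sup>+y. (\<integral>\<^sup>+\<xi>. indicator (ball \<xi> c) y * ennreal (\<bar>h y\<bar> powr p) \<partial>count_space X) \<partial>lborel)"
    proof (rule nn_integral_count_space_nn_integral[OF separated_countable[OF s \<rho>], symmetric])
      show "(\<lambda>y. indicator (ball \<xi> c) y * ennreal (\<bar>h y\<bar> powr p)) \<in> borel_measurable lborel" for \<xi>
        using ibm[of \<xi>] by measurable
    qed
    also have "\<dots> = (\<integral>\<^sup>+y. (\<integral>\<^sup>+\<xi>. indicator (ball \<xi> c) y \<partial>count_space X) * ennreal (\<bar>h y\<bar> powr p) \<partial>lborel)"
      by (intro nn_integral_cong nn_integral_multc) simp
    also have "\<dots> \<le> (\<integral>\<^sup>+y. 1 * ennreal (\<bar>h y\<bar> powr p) \<partial>lborel)"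
      by (intro nn_integral_mono mult_right_mono separated_indicator_sum[OF s c(2)]) auto
    also have "\<dots> = ennreal (Lp_norm_on lborel p h powr p)" by (simp add: Lp_on_nn[OF p h])
    also have "ennreal (1 / (?V * c ^ ?d)) * ennreal (Lp_norm_on lborel p h powr p) = ennreal (1 / (?V * c ^ ?d) * Lp_norm_on lborel p h powr p)"
      using V c by (simp add: ennreal_mult[symmetric])
    also have "\<dots> \<le> ennreal (\<sigma> ^ ?d * (K * Lp_norm_on lborel p h) powr p)"
    proof (rule ennreal_leI)
      define q where "q = \<gamma> / \<sigma> / real r"
      have q: "q \<le> c" unfolding q_def by (rule c(3))
      have "\<gamma> / \<sigma> > 0" "real r > 0" using \<rho> r by auto
      then have q0: "q > 0" unfolding q_def by (rule divide_pos_pos)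
      have "1 / (?V * c ^ ?d) \<le> 1 / (?V * (\<gamma> / \<sigma> / real r) ^ ?d)"
        unfolding q_def[symmetric] using V c q q0 by (intro divide_left_mono mult_left_mono power_mono mult_pos_pos) auto
      also have "\<dots> = \<sigma> ^ ?d * K powr p"
        using V \<gamma> \<sigma> r by (simp add: Kp power_divide field_simps)
      finally have "1 / (?V * c ^ ?d) * Lp_norm_on lborel p h powr p \<le> \<sigma> ^ ?d * K powr p * Lp_norm_on lborel p h powr p"
        by (rule mult_right_mono) simp
      then show "1 / (?V * c ^ ?d) * Lp_norm_on lborel p h powr p \<le> \<sigma> ^ ?d * (K * Lp_norm_on lborel p h) powr p"
        using K0 by (simp add: powr_mult mult.assoc)
    qed
    finally have fin: "(\<integral>\<^sup>+\<xi>. ennreal (\<bar>A h c \<xi>\<bar> powr p) \<partial>count_space X) \<le> ennreal (\<sigma> ^ ?d * (K * Lp_norm_on lborel p h) powr p)"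
      by (simp add: mult_left_mono)
    show ?thesis using lp_leI[OF p \<sigma> _ fin] K0 by (simp add: c_def)
  qed
  define L where "L = (\<Sum>j = 1..r. \<bar>avg_coeff r j\<bar> * K)"
  have L: "L \<ge> 0" unfolding L_def using K0 by (intro sum_nonneg) auto
  have "averaged (\<gamma> / \<sigma>) r h \<in> lp_space p X \<and> lp_norm p \<sigma> X (averaged (\<gamma> / \<sigma>) r h) \<le> (L + 1) * Lp_norm_on lborel p h"
    if \<sigma>: "0 < \<sigma>" and s: "separated (\<gamma> / \<sigma>) X" and h: "h \<in> Lp_on lborel p"
    for \<sigma> and X :: "(real^'d) set" and h
  proof -
    have \<rho>: "\<gamma> / \<sigma> > 0" using \<gamma> \<sigma> by simp
    have hm: "h \<in> borel_measurable borel" using h by (auto simp: Lp_on_def)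
    have eq: "averaged (\<gamma> / \<sigma>) r h = (\<lambda>u. \<Sum>j = 1..r. avg_coeff r j * A h (\<gamma> / \<sigma> * real j / real r) u)"
      unfolding A_def by (simp add: fun_eq_iff averaged_eq_borel[OF \<rho> hm])
    have S: "\<And>j. j \<in> {1..r} \<Longrightarrow> A h (\<gamma> / \<sigma> * real j / real r) \<in> lp_space p X" using key[OF \<sigma> s h] by blast
    have "lp_norm p \<sigma> X (averaged (\<gamma> / \<sigma>) r h) \<le> (\<Sum>j = 1..r. \<bar>avg_coeff r j\<bar> * lp_norm p \<sigma> X (A h (\<gamma> / \<sigma> * real j / real r)))"
      unfolding eq by (intro lp_sum(2)[OF p \<sigma> _ S]) auto
    also have "\<dots> \<le> (\<Sum>j = 1..r. \<bar>avg_coeff r j\<bar> * (K * Lp_norm_on lborel p h))"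
      using key[OF \<sigma> s h] by (intro sum_mono mult_left_mono) auto
    also have "\<dots> = L * Lp_norm_on lborel p h" by (simp add: L_def sum_distrib_right mult.assoc)
    also have "\<dots> \<le> (L + 1) * Lp_norm_on lborel p h" by (intro mult_right_mono) auto
    finally show ?thesis
      unfolding eq using lp_sum(1)[OF p \<sigma> _ S, of "{1..r}"] by auto
  qed
  moreover have "L + 1 > 0" using L by simp
  ultimately show ?thesis by blast
qed

section \<open>Borel representatives\<close>

text \<open>The function spaces consist of Lebesgue measurable functions, but joint measurability of
  \<open>(x, y) \<mapsto> f (x - y)\<close>, as needed for convolutions, is only available for Borel functions.\<close>

lemma locally_integrable_borel:
  fixes u u' :: "real^'d \<Rightarrow> real"
  assumes loc: "locally_integrable u" and [measurable]: "u' \<in> borel_measurable borel"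
    and ae: "AE x in lborel. u x = u' x" and K: "compact K"
  shows "integrable lborel (\<lambda>x. indicator K x * u' x)"
proof -
  have i: "integrable lebesgue (\<lambda>x. indicator K x * u x)"
    using loc K by (simp add: locally_integrable_def set_integrable_def)
  have Ks: "K \<in> sets borel" using K compact_imp_closed borel_closed by blast
  have m: "(\<lambda>x. indicator K x * u' x) \<in> borel_measurable lborel"
    using Ks by measurable
  have "integrable lebesgue (\<lambda>x. indicator K x * u' x)"
  proof (rule integrable_cong_AE_imp[OF i measurable_completion[OF m]])
    have "AE x in lebesgue. u x = u' x" using ae by (rule AE_completion)
    then show "AE x in lebesgue. indicator K x * u x = indicator K x * u' x"
      by eventually_elim simp
  qed
  then show ?thesis by (simp add: integrable_completion[OF m])
qed

lemma Lp_on_locally_integrable: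
  fixes v :: "real^'d \<Rightarrow> real"
  assumes p: "p \<ge> 1" and v: "v \<in> Lp_on lborel p"
  shows "locally_integrable v"
  unfolding locally_integrable_def
proof (intro allI impI)
  fix K :: "(real^'d) set" assume K: "compact K"
  have [measurable]: "v \<in> borel_measurable borel" using v by (auto simp: Lp_on_def)
  obtain R where R: "\<And>x. x \<in> K \<Longrightarrow> norm x \<le> R" using compact_imp_bounded[OF K] by (auto simp: bounded_iff)
  have Ks: "K \<in> sets borel" using K compact_imp_closed borel_closed by blast
  have m: "(\<lambda>x. indicator K x * v x) \<in> borel_measurable lborel" using Ks by measurable
  have "(\<lambda>x. indicator K x * v x) \<in> Lp_on lborel p"
    by (rule Lp_norm_on_mono(1)[OF p v m]) (auto simp: indicator_def)
  then have "integrable lborel (\<lambda>x. indicator K x * v x)"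
  proof (rule bounded_support_L1[OF p, where R = R])
    show "indicator K x * v x = 0" if "norm x > R" for x
      using R[of x] that by (cases "x \<in> K") auto
  qed
  then show "set_integrable lebesgue K v"
    by (simp add: set_integrable_def integrable_completion[OF m])
qed

text \<open>Without such a list the condition in \<open>weak_pair\<close> would be vacuous and weak
  derivatives would not be unique.\<close>

lemma exists_list_with_counts: "\<exists>js. \<forall>i. count_list js i = \<alpha> i" for \<alpha> :: "'d::finite \<Rightarrow> nat"
proof -
  obtain js where "mset js = Abs_multiset \<alpha>" using ex_mset by blast
  moreover have "count (Abs_multiset \<alpha>) = \<alpha>" by (intro Abs_multiset_inverse) simp
  ultimately show ?thesis by (metis count_mset)
qed

lemma is_weak_deriv_borel:
  fixes g u g' u' :: "real^'d \<Rightarrow> real"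
  assumes w: "is_weak_deriv \<alpha> g u"
    and [measurable]: "g' \<in> borel_measurable borel" "u' \<in> borel_measurable borel"
    and ae: "AE x in lborel. g x = g' x" "AE x in lborel. u x = u' x"
    and gm: "g \<in> borel_measurable lebesgue" "u \<in> borel_measurable lebesgue"
  shows "weak_pair \<alpha> g' u'"
proof -
  have int: "(LINT x|lebesgue. h x * \<psi> x) = (LINT x|lborel. h' x * \<psi> x)"
    if hm: "h \<in> borel_measurable lebesgue" and [measurable]: "h' \<in> borel_measurable borel"
      and ae: "AE x in lborel. h x = h' x" and \<psi>: "test_function \<psi>" for h h' \<psi> :: "real^'d \<Rightarrow> real"
  proof -
    have [measurable]: "\<psi> \<in> borel_measurable borel" by (rule test_function_borel[OF \<psi>])
    have m: "(\<lambda>x. h' x * \<psi> x) \<in> borel_measurable lborel" "\<psi> \<in> borel_measurable lborel" by measurable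
    have "AE x in lebesgue. h x = h' x" using ae by (rule AE_completion)
    then have "(LINT x|lebesgue. h x * \<psi> x) = (LINT x|lebesgue. h' x * \<psi> x)"
      by (intro integral_cong_AE borel_measurable_times hm measurable_completion m)
         (auto elim: eventually_mono intro: measurable_completion)
    then show ?thesis by (simp add: integral_completion[OF m(1)])
  qed
  show ?thesis
    unfolding weak_pair_def
  proof (intro allI impI, elim conjE)
    fix \<phi> :: "real^'d \<Rightarrow> real" and js assume \<phi>: "test_function \<phi>" and js: "\<forall>i. count_list js i = \<alpha> i"
    show "(LINT x|lborel. g' x * iter_partial_deriv js \<phi> x) = (-1) ^ (\<Sum>i\<in>UNIV. \<alpha> i) * (LINT x|lborel. u' x * \<phi> x)"
      using w \<phi> js int[OF gm(1) _ ae(1) test_function_iter[OF \<phi>, of js]] int[OF gm(2) _ ae(2) \<phi>]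
      by (simp add: is_weak_deriv_def)
  qed
qed

lemma borel_version:
  fixes u :: "real^'d \<Rightarrow> real"
  assumes "u \<in> borel_measurable lebesgue"
  obtains u' where "u' \<in> borel_measurable borel" "AE x in lborel. u x = u' x"
  using completion_ex_borel_measurable_real[OF assms] by auto

lemma Lp_space_borel_version:
  fixes u u' :: "real^'d \<Rightarrow> real"
  assumes u: "u \<in> borel_measurable lebesgue" and u': "u' \<in> borel_measurable borel"
    and ae: "AE x in lborel. u x = u' x"
  shows "u \<in> Lp_space p \<longleftrightarrow> u' \<in> Lp_on lborel p" "Lp_norm p u = Lp_norm_on lborel p u'"
proof -
  have "AE x in lebesgue. u x = u' x" using ae by (rule AE_completion)
  moreover have "u' \<in> borel_measurable lebesgue" using u' by (intro measurable_completion) simp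
  ultimately have "u \<in> Lp_on lebesgue p \<longleftrightarrow> u' \<in> Lp_on lebesgue p" "Lp_norm_on lebesgue p u = Lp_norm_on lebesgue p u'"
    using Lp_on_cong_AE[OF _ u] by auto
  then show "u \<in> Lp_space p \<longleftrightarrow> u' \<in> Lp_on lborel p" "Lp_norm p u = Lp_norm_on lborel p u'"
    using Lp_on_lebesgue[OF u'] by (simp_all add: Lp_space_eq_Lp_on)
qed

section \<open>Computing the Sobolev seminorm from Borel weak derivatives\<close>

lemma locally_integrable_measurable:
  fixes u :: "real^'d \<Rightarrow> real"
  assumes "locally_integrable u"
  shows "u \<in> borel_measurable lebesgue"
proof (rule borel_measurable_LIMSEQ_metric)
  show "(\<lambda>x. indicator (cball 0 (real n)) x * u x) \<in> borel_measurable lebesgue" for n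
    using assms[unfolded locally_integrable_def, rule_format, of "cball 0 (real n)"]
    by (auto simp: set_integrable_def)
  fix x :: "real^'d"
  have "eventually (\<lambda>n. indicator (cball 0 (real n)) x * u x = u x) sequentially"
    using eventually_ge_at_top[of "nat \<lceil>norm x\<rceil>"]
  proof eventually_elim
    case (elim n)
    then have "norm x \<le> real n" by linarith
    then show ?case by simp
  qed
  then show "(\<lambda>n. indicator (cball 0 (real n)) x * u x) \<longlonglongrightarrow> u x" by (rule tendsto_eventually)
qed

text \<open>The difference of two weak derivatives integrates to 0 against every test function,
  hence vanishes almost everywhere. The norm of the representative selected by
  \<open>weak_deriv\<close> can therefore be read off from any known one.\<close>

lemma weak_deriv_norm_unique:
  fixes g g' u v :: "real^'d \<Rightarrow> real"
  assumes p: "p \<ge> 1" and w: "is_weak_deriv \<alpha> g u" and g': "g' \<in> borel_measurable borel"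
    and ae: "AE x in lborel. g x = g' x" and v: "v \<in> Lp_on lborel p" and wv: "weak_pair \<alpha> g' v"
  shows "Lp_norm p u = Lp_norm_on lborel p v"
proof -
  have loc: "locally_integrable g" "locally_integrable u" using w by (auto simp: is_weak_deriv_def)
  have gm: "g \<in> borel_measurable lebesgue" "u \<in> borel_measurable lebesgue"
    using loc locally_integrable_measurable by auto
  obtain u' where u'[measurable]: "u' \<in> borel_measurable borel" and aeu: "AE x in lborel. u x = u' x"
    using borel_version[OF gm(2)] .
  have wu: "weak_pair \<alpha> g' u'" by (rule is_weak_deriv_borel[OF w g' u' ae aeu gm])
  have vm[measurable]: "v \<in> borel_measurable borel" using v by (auto simp: Lp_on_def)
  have lu: "integrable lborel (\<lambda>x. indicator (cball 0 R) x * u' x)" for R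
    by (rule locally_integrable_borel[OF loc(2) u' aeu]) auto
  have lv: "integrable lborel (\<lambda>x. indicator (cball 0 R) x * v x)" for R
    by (rule locally_integrable_borel[OF Lp_on_locally_integrable[OF p v] vm]) auto
  obtain js where js: "\<forall>i. count_list js i = \<alpha> i" using exists_list_with_counts by blast
  have "AE x in lborel. u' x - v x = 0"
  proof (rule weak_zero_imp_AE_zero)
    show "integrable lborel (\<lambda>x. indicator (cball 0 R) x * (u' x - v x))" for R
      using Bochner_Integration.integrable_diff[OF lu lv] by (simp add: right_diff_distrib)
    fix \<phi> :: "real^'d \<Rightarrow> real" assume \<phi>: "test_function \<phi>"
    obtain B where B: "B \<ge> 0" "\<And>x. \<bar>\<phi> x\<bar> \<le> B" "\<And>x. norm x \<ge> B \<Longrightarrow> \<phi> x = 0"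
      using continuous_bounded_support_bounded[OF test_function_continuous[OF \<phi>]] \<phi>
      by (metis test_function_def)
    have [measurable]: "\<phi> \<in> borel_measurable borel" by (rule test_function_borel[OF \<phi>])
    have int: "integrable lborel (\<lambda>x. h x * \<phi> x)"
      if [measurable]: "h \<in> borel_measurable borel" and h: "integrable lborel (\<lambda>x. indicator (cball 0 B) x * h x)" for h
    proof (rule Bochner_Integration.integrable_bound[OF integrable_mult_right[OF h, of B]])
      show "AE x in lborel. norm (h x * \<phi> x) \<le> norm (B * (indicator (cball 0 B) x * h x))"
      proof (rule AE_I2)
        fix x
        show "norm (h x * \<phi> x) \<le> norm (B * (indicator (cball 0 B) x * h x))"
          using B(1) B(3)[of x] mult_right_mono[OF B(2)[of x], of "\<bar>h x\<bar>"]
          by (cases "norm x \<le> B") (auto simp: abs_mult mult.commute)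
      qed
    qed measurable
    have "(-1) ^ (\<Sum>i\<in>UNIV. \<alpha> i) * (LINT x|lborel. u' x * \<phi> x) = (-1) ^ (\<Sum>i\<in>UNIV. \<alpha> i) * (LINT x|lborel. v x * \<phi> x)"
      using wu[unfolded weak_pair_def, rule_format, of \<phi> js] wv[unfolded weak_pair_def, rule_format, of \<phi> js] \<phi> js
      by simp
    then have "(LINT x|lborel. u' x * \<phi> x) = (LINT x|lborel. v x * \<phi> x)" by simp
    then show "(LINT x|lborel. (u' x - v x) * \<phi> x) = 0"
      using int[OF u' lu] int[OF vm lv] by (simp add: left_diff_distrib)
  qed measurable
  then have "AE x in lborel. u' x = v x" by eventually_elim simp
  then have "Lp_norm_on lborel p u' = Lp_norm_on lborel p v" by (intro Lp_on_cong_AE(2)) auto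
  then show ?thesis using Lp_space_borel_version(2)[OF gm(2) u' aeu] by simp
qed

lemma weak_deriv_norm:
  fixes g g' u v :: "real^'d \<Rightarrow> real"
  assumes p: "p \<ge> 1" and ex: "is_weak_deriv \<alpha> g u" and g': "g' \<in> borel_measurable borel"
    and ae: "AE x in lborel. g x = g' x" and v: "v \<in> Lp_on lborel p" and wv: "weak_pair \<alpha> g' v"
  shows "Lp_norm p (weak_deriv \<alpha> g) = Lp_norm_on lborel p v"
proof (rule weak_deriv_norm_unique[OF p _ g' ae v wv])
  show "is_weak_deriv \<alpha> g (weak_deriv \<alpha> g)"
    unfolding weak_deriv_def by (rule someI[where P = "is_weak_deriv \<alpha> g", OF ex])
qed

lemma Lp_norm_nonneg [simp]: "Lp_norm p f \<ge> 0"
  by (simp add: Lp_norm_def)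

lemma Sobolev_seminorm_nonneg [simp]: "Sobolev_seminorm p s f \<ge> 0"
  unfolding Sobolev_seminorm_def by (intro sum_nonneg) simp

text \<open>The interface between the Sobolev space and the estimates: a Borel representative
  together with Borel weak derivatives of order \<open>s\<close>. Bounding each by the whole
  seminorm costs nothing but constants.\<close>

lemma Sobolev_borel:
  fixes g :: "real^'d \<Rightarrow> real"
  assumes p: "p \<ge> 1" and g: "g \<in> Sobolev_space p s"
  obtains g' where "g' \<in> Lp_on lborel p" "AE x in lborel. g x = g' x"
    "\<forall>\<alpha>\<in>multi_indices s. \<exists>v\<in>Lp_on lborel p. weak_pair \<alpha> g' v \<and> Lp_norm_on lborel p v \<le> Sobolev_seminorm p s g"
proof -
  have gL: "g \<in> Lp_space p" using g by (simp add: Sobolev_space_def)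
  then have gm: "g \<in> borel_measurable lebesgue" by (simp add: Lp_space_def)
  obtain g' where g': "g' \<in> borel_measurable borel" and ae: "AE x in lborel. g x = g' x"
    using borel_version[OF gm] .
  have "g' \<in> Lp_on lborel p" using gL Lp_space_borel_version(1)[OF gm g' ae] by simp
  moreover have "\<exists>v\<in>Lp_on lborel p. weak_pair \<alpha> g' v \<and> Lp_norm_on lborel p v \<le> Sobolev_seminorm p s g"
    if \<alpha>: "\<alpha> \<in> multi_indices s" for \<alpha>
  proof -
    obtain u where u: "u \<in> Lp_space p" "is_weak_deriv \<alpha> g u"
      using g \<alpha> by (auto simp: Sobolev_space_def)
    have um: "u \<in> borel_measurable lebesgue" using u by (simp add: Lp_space_def)
    obtain v where v: "v \<in> borel_measurable borel" and aev: "AE x in lborel. u x = v x"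
      using borel_version[OF um] .
    have vS: "v \<in> Lp_on lborel p" using u Lp_space_borel_version(1)[OF um v aev] by simp
    have wv: "weak_pair \<alpha> g' v" by (rule is_weak_deriv_borel[OF u(2) g' v ae aev gm um])
    have "Lp_norm_on lborel p v = Lp_norm p (weak_deriv \<alpha> g)"
      using weak_deriv_norm[OF p u(2) g' ae vS wv] by simp
    also have "\<dots> \<le> Sobolev_seminorm p s g"
      unfolding Sobolev_seminorm_def using \<alpha> multi_indices_finite by (intro member_le_sum) auto
    finally show ?thesis using vS wv by blast
  qed
  ultimately show ?thesis using that ae by blast
qed

text \<open>The opposite passage, for functions whose weak derivatives have been exhibited, as is
  the case for kernel means.\<close>

lemma Sobolev_seminorm_borel:
  fixes P :: "real^'d \<Rightarrow> real"
  assumes p: "p \<ge> 1" and P: "P \<in> Lp_on lborel p"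
    and v: "\<And>\<alpha>. \<alpha> \<in> multi_indices s \<Longrightarrow> v \<alpha> \<in> Lp_on lborel p \<and> weak_pair \<alpha> P (v \<alpha>)"
  shows "Sobolev_seminorm p s P = (\<Sum>\<alpha>\<in>multi_indices s. Lp_norm_on lborel p (v \<alpha>))"
  unfolding Sobolev_seminorm_def
proof (rule sum.cong[OF refl])
  fix \<alpha> assume \<alpha>: "\<alpha> \<in> (multi_indices s :: ('d \<Rightarrow> nat) set)"
  have Pm: "P \<in> borel_measurable borel" and vm: "v \<alpha> \<in> borel_measurable borel"
    using P v[OF \<alpha>] by (auto simp: Lp_on_def)
  have int: "(LINT x|lebesgue. h x * \<psi> x) = (LINT x|lborel. h x * \<psi> x)"
    if [measurable]: "h \<in> borel_measurable borel" and \<psi>: "test_function \<psi>" for h \<psi> :: "real^'d \<Rightarrow> real"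
  proof -
    have [measurable]: "\<psi> \<in> borel_measurable borel" by (rule test_function_borel[OF \<psi>])
    have m: "(\<lambda>x. h x * \<psi> x) \<in> borel_measurable lborel" by measurable
    show ?thesis by (rule integral_completion[OF m])
  qed
  have "is_weak_deriv \<alpha> P (v \<alpha>)"
    unfolding is_weak_deriv_def
  proof (intro conjI allI impI)
    show "locally_integrable P" "locally_integrable (v \<alpha>)"
      using Lp_on_locally_integrable[OF p] P v[OF \<alpha>] by auto
    fix \<phi> :: "real^'d \<Rightarrow> real" and js assume h: "test_function \<phi> \<and> (\<forall>i. count_list js i = \<alpha> i)"
    then show "(LINT x|lebesgue. P x * iter_partial_deriv js \<phi> x) = (-1) ^ (\<Sum>i\<in>UNIV. \<alpha> i) * (LINT x|lebesgue. v \<alpha> x * \<phi> x)"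
      using v[OF \<alpha>] int[OF Pm test_function_iter, of \<phi> js] int[OF vm, of \<phi>] by (simp add: weak_pair_def)
  qed
  then show "Lp_norm p (weak_deriv \<alpha> P) = Lp_norm_on lborel p (v \<alpha>)"
    using weak_deriv_norm[OF p _ Pm] v[OF \<alpha>] by blast
qed

lemma weak_pair_sum:
  fixes f v :: "'i \<Rightarrow> real^'d \<Rightarrow> real"
  assumes p: "p \<ge> 1" and I: "finite I"
    and f: "\<And>i. i \<in> I \<Longrightarrow> f i \<in> Lp_on lborel p" and v: "\<And>i. i \<in> I \<Longrightarrow> v i \<in> Lp_on lborel p"
    and w: "\<And>i. i \<in> I \<Longrightarrow> weak_pair \<alpha> (f i) (v i)"
  shows "weak_pair \<alpha> (\<lambda>x. \<Sum>i\<in>I. c i * f i x) (\<lambda>x. \<Sum>i\<in>I. c i * v i x)"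
proof -
  have int: "integrable lborel (\<lambda>x. h x * \<psi> x)" if h: "h \<in> Lp_on lborel p" and \<psi>: "test_function \<psi>" for h \<psi> :: "real^'d \<Rightarrow> real"
  proof -
    obtain B where B: "\<And>x. \<bar>\<psi> x\<bar> \<le> B" "bounded {x. \<psi> x \<noteq> 0}" "\<psi> \<in> borel_measurable borel"
      using test_function_bounds[OF \<psi>] by blast
    \<comment> \<open>The reflected test function serves as the kernel in
      \<open>conv_integrable\<close>, evaluated at 0.\<close>
    have "\<bar>\<psi> (- x)\<bar> \<le> B" for x using B by blast
    moreover have "integrable lborel (\<lambda>x. \<psi> (- x))"
      using bounded_support_integrable[OF B(3,1,2)] lborel_integral_affine(2)[OF B(3), of "-1" 0] by simp
    ultimately show ?thesis
      using conv_integrable[OF p _ _ h, of "\<lambda>x. \<psi> (- x)" B 0] by (simp add: mult.commute)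
  qed
  have lin: "(LINT x|lborel. (\<Sum>i\<in>I. c i * h i x) * \<psi> x) = (\<Sum>i\<in>I. c i * (LINT x|lborel. h i x * \<psi> x))"
    if h: "\<And>i. i \<in> I \<Longrightarrow> h i \<in> Lp_on lborel p" and \<psi>: "test_function \<psi>" for h and \<psi> :: "real^'d \<Rightarrow> real"
  proof -
    have "(LINT x|lborel. (\<Sum>i\<in>I. c i * h i x) * \<psi> x) = (LINT x|lborel. (\<Sum>i\<in>I. c i * (h i x * \<psi> x)))"
      by (simp add: sum_distrib_right mult.assoc)
    also have "\<dots> = (\<Sum>i\<in>I. LINT x|lborel. c i * (h i x * \<psi> x))"
      by (rule Bochner_Integration.integral_sum) (intro integrable_mult_right int h \<psi>)
    finally show ?thesis by (simp only: integral_mult_right_zero)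
  qed
  show ?thesis
    unfolding weak_pair_def
  proof (intro allI impI, elim conjE)
    fix \<phi> :: "real^'d \<Rightarrow> real" and js assume \<phi>: "test_function \<phi>" and js: "\<forall>i. count_list js i = \<alpha> i"
    let ?s = "(-1) ^ (\<Sum>i\<in>UNIV. \<alpha> i) :: real"
    have "(LINT x|lborel. f i x * iter_partial_deriv js \<phi> x) = ?s * (LINT x|lborel. v i x * \<phi> x)" if "i \<in> I" for i
      using w[OF that] \<phi> js unfolding weak_pair_def by blast
    then show "(LINT x|lborel. (\<Sum>i\<in>I. c i * f i x) * iter_partial_deriv js \<phi> x) = ?s * (LINT x|lborel. (\<Sum>i\<in>I. c i * v i x) * \<phi> x)"
      by (simp add: lin[OF f test_function_iter[OF \<phi>]] lin[OF v \<phi>] sum_distrib_left mult.left_commute)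
  qed
qed

lemma conv_add:
  fixes g h :: "real^'d \<Rightarrow> real"
  assumes p: "p \<ge> 1" and K: "integrable lborel K" "\<And>x. \<bar>K x\<bar> \<le> B" and g: "g \<in> Lp_on lborel p" and h: "h \<in> Lp_on lborel p"
  shows "conv K (\<lambda>x. g x + h x) x = conv K g x + conv K h x"
    and "conv K (\<lambda>x. g x - h x) x = conv K g x - conv K h x"
  using conv_integrable[OF p K g, of x] conv_integrable[OF p K h, of x]
  by (simp_all add: conv_def distrib_left right_diff_distrib)

lemma kern_bound_ex: "\<exists>B. \<forall>x::real^'d. \<bar>kern b x\<bar> \<le> B"
  using kern_deriv_bounded[of b "\<lambda>_. 0"] by (auto simp: kern_def)

lemma averaged_sum:
  fixes f :: "'i \<Rightarrow> real^'d \<Rightarrow> real"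
  assumes p: "p \<ge> 1" and I: "finite I" and f: "\<And>i. i \<in> I \<Longrightarrow> f i \<in> Lp_on lborel p" and \<delta>: "\<delta> > 0"
  shows "averaged \<delta> r (\<lambda>x. \<Sum>i\<in>I. c i * f i x) x = (\<Sum>i\<in>I. c i * averaged \<delta> r (f i) x)"
proof -
  have m: "f i \<in> borel_measurable borel" if "i \<in> I" for i using f[OF that] by (simp add: Lp_on_def)
  have sm: "(\<lambda>x. \<Sum>i\<in>I. c i * f i x) \<in> borel_measurable borel"
    using m by (intro borel_measurable_sum borel_measurable_times) auto
  have "(LINT z|lborel. ball_density z * (\<Sum>i\<in>I. c i * f i (x + a *\<^sub>R z))) = (\<Sum>i\<in>I. c i * (LINT z|lborel. ball_density z * f i (x + a *\<^sub>R z)))" for a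
  proof -
    have "(LINT z|lborel. ball_density z * (\<Sum>i\<in>I. c i * f i (x + a *\<^sub>R z))) = (LINT z|lborel. (\<Sum>i\<in>I. c i * (ball_density z * f i (x + a *\<^sub>R z))))"
      by (simp add: sum_distrib_left mult.left_commute)
    also have "\<dots> = (\<Sum>i\<in>I. LINT z|lborel. c i * (ball_density z * f i (x + a *\<^sub>R z)))"
      by (rule Bochner_Integration.integral_sum) (intro integrable_mult_right ball_density_Lp_integrable[OF p f])
    finally show ?thesis by (simp only: integral_mult_right_zero)
  qed
  then have "averaged \<delta> r (\<lambda>x. \<Sum>i\<in>I. c i * f i x) x = (\<Sum>j = 1..r. \<Sum>i\<in>I. avg_coeff r j * (c i * (LINT z|lborel. ball_density z * f i (x + (\<delta> * real j / real r) *\<^sub>R z))))"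
    by (simp add: averaged_eq_borel[OF \<delta> sm] sum_distrib_left)
  also have "\<dots> = (\<Sum>i\<in>I. \<Sum>j = 1..r. avg_coeff r j * (c i * (LINT z|lborel. ball_density z * f i (x + (\<delta> * real j / real r) *\<^sub>R z))))"
    by (rule sum.swap)
  also have "\<dots> = (\<Sum>i\<in>I. c i * averaged \<delta> r (f i) x)"
    by (intro sum.cong refl) (simp add: averaged_eq_borel[OF \<delta> m] sum_distrib_left mult.left_commute)
  finally show ?thesis .
qed

lemma averaged_diff:
  fixes f g :: "real^'d \<Rightarrow> real"
  assumes p: "p \<ge> 1" and f: "f \<in> Lp_on lborel p" and g: "g \<in> Lp_on lborel p" and \<delta>: "\<delta> > 0"
  shows "averaged \<delta> r (\<lambda>x. f x - g x) x = averaged \<delta> r f x - averaged \<delta> r g x"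
proof -
  define F where "F b = (if b then f else g)" for b
  have F: "\<And>b. b \<in> UNIV \<Longrightarrow> F b \<in> Lp_on lborel p" using f g by (simp add: F_def)
  show ?thesis
    using averaged_sum[where I = UNIV and f = F and c = "\<lambda>b. if b then 1 else -1" and x = x and r = r, OF p _ F \<delta>]
    by (simp add: UNIV_bool F_def)
qed

section \<open>Approximation by band-limited functions\<close>

text \<open>With these coefficients \<open>jackson s b g - g\<close> is a mean of differences of \<open>g\<close> of order \<open>s\<close>.\<close>

definition jackson_coeff :: "nat \<Rightarrow> nat \<Rightarrow> real" where
  "jackson_coeff s \<nu> = (-1) ^ (\<nu> + 1) * real (s choose \<nu>)"

text \<open>The kernel with parameter \<open>b / real \<nu>\<close> samples \<open>h\<close> at
  \<open>\<nu>\<close> times the steps of \<open>kern b\<close>, as a difference of order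
  \<open>s\<close> requires. Its band is narrower than \<open>b\<close>, so every term stays within
  the band \<open>b\<close>.\<close>

definition jackson :: "nat \<Rightarrow> real \<Rightarrow> (real^'d \<Rightarrow> real) \<Rightarrow> real^'d \<Rightarrow> real" where
  "jackson s b h x = (\<Sum>\<nu>=1..s. jackson_coeff s \<nu> * conv (kern (b / real \<nu>)) h x)"

definition jackson_coeff_sum :: "nat \<Rightarrow> real" where
  "jackson_coeff_sum s = (\<Sum>\<nu>=1..s. \<bar>jackson_coeff s \<nu>\<bar>)"

lemma jackson_coeff_sum_nonneg: "jackson_coeff_sum s \<ge> 0"
  unfolding jackson_coeff_sum_def by (intro sum_nonneg) auto

lemma conv_kern_Lp_on:
  fixes h :: "real^'d \<Rightarrow> real"
  assumes p: "p \<ge> 1" and b: "b > 0" and h: "h \<in> Lp_on lborel p"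
  shows "conv (kern b) h \<in> Lp_on lborel p" "Lp_norm_on lborel p (conv (kern b) h) \<le> kern_norm TYPE('d) * Lp_norm_on lborel p h"
  using conv_Lp_on[OF p kern_integrable[OF b] h] kern_abs_integral[OF b, where 'd = 'd] by auto

lemma jackson_Lp_on:
  fixes h :: "real^'d \<Rightarrow> real"
  assumes p: "p \<ge> 1" and b: "b > 0" and h: "h \<in> Lp_on lborel p"
  shows "jackson s b h \<in> Lp_on lborel p"
    and jackson_Lp_norm_on: "Lp_norm_on lborel p (jackson s b h) \<le> jackson_coeff_sum s * (kern_norm TYPE('d) * Lp_norm_on lborel p h)"
proof -
  have i: "(\<lambda>x. jackson_coeff s \<nu> * conv (kern (b / real \<nu>)) h x) \<in> Lp_on lborel p" if "\<nu> \<in> {1..s}" for \<nu>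
    using that b by (intro Lp_on_cmult conv_kern_Lp_on p h) auto
  show "jackson s b h \<in> Lp_on lborel p" unfolding jackson_def[abs_def] by (rule Lp_on_sum(1)[OF p _ i]) auto
  have "Lp_norm_on lborel p (jackson s b h) \<le> (\<Sum>\<nu>=1..s. Lp_norm_on lborel p (\<lambda>x. jackson_coeff s \<nu> * conv (kern (b / real \<nu>)) h x))"
    unfolding jackson_def[abs_def] by (rule Lp_norm_on_sum[OF p _ i]) auto
  also have "\<dots> \<le> (\<Sum>\<nu>=1..s. \<bar>jackson_coeff s \<nu>\<bar> * (kern_norm TYPE('d) * Lp_norm_on lborel p h))"
    unfolding Lp_norm_on_cmult[OF p] by (intro sum_mono mult_left_mono conv_kern_Lp_on p h) (use b in auto)
  finally show "Lp_norm_on lborel p (jackson s b h) \<le> jackson_coeff_sum s * (kern_norm TYPE('d) * Lp_norm_on lborel p h)"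
    by (simp add: jackson_coeff_sum_def sum_distrib_right)
qed

lemma jackson_diff:
  fixes g h :: "real^'d \<Rightarrow> real"
  assumes p: "p \<ge> 1" and b: "b > 0" and g: "g \<in> Lp_on lborel p" and h: "h \<in> Lp_on lborel p"
  shows "jackson s b (\<lambda>x. g x - h x) x = jackson s b g x - jackson s b h x"
proof -
  have "conv (kern (b / real \<nu>)) (\<lambda>x. g x - h x) x = conv (kern (b / real \<nu>)) g x - conv (kern (b / real \<nu>)) h x"
    if "\<nu> \<in> {1..s}" for \<nu>
  proof -
    have b': "b / real \<nu> > 0" using b that by auto
    obtain B where "\<And>x::real^'d. \<bar>kern (b / real \<nu>) x\<bar> \<le> B" using kern_bound_ex by blast
    then show ?thesis by (rule conv_add(2)[OF p kern_integrable[OF b'] _ g h])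
  qed
  then show ?thesis by (simp add: jackson_def sum_subtractf[symmetric] right_diff_distrib)
qed

lemma kern_Lp_integrable:
  fixes g :: "real^'d \<Rightarrow> real"
  assumes p: "p \<ge> 1" and g: "g \<in> Lp_on lborel p" and c: "c \<noteq> 0"
  shows "integrable lborel (\<lambda>z. kern 1 z * g (x - c *\<^sub>R z))"
proof -
  have [measurable]: "g \<in> borel_measurable borel" using g by (auto simp: Lp_on_def)
  obtain B where B: "\<And>x::real^'d. \<bar>kern 1 x\<bar> \<le> B" using kern_bound_ex by blast
  have "integrable lborel (\<lambda>y. kern 1 (0 - y) * g (x + c *\<^sub>R y))"
    by (rule conv_integrable[OF p kern_integrable B Lp_on_affine[OF g c]]) simp
  then show ?thesis
    using lborel_integral_affine(2)[of "\<lambda>z. kern 1 z * g (x - c *\<^sub>R z)" "-1" 0] by simp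
qed

text \<open>Rescaling turns all terms into integrals against \<open>kern 1\<close>. The index
  \<open>\<nu> = 0\<close>, absent from \<open>jackson\<close>, has coefficient -1 and, the kernel
  having mass 1, accounts for \<open>- g x\<close>.\<close>

lemma jackson_minus_eq:
  fixes g :: "real^'d \<Rightarrow> real"
  assumes p: "p \<ge> 1" and b: "b > 0" and g: "g \<in> Lp_on lborel p"
  shows "jackson s b g x - g x = (LINT z|lborel. kern 1 z * (- ((-1) ^ s) * finite_diff s (- (1 / b) *\<^sub>R z) g x))"
proof -
  have gm: "g \<in> borel_measurable borel" using g by (auto simp: Lp_on_def)
  have pt: "- ((-1) ^ s) * finite_diff s (- (1 / b) *\<^sub>R z) g x = (\<Sum>\<nu>=1..s. jackson_coeff s \<nu> * g (x - (real \<nu> / b) *\<^sub>R z)) - g x" for z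
  proof -
    let ?h = "- (1 / b) *\<^sub>R z"
    have "finite_diff s ?h g x = (\<Sum>\<mu>\<le>s. real (s choose \<mu>) * (-1) ^ (s - \<mu>) * g (x + real \<mu> *\<^sub>R ?h))"
      unfolding finite_diff_def
    proof (rule sum.reindex_bij_witness[of _ "\<lambda>\<mu>. s - \<mu>" "\<lambda>\<mu>. s - \<mu>"])
      fix \<nu> assume "\<nu> \<in> {..s}"
      then show "real (s choose (s - \<nu>)) * (-1) ^ (s - (s - \<nu>)) * g (x + real (s - \<nu>) *\<^sub>R ?h) =
        real (s choose \<nu>) * (-1) ^ \<nu> * g (x + real (s - \<nu>) *\<^sub>R ?h)"
        using binomial_symmetric[of \<nu> s] by simp
    qed auto
    then have "- ((-1) ^ s) * finite_diff s ?h g x = (\<Sum>\<mu>\<le>s. - ((-1) ^ s) * (real (s choose \<mu>) * (-1) ^ (s - \<mu>) * g (x + real \<mu> *\<^sub>R ?h)))"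
      by (simp only: sum_distrib_left)
    also have "\<dots> = (\<Sum>\<mu>\<le>s. jackson_coeff s \<mu> * g (x - (real \<mu> / b) *\<^sub>R z))"
    proof (rule sum.cong[OF refl])
      fix \<mu> assume "\<mu> \<in> {..s}"
      then obtain k where k: "s = \<mu> + k" using le_Suc_ex by auto
      have e: "x + real \<mu> *\<^sub>R ?h = x - (real \<mu> / b) *\<^sub>R z" by simp
      have "(-1 :: real) ^ s * (-1) ^ (s - \<mu>) = (-1) ^ \<mu> * ((-1) ^ k * (-1) ^ k)"
        by (simp add: k power_add)
      also have "((-1) ^ k * (-1) ^ k :: real) = 1" by (metis left_minus_one_mult_self mult.right_neutral)
      finally have q: "(-1 :: real) ^ s * (-1) ^ (s - \<mu>) = (-1) ^ \<mu>" by simp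
      have "- ((-1) ^ s) * (real (s choose \<mu>) * (-1) ^ (s - \<mu>) * g (x + real \<mu> *\<^sub>R ?h)) =
        - ((-1) ^ s * (-1) ^ (s - \<mu>)) * real (s choose \<mu>) * g (x + real \<mu> *\<^sub>R ?h)" by simp
      then show "- ((-1) ^ s) * (real (s choose \<mu>) * (-1) ^ (s - \<mu>) * g (x + real \<mu> *\<^sub>R ?h)) = jackson_coeff s \<mu> * g (x - (real \<mu> / b) *\<^sub>R z)"
        unfolding q e by (simp add: jackson_coeff_def)
    qed
    also have "{..s} = insert 0 {1..s}" by auto
    also have "(\<Sum>\<mu>\<in>insert 0 {1..s}. jackson_coeff s \<mu> * g (x - (real \<mu> / b) *\<^sub>R z)) = - g x + (\<Sum>\<nu>=1..s. jackson_coeff s \<nu> * g (x - (real \<nu> / b) *\<^sub>R z))"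
      by (subst sum.insert) (auto simp: jackson_coeff_def)
    finally show ?thesis by simp
  qed
  have i: "integrable lborel (\<lambda>z. kern 1 z * g (x - (real \<nu> / b) *\<^sub>R z))" if "\<nu> \<in> {1..s}" for \<nu>
    by (rule kern_Lp_integrable[OF p g]) (use that b in auto)
  have k1: "integrable lborel (\<lambda>z::real^'d. kern 1 z * g x)" "(LINT z|lborel. kern 1 (z::real^'d) * g x) = g x"
    by (auto simp: kern_integral intro!: integrable_mult_left kern_integrable)
  have "(LINT z|lborel. kern 1 z * (- ((-1) ^ s) * finite_diff s (- (1 / b) *\<^sub>R z) g x)) =
    (LINT z|lborel. (\<Sum>\<nu>=1..s. jackson_coeff s \<nu> * (kern 1 z * g (x - (real \<nu> / b) *\<^sub>R z))) - kern 1 z * g x)"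
    unfolding pt by (simp add: right_diff_distrib sum_distrib_left mult.left_commute)
  also have "\<dots> = (LINT z|lborel. (\<Sum>\<nu>=1..s. jackson_coeff s \<nu> * (kern 1 z * g (x - (real \<nu> / b) *\<^sub>R z)))) - (LINT z|lborel. kern 1 (z::real^'d) * g x)"
    by (intro Bochner_Integration.integral_diff Bochner_Integration.integrable_sum integrable_mult_right i k1)
  also have "(LINT z|lborel. (\<Sum>\<nu>=1..s. jackson_coeff s \<nu> * (kern 1 z * g (x - (real \<nu> / b) *\<^sub>R z)))) =
     (\<Sum>\<nu>=1..s. LINT z|lborel. jackson_coeff s \<nu> * (kern 1 z * g (x - (real \<nu> / b) *\<^sub>R z)))"
    by (intro Bochner_Integration.integral_sum integrable_mult_right i)
  also have "\<dots> = jackson s b g x"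
    unfolding jackson_def integral_mult_right_zero
    using b by (intro sum.cong refl) (auto simp: conv_kern_scale[OF _ gm])
  finally show ?thesis using k1 by simp
qed

definition kern_moment :: "'d::finite itself \<Rightarrow> nat \<Rightarrow> real" where
  "kern_moment _ s = (LINT z|lborel. \<bar>kern 1 z * (1 + norm (z::real^'d)) ^ s\<bar>)"

lemma jackson_error:
  fixes g :: "real^'d \<Rightarrow> real"
  assumes p: "p \<ge> 1" and b: "b > 0" and g: "g \<in> Lp_on lborel p" and S: "S \<ge> 0"
    and D: "\<And>h. Lp_norm_on lborel p (finite_diff s h g) \<le> (CARD('d) * norm h) ^ s * S"
  shows "Lp_norm_on lborel p (\<lambda>x. jackson s b g x - g x) \<le> kern_moment TYPE('d) s * ((CARD('d) / b) ^ s * S)"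
proof -
  have [measurable]: "g \<in> borel_measurable borel" using g by (auto simp: Lp_on_def)
  \<comment> \<open>The differences grow like \<open>norm z ^ s\<close>. Dividing by
    \<open>(1 + norm z) ^ s\<close> here and multiplying the kernel by it bounds \<open>Q z\<close>
    uniformly in \<open>z\<close> and leaves a moment of the kernel.\<close>
  define Q where "Q z x = (- ((-1) ^ s) / (1 + norm z) ^ s) * finite_diff s (- (1 / b) *\<^sub>R z) g x" for z x
  have Qm: "(\<lambda>(z, x). Q z x) \<in> borel_measurable (lborel \<Otimes>\<^sub>M lborel)"
    unfolding Q_def finite_diff_def by measurable
  have QS: "Q z \<in> Lp_on lborel p \<and> Lp_norm_on lborel p (Q z) \<le> (CARD('d) / b) ^ s * S" for z
  proof
    show "Q z \<in> Lp_on lborel p" unfolding Q_def[abs_def] by (intro Lp_on_cmult finite_diff_Lp_on p g)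
    have pos: "(1 + norm z) ^ s > 0" by (intro zero_less_power add_pos_nonneg) auto
    have "Lp_norm_on lborel p (Q z) = 1 / (1 + norm z) ^ s * Lp_norm_on lborel p (finite_diff s (- (1 / b) *\<^sub>R z) g)"
      unfolding Q_def[abs_def] Lp_norm_on_cmult[OF p] using pos by (simp add: power_abs abs_divide)
    also have "\<dots> \<le> 1 / (1 + norm z) ^ s * ((CARD('d) * norm (- (1 / b) *\<^sub>R z)) ^ s * S)"
      using pos by (intro mult_left_mono D) auto
    also have "\<dots> = (norm z) ^ s / (1 + norm z) ^ s * ((CARD('d) / b) ^ s * S)"
      using b by (simp add: power_mult_distrib power_divide)
    also have "\<dots> \<le> 1 * ((CARD('d) / b) ^ s * S)"
      using pos S b by (intro mult_right_mono mult_nonneg_nonneg) (auto simp: divide_le_eq intro!: power_mono)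
    finally show "Lp_norm_on lborel p (Q z) \<le> (CARD('d) / b) ^ s * S" by simp
  qed
  have "kern 1 z * (- ((-1) ^ s) * finite_diff s (- (1 / b) *\<^sub>R z) g x) = kern 1 z * (1 + norm z) ^ s * Q z x" for z x
  proof -
    have "1 + norm z \<noteq> 0" using norm_ge_zero[of z] by linarith
    then show ?thesis by (simp add: Q_def)
  qed
  then have "(\<lambda>x. jackson s b g x - g x) = (\<lambda>x. LINT z|lborel. kern 1 z * (1 + norm z) ^ s * Q z x)"
    by (simp add: fun_eq_iff jackson_minus_eq[OF p b g])
  then show ?thesis
    using pair_sigma_finite.minkowski_jensen_bound(2)[OF lborel_pair_sigma_finite p kern_moment_integrable Qm _ QS] S b
    by (simp add: kern_moment_def)
qed

lemma jackson_band_limited: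
  fixes g :: "real^'d \<Rightarrow> real"
  assumes p: "p \<ge> 1" and b: "b > 0" and g: "g \<in> Lp_on lborel p" and R: "\<And>x. norm x > R \<Longrightarrow> g x = 0"
  shows "jackson s b g \<in> band_limited p b"
  unfolding jackson_def[abs_def]
proof (rule band_limited_sum[OF p])
  fix \<nu> assume \<nu>: "\<nu> \<in> {1..s}"
  then have "b / real \<nu> \<le> b / 1" using b by (intro divide_left_mono) auto
  moreover have "b / real \<nu> > 0" using b \<nu> by auto
  ultimately show "conv (kern (b / real \<nu>)) g \<in> band_limited p b"
    by (intro conv_kern_band_limited[OF p _ _ g R]) simp_all
qed simp

lemma jackson_sample:
  fixes h :: "real^'d \<Rightarrow> real" and X :: "(real^'d) set"
  assumes p: "p \<ge> 1" and b: "0 < b" "b \<le> \<sigma>" and h: "h \<in> Lp_on lborel p" and s: "separated (\<gamma> / \<sigma>) X"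
    and PP: "\<forall>b \<sigma> X h. 0 < b \<longrightarrow> b \<le> \<sigma> \<longrightarrow> separated (\<gamma> / \<sigma>) X \<longrightarrow> h \<in> Lp_on lborel p \<longrightarrow>
     conv (kern b) h \<in> lp_space p (X :: (real^'d) set) \<and> lp_norm p \<sigma> X (conv (kern b) h) \<le> C * Lp_norm_on lborel p h"
  shows "jackson k b h \<in> lp_space p X" "lp_norm p \<sigma> X (jackson k b h) \<le> jackson_coeff_sum k * (C * Lp_norm_on lborel p h)"
proof -
  have \<sigma>: "\<sigma> > 0" using b by simp
  have i: "conv (kern (b / real \<nu>)) h \<in> lp_space p X \<and> lp_norm p \<sigma> X (conv (kern (b / real \<nu>)) h) \<le> C * Lp_norm_on lborel p h"
    if \<nu>: "\<nu> \<in> {1..k}" for \<nu>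
  proof -
    have "b / real \<nu> \<le> b / 1" using b \<nu> by (intro divide_left_mono) auto
    then have "b / real \<nu> \<le> \<sigma>" "0 < b / real \<nu>" using b \<nu> by auto
    then show ?thesis using PP s h by blast
  qed
  show "jackson k b h \<in> lp_space p X"
    unfolding jackson_def[abs_def] by (rule lp_sum(1)[OF p \<sigma>]) (use i in auto)
  have "lp_norm p \<sigma> X (jackson k b h) \<le> (\<Sum>\<nu>=1..k. \<bar>jackson_coeff k \<nu>\<bar> * lp_norm p \<sigma> X (conv (kern (b / real \<nu>)) h))"
    unfolding jackson_def[abs_def] by (rule lp_sum(2)[OF p \<sigma>]) (use i in auto)
  also have "\<dots> \<le> (\<Sum>\<nu>=1..k. \<bar>jackson_coeff k \<nu>\<bar> * (C * Lp_norm_on lborel p h))"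
    using i by (intro sum_mono mult_left_mono) auto
  finally show "lp_norm p \<sigma> X (jackson k b h) \<le> jackson_coeff_sum k * (C * Lp_norm_on lborel p h)"
    by (simp add: jackson_coeff_sum_def sum_distrib_right)
qed

text \<open>Because averaging commutes with convolution, the averaged error of the approximant is
  again a kernel mean, of the averaged error of \<open>h\<close>; its samples are thus within reach
  of \<open>plancherel_polya\<close>.\<close>

lemma jackson_averaged:
  fixes h :: "real^'d \<Rightarrow> real"
  assumes p: "p \<ge> 1" and b: "b > 0" and h: "h \<in> Lp_on lborel p" and \<delta>: "\<delta> > 0" and r: "r \<ge> 1"
  shows "averaged \<delta> r (jackson s b h) x - jackson s b h x = jackson s b (\<lambda>x. averaged \<delta> r h x - h x) x"
proof -
  have i: "conv (kern (b / real \<nu>)) h \<in> Lp_on lborel p" if "\<nu> \<in> {1..s}" for \<nu>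
    using that b by (intro conv_kern_Lp_on p h) auto
  have "averaged \<delta> r (conv (kern (b / real \<nu>)) h) x = conv (kern (b / real \<nu>)) (averaged \<delta> r h) x" if \<nu>: "\<nu> \<in> {1..s}" for \<nu>
  proof -
    have b': "b / real \<nu> > 0" using b \<nu> by auto
    obtain B where "\<And>x::real^'d. \<bar>kern (b / real \<nu>) x\<bar> \<le> B" using kern_bound_ex by blast
    then show ?thesis by (rule averaged_conv[OF p kern_integrable[OF b'] _ h \<delta>])
  qed
  then have "averaged \<delta> r (jackson s b h) x = jackson s b (averaged \<delta> r h) x"
    unfolding jackson_def[abs_def] by (subst averaged_sum[OF p _ i \<delta>]) auto
  then show ?thesis by (simp add: jackson_diff[OF p b averaged_Lp_on[OF p h \<delta> r] h])
qed

text \<open>A band-limited function has to be integrable, so the approximant of \<open>g\<close> is formed from a truncation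
  \<open>h\<close>, which has no weak derivatives in general. The derivatives fall on the kernel for \<open>h - g\<close>, at the
  price of a factor \<open>D\<close> depending on \<open>b\<close>, and on \<open>g\<close> otherwise.\<close>

lemma jackson_seminorm:
  fixes g e :: "real^'d \<Rightarrow> real"
  assumes p: "p \<ge> 1" and b: "b > 0" and g: "g \<in> Lp_on lborel p" and S: "S \<ge> 0"
    and v: "\<forall>\<alpha>\<in>multi_indices s. \<exists>v\<in>Lp_on lborel p. weak_pair \<alpha> g v \<and> Lp_norm_on lborel p v \<le> S"
  shows "\<exists>D\<ge>0. \<forall>h\<in>Lp_on lborel p. Sobolev_seminorm p s (jackson s b h) \<le>
     real (card (multi_indices s :: ('d \<Rightarrow> nat) set)) * (jackson_coeff_sum s * (kern_norm TYPE('d) * S)) + D * Lp_norm_on lborel p (\<lambda>x. h x - g x)"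
proof -
  let ?I = "multi_indices s :: ('d \<Rightarrow> nat) set" and ?A = "kern_norm TYPE('d)"
  obtain v where v: "\<And>\<alpha>. \<alpha> \<in> ?I \<Longrightarrow> v \<alpha> \<in> Lp_on lborel p" "\<And>\<alpha>. \<alpha> \<in> ?I \<Longrightarrow> weak_pair \<alpha> g (v \<alpha>)"
    "\<And>\<alpha>. \<alpha> \<in> ?I \<Longrightarrow> Lp_norm_on lborel p (v \<alpha>) \<le> S" using v by metis
  define d where "d \<alpha> \<nu> = (LINT z|lborel. \<bar>kern_deriv (b / real \<nu>) \<alpha> (z :: real^'d)\<bar>)" for \<alpha> \<nu>
  have d0: "d \<alpha> \<nu> \<ge> 0" for \<alpha> \<nu> by (simp add: d_def)
  \<comment> \<open>The total mass of the kernel derivatives. It depends on \<open>b\<close> but not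
    on \<open>h\<close>, so the truncation can be chosen once \<open>D\<close> is known.\<close>
  define D where "D = (\<Sum>\<alpha>\<in>?I. \<Sum>\<nu>=1..s. \<bar>jackson_coeff s \<nu>\<bar> * d \<alpha> \<nu>)"
  have D: "D \<ge> 0" unfolding D_def by (intro sum_nonneg mult_nonneg_nonneg d0) auto
  have "Sobolev_seminorm p s (jackson s b h) \<le> real (card ?I) * (jackson_coeff_sum s * (?A * S)) + D * Lp_norm_on lborel p (\<lambda>x. h x - g x)"
    if h: "h \<in> Lp_on lborel p" for h
  proof -
    let ?e = "\<lambda>x. h x - g x"
    have e: "?e \<in> Lp_on lborel p" by (rule Lp_on_diff(1)[OF p h g])
    define w where "w \<alpha> \<nu> x = conv (kern (b / real \<nu>)) (v \<alpha>) x + conv (kern_deriv (b / real \<nu>) \<alpha>) ?e x" for \<alpha> \<nu> x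
    have b': "b / real \<nu> > 0" if "\<nu> \<in> {1..s}" for \<nu> using b that by auto
    have wS: "w \<alpha> \<nu> \<in> Lp_on lborel p" and wN: "Lp_norm_on lborel p (w \<alpha> \<nu>) \<le> ?A * S + d \<alpha> \<nu> * Lp_norm_on lborel p ?e"
      and ww: "weak_pair \<alpha> (conv (kern (b / real \<nu>)) h) (w \<alpha> \<nu>)" if \<alpha>: "\<alpha> \<in> ?I" and \<nu>: "\<nu> \<in> {1..s}" for \<alpha> \<nu>
    proof -
      note k1 = conv_kern_Lp_on[OF p b'[OF \<nu>] v(1)[OF \<alpha>]]
      note k2 = conv_Lp_on[OF p kern_deriv_integrable[OF b'[OF \<nu>], of \<alpha>] e]
      show "w \<alpha> \<nu> \<in> Lp_on lborel p" unfolding w_def[abs_def] by (rule Lp_on_add(1)[OF p k1(1) k2(1)])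
      have "Lp_norm_on lborel p (w \<alpha> \<nu>) \<le> Lp_norm_on lborel p (conv (kern (b / real \<nu>)) (v \<alpha>)) + Lp_norm_on lborel p (conv (kern_deriv (b / real \<nu>) \<alpha>) ?e)"
        unfolding w_def[abs_def] by (rule Lp_norm_on_triangle[OF p k1(1) k2(1)])
      also have "\<dots> \<le> ?A * S + d \<alpha> \<nu> * Lp_norm_on lborel p ?e"
        using k1(2) k2(2) mult_left_mono[OF v(3)[OF \<alpha>] kern_norm_nonneg[where 'd = 'd]] by (simp add: d_def)
      finally show "Lp_norm_on lborel p (w \<alpha> \<nu>) \<le> ?A * S + d \<alpha> \<nu> * Lp_norm_on lborel p ?e" .
      have 1: "weak_pair \<alpha> (conv (kern (b / real \<nu>)) g) (conv (kern (b / real \<nu>)) (v \<alpha>))"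
        by (rule weak_pair_conv[OF p kern_integrable[OF b'[OF \<nu>]] g v(1)[OF \<alpha>] v(2)[OF \<alpha>]])
      have 2: "weak_pair \<alpha> (conv (kern (b / real \<nu>)) ?e) (conv (kern_deriv (b / real \<nu>) \<alpha>) ?e)"
        by (rule weak_pair_conv_kern[OF p b'[OF \<nu>] e])
      obtain B where B: "\<And>x::real^'d. \<bar>kern (b / real \<nu>) x\<bar> \<le> B" using kern_bound_ex by blast
      \<comment> \<open>The splitting of \<open>h\<close> into \<open>g\<close> and
        \<open>h - g\<close>, written as a sum over \<open>bool\<close> so that
        \<open>weak_pair_sum\<close> applies.\<close>
      have "weak_pair \<alpha> (\<lambda>x. \<Sum>t\<in>(UNIV :: bool set). 1 * (if t then conv (kern (b / real \<nu>)) g else conv (kern (b / real \<nu>)) ?e) x)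
         (\<lambda>x. \<Sum>t\<in>(UNIV :: bool set). 1 * (if t then conv (kern (b / real \<nu>)) (v \<alpha>) else conv (kern_deriv (b / real \<nu>) \<alpha>) ?e) x)"
        by (rule weak_pair_sum[OF p]) (use 1 2 k1 k2 conv_kern_Lp_on[OF p b'[OF \<nu>] g] conv_kern_Lp_on[OF p b'[OF \<nu>] e] in auto)
      moreover have "(\<lambda>x. \<Sum>t\<in>(UNIV :: bool set). 1 * (if t then conv (kern (b / real \<nu>)) g else conv (kern (b / real \<nu>)) ?e) x) = conv (kern (b / real \<nu>)) h"
        by (simp add: UNIV_bool fun_eq_iff conv_add(2)[OF p kern_integrable[OF b'[OF \<nu>]] B h g])
      moreover have "(\<lambda>x. \<Sum>t\<in>(UNIV :: bool set). 1 * (if t then conv (kern (b / real \<nu>)) (v \<alpha>) else conv (kern_deriv (b / real \<nu>) \<alpha>) ?e) x) = w \<alpha> \<nu>"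
        by (simp add: UNIV_bool fun_eq_iff w_def)
      ultimately show "weak_pair \<alpha> (conv (kern (b / real \<nu>)) h) (w \<alpha> \<nu>)" by simp
    qed
    let ?u = "\<lambda>\<alpha> x. \<Sum>\<nu>=1..s. jackson_coeff s \<nu> * w \<alpha> \<nu> x"
    have uS: "?u \<alpha> \<in> Lp_on lborel p \<and> weak_pair \<alpha> (jackson s b h) (?u \<alpha>)" if \<alpha>: "\<alpha> \<in> ?I" for \<alpha>
    proof
      show "?u \<alpha> \<in> Lp_on lborel p" by (intro Lp_on_sum p Lp_on_cmult wS \<alpha>) auto
      show "weak_pair \<alpha> (jackson s b h) (?u \<alpha>)"
        unfolding jackson_def[abs_def]
        by (rule weak_pair_sum[OF p]) (use \<alpha> b' wS ww h p in \<open>auto intro!: conv_kern_Lp_on\<close>)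
    qed
    have uN: "Lp_norm_on lborel p (?u \<alpha>) \<le> jackson_coeff_sum s * (?A * S) + (\<Sum>\<nu>=1..s. \<bar>jackson_coeff s \<nu>\<bar> * d \<alpha> \<nu>) * Lp_norm_on lborel p ?e" if \<alpha>: "\<alpha> \<in> ?I" for \<alpha>
    proof -
      have "Lp_norm_on lborel p (?u \<alpha>) \<le> (\<Sum>\<nu>=1..s. Lp_norm_on lborel p (\<lambda>x. jackson_coeff s \<nu> * w \<alpha> \<nu> x))"
        by (intro Lp_norm_on_sum p Lp_on_cmult wS \<alpha>) auto
      also have "\<dots> \<le> (\<Sum>\<nu>=1..s. \<bar>jackson_coeff s \<nu>\<bar> * (?A * S + d \<alpha> \<nu> * Lp_norm_on lborel p ?e))"
        unfolding Lp_norm_on_cmult[OF p] by (intro sum_mono mult_left_mono wN \<alpha>) auto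
      also have "\<dots> = jackson_coeff_sum s * (?A * S) + (\<Sum>\<nu>=1..s. \<bar>jackson_coeff s \<nu>\<bar> * d \<alpha> \<nu>) * Lp_norm_on lborel p ?e"
        by (simp add: jackson_coeff_sum_def sum_distrib_right distrib_left sum.distrib mult.assoc)
      finally show ?thesis .
    qed
    have "Sobolev_seminorm p s (jackson s b h) = (\<Sum>\<alpha>\<in>?I. Lp_norm_on lborel p (?u \<alpha>))"
      by (rule Sobolev_seminorm_borel[OF p jackson_Lp_on(1)[OF p b h] uS])
    also have "\<dots> \<le> (\<Sum>\<alpha>\<in>?I. jackson_coeff_sum s * (?A * S) + (\<Sum>\<nu>=1..s. \<bar>jackson_coeff s \<nu>\<bar> * d \<alpha> \<nu>) * Lp_norm_on lborel p ?e)"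
      by (intro sum_mono uN)
    also have "\<dots> = real (card ?I) * (jackson_coeff_sum s * (?A * S)) + D * Lp_norm_on lborel p ?e"
      by (simp add: sum.distrib D_def sum_distrib_right)
    finally show ?thesis .
  qed
  then show ?thesis using D by blast
qed

section \<open>Band-limited approximants of Sobolev functions and of functions in
  \<open>Lp_on lborel p\<close>\<close>

lemma truncated_approximation:
  fixes g :: "real^'d \<Rightarrow> real"
  assumes p: "p \<ge> 1" and g: "g \<in> Lp_on lborel p" and e: "e > 0"
  obtains h R where "h \<in> Lp_on lborel p" "\<And>x. norm x > R \<Longrightarrow> h x = 0" "Lp_norm_on lborel p (\<lambda>x. h x - g x) < e"
proof -
  have [measurable]: "g \<in> borel_measurable borel" using g by (auto simp: Lp_on_def)
  obtain m where m: "Lp_norm_on lborel p (\<lambda>x. (if norm x \<le> real m then g x else 0) - g x) < e"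
    using order_tendstoD(2)[OF Lp_truncate[OF p g], of e] e by (auto simp: eventually_sequentially)
  have "(\<lambda>x. if norm x \<le> real m then g x else 0) \<in> borel_measurable lborel" by measurable
  then have "(\<lambda>x. if norm x \<le> real m then g x else 0) \<in> Lp_on lborel p"
    by (rule Lp_norm_on_mono(1)[OF p g]) auto
  then show ?thesis using that[of "\<lambda>x. if norm x \<le> real m then g x else 0" "real m"] m by auto
qed

lemma averaged_perturb:
  fixes g h :: "real^'d \<Rightarrow> real"
  assumes p: "p \<ge> 1" and g: "g \<in> Lp_on lborel p" and h: "h \<in> Lp_on lborel p" and \<delta>: "\<delta> > 0" and r: "r \<ge> 1"
  shows "Lp_norm_on lborel p (\<lambda>x. averaged \<delta> r h x - h x) \<le>
    Lp_norm_on lborel p (\<lambda>x. averaged \<delta> r g x - g x) + 2 ^ (2 * r) * Lp_norm_on lborel p (\<lambda>x. h x - g x)"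
proof -
  have e: "(\<lambda>x. h x - g x) \<in> Lp_on lborel p" by (rule Lp_on_diff(1)[OF p h g])
  have "(\<lambda>x. averaged \<delta> r h x - h x) = (\<lambda>x. (averaged \<delta> r g x - g x) + (averaged \<delta> r (\<lambda>x. h x - g x) x - (h x - g x)))"
    by (simp add: fun_eq_iff averaged_diff[OF p h g \<delta>])
  then have "Lp_norm_on lborel p (\<lambda>x. averaged \<delta> r h x - h x) \<le> Lp_norm_on lborel p (\<lambda>x. averaged \<delta> r g x - g x)
     + Lp_norm_on lborel p (\<lambda>x. averaged \<delta> r (\<lambda>x. h x - g x) x - (h x - g x))"
    using Lp_norm_on_triangle[OF p averaged_diff_Lp_on(1)[OF p g \<delta> r] averaged_diff_Lp_on(1)[OF p e \<delta> r]] by simp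
  then show ?thesis using averaged_diff_Lp_norm_on[OF p e \<delta> r] by linarith
qed

text \<open>One function \<open>P\<close> must satisfy all requirements at once: closeness to
  \<open>g\<close>, a controlled seminorm for (A3), samples in the right space, and a small averaged
  error on the samples. All errors are measured in units of \<open>S / \<tau> ^ s\<close>, and
  \<epsilon> pays for the truncation.\<close>

lemma band_limited_approximant:
  fixes p \<gamma> lam :: real and r s :: nat
  assumes p: "p \<ge> 1" and r: "r \<ge> 1" and sr: "s \<le> 2 * r" and \<gamma>: "0 < \<gamma>" "\<gamma> \<le> 1" and lam: "0 < lam" "lam \<le> 1"
  shows "\<exists>C>0. \<forall>(g :: real^'d \<Rightarrow> real) S \<tau> \<epsilon>. g \<in> Lp_on lborel p \<longrightarrow> S \<ge> 0 \<longrightarrow>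
    (\<forall>\<alpha>\<in>multi_indices s. \<exists>v\<in>Lp_on lborel p. weak_pair \<alpha> g v \<and> Lp_norm_on lborel p v \<le> S) \<longrightarrow> \<tau> > 0 \<longrightarrow> \<epsilon> > 0 \<longrightarrow>
    (\<exists>P. P \<in> band_limited p (lam * \<tau>) \<and> P \<in> Lp_on lborel p \<and>
      Lp_norm_on lborel p (\<lambda>x. P x - g x) \<le> C * (S / \<tau> ^ s) + \<epsilon> \<and>
      Sobolev_seminorm p s P / \<tau> ^ s \<le> C * (S / \<tau> ^ s) + \<epsilon> \<and>
      (\<forall>\<sigma> X. \<tau> \<le> \<sigma> \<longrightarrow> separated (\<gamma> / \<sigma>) X \<longrightarrow> P \<in> lp_space p X) \<and>
      (\<forall>X. separated (\<gamma> / \<tau>) X \<longrightarrow> (\<lambda>x. averaged (\<gamma> / \<tau>) r P x - P x) \<in> lp_space p X \<and>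
        lp_norm p \<tau> X (\<lambda>x. averaged (\<gamma> / \<tau>) r P x - P x) \<le> C * (S / \<tau> ^ s) + \<epsilon>))"
proof -
  obtain PC where PC: "PC > 0" "\<forall>b \<sigma> X h. 0 < b \<longrightarrow> b \<le> \<sigma> \<longrightarrow> separated (\<gamma> / \<sigma>) X \<longrightarrow> h \<in> Lp_on lborel p \<longrightarrow>
     conv (kern b) h \<in> lp_space p (X :: (real^'d) set) \<and> lp_norm p \<sigma> X (conv (kern b) h) \<le> PC * Lp_norm_on lborel p h"
    using plancherel_polya[OF p \<gamma>] by blast
  let ?d = "real CARD('d)" and ?L = "jackson_coeff_sum s" and ?A = "kern_norm TYPE('d)"
  let ?N = "real (card (multi_indices s :: ('d \<Rightarrow> nat) set))"
  \<comment> \<open>\<open>C1\<close> comes from the Jackson error, where the narrower band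
    \<open>lam * \<tau>\<close> costs \<open>lam\<close> to the power \<open>- s\<close>;
    \<open>C2\<close> from the seminorm; \<open>C3\<close> from the averaged error on the
    samples.\<close>
  define C1 where "C1 = kern_moment TYPE('d) s * (?d / lam) ^ s"
  define C2 where "C2 = ?N * (?L * ?A)"
  define C3 where "C3 = ?L * PC * (2 ^ (2 * r - s) * ?d ^ s)"
  have L0: "?L \<ge> 0" by (rule jackson_coeff_sum_nonneg)
  have A0: "?A \<ge> 0" by (rule kern_norm_nonneg)
  have C: "C1 \<ge> 0" "C2 \<ge> 0" "C3 \<ge> 0"
    using L0 A0 PC lam by (auto simp: C1_def C2_def C3_def kern_moment_def)
  define C where "C = C1 + C2 + C3 + 1"
  have C0: "C > 0" using C by (simp add: C_def)
  have "\<exists>P. P \<in> band_limited p (lam * \<tau>) \<and> P \<in> Lp_on lborel p \<and>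
      Lp_norm_on lborel p (\<lambda>x. P x - g x) \<le> C * (S / \<tau> ^ s) + \<epsilon> \<and>
      Sobolev_seminorm p s P / \<tau> ^ s \<le> C * (S / \<tau> ^ s) + \<epsilon> \<and>
      (\<forall>\<sigma> X. \<tau> \<le> \<sigma> \<longrightarrow> separated (\<gamma> / \<sigma>) X \<longrightarrow> P \<in> lp_space p X) \<and>
      (\<forall>X. separated (\<gamma> / \<tau>) X \<longrightarrow> (\<lambda>x. averaged (\<gamma> / \<tau>) r P x - P x) \<in> lp_space p X \<and>
        lp_norm p \<tau> X (\<lambda>x. averaged (\<gamma> / \<tau>) r P x - P x) \<le> C * (S / \<tau> ^ s) + \<epsilon>)"
    if g: "g \<in> Lp_on lborel p" and S: "S \<ge> 0"
      and v: "\<forall>\<alpha>\<in>multi_indices s. \<exists>v\<in>Lp_on lborel p. weak_pair \<alpha> g v \<and> Lp_norm_on lborel p v \<le> S"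
      and \<tau>: "\<tau> > 0" and \<epsilon>: "\<epsilon> > 0" for g :: "real^'d \<Rightarrow> real" and S \<tau> \<epsilon>
  proof -
    define b where "b = lam * \<tau>"
    have b: "b > 0" "b \<le> \<tau>" using lam \<tau> by (auto simp: b_def)
    have St: "S / \<tau> ^ s \<ge> 0" using S \<tau> by simp
    have FD: "Lp_norm_on lborel p (finite_diff s h g) \<le> (?d * norm h) ^ s * S" for h
      by (rule sobolev_finite_diff_bound[OF p g]) (use v in blast)
    obtain D where D: "D \<ge> 0" "\<And>h. h \<in> Lp_on lborel p \<Longrightarrow> Sobolev_seminorm p s (jackson s b h) \<le>
       ?N * (?L * (?A * S)) + D * Lp_norm_on lborel p (\<lambda>x. h x - g x)"
      using jackson_seminorm[OF p b(1) g S v] by blast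
    \<comment> \<open>\<open>M\<close> dominates the three factors with which the truncation error
      is multiplied below, among them the one with \<open>D\<close>; hence a truncation error below
      \<open>\<epsilon> / M\<close> suffices everywhere.\<close>
    define M where "M = ?L * ?A + D / \<tau> ^ s + ?L * PC * 2 ^ (2 * r) + 1"
    have M0: "?L * ?A \<ge> 0" "D / \<tau> ^ s \<ge> 0" "?L * PC * 2 ^ (2 * r) \<ge> 0"
      using L0 A0 D(1) \<tau> PC(1) by auto
    then have M: "M > 0" "?L * ?A \<le> M" "D / \<tau> ^ s \<le> M" "?L * PC * 2 ^ (2 * r) \<le> M"
      by (auto simp: M_def)
    obtain h R where h: "h \<in> Lp_on lborel p" "\<And>x. norm x > R \<Longrightarrow> h x = 0"
      and he: "Lp_norm_on lborel p (\<lambda>x. h x - g x) < \<epsilon> / M"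
      using truncated_approximation[OF p g, of "\<epsilon> / M"] \<epsilon> M(1) by (metis divide_pos_pos)
    let ?\<eta> = "Lp_norm_on lborel p (\<lambda>x. h x - g x)"
    have \<eta>: "K * ?\<eta> \<le> \<epsilon>" if "K \<le> M" for K
    proof -
      have "K * ?\<eta> \<le> M * ?\<eta>" using that by (intro mult_right_mono) auto
      also have "\<dots> \<le> M * (\<epsilon> / M)" using he M(1) by (intro mult_left_mono) auto
      finally show ?thesis using M(1) by simp
    qed
    let ?P = "jackson s b h"
    have hg: "(\<lambda>x. h x - g x) \<in> Lp_on lborel p" by (rule Lp_on_diff(1)[OF p h(1) g])
    have PS: "?P \<in> Lp_on lborel p" by (rule jackson_Lp_on(1)[OF p b(1) h(1)])
    have le: "C' * (S / \<tau> ^ s) \<le> C * (S / \<tau> ^ s)" if "C' \<le> C" for C' using that St by (rule mult_right_mono)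
    have Cle: "C1 \<le> C" "C2 \<le> C" "C3 \<le> C" using C by (auto simp: C_def)
    have 1: "Lp_norm_on lborel p (\<lambda>x. ?P x - g x) \<le> C * (S / \<tau> ^ s) + \<epsilon>"
    proof -
      have "(\<lambda>x. ?P x - g x) = (\<lambda>x. jackson s b (\<lambda>x. h x - g x) x + (jackson s b g x - g x))"
        by (simp add: fun_eq_iff jackson_diff[OF p b(1) h(1) g])
      then have "Lp_norm_on lborel p (\<lambda>x. ?P x - g x) \<le> Lp_norm_on lborel p (jackson s b (\<lambda>x. h x - g x)) + Lp_norm_on lborel p (\<lambda>x. jackson s b g x - g x)"
        using Lp_norm_on_triangle[OF p jackson_Lp_on(1)[OF p b(1) hg] Lp_on_diff(1)[OF p jackson_Lp_on(1)[OF p b(1) g] g]] by simp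
      also have "\<dots> \<le> ?L * (?A * ?\<eta>) + kern_moment TYPE('d) s * ((?d / b) ^ s * S)"
        by (intro add_mono jackson_Lp_norm_on[OF p b(1) hg] jackson_error[OF p b(1) g S FD])
      also have "?L * (?A * ?\<eta>) \<le> \<epsilon>" using \<eta>[OF M(2)] by (simp add: mult.assoc)
      also have "kern_moment TYPE('d) s * ((?d / b) ^ s * S) = C1 * (S / \<tau> ^ s)"
        by (simp add: C1_def b_def power_divide power_mult_distrib)
      finally show ?thesis using le[OF Cle(1)] by linarith
    qed
    have 2: "Sobolev_seminorm p s ?P / \<tau> ^ s \<le> C * (S / \<tau> ^ s) + \<epsilon>"
    proof -
      have "Sobolev_seminorm p s ?P / \<tau> ^ s \<le> (?N * (?L * (?A * S)) + D * ?\<eta>) / \<tau> ^ s"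
        using D(2)[OF h(1)] \<tau> by (intro divide_right_mono) auto
      also have "\<dots> = C2 * (S / \<tau> ^ s) + D / \<tau> ^ s * ?\<eta>"
        by (simp add: C2_def add_divide_distrib mult.assoc)
      finally show ?thesis using le[OF Cle(2)] \<eta>[OF M(3)] by linarith
    qed
    have 3: "?P \<in> lp_space p X" if "\<tau> \<le> \<sigma>" "separated (\<gamma> / \<sigma>) X" for \<sigma> X
      using jackson_sample(1)[OF p b(1) order.trans[OF b(2) that(1)] h(1) that(2) PC(2)] .
    have 4: "(\<lambda>x. averaged (\<gamma> / \<tau>) r ?P x - ?P x) \<in> lp_space p X \<and>
        lp_norm p \<tau> X (\<lambda>x. averaged (\<gamma> / \<tau>) r ?P x - ?P x) \<le> C * (S / \<tau> ^ s) + \<epsilon>"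
      if X: "separated (\<gamma> / \<tau>) X" for X
    proof -
      have \<delta>: "\<gamma> / \<tau> > 0" using \<gamma> \<tau> by simp
      let ?ah = "\<lambda>x. averaged (\<gamma> / \<tau>) r h x - h x"
      have eq: "(\<lambda>x. averaged (\<gamma> / \<tau>) r ?P x - ?P x) = jackson s b ?ah"
        by (simp add: fun_eq_iff jackson_averaged[OF p b(1) h(1) \<delta> r])
      have ahS: "?ah \<in> Lp_on lborel p" by (rule averaged_diff_Lp_on(1)[OF p h(1) \<delta> r])
      note js = jackson_sample[OF p b ahS X PC(2), of s]
      have "Lp_norm_on lborel p (\<lambda>x. averaged (\<gamma> / \<tau>) r g x - g x) \<le> 2 ^ (2 * r - s) * (?d ^ s * (S / \<tau> ^ s))"
      proof (rule averaged_diff_bound(2)[OF p g \<delta> r])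
        show "0 \<le> 2 ^ (2 * r - s) * (?d ^ s * (S / \<tau> ^ s))" by (intro mult_nonneg_nonneg St) simp_all
        fix k :: "real^'d" assume k: "norm k \<le> \<gamma> / \<tau>"
        \<comment> \<open>Here \<open>s \<le> 2 * r\<close> enters: \<open>s\<close> of the
          differences are converted into derivatives, and the remaining ones cost a factor 2
          each.\<close>
        have "2 * r = (2 * r - s) + s" using sr by simp
        then have "finite_diff (2 * r) k g = finite_diff (2 * r - s) k (finite_diff s k g)"
          by (metis finite_diff_add)
        then have "Lp_norm_on lborel p (finite_diff (2 * r) k g) \<le> 2 ^ (2 * r - s) * Lp_norm_on lborel p (finite_diff s k g)"
          using finite_diff_Lp_norm_on[OF p finite_diff_Lp_on(1)[OF p g]] by simp
        also have "\<dots> \<le> 2 ^ (2 * r - s) * ((?d * norm k) ^ s * S)" by (intro mult_left_mono FD) auto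
        also have "\<dots> \<le> 2 ^ (2 * r - s) * ((?d * (1 / \<tau>)) ^ s * S)"
        proof -
          have "norm k \<le> 1 / \<tau>" using k \<gamma>(2) \<tau> by (meson divide_right_mono less_imp_le order.trans)
          then show ?thesis using S by (intro mult_left_mono mult_right_mono power_mono) auto
        qed
        also have "\<dots> = 2 ^ (2 * r - s) * (?d ^ s * (S / \<tau> ^ s))" by (simp add: power_divide)
        finally show "Lp_norm_on lborel p (finite_diff (2 * r) k g) \<le> 2 ^ (2 * r - s) * (?d ^ s * (S / \<tau> ^ s))" .
      qed
      then have "Lp_norm_on lborel p ?ah \<le> 2 ^ (2 * r - s) * (?d ^ s * (S / \<tau> ^ s)) + 2 ^ (2 * r) * ?\<eta>"
        using averaged_perturb[OF p g h(1) \<delta> r] by linarith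
      then have "?L * (PC * Lp_norm_on lborel p ?ah) \<le> ?L * (PC * (2 ^ (2 * r - s) * (?d ^ s * (S / \<tau> ^ s)) + 2 ^ (2 * r) * ?\<eta>))"
        using L0 PC(1) by (intro mult_left_mono) auto
      also have "\<dots> = C3 * (S / \<tau> ^ s) + ?L * PC * 2 ^ (2 * r) * ?\<eta>"
        by (simp add: C3_def distrib_left mult.assoc)
      also have "\<dots> \<le> C * (S / \<tau> ^ s) + \<epsilon>" by (intro add_mono le Cle \<eta> M(4))
      finally show ?thesis unfolding eq using js by auto
    qed
    have 5: "?P \<in> band_limited p (lam * \<tau>)"
      unfolding b_def[symmetric] by (rule jackson_band_limited[OF p b(1) h])
    show ?thesis using PS 1 2 3 4 5 by blast
  qed
  then show ?thesis using C0 by blast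
qed

text \<open>The qualitative counterpart of \<open>band_limited_approximant\<close> for functions
  without derivatives: a fixed \<open>P\<close>, obtained from a kernel mean of large band and a
  truncation, whose averaged error on the samples tends to 0 without a rate.\<close>

lemma band_limited_dense:
  fixes f :: "real^'d \<Rightarrow> real"
  assumes p: "p \<ge> 1" and r: "r \<ge> 1" and \<gamma>: "0 < \<gamma>" "\<gamma> \<le> 1" and f: "f \<in> Lp_on lborel p" and \<epsilon>: "\<epsilon> > 0"
  shows "\<exists>a>0. \<exists>P\<in>band_limited p a. P \<in> Lp_on lborel p \<and> Lp_norm_on lborel p (\<lambda>x. P x - f x) \<le> \<epsilon> \<and>
    (\<forall>\<sigma> X. a \<le> \<sigma> \<longrightarrow> separated (\<gamma> / \<sigma>) X \<longrightarrow> P \<in> lp_space p X) \<and>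
    (\<forall>e>0. \<exists>\<sigma>0>0. \<forall>\<sigma> X. \<sigma>0 \<le> \<sigma> \<longrightarrow> separated (\<gamma> / \<sigma>) X \<longrightarrow>
       (\<lambda>x. averaged (\<gamma> / \<sigma>) r P x - P x) \<in> lp_space p X \<and> lp_norm p \<sigma> X (\<lambda>x. averaged (\<gamma> / \<sigma>) r P x - P x) \<le> e)"
proof -
  obtain PC where PC: "PC > 0" "\<forall>b \<sigma> X h. 0 < b \<longrightarrow> b \<le> \<sigma> \<longrightarrow> separated (\<gamma> / \<sigma>) X \<longrightarrow> h \<in> Lp_on lborel p \<longrightarrow>
     conv (kern b) h \<in> lp_space p (X :: (real^'d) set) \<and> lp_norm p \<sigma> X (conv (kern b) h) \<le> PC * Lp_norm_on lborel p h"
    using plancherel_polya[OF p \<gamma>] by blast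
  let ?A = "kern_norm TYPE('d)"
  have A0: "?A \<ge> 0" by (rule kern_norm_nonneg)
  have fm: "f \<in> borel_measurable borel" using f by (auto simp: Lp_on_def)
  have eq: "conv (kern (real (Suc n))) f x - f x = (LINT z|lborel. kern 1 z * (f (x + (- inverse (real (Suc n))) *\<^sub>R z) - f x))" for n x
  proof -
    have "integrable lborel (\<lambda>z. kern 1 z * f (x - (1 / real (Suc n)) *\<^sub>R z))" by (rule kern_Lp_integrable[OF p f]) simp
    moreover have "integrable lborel (\<lambda>z::real^'d. kern 1 z * f x)" "(LINT z|lborel. kern 1 (z::real^'d) * f x) = f x"
      by (auto simp: kern_integral intro!: integrable_mult_left kern_integrable)
    ultimately show ?thesis
      by (subst conv_kern_scale[OF _ fm]) (simp_all add: right_diff_distrib inverse_eq_divide del: of_nat_Suc)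
  qed
  have "(\<lambda>n. Lp_norm_on lborel p (\<lambda>x. conv (kern (real (Suc n))) f x - f x)) \<longlonglongrightarrow> 0"
    unfolding eq using approx_identity[OF p f kern_integrable[of 1], of "\<lambda>n. - inverse (real (Suc n))"]
      tendsto_minus[OF LIMSEQ_inverse_real_of_nat] by simp
  then obtain n where n: "Lp_norm_on lborel p (\<lambda>x. conv (kern (real (Suc n))) f x - f x) < \<epsilon> / 2"
    using order_tendstoD(2)[of _ 0 sequentially "\<epsilon> / 2"] \<epsilon> by (fastforce simp: eventually_sequentially)
  define b where "b = real (Suc n)"
  have b: "b > 0" by (simp add: b_def)
  \<comment> \<open>The mean enlarges norms by at most \<open>?A\<close>; the added 1 keeps the
    divisor positive.\<close>
  obtain h R where h: "h \<in> Lp_on lborel p" "\<And>x. norm x > R \<Longrightarrow> h x = 0"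
    and he: "Lp_norm_on lborel p (\<lambda>x. h x - f x) < \<epsilon> / 2 / (?A + 1)"
    using truncated_approximation[OF p f, of "\<epsilon> / 2 / (?A + 1)"] \<epsilon> A0 by (metis add_nonneg_pos divide_pos_pos half_gt_zero zero_less_one)
  have hf: "(\<lambda>x. h x - f x) \<in> Lp_on lborel p" by (rule Lp_on_diff(1)[OF p h(1) f])
  let ?P = "conv (kern b) h"
  obtain B where B: "\<And>x::real^'d. \<bar>kern b x\<bar> \<le> B" using kern_bound_ex by blast
  have 0: "?P \<in> band_limited p b" by (rule conv_kern_band_limited[OF p b order_refl h])
  have PS: "?P \<in> Lp_on lborel p" by (rule conv_kern_Lp_on(1)[OF p b h(1)])
  have 1: "Lp_norm_on lborel p (\<lambda>x. ?P x - f x) \<le> \<epsilon>"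
  proof -
    have "(\<lambda>x. ?P x - f x) = (\<lambda>x. conv (kern b) (\<lambda>x. h x - f x) x + (conv (kern b) f x - f x))"
      by (simp add: fun_eq_iff conv_add(2)[OF p kern_integrable[OF b] B h(1) f])
    then have "Lp_norm_on lborel p (\<lambda>x. ?P x - f x) \<le> Lp_norm_on lborel p (conv (kern b) (\<lambda>x. h x - f x)) + Lp_norm_on lborel p (\<lambda>x. conv (kern b) f x - f x)"
      using Lp_norm_on_triangle[OF p conv_kern_Lp_on(1)[OF p b hf] Lp_on_diff(1)[OF p conv_kern_Lp_on(1)[OF p b f] f]] by simp
    moreover have "Lp_norm_on lborel p (conv (kern b) (\<lambda>x. h x - f x)) \<le> (?A + 1) * Lp_norm_on lborel p (\<lambda>x. h x - f x)"
      using conv_kern_Lp_on(2)[OF p b hf] by (simp add: distrib_right add_increasing2)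
    moreover have "(?A + 1) * Lp_norm_on lborel p (\<lambda>x. h x - f x) \<le> \<epsilon> / 2"
      using he A0 by (simp add: field_simps)
    ultimately show ?thesis using n by (simp add: b_def)
  qed
  have 2: "?P \<in> lp_space p X" if "b \<le> \<sigma>" "separated (\<gamma> / \<sigma>) X" for \<sigma> X
    using PC(2) b that h(1) by blast
  have 3: "\<exists>\<sigma>0>0. \<forall>\<sigma> X. \<sigma>0 \<le> \<sigma> \<longrightarrow> separated (\<gamma> / \<sigma>) X \<longrightarrow>
       (\<lambda>x. averaged (\<gamma> / \<sigma>) r ?P x - ?P x) \<in> lp_space p X \<and> lp_norm p \<sigma> X (\<lambda>x. averaged (\<gamma> / \<sigma>) r ?P x - ?P x) \<le> e"
    if e: "e > 0" for e
  proof -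
    have "e / PC > 0" using e PC by simp
    then obtain d where d: "d > 0" "\<And>\<delta>. 0 < \<delta> \<Longrightarrow> \<delta> < d \<Longrightarrow> Lp_norm_on lborel p (\<lambda>x. averaged \<delta> r h x - h x) \<le> e / PC"
      using averaged_diff_tendsto_0[OF p h(1) r] by blast
    \<comment> \<open>The threshold \<open>b\<close> is the one of \<open>plancherel_polya\<close>,
      and \<open>\<gamma> / d + 1\<close> forces the radius \<open>\<gamma> / \<sigma>\<close> below
      \<open>d\<close>.\<close>
    have "(\<lambda>x. averaged (\<gamma> / \<sigma>) r ?P x - ?P x) \<in> lp_space p X \<and> lp_norm p \<sigma> X (\<lambda>x. averaged (\<gamma> / \<sigma>) r ?P x - ?P x) \<le> e"
      if \<sigma>: "max b (\<gamma> / d + 1) \<le> \<sigma>" and X: "separated (\<gamma> / \<sigma>) X" for \<sigma> X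
    proof -
      have \<sigma>0: "\<sigma> > 0" "b \<le> \<sigma>" "\<gamma> / d < \<sigma>" using \<sigma> b by auto
      have \<delta>: "0 < \<gamma> / \<sigma>" "\<gamma> / \<sigma> < d" using \<sigma>0 \<gamma> d(1) by (auto simp: field_simps)
      have ah: "(\<lambda>x. averaged (\<gamma> / \<sigma>) r h x - h x) \<in> Lp_on lborel p" by (rule averaged_diff_Lp_on(1)[OF p h(1) \<delta>(1) r])
      have eq: "(\<lambda>x. averaged (\<gamma> / \<sigma>) r ?P x - ?P x) = conv (kern b) (\<lambda>x. averaged (\<gamma> / \<sigma>) r h x - h x)"
        by (simp add: fun_eq_iff averaged_conv[OF p kern_integrable[OF b] B h(1) \<delta>(1)]
            conv_add(2)[OF p kern_integrable[OF b] B averaged_Lp_on[OF p h(1) \<delta>(1) r] h(1)])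
      have "PC * Lp_norm_on lborel p (\<lambda>x. averaged (\<gamma> / \<sigma>) r h x - h x) \<le> PC * (e / PC)"
        using d(2)[OF \<delta>] PC by (intro mult_left_mono) auto
      then have "PC * Lp_norm_on lborel p (\<lambda>x. averaged (\<gamma> / \<sigma>) r h x - h x) \<le> e" using PC(1) by simp
      then show ?thesis unfolding eq using PC(2)[rule_format, OF b \<sigma>0(2) X ah] by auto
    qed
    moreover have "max b (\<gamma> / d + 1) > 0" using b by simp
    ultimately show ?thesis by blast
  qed
  show ?thesis using b 0 PS 1 2 3 by blast
qed

section \<open>The inverse estimate\<close>

lemma AE_lborel_shift:
  assumes "AE x in (lborel :: 'a::euclidean_space measure). P x"
  shows "AE x in lborel. P (x + c)"
proof -
  have "AE x in distr lborel borel ((+) c). P x"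
    using assms by (simp only: lborel_distr_plus)
  then have "AE x in lborel. P (c + x)"
    by (rule AE_distrD[rotated]) simp
  then show ?thesis by (simp add: add.commute)
qed

lemma finite_diff_cong_AE:
  fixes f f' :: "real^'d \<Rightarrow> real"
  assumes "AE x in lborel. f x = f' x"
  shows "AE x in lborel. finite_diff s h f x = finite_diff s h f' x"
proof -
  have "AE x in lborel. \<forall>\<nu>. f (x + real (s - \<nu>) *\<^sub>R h) = f' (x + real (s - \<nu>) *\<^sub>R h)"
    unfolding AE_all_countable by (intro allI AE_lborel_shift assms)
  then show ?thesis by eventually_elim (simp only: finite_diff_def)
qed

lemma finite_diff_Lp_borel:
  fixes f f' :: "real^'d \<Rightarrow> real"
  assumes f': "f' \<in> borel_measurable borel" and ae: "AE x in lborel. f x = f' x"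
  shows "Lp_norm p (finite_diff s h f) = Lp_norm_on lborel p (finite_diff s h f')"
proof -
  have ae': "AE x in lborel. finite_diff s h f x = finite_diff s h f' x" by (rule finite_diff_cong_AE[OF ae])
  have m: "finite_diff s h f' \<in> borel_measurable borel" using f' by measurable
  have "finite_diff s h f \<in> borel_measurable lebesgue"
  proof (rule borel_measurable_AE)
    show "finite_diff s h f' \<in> borel_measurable lebesgue" using m by (intro measurable_completion) simp
    have "AE x in lborel. finite_diff s h f' x = finite_diff s h f x" using ae' by eventually_elim simp
    then show "AE x in lebesgue. finite_diff s h f' x = finite_diff s h f x" by (rule AE_completion)
  qed
  then show ?thesis by (rule Lp_space_borel_version(2)[OF _ m ae'])
qed

section \<open>Triangle inequalities and comparison of sampling norms\<close>

lemma Lp_triangle: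
  assumes p: "p \<ge> 1" and f: "f \<in> Lp_space p" and g: "g \<in> Lp_space p"
  shows "(\<lambda>x. f x + g x) \<in> Lp_space p" "(\<lambda>x. f x - g x) \<in> Lp_space p"
    and "Lp_norm p (\<lambda>x. f x + g x) \<le> Lp_norm p f + Lp_norm p g"
    and "Lp_norm p (\<lambda>x. f x - g x) \<le> Lp_norm p f + Lp_norm p g"
  using Lp_on_add[OF p, of f lebesgue g] Lp_on_diff[OF p, of f lebesgue g] f g
  by (simp_all add: Lp_space_eq_Lp_on)

lemma Lp_norm_commute: "Lp_norm p (\<lambda>x. f x - g x) = Lp_norm p (\<lambda>x. g x - f x)"
  by (simp add: Lp_norm_def abs_minus_commute)

lemma Lp_norm_triangle3:
  assumes p: "p \<ge> 1" and f: "f \<in> Lp_space p" and g: "g \<in> Lp_space p" and h: "h \<in> Lp_space p"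
  shows "Lp_norm p (\<lambda>x. f x - h x) \<le> Lp_norm p (\<lambda>x. f x - g x) + Lp_norm p (\<lambda>x. g x - h x)"
  using Lp_triangle(3)[OF p Lp_triangle(2)[OF p f g] Lp_triangle(2)[OF p g h]] by simp

lemma lp_cong:
  assumes "\<And>\<xi>. \<xi> \<in> X \<Longrightarrow> u \<xi> = v \<xi>"
  shows "u \<in> lp_space p X \<longleftrightarrow> v \<in> lp_space p X" "lp_norm p \<sigma> X u = lp_norm p \<sigma> X v"
proof -
  show "u \<in> lp_space p X \<longleftrightarrow> v \<in> lp_space p X"
    unfolding lp_space_def mem_Collect_eq by (rule summable_on_cong) (simp add: assms)
  have "(\<Sum>\<^sub>\<infinity>\<xi>\<in>X. \<bar>u \<xi>\<bar> powr p) = (\<Sum>\<^sub>\<infinity>\<xi>\<in>X. \<bar>v \<xi>\<bar> powr p)"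
    by (rule infsum_cong) (simp add: assms)
  then show "lp_norm p \<sigma> X u = lp_norm p \<sigma> X v" by (simp add: lp_norm_def)
qed

lemma lp_space_subset: "u \<in> lp_space p Y \<Longrightarrow> X \<subseteq> Y \<Longrightarrow> u \<in> lp_space p X"
  unfolding lp_space_def mem_Collect_eq by (rule summable_on_subset_banach)

text \<open>Dropping points only decreases the sum, while halving the parameter enlarges the
  normalising factor by \<open>2 ^ CARD('d)\<close>, of which the root of order \<open>p\<close>
  remains.\<close>

lemma lp_norm_double:
  fixes X Y :: "(real^'d) set"
  assumes p: "p \<ge> 1" and \<tau>: "\<tau> > 0" and u: "u \<in> lp_space p Y" and XY: "X \<subseteq> Y"
  shows "lp_norm p \<tau> X u \<le> (2 ^ CARD('d)) powr (1 / p) * lp_norm p (2 * \<tau>) Y u"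
proof -
  have "(\<Sum>\<^sub>\<infinity>\<xi>\<in>X. \<bar>u \<xi>\<bar> powr p) \<le> (\<Sum>\<^sub>\<infinity>\<xi>\<in>Y. \<bar>u \<xi>\<bar> powr p)"
    by (rule infsum_mono2) (use u lp_space_subset[OF u XY] XY in \<open>auto simp: lp_space_def\<close>)
  then have "1 / \<tau> ^ CARD('d) * (\<Sum>\<^sub>\<infinity>\<xi>\<in>X. \<bar>u \<xi>\<bar> powr p) \<le> 1 / \<tau> ^ CARD('d) * (\<Sum>\<^sub>\<infinity>\<xi>\<in>Y. \<bar>u \<xi>\<bar> powr p)"
    using \<tau> by (intro mult_left_mono) auto
  also have "\<dots> = 2 ^ CARD('d) * (1 / (2 * \<tau>) ^ CARD('d) * (\<Sum>\<^sub>\<infinity>\<xi>\<in>Y. \<bar>u \<xi>\<bar> powr p))"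
    by (simp add: power_mult_distrib)
  finally have "lp_norm p \<tau> X u \<le> (2 ^ CARD('d) * (1 / (2 * \<tau>) ^ CARD('d) * (\<Sum>\<^sub>\<infinity>\<xi>\<in>Y. \<bar>u \<xi>\<bar> powr p))) powr (1 / p)"
    unfolding lp_norm_def using p \<tau> by (intro powr_mono2) (auto intro!: mult_nonneg_nonneg divide_nonneg_nonneg infsum_nonneg)
  then show ?thesis by (simp only: lp_norm_def powr_mult)
qed

lemma band_limited_mono: "a \<le> b \<Longrightarrow> band_limited p a \<subseteq> (band_limited p b :: (real^'d \<Rightarrow> real) set)"
proof -
  assume "a \<le> b"
  then have "cbox (\<chi> i. - a) (\<chi> i. a) \<subseteq> (cbox (\<chi> i. - b) (\<chi> i. b) :: (real^'d) set)"
    by (intro subset_box_imp) (auto simp: Basis_vec_def inner_axis)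
  then show ?thesis by (auto simp: band_limited_def)
qed

text \<open>All data except \<open>f\<close> are fixed here, so a constant obtained before
  \<open>f\<close> and \<sigma> are introduced is automatically independent of both.\<close>

locale sampling =
  fixes p \<gamma> lam \<kappa>\<^sub>1 \<kappa>\<^sub>2 \<kappa>\<^sub>3 :: real and r s :: nat
    and X :: "real \<Rightarrow> (real^'d) set" and \<psi> :: "real \<Rightarrow> real^'d \<Rightarrow> real^'d \<Rightarrow> real"
  assumes p: "1 \<le> p" and r: "1 \<le> r" and s: "1 \<le> s" and sr: "s \<le> 2 * r"
    and \<gamma>: "0 < \<gamma>" "\<gamma> \<le> 1" and lam: "0 < lam" "lam \<le> 1"
    and \<kappa>: "0 < \<kappa>\<^sub>1" "0 < \<kappa>\<^sub>2" "0 < \<kappa>\<^sub>3"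
    and sep: "sampling_sets \<gamma> X"
    and defined: "\<And>\<sigma>. \<sigma> > 0 \<Longrightarrow> sampling_op_defined p X \<psi> \<sigma>"
    and A1: "\<And>\<sigma>. \<sigma> > 0 \<Longrightarrow> cond_A1 p X \<psi> \<kappa>\<^sub>1 \<sigma>"
    and A2: "\<And>\<sigma>. \<sigma> > 0 \<Longrightarrow> cond_A2 p X \<psi> \<kappa>\<^sub>2 \<sigma>"
    and A3: "\<And>\<sigma>. \<sigma> > 0 \<Longrightarrow> cond_A3 p s X \<psi> \<kappa>\<^sub>3 lam \<sigma>"
    and nested: "\<And>\<sigma>. \<sigma> > 0 \<Longrightarrow> X \<sigma> \<subseteq> X (2 * \<sigma>)"
begin

abbreviation G :: "real \<Rightarrow> (real^'d \<Rightarrow> real) \<Rightarrow> real^'d \<Rightarrow> real" where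
  "G \<equiv> sampling_op X \<psi>"

lemma separated_X: "\<sigma> > 0 \<Longrightarrow> separated (\<gamma> / \<sigma>) (X \<sigma>)"
  using sep by (auto simp: separated_def sampling_sets_def)

lemma G_cong: "(\<And>\<xi>. \<xi> \<in> X \<sigma> \<Longrightarrow> u \<xi> = v \<xi>) \<Longrightarrow> G \<sigma> u = G \<sigma> v"
  unfolding sampling_op_def fun_eq_iff by (intro allI infsum_cong) simp

lemma G_Lp: "\<sigma> > 0 \<Longrightarrow> u \<in> Lp_space p \<Longrightarrow> u \<in> lp_space p (X \<sigma>) \<Longrightarrow> G \<sigma> u \<in> Lp_space p"
  using A1 by (auto simp: cond_A1_def)

text \<open>An unconditional sum that fails to converge has the value 0, so linearity is not
  automatic; it rests on the pointwise convergence granted by \<open>defined\<close>.\<close>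

lemma G_diff:
  assumes \<sigma>: "\<sigma> > 0" and u: "u \<in> Lp_space p" "u \<in> lp_space p (X \<sigma>)" and v: "v \<in> Lp_space p" "v \<in> lp_space p (X \<sigma>)"
  shows "G \<sigma> (\<lambda>x. u x - v x) = (\<lambda>x. G \<sigma> u x - G \<sigma> v x)"
proof
  fix x
  have su: "(\<lambda>\<xi>. u \<xi> * \<psi> \<sigma> \<xi> x) summable_on X \<sigma>" and sv: "(\<lambda>\<xi>. v \<xi> * \<psi> \<sigma> \<xi> x) summable_on X \<sigma>"
    using defined[OF \<sigma>] u v by (auto simp: sampling_op_defined_def)
  then have "(\<lambda>\<xi>. - (v \<xi> * \<psi> \<sigma> \<xi> x)) summable_on X \<sigma>" by (simp add: summable_on_uminus)
  from infsum_add[OF su this] show "G \<sigma> (\<lambda>x. u x - v x) x = G \<sigma> u x - G \<sigma> v x"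
    by (simp add: sampling_op_def left_diff_distrib infsum_uminus)
qed

lemma G_diff_bounds:
  assumes \<sigma>: "\<sigma> > 0" and u: "u \<in> Lp_space p" "u \<in> lp_space p (X \<sigma>)" and v: "v \<in> Lp_space p" "v \<in> lp_space p (X \<sigma>)"
  shows "Lp_norm p (\<lambda>x. G \<sigma> u x - G \<sigma> v x) \<le> \<kappa>\<^sub>1 * lp_norm p \<sigma> (X \<sigma>) (\<lambda>x. u x - v x)"
    and "\<kappa>\<^sub>2 * lp_norm p \<sigma> (X \<sigma>) (\<lambda>x. u x - v x) \<le> Lp_norm p (\<lambda>x. G \<sigma> u x - G \<sigma> v x)"
proof -
  have d: "(\<lambda>x. u x - v x) \<in> Lp_space p \<inter> lp_space p (X \<sigma>)"
    using Lp_triangle(2)[OF p u(1) v(1)] lp_triangle(2)[OF p \<sigma> u(2) v(2)] by simp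
  show "Lp_norm p (\<lambda>x. G \<sigma> u x - G \<sigma> v x) \<le> \<kappa>\<^sub>1 * lp_norm p \<sigma> (X \<sigma>) (\<lambda>x. u x - v x)"
    using A1[OF \<sigma>] d by (simp add: cond_A1_def G_diff[OF \<sigma> u v, symmetric])
  show "\<kappa>\<^sub>2 * lp_norm p \<sigma> (X \<sigma>) (\<lambda>x. u x - v x) \<le> Lp_norm p (\<lambda>x. G \<sigma> u x - G \<sigma> v x)"
    using A2[OF \<sigma>] d by (simp add: cond_A2_def G_diff[OF \<sigma> u v, symmetric])
qed

text \<open>A function of band \<open>lam * \<tau>\<close> also has the larger band
  \<open>lam * T\<close>. Hence one approximant built at scale \<open>\<tau>\<close> can be used
  with \<open>G \<tau>\<close> as well as with \<open>G (2 * \<tau>)\<close>, at the rate of the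
  coarser scale.\<close>

lemma A3_bound:
  assumes \<tau>: "0 < \<tau>" "\<tau> \<le> T" and P: "P \<in> band_limited p (lam * \<tau>)"
  shows "Lp_norm p (\<lambda>x. P x - G T P x) \<le> \<kappa>\<^sub>3 * (Sobolev_seminorm p s P / \<tau> ^ s)"
proof -
  have T: "T > 0" using \<tau> by simp
  have "lam * \<tau> \<le> lam * T" using \<tau> lam by simp
  then have "P \<in> band_limited p (lam * T)" using band_limited_mono P by blast
  then have "Lp_norm p (\<lambda>x. P x - G T P x) \<le> \<kappa>\<^sub>3 * T powr (- real s) * Sobolev_seminorm p s P"
    using A3[OF T] by (simp add: cond_A3_def)
  also have "\<dots> = \<kappa>\<^sub>3 * (Sobolev_seminorm p s P / T ^ s)"
    using T by (simp add: powr_minus powr_realpow divide_inverse)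
  also have "\<dots> \<le> \<kappa>\<^sub>3 * (Sobolev_seminorm p s P / \<tau> ^ s)"
    using \<tau> \<kappa> by (intro mult_left_mono divide_left_mono power_mono mult_pos_pos) auto
  finally show ?thesis .
qed

text \<open>All properties of the approximant at scale \<open>\<tau>\<close> with a common error
  bound \<open>E\<close>. Samples are required for every \<open>\<sigma> \<ge> \<tau>\<close>
  because \<open>P\<close> is sampled on \<open>X (2 * \<tau>)\<close> as well as on
  \<open>X \<tau>\<close>.\<close>

definition good_approximant :: "(real^'d \<Rightarrow> real) \<Rightarrow> real \<Rightarrow> real \<Rightarrow> (real^'d \<Rightarrow> real) \<Rightarrow> bool" where
  "good_approximant g \<tau> E P \<longleftrightarrow> P \<in> band_limited p (lam * \<tau>) \<and> P \<in> Lp_on lborel p \<and>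
     Lp_norm p (\<lambda>x. P x - g x) \<le> E \<and> Sobolev_seminorm p s P / \<tau> ^ s \<le> E \<and>
     (\<forall>\<sigma>\<ge>\<tau>. P \<in> lp_space p (X \<sigma>)) \<and>
     (\<lambda>x. averaged (\<gamma> / \<tau>) r P x - P x) \<in> lp_space p (X \<tau>) \<and>
     lp_norm p \<tau> (X \<tau>) (\<lambda>x. averaged (\<gamma> / \<tau>) r P x - P x) \<le> E"

lemma good_approximant_exists:
  "\<exists>C>0. \<forall>g\<in>Sobolev_space p s. \<forall>\<tau>>0. \<forall>\<epsilon>>0. \<exists>P. good_approximant g \<tau> (C * (Sobolev_seminorm p s g / \<tau> ^ s) + \<epsilon>) P"
proof -
  obtain C where C: "C > 0" "\<forall>(g :: real^'d \<Rightarrow> real) S \<tau> \<epsilon>. g \<in> Lp_on lborel p \<longrightarrow> S \<ge> 0 \<longrightarrow>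
    (\<forall>\<alpha>\<in>multi_indices s. \<exists>v\<in>Lp_on lborel p. weak_pair \<alpha> g v \<and> Lp_norm_on lborel p v \<le> S) \<longrightarrow> \<tau> > 0 \<longrightarrow> \<epsilon> > 0 \<longrightarrow>
    (\<exists>P. P \<in> band_limited p (lam * \<tau>) \<and> P \<in> Lp_on lborel p \<and>
      Lp_norm_on lborel p (\<lambda>x. P x - g x) \<le> C * (S / \<tau> ^ s) + \<epsilon> \<and>
      Sobolev_seminorm p s P / \<tau> ^ s \<le> C * (S / \<tau> ^ s) + \<epsilon> \<and>
      (\<forall>\<sigma> X. \<tau> \<le> \<sigma> \<longrightarrow> separated (\<gamma> / \<sigma>) X \<longrightarrow> P \<in> lp_space p X) \<and>
      (\<forall>X. separated (\<gamma> / \<tau>) X \<longrightarrow> (\<lambda>x. averaged (\<gamma> / \<tau>) r P x - P x) \<in> lp_space p X \<and>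
        lp_norm p \<tau> X (\<lambda>x. averaged (\<gamma> / \<tau>) r P x - P x) \<le> C * (S / \<tau> ^ s) + \<epsilon>))"
    using band_limited_approximant[OF p r sr \<gamma> lam] by blast
  have "\<exists>P. good_approximant g \<tau> (C * (Sobolev_seminorm p s g / \<tau> ^ s) + \<epsilon>) P"
    if g: "g \<in> Sobolev_space p s" and \<tau>: "\<tau> > 0" and \<epsilon>: "\<epsilon> > 0" for g \<tau> \<epsilon>
  proof -
    let ?E = "C * (Sobolev_seminorm p s g / \<tau> ^ s) + \<epsilon>"
    obtain g' where g': "g' \<in> Lp_on lborel p" and ae: "AE x in lborel. g x = g' x"
      and v: "\<forall>\<alpha>\<in>multi_indices s. \<exists>v\<in>Lp_on lborel p. weak_pair \<alpha> g' v \<and> Lp_norm_on lborel p v \<le> Sobolev_seminorm p s g"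
      using Sobolev_borel[OF p g] by blast
    obtain P where P: "P \<in> band_limited p (lam * \<tau>)" "P \<in> Lp_on lborel p" "Lp_norm_on lborel p (\<lambda>x. P x - g' x) \<le> ?E"
      "Sobolev_seminorm p s P / \<tau> ^ s \<le> ?E"
      "\<forall>\<sigma> X. \<tau> \<le> \<sigma> \<longrightarrow> separated (\<gamma> / \<sigma>) X \<longrightarrow> P \<in> lp_space p X"
      "\<forall>X. separated (\<gamma> / \<tau>) X \<longrightarrow> (\<lambda>x. averaged (\<gamma> / \<tau>) r P x - P x) \<in> lp_space p X \<and>
        lp_norm p \<tau> X (\<lambda>x. averaged (\<gamma> / \<tau>) r P x - P x) \<le> ?E"
      using C(2)[rule_format, OF g' Sobolev_seminorm_nonneg v[rule_format] \<tau> \<epsilon>] by blast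
    have gm: "g \<in> borel_measurable lebesgue" using g by (simp add: Sobolev_space_def Lp_space_def)
    have g'm: "g' \<in> borel_measurable borel" and Pm: "P \<in> borel_measurable borel" using g' P(2) by (auto simp: Lp_on_def)
    have "Lp_norm p (\<lambda>x. P x - g x) = Lp_norm_on lborel p (\<lambda>x. P x - g' x)"
    proof (rule Lp_space_borel_version(2))
      show "(\<lambda>x. P x - g x) \<in> borel_measurable lebesgue"
        using gm measurable_completion[of P lborel borel] Pm by (intro borel_measurable_diff) auto
      show "(\<lambda>x. P x - g' x) \<in> borel_measurable borel" using Pm g'm by measurable
      show "AE x in lborel. P x - g x = P x - g' x" using ae by eventually_elim simp
    qed
    moreover have "P \<in> lp_space p (X \<sigma>)" if "\<sigma> \<ge> \<tau>" for \<sigma>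
      using P(5) that separated_X[of \<sigma>] \<tau> by auto
    ultimately show ?thesis
      using P separated_X[OF \<tau>] unfolding good_approximant_def by auto
  qed
  then show ?thesis using C(1) by blast
qed

lemma good_approximant_Lp: "good_approximant g \<tau> E P \<Longrightarrow> P \<in> Lp_space p"
  by (simp add: good_approximant_def band_limited_def)

text \<open>A small norm of \<open>P - g\<close> says nothing about samples. As \<open>g\<close> is
  a fixed point of \<open>G T\<close>, (A2) bounds the samples of \<open>P - g\<close> by the norm
  of \<open>G T P - g\<close>, and \<open>P\<close> can be inserted between the two: one part is
  (A3), the other the approximation error.\<close>

lemma good_approximant_sample_error:
  assumes n: "good_approximant g \<tau> E P" and \<tau>: "0 < \<tau>" "\<tau> \<le> T"
    and g: "g \<in> Lp_space p" "g \<in> lp_space p (X T)" and GT: "G T g = g"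
  shows "lp_norm p T (X T) (\<lambda>x. P x - g x) \<le> (1 + \<kappa>\<^sub>3) / \<kappa>\<^sub>2 * E"
proof -
  have T: "T > 0" using \<tau> by simp
  have P: "P \<in> Lp_space p" "P \<in> lp_space p (X T)" using good_approximant_Lp[OF n] n \<tau> by (auto simp: good_approximant_def)
  have GP: "G T P \<in> Lp_space p" by (rule G_Lp[OF T P])
  have "\<kappa>\<^sub>2 * lp_norm p T (X T) (\<lambda>x. P x - g x) \<le> Lp_norm p (\<lambda>x. G T P x - g x)"
    using G_diff_bounds(2)[OF T P g] GT by simp
  also have "\<dots> \<le> Lp_norm p (\<lambda>x. G T P x - P x) + Lp_norm p (\<lambda>x. P x - g x)"
    by (rule Lp_norm_triangle3[OF p GP P(1) g(1)])
  also have "Lp_norm p (\<lambda>x. G T P x - P x) \<le> \<kappa>\<^sub>3 * (Sobolev_seminorm p s P / \<tau> ^ s)"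
    using A3_bound[OF \<tau>] n by (simp add: Lp_norm_commute[of p "G T P"] good_approximant_def)
  also have "\<dots> \<le> \<kappa>\<^sub>3 * E" using n \<kappa> by (intro mult_left_mono) (auto simp: good_approximant_def)
  also have "Lp_norm p (\<lambda>x. P x - g x) \<le> E" using n by (simp add: good_approximant_def)
  finally have "\<kappa>\<^sub>2 * lp_norm p T (X T) (\<lambda>x. P x - g x) \<le> \<kappa>\<^sub>3 * E + E" by simp
  then have "lp_norm p T (X T) (\<lambda>x. P x - g x) \<le> (\<kappa>\<^sub>3 * E + E) / \<kappa>\<^sub>2"
    using \<kappa> by (simp add: pos_le_divide_eq mult.commute)
  then show ?thesis by (simp add: algebra_simps)
qed

section \<open>Error estimates for functions interpolated by the sampling operator\<close>

definition admissible :: "(real^'d \<Rightarrow> real) \<Rightarrow> bool" where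
  "admissible f \<longleftrightarrow> f \<in> Lp_space p \<and> (\<forall>\<sigma>>0. f \<in> lp_space p (X \<sigma>)) \<and>
     (\<forall>\<sigma>>0. G \<sigma> f \<in> Sobolev_space p s) \<and> (\<forall>\<sigma>>0. \<forall>\<xi>\<in>X \<sigma>. G \<sigma> f \<xi> = f \<xi>)"

lemma admissible_G:
  assumes f: "admissible f" and \<sigma>: "\<sigma> > 0"
  shows "G \<sigma> f \<in> Lp_space p" "G \<sigma> f \<in> lp_space p (X \<sigma>)" "G \<sigma> (G \<sigma> f) = G \<sigma> f"
proof -
  have eq: "\<And>\<xi>. \<xi> \<in> X \<sigma> \<Longrightarrow> G \<sigma> f \<xi> = f \<xi>" using f \<sigma> by (simp add: admissible_def)
  show "G \<sigma> f \<in> Lp_space p" using f \<sigma> by (simp add: admissible_def Sobolev_space_def)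
  show "G \<sigma> f \<in> lp_space p (X \<sigma>)" using lp_cong(1)[of "X \<sigma>" "G \<sigma> f" f p] eq f \<sigma> by (simp add: admissible_def)
  show "G \<sigma> (G \<sigma> f) = G \<sigma> f" by (rule G_cong[OF eq])
qed

text \<open>With \<open>g\<close> short for \<open>G (2 * \<tau>) f\<close>, the path from
  \<open>g\<close> to \<open>G \<tau> f\<close> leads through \<open>P\<close> and
  \<open>G \<tau> P\<close>. Its last section is a difference of two values of
  \<open>G \<tau>\<close>, namely at \<open>P\<close> and at \<open>g\<close>, since
  \<open>G \<tau> g = G \<tau> f\<close>.\<close>

lemma consecutive_difference:
  "\<exists>K>0. \<forall>f \<tau>. admissible f \<longrightarrow> \<tau> > 0 \<longrightarrow>
     Lp_norm p (\<lambda>x. G (2 * \<tau>) f x - G \<tau> f x) \<le> K * (Sobolev_seminorm p s (G (2 * \<tau>) f) / \<tau> ^ s)"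
proof -
  obtain C where C: "C > 0" "\<And>g \<tau> \<epsilon>. g \<in> Sobolev_space p s \<Longrightarrow> \<tau> > 0 \<Longrightarrow> \<epsilon> > 0 \<Longrightarrow>
      \<exists>P. good_approximant g \<tau> (C * (Sobolev_seminorm p s g / \<tau> ^ s) + \<epsilon>) P"
    using good_approximant_exists by blast
  \<comment> \<open>The first factor is the cost of passing from \<open>X (2 * \<tau>)\<close> to
    \<open>X \<tau>\<close>, the second the constant of
    \<open>good_approximant_sample_error\<close>.\<close>
  define D where "D = (2 ^ CARD('d)) powr (1 / p) * ((1 + \<kappa>\<^sub>3) / \<kappa>\<^sub>2)"
  have D: "D \<ge> 0" using \<kappa> by (auto simp: D_def)
  define K where "K = 1 + \<kappa>\<^sub>3 + \<kappa>\<^sub>1 * D"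
  have K: "K > 0" using \<kappa> D by (simp add: K_def add_pos_nonneg)
  have "Lp_norm p (\<lambda>x. G (2 * \<tau>) f x - G \<tau> f x) \<le> (K * C) * (Sobolev_seminorm p s (G (2 * \<tau>) f) / \<tau> ^ s)"
    if f: "admissible f" and \<tau>: "\<tau> > 0" for f \<tau>
  proof (rule field_le_epsilon)
    fix e :: real assume e: "e > 0"
    let ?g = "G (2 * \<tau>) f" and ?S = "Sobolev_seminorm p s (G (2 * \<tau>) f)"
    have T: "2 * \<tau> > 0" "\<tau> \<le> 2 * \<tau>" using \<tau> by auto
    note gG = admissible_G[OF f T(1)]
    have gS: "?g \<in> Sobolev_space p s" using f T by (simp add: admissible_def)
    \<comment> \<open>The slack \<open>e / K\<close> is chosen so that the three errors, together at
      most \<open>K * E\<close>, exceed the desired bound by \<open>e\<close> only.\<close>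
    define E where "E = C * (?S / \<tau> ^ s) + e / K"
    obtain P where n: "good_approximant ?g \<tau> E P"
      using C(2)[OF gS \<tau>, of "e / K"] e K by (auto simp: E_def)
    have P: "P \<in> Lp_space p" "P \<in> lp_space p (X \<tau>)" "P \<in> lp_space p (X (2 * \<tau>))"
      using good_approximant_Lp[OF n] n T by (auto simp: good_approximant_def)
    have gX: "?g \<in> lp_space p (X \<tau>)" by (rule lp_space_subset[OF gG(2) nested[OF \<tau>]])
    have Gg: "G \<tau> ?g = G \<tau> f"
      by (rule G_cong) (use f T nested[OF \<tau>] in \<open>auto simp: admissible_def\<close>)
    have GP: "G \<tau> P \<in> Lp_space p" by (rule G_Lp[OF \<tau> P(1,2)])
    have Gf: "G \<tau> f \<in> Lp_space p" by (rule admissible_G(1)[OF f \<tau>])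
    have "Lp_norm p (\<lambda>x. ?g x - G \<tau> f x) \<le> Lp_norm p (\<lambda>x. ?g x - P x) + (Lp_norm p (\<lambda>x. P x - G \<tau> P x) + Lp_norm p (\<lambda>x. G \<tau> P x - G \<tau> f x))"
      using Lp_norm_triangle3[OF p gG(1) P(1) Gf] Lp_norm_triangle3[OF p P(1) GP Gf] by linarith
    also have "Lp_norm p (\<lambda>x. ?g x - P x) \<le> E"
      using n by (simp add: Lp_norm_commute[of p ?g] good_approximant_def)
    also have "Lp_norm p (\<lambda>x. P x - G \<tau> P x) \<le> \<kappa>\<^sub>3 * (Sobolev_seminorm p s P / \<tau> ^ s)"
      using A3_bound[OF \<tau> order_refl] n by (simp add: good_approximant_def)
    also have "\<dots> \<le> \<kappa>\<^sub>3 * E" using n \<kappa> by (intro mult_left_mono) (auto simp: good_approximant_def)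
    also have "Lp_norm p (\<lambda>x. G \<tau> P x - G \<tau> f x) \<le> \<kappa>\<^sub>1 * lp_norm p \<tau> (X \<tau>) (\<lambda>x. P x - ?g x)"
      using G_diff_bounds(1)[OF \<tau> P(1,2) gG(1) gX] by (simp add: Gg)
    also have "\<dots> \<le> \<kappa>\<^sub>1 * (D * E)"
    proof -
      have "lp_norm p \<tau> (X \<tau>) (\<lambda>x. P x - ?g x) \<le> (2 ^ CARD('d)) powr (1 / p) * lp_norm p (2 * \<tau>) (X (2 * \<tau>)) (\<lambda>x. P x - ?g x)"
        by (rule lp_norm_double[OF p \<tau> lp_triangle(2)[OF p T(1) P(3) gG(2)] nested[OF \<tau>]])
      also have "\<dots> \<le> (2 ^ CARD('d)) powr (1 / p) * ((1 + \<kappa>\<^sub>3) / \<kappa>\<^sub>2 * E)"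
        by (intro mult_left_mono good_approximant_sample_error[OF n \<tau> T(2) gG]) simp
      finally show ?thesis using \<kappa> by (intro mult_left_mono) (auto simp: D_def)
    qed
    finally have "Lp_norm p (\<lambda>x. ?g x - G \<tau> f x) \<le> K * E"
      by (simp add: K_def algebra_simps)
    also have "\<dots> = (K * C) * (?S / \<tau> ^ s) + e" using K by (simp add: E_def distrib_left)
    finally show "Lp_norm p (\<lambda>x. ?g x - G \<tau> f x) \<le> (K * C) * (?S / \<tau> ^ s) + e" by simp
  qed
  moreover have "K * C > 0" using K C by simp
  ultimately show ?thesis by blast
qed

text \<open>On \<open>X \<sigma>\<close> the value of \<open>f\<close> may be replaced by that of
  \<open>g\<close>, short for \<open>G \<sigma> f\<close>. The error then splits into the average of
  \<open>f - P\<close>, controlled by its norm, the averaged error of \<open>P\<close>, and the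
  samples of \<open>P - g\<close>; no samples of \<open>f - P\<close> have to be estimated.\<close>

lemma averaged_error:
  "\<exists>K>0. \<forall>f \<sigma>. admissible f \<longrightarrow> \<sigma> > 0 \<longrightarrow>
     lp_norm p \<sigma> (X \<sigma>) (\<lambda>x. averaged (\<gamma> / \<sigma>) r f x - f x) \<le>
       K * (Lp_norm p (\<lambda>x. f x - G \<sigma> f x) + Sobolev_seminorm p s (G \<sigma> f) / \<sigma> ^ s)"
proof -
  obtain C where C: "C > 0" "\<And>g \<tau> \<epsilon>. g \<in> Sobolev_space p s \<Longrightarrow> \<tau> > 0 \<Longrightarrow> \<epsilon> > 0 \<Longrightarrow>
      \<exists>P. good_approximant g \<tau> (C * (Sobolev_seminorm p s g / \<tau> ^ s) + \<epsilon>) P"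
    using good_approximant_exists by blast
  obtain B where B: "B > 0" "\<And>\<sigma> X h. 0 < \<sigma> \<Longrightarrow> separated (\<gamma> / \<sigma>) X \<Longrightarrow> h \<in> Lp_on lborel p \<Longrightarrow>
    averaged (\<gamma> / \<sigma>) r h \<in> lp_space p (X :: (real^'d) set) \<and> lp_norm p \<sigma> X (averaged (\<gamma> / \<sigma>) r h) \<le> B * Lp_norm_on lborel p h"
    using averaged_sample_bound[OF p \<gamma>(1) r] by blast
  define D where "D = (1 + \<kappa>\<^sub>3) / \<kappa>\<^sub>2"
  have D: "D \<ge> 0" using \<kappa> by (auto simp: D_def)
  define K where "K = B + 1 + D"
  have K: "K > 0" "B \<le> K" using B D by (auto simp: K_def)
  define L where "L = K * C + B"
  have "K * C > 0" using K(1) C(1) by simp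
  then have L: "L > 0" "B \<le> L" "K * C \<le> L" using B(1) by (auto simp: L_def)
  have "lp_norm p \<sigma> (X \<sigma>) (\<lambda>x. averaged (\<gamma> / \<sigma>) r f x - f x) \<le>
       L * (Lp_norm p (\<lambda>x. f x - G \<sigma> f x) + Sobolev_seminorm p s (G \<sigma> f) / \<sigma> ^ s)"
    if f: "admissible f" and \<sigma>: "\<sigma> > 0" for f \<sigma>
  proof (rule field_le_epsilon)
    fix e :: real assume e: "e > 0"
    let ?g = "G \<sigma> f"
    let ?S = "Sobolev_seminorm p s ?g"
    note gG = admissible_G[OF f \<sigma>]
    have gS: "?g \<in> Sobolev_space p s" using f \<sigma> by (simp add: admissible_def)
    have fL: "f \<in> Lp_space p" and fX: "f \<in> lp_space p (X \<sigma>)" using f \<sigma> by (auto simp: admissible_def)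
    define E where "E = C * (?S / \<sigma> ^ s) + e / K"
    obtain P where n: "good_approximant ?g \<sigma> E P"
      using C(2)[OF gS \<sigma>, of "e / K"] e K by (auto simp: E_def)
    have P: "P \<in> Lp_space p" "P \<in> lp_space p (X \<sigma>)" "P \<in> Lp_on lborel p"
      using good_approximant_Lp[OF n] n by (auto simp: good_approximant_def)
    have fm: "f \<in> borel_measurable lebesgue" using fL by (simp add: Lp_space_def)
    obtain f' where f': "f' \<in> borel_measurable borel" and ae: "AE x in lborel. f x = f' x"
      using borel_version[OF fm] .
    have f'S: "f' \<in> Lp_on lborel p" using fL Lp_space_borel_version(1)[OF fm f' ae] by simp
    have Pm: "P \<in> borel_measurable borel" using P(3) by (simp add: Lp_on_def)
    have \<rho>: "\<gamma> / \<sigma> > 0" using \<gamma> \<sigma> by simp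
    let ?d = "\<lambda>x. f' x - P x"
    have dS: "?d \<in> Lp_on lborel p" by (rule Lp_on_diff(1)[OF p f'S P(3)])
    have dN: "Lp_norm_on lborel p ?d = Lp_norm p (\<lambda>x. f x - P x)"
    proof (rule Lp_space_borel_version(2)[symmetric])
      show "(\<lambda>x. f x - P x) \<in> borel_measurable lebesgue"
        using fm measurable_completion[of P lborel borel] Pm by (intro borel_measurable_diff) auto
      show "?d \<in> borel_measurable borel" using Pm f' by measurable
      show "AE x in lborel. f x - P x = f' x - P x" using ae by eventually_elim simp
    qed
    have a1: "averaged (\<gamma> / \<sigma>) r ?d \<in> lp_space p (X \<sigma>)" "lp_norm p \<sigma> (X \<sigma>) (averaged (\<gamma> / \<sigma>) r ?d) \<le> B * Lp_norm_on lborel p ?d"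
      using B(2)[OF \<sigma> separated_X[OF \<sigma>] dS] by auto
    have a2: "(\<lambda>x. averaged (\<gamma> / \<sigma>) r P x - P x) \<in> lp_space p (X \<sigma>)" "lp_norm p \<sigma> (X \<sigma>) (\<lambda>x. averaged (\<gamma> / \<sigma>) r P x - P x) \<le> E"
      using n by (auto simp: good_approximant_def)
    have a3: "(\<lambda>x. P x - ?g x) \<in> lp_space p (X \<sigma>)" "lp_norm p \<sigma> (X \<sigma>) (\<lambda>x. P x - ?g x) \<le> D * E"
      using lp_triangle(2)[OF p \<sigma> P(2) gG(2)] good_approximant_sample_error[OF n \<sigma> order_refl gG] by (auto simp: D_def)
    have "lp_norm p \<sigma> (X \<sigma>) (\<lambda>x. averaged (\<gamma> / \<sigma>) r f x - f x) =
      lp_norm p \<sigma> (X \<sigma>) (\<lambda>x. averaged (\<gamma> / \<sigma>) r ?d x + ((averaged (\<gamma> / \<sigma>) r P x - P x) + (P x - ?g x)))"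
    proof (rule lp_cong(2))
      fix \<xi> assume "\<xi> \<in> X \<sigma>"
      then have "?g \<xi> = f \<xi>" using f \<sigma> by (simp add: admissible_def)
      then show "averaged (\<gamma> / \<sigma>) r f \<xi> - f \<xi> = averaged (\<gamma> / \<sigma>) r ?d \<xi> + ((averaged (\<gamma> / \<sigma>) r P \<xi> - P \<xi>) + (P \<xi> - ?g \<xi>))"
        by (simp add: averaged_cong_AE[OF \<rho> fm f' ae] averaged_diff[OF p f'S P(3) \<rho>])
    qed
    also have "\<dots> \<le> lp_norm p \<sigma> (X \<sigma>) (averaged (\<gamma> / \<sigma>) r ?d) +
       (lp_norm p \<sigma> (X \<sigma>) (\<lambda>x. averaged (\<gamma> / \<sigma>) r P x - P x) + lp_norm p \<sigma> (X \<sigma>) (\<lambda>x. P x - ?g x))"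
      using lp_triangle(3)[OF p \<sigma> a1(1) lp_triangle(1)[OF p \<sigma> a2(1) a3(1)]] lp_triangle(3)[OF p \<sigma> a2(1) a3(1)] by linarith
    also have "\<dots> \<le> B * (Lp_norm p (\<lambda>x. f x - ?g x) + E) + (E + D * E)"
    proof -
      have "Lp_norm p (\<lambda>x. f x - P x) \<le> Lp_norm p (\<lambda>x. f x - ?g x) + Lp_norm p (\<lambda>x. ?g x - P x)"
        by (rule Lp_norm_triangle3[OF p fL gG(1) P(1)])
      also have "Lp_norm p (\<lambda>x. ?g x - P x) \<le> E" using n by (simp add: Lp_norm_commute[of p ?g] good_approximant_def)
      finally have "B * Lp_norm_on lborel p ?d \<le> B * (Lp_norm p (\<lambda>x. f x - ?g x) + E)"
        using B(1) by (simp add: dN)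
      then show ?thesis using a1(2) a2(2) a3(2) by linarith
    qed
    also have "\<dots> = B * Lp_norm p (\<lambda>x. f x - ?g x) + K * E" by (simp add: K_def algebra_simps)
    also have "K * E = (K * C) * (?S / \<sigma> ^ s) + e" using K by (simp add: E_def distrib_left)
    also have "B * Lp_norm p (\<lambda>x. f x - ?g x) + ((K * C) * (?S / \<sigma> ^ s) + e) \<le> L * Lp_norm p (\<lambda>x. f x - ?g x) + (L * (?S / \<sigma> ^ s) + e)"
      using L \<sigma> by (intro add_mono mult_right_mono divide_nonneg_pos) auto
    finally show "lp_norm p \<sigma> (X \<sigma>) (\<lambda>x. averaged (\<gamma> / \<sigma>) r f x - f x) \<le>
       L * (Lp_norm p (\<lambda>x. f x - ?g x) + ?S / \<sigma> ^ s) + e" by (simp add: distrib_left)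
  qed
  then show ?thesis using L(1) by blast
qed

text \<open>The smooth part \<open>g\<close> contributes through its seminorm with steps below
  \<open>1 / \<sigma>\<close>, and the remainder \<open>f - g\<close> through the trivial factor 2
  per difference.\<close>

lemma modulus_bound:
  fixes f g :: "real^'d \<Rightarrow> real"
  assumes f: "f \<in> Lp_space p" and g: "g \<in> Sobolev_space p s" and \<sigma>: "\<sigma> > 0"
  shows "modulus_of_smoothness p s f (1 / \<sigma>) \<le>
    2 ^ s * Lp_norm p (\<lambda>x. f x - g x) + real CARD('d) ^ s * (Sobolev_seminorm p s g / \<sigma> ^ s)"
  unfolding modulus_of_smoothness_def
proof (rule cSUP_least)
  have "(0::real^'d) \<in> {h. norm h < 1 / \<sigma>}" using \<sigma> by simp
  then show "{h::real^'d. norm h < 1 / \<sigma>} \<noteq> {}" by blast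
  fix h :: "real^'d" assume "h \<in> {h. norm h < 1 / \<sigma>}"
  then have h: "norm h \<le> 1 / \<sigma>" by simp
  have fm: "f \<in> borel_measurable lebesgue" and gm: "g \<in> borel_measurable lebesgue"
    using f g by (auto simp: Lp_space_def Sobolev_space_def)
  obtain f' where f': "f' \<in> borel_measurable borel" and aef: "AE x in lborel. f x = f' x"
    using borel_version[OF fm] .
  have f'S: "f' \<in> Lp_on lborel p" using f Lp_space_borel_version(1)[OF fm f' aef] by simp
  obtain g' where g'S: "g' \<in> Lp_on lborel p" and aeg: "AE x in lborel. g x = g' x"
    and v: "\<forall>\<alpha>\<in>multi_indices s. \<exists>v\<in>Lp_on lborel p. weak_pair \<alpha> g' v \<and> Lp_norm_on lborel p v \<le> Sobolev_seminorm p s g"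
    using Sobolev_borel[OF p g] by blast
  have g': "g' \<in> borel_measurable borel" using g'S by (simp add: Lp_on_def)
  let ?S = "Sobolev_seminorm p s g"
  have d: "(\<lambda>x. f' x - g' x) \<in> Lp_on lborel p" by (rule Lp_on_diff(1)[OF p f'S g'S])
  have dN: "Lp_norm p (\<lambda>x. f x - g x) = Lp_norm_on lborel p (\<lambda>x. f' x - g' x)"
  proof (rule Lp_space_borel_version(2))
    show "(\<lambda>x. f x - g x) \<in> borel_measurable lebesgue" using fm gm by (intro borel_measurable_diff)
    show "(\<lambda>x. f' x - g' x) \<in> borel_measurable borel" using f' g' by measurable
    show "AE x in lborel. f x - g x = f' x - g' x" using aef aeg by eventually_elim simp
  qed
  have eq: "finite_diff s h f' = (\<lambda>x. finite_diff s h (\<lambda>x. f' x - g' x) x + finite_diff s h g' x)"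
    by (simp add: fun_eq_iff finite_diff_diff)
  have "Lp_norm p (finite_diff s h f) = Lp_norm_on lborel p (finite_diff s h f')"
    by (rule finite_diff_Lp_borel[OF f' aef])
  also have "\<dots> \<le> Lp_norm_on lborel p (finite_diff s h (\<lambda>x. f' x - g' x)) + Lp_norm_on lborel p (finite_diff s h g')"
    unfolding eq by (rule Lp_norm_on_triangle[OF p finite_diff_Lp_on(1)[OF p d] finite_diff_Lp_on(1)[OF p g'S]])
  also have "Lp_norm_on lborel p (finite_diff s h (\<lambda>x. f' x - g' x)) \<le> 2 ^ s * Lp_norm_on lborel p (\<lambda>x. f' x - g' x)"
    by (rule finite_diff_Lp_norm_on[OF p d])
  also have "Lp_norm_on lborel p (finite_diff s h g') \<le> (CARD('d) * norm h) ^ s * ?S"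
    by (rule sobolev_finite_diff_bound[OF p g'S]) (use v in blast)
  also have "(CARD('d) * norm h) ^ s * ?S \<le> (CARD('d) * (1 / \<sigma>)) ^ s * ?S"
    using h by (intro mult_right_mono power_mono mult_left_mono) auto
  also have "\<dots> = real CARD('d) ^ s * (?S / \<sigma> ^ s)" by (simp add: power_divide)
  finally show "Lp_norm p (finite_diff s h f) \<le> 2 ^ s * Lp_norm p (\<lambda>x. f x - g x) + real CARD('d) ^ s * (?S / \<sigma> ^ s)"
    by (simp add: dN)
qed

text \<open>The approximant \<open>P\<close> is fixed first and \<sigma> is sent to infinity
  afterwards: its seminorm may be huge, but (A3) multiplies it by
  \<open>\<sigma> powr (- real s)\<close>, which tends to 0 as \<open>s \<ge> 1\<close>.\<close>

lemma G_convergence: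
  assumes f: "admissible f"
    and lim: "((\<lambda>\<sigma>. lp_norm p \<sigma> (X \<sigma>) (\<lambda>x. averaged (\<gamma> / \<sigma>) r f x - f x)) \<longlongrightarrow> 0) at_top"
    and e: "e > 0"
  shows "eventually (\<lambda>\<sigma>. Lp_norm p (\<lambda>x. f x - G \<sigma> f x) \<le> e) at_top"
proof -
  obtain B where B: "B > 0" "\<And>\<sigma> X h. 0 < \<sigma> \<Longrightarrow> separated (\<gamma> / \<sigma>) X \<Longrightarrow> h \<in> Lp_on lborel p \<Longrightarrow>
    averaged (\<gamma> / \<sigma>) r h \<in> lp_space p (X :: (real^'d) set) \<and> lp_norm p \<sigma> X (averaged (\<gamma> / \<sigma>) r h) \<le> B * Lp_norm_on lborel p h"
    using averaged_sample_bound[OF p \<gamma>(1) r] by blast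
  \<comment> \<open>\<open>M\<close> counts the copies of \<open>\<epsilon>\<close> in the final
    bound: one for \<open>f - P\<close>, one for \<open>P - G \<sigma> P\<close>, and
    \<open>\<kappa>\<^sub>1\<close> times the sampling error of \<open>P - f\<close>, which consists
    of \<open>B\<close> copies from the average of the difference and one from each averaged
    error.\<close>
  define M where "M = 1 + 1 + \<kappa>\<^sub>1 * (1 + B + 1)"
  have M: "M > 0" using \<kappa> B by (simp add: M_def add_pos_pos)
  define \<epsilon> where "\<epsilon> = e / M"
  have \<epsilon>: "\<epsilon> > 0" using e M by (simp add: \<epsilon>_def)
  have fL: "f \<in> Lp_space p" using f by (simp add: admissible_def)
  have fm: "f \<in> borel_measurable lebesgue" using fL by (simp add: Lp_space_def)
  obtain f' where f': "f' \<in> borel_measurable borel" and ae: "AE x in lborel. f x = f' x"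
    using borel_version[OF fm] .
  have f'S: "f' \<in> Lp_on lborel p" using fL Lp_space_borel_version(1)[OF fm f' ae] by simp
  obtain a P where a: "a > 0" and P: "P \<in> band_limited p a" "P \<in> Lp_on lborel p"
    and PN: "Lp_norm_on lborel p (\<lambda>x. P x - f' x) \<le> \<epsilon>"
    and PX: "\<And>\<sigma> X. a \<le> \<sigma> \<Longrightarrow> separated (\<gamma> / \<sigma>) X \<Longrightarrow> P \<in> lp_space p X"
    and Pa: "\<And>e. e > 0 \<Longrightarrow> \<exists>\<sigma>0>0. \<forall>\<sigma> X. \<sigma>0 \<le> \<sigma> \<longrightarrow> separated (\<gamma> / \<sigma>) X \<longrightarrow>
       (\<lambda>x. averaged (\<gamma> / \<sigma>) r P x - P x) \<in> lp_space p X \<and> lp_norm p \<sigma> X (\<lambda>x. averaged (\<gamma> / \<sigma>) r P x - P x) \<le> e"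
    using band_limited_dense[OF p r \<gamma> f'S \<epsilon>] by blast
  obtain \<sigma>0 where \<sigma>0: "\<And>\<sigma> X. \<sigma>0 \<le> \<sigma> \<Longrightarrow> separated (\<gamma> / \<sigma>) X \<Longrightarrow>
       (\<lambda>x. averaged (\<gamma> / \<sigma>) r P x - P x) \<in> lp_space p X \<and> lp_norm p \<sigma> X (\<lambda>x. averaged (\<gamma> / \<sigma>) r P x - P x) \<le> \<epsilon>"
    using Pa[OF \<epsilon>] by blast
  have PL: "P \<in> Lp_space p" using P(1) by (simp add: band_limited_def)
  have Pm: "P \<in> borel_measurable borel" using P(2) by (simp add: Lp_on_def)
  have d: "(\<lambda>x. P x - f' x) \<in> Lp_on lborel p" by (rule Lp_on_diff(1)[OF p P(2) f'S])
  have PfN: "Lp_norm p (\<lambda>x. P x - f x) \<le> \<epsilon>"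
  proof -
    have "Lp_norm p (\<lambda>x. P x - f x) = Lp_norm_on lborel p (\<lambda>x. P x - f' x)"
    proof (rule Lp_space_borel_version(2))
      show "(\<lambda>x. P x - f x) \<in> borel_measurable lebesgue"
        using fm measurable_completion[of P lborel borel] Pm by (intro borel_measurable_diff) auto
      show "(\<lambda>x. P x - f' x) \<in> borel_measurable borel" using Pm f' by measurable
      show "AE x in lborel. P x - f x = P x - f' x" using ae by eventually_elim simp
    qed
    then show ?thesis using PN by simp
  qed
  let ?SP = "Sobolev_seminorm p s P"
  have "((\<lambda>\<sigma>::real. \<sigma> powr - real s) \<longlongrightarrow> 0) at_top"
    using s by (intro tendsto_neg_powr filterlim_ident) auto
  from tendsto_mult_right_zero[OF this, of "\<kappa>\<^sub>3 * ?SP"]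
  have "((\<lambda>\<sigma>. \<kappa>\<^sub>3 * ?SP * \<sigma> powr - real s) \<longlongrightarrow> 0) at_top" .
  then have ev1: "eventually (\<lambda>\<sigma>. \<kappa>\<^sub>3 * ?SP * \<sigma> powr - real s < \<epsilon>) at_top" using \<epsilon> by (rule order_tendstoD(2))
  have ev2: "eventually (\<lambda>\<sigma>. lp_norm p \<sigma> (X \<sigma>) (\<lambda>x. averaged (\<gamma> / \<sigma>) r f x - f x) < \<epsilon>) at_top"
    using lim \<epsilon> by (rule order_tendstoD(2))
  \<comment> \<open>From \<open>a / lam\<close> on, \<open>P\<close> lies in the band
    \<open>lam * \<sigma>\<close> of (A3); from \<open>max a \<sigma>0\<close> on, its samples and
    its averaged error are under control.\<close>
  show ?thesis
    using ev1 ev2 eventually_ge_at_top[of "a / lam"] eventually_ge_at_top[of "max a \<sigma>0"]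
  proof eventually_elim
    case (elim \<sigma>)
    have \<sigma>: "\<sigma> > 0" "a \<le> \<sigma>" "\<sigma>0 \<le> \<sigma>" using elim a by auto
    have "a \<le> lam * \<sigma>" using elim(3) lam by (simp add: divide_le_eq mult.commute)
    then have Pb: "P \<in> band_limited p (lam * \<sigma>)" using band_limited_mono P(1) by blast
    note sX = separated_X[OF \<sigma>(1)]
    have PXs: "P \<in> lp_space p (X \<sigma>)" by (rule PX[OF \<sigma>(2) sX])
    have fX: "f \<in> lp_space p (X \<sigma>)" using f \<sigma> by (simp add: admissible_def)
    have GP: "G \<sigma> P \<in> Lp_space p" by (rule G_Lp[OF \<sigma>(1) PL PXs])
    have Gf: "G \<sigma> f \<in> Lp_space p" by (rule G_Lp[OF \<sigma>(1) fL fX])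
    have \<rho>: "\<gamma> / \<sigma> > 0" using \<gamma> \<sigma> by simp
    let ?d = "\<lambda>x. P x - f' x"
    have a1: "averaged (\<gamma> / \<sigma>) r ?d \<in> lp_space p (X \<sigma>)" "lp_norm p \<sigma> (X \<sigma>) (averaged (\<gamma> / \<sigma>) r ?d) \<le> B * Lp_norm_on lborel p ?d"
      using B(2)[OF \<sigma>(1) sX d] by auto
    have a2: "(\<lambda>x. averaged (\<gamma> / \<sigma>) r P x - P x) \<in> lp_space p (X \<sigma>)" "lp_norm p \<sigma> (X \<sigma>) (\<lambda>x. averaged (\<gamma> / \<sigma>) r P x - P x) \<le> \<epsilon>"
      using \<sigma>0[OF \<sigma>(3) sX] by auto
    have a3: "(\<lambda>x. averaged (\<gamma> / \<sigma>) r f x - f x) \<in> lp_space p (X \<sigma>)"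
    proof -
      have "averaged (\<gamma> / \<sigma>) r f' \<in> lp_space p (X \<sigma>)" using B(2)[OF \<sigma>(1) sX f'S] by simp
      then show ?thesis
        using lp_triangle(2)[OF p \<sigma>(1) _ fX] by (simp add: averaged_cong_AE[OF \<rho> fm f' ae])
    qed
    \<comment> \<open>The samples of \<open>P - f\<close> are reached through its average, whose
      samples are bounded by the norm; the correction is the difference of two averaged errors,
      small for \<open>f\<close> by hypothesis and for \<open>P\<close> by construction.\<close>
    have "lp_norm p \<sigma> (X \<sigma>) (\<lambda>x. P x - f x) =
       lp_norm p \<sigma> (X \<sigma>) (\<lambda>x. averaged (\<gamma> / \<sigma>) r ?d x + ((averaged (\<gamma> / \<sigma>) r f x - f x) - (averaged (\<gamma> / \<sigma>) r P x - P x)))"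
      by (rule lp_cong(2)) (simp add: averaged_cong_AE[OF \<rho> fm f' ae] averaged_diff[OF p P(2) f'S \<rho>])
    also have "\<dots> \<le> lp_norm p \<sigma> (X \<sigma>) (averaged (\<gamma> / \<sigma>) r ?d) +
       (lp_norm p \<sigma> (X \<sigma>) (\<lambda>x. averaged (\<gamma> / \<sigma>) r f x - f x) + lp_norm p \<sigma> (X \<sigma>) (\<lambda>x. averaged (\<gamma> / \<sigma>) r P x - P x))"
      using lp_triangle(3)[OF p \<sigma>(1) a1(1) lp_triangle(2)[OF p \<sigma>(1) a3 a2(1)]] lp_triangle(4)[OF p \<sigma>(1) a3 a2(1)] by linarith
    also have "\<dots> \<le> B * \<epsilon> + (\<epsilon> + \<epsilon>)"
      using a1(2) mult_left_mono[OF PN, of B] B(1) elim(2) a2(2) by linarith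
    finally have lpPf: "lp_norm p \<sigma> (X \<sigma>) (\<lambda>x. P x - f x) \<le> (1 + B + 1) * \<epsilon>" by (simp add: algebra_simps)
    have "Lp_norm p (\<lambda>x. f x - G \<sigma> f x) \<le> Lp_norm p (\<lambda>x. f x - P x) + (Lp_norm p (\<lambda>x. P x - G \<sigma> P x) + Lp_norm p (\<lambda>x. G \<sigma> P x - G \<sigma> f x))"
      using Lp_norm_triangle3[OF p fL PL Gf] Lp_norm_triangle3[OF p PL GP Gf] by linarith
    also have "Lp_norm p (\<lambda>x. f x - P x) \<le> \<epsilon>" using PfN by (simp add: Lp_norm_commute[of p f])
    also have "Lp_norm p (\<lambda>x. P x - G \<sigma> P x) \<le> \<epsilon>"
      using A3[OF \<sigma>(1)] Pb elim(1) by (fastforce simp: cond_A3_def mult_ac)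
    also have "Lp_norm p (\<lambda>x. G \<sigma> P x - G \<sigma> f x) \<le> \<kappa>\<^sub>1 * ((1 + B + 1) * \<epsilon>)"
      using G_diff_bounds(1)[OF \<sigma>(1) PL PXs fL fX] mult_left_mono[OF lpPf, of \<kappa>\<^sub>1] \<kappa>(1) by linarith
    finally have "Lp_norm p (\<lambda>x. f x - G \<sigma> f x) \<le> M * \<epsilon>" by (simp add: M_def algebra_simps)
    then show ?case using M by (simp add: \<epsilon>_def)
  qed
qed

text \<open>Each dyadic step is estimated at the coarser scale by the seminorm at the finer one.
  Normalising the latter with its own scale costs \<open>2 ^ s\<close> and makes the sum begin at
  index 1.\<close>

lemma telescoped_error:
  assumes f: "admissible f" and \<sigma>: "\<sigma> > 0"
    and K: "\<And>\<tau>. \<tau> > 0 \<Longrightarrow> Lp_norm p (\<lambda>x. G (2 * \<tau>) f x - G \<tau> f x) \<le> K * (Sobolev_seminorm p s (G (2 * \<tau>) f) / \<tau> ^ s)"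
  shows "Lp_norm p (\<lambda>x. f x - G \<sigma> f x) \<le> Lp_norm p (\<lambda>x. f x - G (2 ^ N * \<sigma>) f x) +
    K * 2 ^ s * (\<Sum>k<N. Sobolev_seminorm p s (G (2 ^ Suc k * \<sigma>) f) / (2 ^ Suc k * \<sigma>) ^ s)"
proof (induction N)
  case (Suc N)
  let ?\<tau> = "2 ^ N * \<sigma>"
  have \<tau>: "?\<tau> > 0" "2 * ?\<tau> = 2 ^ Suc N * \<sigma>" using \<sigma> by auto
  have \<tau>': "2 ^ Suc N * \<sigma> > 0" using \<sigma> by simp
  have fL: "f \<in> Lp_space p" using f by (simp add: admissible_def)
  have "Lp_norm p (\<lambda>x. f x - G ?\<tau> f x) \<le> Lp_norm p (\<lambda>x. f x - G (2 ^ Suc N * \<sigma>) f x) + Lp_norm p (\<lambda>x. G (2 ^ Suc N * \<sigma>) f x - G ?\<tau> f x)"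
    by (rule Lp_norm_triangle3[OF p fL admissible_G(1)[OF f \<tau>'] admissible_G(1)[OF f \<tau>(1)]])
  also have "Lp_norm p (\<lambda>x. G (2 ^ Suc N * \<sigma>) f x - G ?\<tau> f x) \<le> K * (Sobolev_seminorm p s (G (2 ^ Suc N * \<sigma>) f) / ?\<tau> ^ s)"
    using K[OF \<tau>(1)] unfolding \<tau>(2) .
  also have "\<dots> = K * 2 ^ s * (Sobolev_seminorm p s (G (2 ^ Suc N * \<sigma>) f) / (2 ^ Suc N * \<sigma>) ^ s)"
    using \<sigma> by (simp add: power_mult_distrib field_simps)
  finally show ?case using Suc by (simp add: distrib_left)
qed simp

text \<open>The right-hand side is a series in \<open>ennreal\<close>, so its divergence is an
  admissible value and no summability has to be assumed.\<close>

theorem inverse_estimate: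
  "\<exists>C>0. \<forall>f. admissible f \<longrightarrow>
    ((\<lambda>\<sigma>. lp_norm p \<sigma> (X \<sigma>) (\<lambda>x. averaged (\<gamma> / \<sigma>) r f x - f x)) \<longlongrightarrow> 0) at_top \<longrightarrow>
    (\<forall>\<sigma>>0. ennreal (lp_norm p \<sigma> (X \<sigma>) (\<lambda>x. averaged (\<gamma> / \<sigma>) r f x - f x) + modulus_of_smoothness p s f (1 / \<sigma>))
      \<le> ennreal C * (\<Sum>k. ennreal ((\<sigma> * 2 ^ k) powr (- real s) * Sobolev_seminorm p s (G (2 ^ k * \<sigma>) f))))"
proof -
  obtain K where K: "K > 0" "\<And>f \<tau>. admissible f \<Longrightarrow> \<tau> > 0 \<Longrightarrow>
     Lp_norm p (\<lambda>x. G (2 * \<tau>) f x - G \<tau> f x) \<le> K * (Sobolev_seminorm p s (G (2 * \<tau>) f) / \<tau> ^ s)"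
    using consecutive_difference by blast
  obtain L where L: "L > 0" "\<And>f \<sigma>. admissible f \<Longrightarrow> \<sigma> > 0 \<Longrightarrow>
     lp_norm p \<sigma> (X \<sigma>) (\<lambda>x. averaged (\<gamma> / \<sigma>) r f x - f x) \<le>
       L * (Lp_norm p (\<lambda>x. f x - G \<sigma> f x) + Sobolev_seminorm p s (G \<sigma> f) / \<sigma> ^ s)"
    using averaged_error by blast
  \<comment> \<open>The error of \<open>G \<sigma> f\<close> occurs with \<open>L\<close> from the
    averaged error and \<open>2 ^ s\<close> from the modulus, its seminorm with \<open>L\<close> and
    \<open>real CARD('d) ^ s\<close>; \<open>M\<close> covers both sums.\<close>
  define M where "M = L + 2 ^ s + real CARD('d) ^ s"
  have M: "M > 0" "L + 2 ^ s \<le> M" "L + real CARD('d) ^ s \<le> M" using L by (auto simp: M_def add_pos_nonneg)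
  define C where "C = M * (1 + K * 2 ^ s)"
  have C: "C > 0" using M K by (simp add: C_def add_pos_pos)
  have "ennreal (lp_norm p \<sigma> (X \<sigma>) (\<lambda>x. averaged (\<gamma> / \<sigma>) r f x - f x) + modulus_of_smoothness p s f (1 / \<sigma>))
      \<le> ennreal C * (\<Sum>k. ennreal ((\<sigma> * 2 ^ k) powr (- real s) * Sobolev_seminorm p s (G (2 ^ k * \<sigma>) f)))"
    if f: "admissible f"
      and lim: "((\<lambda>\<sigma>. lp_norm p \<sigma> (X \<sigma>) (\<lambda>x. averaged (\<gamma> / \<sigma>) r f x - f x)) \<longlongrightarrow> 0) at_top"
      and \<sigma>: "\<sigma> > 0" for f \<sigma>
  proof -
    define T where "T = lp_norm p \<sigma> (X \<sigma>) (\<lambda>x. averaged (\<gamma> / \<sigma>) r f x - f x) + modulus_of_smoothness p s f (1 / \<sigma>)"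
    define c where "c k = Sobolev_seminorm p s (G (2 ^ k * \<sigma>) f) / (2 ^ k * \<sigma>) ^ s" for k
    have c0: "c k \<ge> 0" for k using \<sigma> by (simp add: c_def)
    have cc: "(\<sigma> * 2 ^ k) powr (- real s) * Sobolev_seminorm p s (G (2 ^ k * \<sigma>) f) = c k" for k
      using \<sigma> by (simp add: c_def powr_minus powr_realpow divide_inverse mult.commute)
    let ?err = "\<lambda>\<tau>. Lp_norm p (\<lambda>x. f x - G \<tau> f x)"
    have fL: "f \<in> Lp_space p" and gS: "G \<sigma> f \<in> Sobolev_space p s" using f \<sigma> by (auto simp: admissible_def)
    have T1: "T \<le> M * ?err \<sigma> + M * c 0"
    proof -
      have "T \<le> L * (?err \<sigma> + c 0) + (2 ^ s * ?err \<sigma> + real CARD('d) ^ s * c 0)"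
        unfolding T_def using L(2)[OF f \<sigma>] modulus_bound[OF fL gS \<sigma>] by (simp add: c_def)
      also have "\<dots> = (L + 2 ^ s) * ?err \<sigma> + (L + real CARD('d) ^ s) * c 0" by (simp add: algebra_simps)
      also have "\<dots> \<le> M * ?err \<sigma> + M * c 0" using M c0 by (intro add_mono mult_right_mono) auto
      finally show ?thesis .
    qed
    \<comment> \<open>The term \<open>c 0\<close> comes from comparing \<open>f\<close> with
      \<open>G \<sigma> f\<close>, the terms \<open>c (Suc k)\<close> from telescoping;
      \<open>C\<close> exceeds the factors \<open>M\<close> and \<open>M * (K * 2 ^ s)\<close> that
      they carry.\<close>
    have T2: "T \<le> M * ?err (2 ^ N * \<sigma>) + C * (\<Sum>k<Suc N. c k)" for N
    proof -
      have "M * ?err \<sigma> \<le> M * (?err (2 ^ N * \<sigma>) + K * 2 ^ s * (\<Sum>k<N. c (Suc k)))"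
        using telescoped_error[OF f \<sigma> K(2)[OF f], of N] M by (intro mult_left_mono) (auto simp: c_def)
      moreover have "M * (K * 2 ^ s) * (\<Sum>k<N. c (Suc k)) \<le> C * (\<Sum>k<N. c (Suc k))"
        using M K c0 by (intro mult_right_mono sum_nonneg) (auto simp: C_def distrib_left)
      moreover have "M * c 0 \<le> C * c 0"
        using M K c0 by (intro mult_right_mono) (auto simp: C_def distrib_left)
      moreover have "(\<Sum>k<Suc N. c k) = c 0 + (\<Sum>k<N. c (Suc k))" by (rule sum.lessThan_Suc_shift)
      ultimately show ?thesis using T1 by (simp add: distrib_left mult.assoc)
    qed
    let ?S = "\<Sum>k. ennreal (c k)"
    \<comment> \<open>The remainder at \<open>2 ^ N * \<sigma>\<close> tends to 0 without a rate, so
      a single large \<open>N\<close> is taken for each \<open>e\<close> before the partial sum is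
      enlarged to the series.\<close>
    have T3: "ennreal T \<le> ennreal e + ennreal C * ?S" if e: "e > 0" for e
    proof -
      have "eventually (\<lambda>\<tau>. ?err \<tau> \<le> e / M) at_top" using G_convergence[OF f lim, of "e / M"] e M by simp
      moreover have "filterlim (\<lambda>N. 2 ^ N * \<sigma>) at_top sequentially"
      proof -
        have "filterlim (\<lambda>N. (2::real) ^ N) at_top sequentially"
          by (rule filterlim_at_top_mono[OF filterlim_real_sequentially]) (simp add: less_imp_le[OF of_nat_less_two_power])
        then show ?thesis using \<sigma> by (intro filterlim_at_top_mult_tendsto_pos[OF tendsto_const])
      qed
      ultimately have "eventually (\<lambda>N. ?err (2 ^ N * \<sigma>) \<le> e / M) sequentially"
        by (rule eventually_compose_filterlim)
      then obtain N where "?err (2 ^ N * \<sigma>) \<le> e / M" by (auto simp: eventually_sequentially)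
      then have "M * ?err (2 ^ N * \<sigma>) \<le> M * (e / M)" using M(1) by (intro mult_left_mono) auto
      then have "M * ?err (2 ^ N * \<sigma>) \<le> e" using M(1) by simp
      then have "T \<le> e + C * (\<Sum>k<Suc N. c k)" using T2[of N] by linarith
      then have "ennreal T \<le> ennreal (e + C * (\<Sum>k<Suc N. c k))" by (rule ennreal_leI)
      also have "\<dots> = ennreal e + ennreal C * (\<Sum>k<Suc N. ennreal (c k))"
        using e C c0 by (subst ennreal_plus) (auto simp: ennreal_mult sum_ennreal sum_nonneg simp del: sum.lessThan_Suc)
      also have "\<dots> \<le> ennreal e + ennreal C * ?S"
        by (intro add_left_mono mult_left_mono sum_le_suminf) auto
      finally show ?thesis .
    qed
    have "ennreal T \<le> ennreal C * ?S"
    proof (rule ennreal_le_epsilon)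
      fix e :: real assume "e > 0"
      then show "ennreal T \<le> ennreal C * ?S + ennreal e" using T3[of e] by (simp add: add.commute)
    qed
    then show ?thesis unfolding cc T_def .
  qed
  then show ?thesis using C by blast
qed

end

theorem theorem4p9:
  fixes p \<gamma> lam \<kappa>\<^sub>1 \<kappa>\<^sub>2 \<kappa>\<^sub>3 :: real
    and r s :: nat
    and X :: "real \<Rightarrow> (real^'d) set"
    and \<psi> :: "real \<Rightarrow> real^'d \<Rightarrow> real^'d \<Rightarrow> real"
    and \<Phi> :: "real \<Rightarrow> (real^'d \<Rightarrow> real) set"
  assumes "1 \<le> p" and "1 \<le> r" and "1 \<le> s" and "s \<le> 2 * r"
    and "0 < \<gamma>" and "\<gamma> \<le> 1"
    and "0 < lam" and "lam \<le> 1"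
    and "0 < \<kappa>\<^sub>1" and "0 < \<kappa>\<^sub>2" and "0 < \<kappa>\<^sub>3"
    and "sampling_sets \<gamma> X"
    and "approximating_family p s \<Phi>"
    and "\<And>\<sigma>. \<sigma> > 0 \<Longrightarrow> sampling_op_defined p X \<psi> \<sigma>"
    and "\<And>\<sigma>. \<sigma> > 0 \<Longrightarrow> cond_A1 p X \<psi> \<kappa>\<^sub>1 \<sigma>"
    and "\<And>\<sigma>. \<sigma> > 0 \<Longrightarrow> cond_A2 p X \<psi> \<kappa>\<^sub>2 \<sigma>"
    and "\<And>\<sigma>. \<sigma> > 0 \<Longrightarrow> cond_A3 p s X \<psi> \<kappa>\<^sub>3 lam \<sigma>"
    and "\<And>\<sigma>. \<sigma> > 0 \<Longrightarrow> X \<sigma> \<subseteq> X (2 * \<sigma>)"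
  shows "\<exists>C>0. \<forall>f \<in> Lp_space p.
    (\<forall>\<sigma>>0. f \<in> lp_space p (X \<sigma>)) \<longrightarrow>
    ((\<lambda>\<sigma>. lp_norm p \<sigma> (X \<sigma>) (\<lambda>x. averaged (\<gamma> / \<sigma>) r f x - f x)) \<longlongrightarrow> 0) at_top \<longrightarrow>
    (\<forall>\<sigma>>0. sampling_op X \<psi> \<sigma> f \<in> \<Phi> \<sigma> \<inter> Sobolev_space p s) \<longrightarrow>
    (\<forall>\<sigma>>0. \<forall>\<xi> \<in> X \<sigma>. sampling_op X \<psi> \<sigma> f \<xi> = f \<xi>) \<longrightarrow>
    (\<forall>\<sigma>>0.
      ennreal (lp_norm p \<sigma> (X \<sigma>) (\<lambda>x. averaged (\<gamma> / \<sigma>) r f x - f x)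
               + modulus_of_smoothness p s f (1 / \<sigma>))
      \<le> ennreal C * (\<Sum>k. ennreal ((\<sigma> * 2 ^ k) powr (- real s)
               * Sobolev_seminorm p s (sampling_op X \<psi> (2 ^ k * \<sigma>) f))))"
proof -
  interpret sampling p \<gamma> lam \<kappa>\<^sub>1 \<kappa>\<^sub>2 \<kappa>\<^sub>3 r s X \<psi>
    using assms by unfold_locales
  obtain C where C: "C > 0" and est: "\<forall>f. admissible f \<longrightarrow>
    ((\<lambda>\<sigma>. lp_norm p \<sigma> (X \<sigma>) (\<lambda>x. averaged (\<gamma> / \<sigma>) r f x - f x)) \<longlongrightarrow> 0) at_top \<longrightarrow>
    (\<forall>\<sigma>>0. ennreal (lp_norm p \<sigma> (X \<sigma>) (\<lambda>x. averaged (\<gamma> / \<sigma>) r f x - f x) + modulus_of_smoothness p s f (1 / \<sigma>))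
      \<le> ennreal C * (\<Sum>k. ennreal ((\<sigma> * 2 ^ k) powr (- real s) * Sobolev_seminorm p s (G (2 ^ k * \<sigma>) f))))"
    by (rule exE[OF inverse_estimate], erule conjE, rule that)
  show ?thesis
  proof (rule exI, rule conjI[OF C], rule ballI, rule impI, rule impI, rule impI, rule impI)
    fix f :: "real^'d \<Rightarrow> real"
    assume f: "f \<in> Lp_space p" "\<forall>\<sigma>>0. f \<in> lp_space p (X \<sigma>)"
      and lim: "((\<lambda>\<sigma>. lp_norm p \<sigma> (X \<sigma>) (\<lambda>x. averaged (\<gamma> / \<sigma>) r f x - f x)) \<longlongrightarrow> 0) at_top"
      and G: "\<forall>\<sigma>>0. G \<sigma> f \<in> \<Phi> \<sigma> \<inter> Sobolev_space p s" "\<forall>\<sigma>>0. \<forall>\<xi>\<in>X \<sigma>. G \<sigma> f \<xi> = f \<xi>"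
    have "admissible f" unfolding admissible_def using f G by blast
    from est[rule_format, OF this lim]
    show "\<forall>\<sigma>>0. ennreal (lp_norm p \<sigma> (X \<sigma>) (\<lambda>x. averaged (\<gamma> / \<sigma>) r f x - f x) + modulus_of_smoothness p s f (1 / \<sigma>))
      \<le> ennreal C * (\<Sum>k. ennreal ((\<sigma> * 2 ^ k) powr (- real s) * Sobolev_seminorm p s (G (2 ^ k * \<sigma>) f)))"
      by (intro allI impI)
  qed
qed

end
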